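(* Let $d\ge 2$ and let $\theta_1,\ldots,\theta_d\in\mathbb{T}=\mathbb{R}/\mathbb{Z}$. Assume there exist $\nu>0$ and $C>0$ such that for every $k\in\mathbb{Z}\setminus\{0\}$, $$\max(\|k\theta_1\|,\ldots,\|k\theta_d\|)\ \ge\ C|k|^{-\nu}.$$ Let $f_1,\ldots,f_d$ be $C^\infty$ orientation-preserving diffeomorphisms of the circle $\mathbb{T}$ such that $f_i$ has rotation number $\theta_i$ for each $i$, and such that $f_i\circ f_j=f_j\circ f_i$ for all $i,j$. Then there exists a $C^\infty$ orientation-preserving diffeomorphism $h$ of $\mathbb{T}$ such that $h\circ f_i\circ h^{-1}=R_{\theta_i}$ for every $1\le i\le d$, where $R_\alpha(x)=x+\alpha$.
   Context: $\|x\|$ denotes the distance from $x\in\mathbb{R}$ to the nearest integer. The rotation number of an orientation-preserving circle homeomorphism $f$ with lift $\tilde f$ is $\lim_{j\to\infty}(\tilde f^j(x)-x)/j \bmod 1$ (Poincaré). *)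

theory Defs
  imports "HOL-Analysis.Analysis"
begin

definition dist_int :: "real \<Rightarrow> real" where
  "dist_int x = \<bar>x - of_int (round x)\<bar>"

definition smooth_real :: "(real \<Rightarrow> real) \<Rightarrow> bool" where
  "smooth_real F \<longleftrightarrow> (\<forall>n x. ((deriv ^^ n) F) differentiable (at x))"

definition circle_diffeo_lift :: "(real \<Rightarrow> real) \<Rightarrow> bool" where
  "circle_diffeo_lift F \<longleftrightarrow>
     bij F \<and> smooth_real F \<and> smooth_real (inv F) \<and> strict_mono F \<and>
     (\<forall>x. F (x + 1) = F x + 1)"

text \<open>Rotation number (as a real, to be read modulo 1) of the circle map with lift F.\<close>
definition rotation_number :: "(real \<Rightarrow> real) \<Rightarrow> real" where
  "rotation_number F = lim (\<lambda>j. ((F ^^ j) 0 - 0) / real j)"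

end

theory Submission
  imports Defs
begin

text \<open>
  Some $\theta_i$ is irrational, so Denjoy's theorem gives a homeomorphism $h$ conjugating $F_i$, hence all the
  commuting $F_j$, to translations. Put $\Phi_r = h^{-1}(h + r)$; the set of $r$ with $\Phi_r$ a smooth
  diffeomorphism contains the group generated by 1 and the rotation numbers $c_j$. By the simultaneous Diophantine
  condition each small $\alpha$ in this group is followed by some $\alpha' = l c_j + p$ in it with
  $\alpha^P \le \alpha' \le \alpha/8$, where the first $l$ iterates of $F_j$ move every $\Phi$-segment of length
  $\alpha/8$ disjointly.

  Write $A_r = \ln \Phi_r'$ and $m_r = \Phi_r - \mathrm{id}$. Disjointness bounds the distortion and, via the
  Schwarzian, the derivatives of $A$ along these words by powers of $\eta/m_\alpha$ with
  $\eta = O(\sup |A_\alpha| + \sup \sqrt{m_\alpha})$. Interpolation at the points $\Phi_{i\alpha} x$ then shows that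
  $m_{\alpha'}$ is nearly constant on $[x, \Phi_\alpha x]$ unless $\alpha'$ is smaller than every power of $\alpha$,
  which the Diophantine condition forbids. Hence $\eta$ decays like a power of $\alpha$, so $m_\beta$ is comparable to
  $\beta$ and $h$ is bi-Lipschitz. Since $\Phi_v$ and $\Phi_w$ commute, the displacement $m_w$ is almost
  $\Phi_v$-invariant; interpolation turns this into bounds for one more derivative at a time. Finally $h$ is, up to a
  constant, the average of the $\Phi_r$ over $0 \le r \le 1$, whose Riemann sums have uniformly bounded derivatives.
\<close>

section \<open>Smooth functions on the line\<close>

text \<open>No single \<open>F i\<close> can be linearized by itself: each rotation number may be
  Liouville, since only the maximum in the hypothesis is bounded below. The generator in use has to
  change with the scale, and what the scales share is the group \<Phi>, which exists as soon as
  \<open>h\<close> does, long before \<open>\<Phi> r\<close> is known to be smooth for general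
  \<open>r\<close>. The obstacle is circular: a step from \<alpha> to \<alpha>' is controlled unless
  \<alpha>/\<alpha>' exceeds a high power of 1/\<eta>, but \<eta> is known to be a power of \<alpha>
  only after many controlled steps. It is broken in two rounds. \<open>decay\<close> carries an
  invariant with a tiny exponent that survives even an uncontrolled step; \<open>good_scales\<close>
  then raises the order of interpolation until uncontrolled steps contradict the arithmetic. For
  higher derivatives the decisive gain is that, through the Schwarzian, a derivative of a word costs
  \<alpha>^(-1/2) instead of the naive \<alpha>^(-1), so that interpolation over lengths slightly
  below \<alpha>^(1/2) beats the growth of high derivatives.\<close>

definition kdiff :: "nat \<Rightarrow> (real \<Rightarrow> real) \<Rightarrow> bool" where
  "kdiff n F \<longleftrightarrow> (\<forall>i<n. \<forall>x. ((deriv ^^ i) F) differentiable (at x))"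

lemma smooth_iff_kdiff: "smooth_real F \<longleftrightarrow> (\<forall>n. kdiff n F)"
  unfolding smooth_real_def kdiff_def by blast

lemma kdiff_0 [simp]: "kdiff 0 F"
  by (simp add: kdiff_def)

text \<open>Peeling off the innermost derivative, rather than the outermost one to which
  \<open>deriv ^^ Suc i\<close> unfolds, is what makes the closure properties below provable by
  induction on the order.\<close>

lemma kdiff_Suc: "kdiff (Suc n) F \<longleftrightarrow> (\<forall>x. F differentiable (at x)) \<and> kdiff n (deriv F)"
proof
  assume "kdiff (Suc n) F"
  then have *: "\<And>i x. i < Suc n \<Longrightarrow> ((deriv ^^ i) F) differentiable (at x)"
    by (auto simp: kdiff_def)
  show "(\<forall>x. F differentiable (at x)) \<and> kdiff n (deriv F)"
    using *[of 0] *[of "Suc i" for i] by (simp add: kdiff_def funpow_swap1)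
next
  assume *: "(\<forall>x. F differentiable (at x)) \<and> kdiff n (deriv F)"
  show "kdiff (Suc n) F"
    unfolding kdiff_def
  proof (intro allI impI)
    fix i x assume "i < Suc n"
    then show "((deriv ^^ i) F) differentiable (at x)"
      using * by (cases i) (simp_all add: kdiff_def funpow_swap1)
  qed
qed

lemma kdiff_SucD: "kdiff (Suc n) F \<Longrightarrow> kdiff n F"
  by (auto simp: kdiff_def)

lemma real_differentiable_deriv:
  "F differentiable (at x) \<Longrightarrow> (F has_real_derivative deriv F x) (at (x::real))"
  by (simp add: DERIV_deriv_iff_real_differentiable)

lemma kdiff_SucI:
  assumes "\<And>x. (F has_real_derivative G x) (at x)" "kdiff n G"
  shows "kdiff (Suc n) F"
proof -
  have "deriv F = G" using assms(1) DERIV_imp_deriv by blast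
  then show ?thesis using assms by (auto simp: kdiff_Suc real_differentiable_def)
qed

lemma kdiff_const [simp]: "kdiff n (\<lambda>x. c)"
proof (induction n arbitrary: c)
  case (Suc n)
  show ?case by (rule kdiff_SucI[where G="\<lambda>x. 0"]) (auto intro: Suc)
qed simp

lemma kdiff_ident [simp]: "kdiff n (\<lambda>x. x)"
  by (cases n) (auto intro!: kdiff_SucI[where G="\<lambda>x. 1"])

lemma kdiff_add: "kdiff n F \<Longrightarrow> kdiff n G \<Longrightarrow> kdiff n (\<lambda>x. F x + G x)"
proof (induction n arbitrary: F G)
  case (Suc n)
  show ?case
    by (rule kdiff_SucI[where G="\<lambda>x. deriv F x + deriv G x"])
      (use Suc in \<open>auto simp: kdiff_Suc intro!: derivative_intros real_differentiable_deriv\<close>)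
qed simp

lemma kdiff_mult: "kdiff n F \<Longrightarrow> kdiff n G \<Longrightarrow> kdiff n (\<lambda>x. F x * G x)"
proof (induction n arbitrary: F G)
  case (Suc n)
  have d: "\<And>x. F differentiable (at x)" "\<And>x. G differentiable (at x)"
    "kdiff n (deriv F)" "kdiff n (deriv G)"
    using Suc.prems by (auto simp: kdiff_Suc)
  show ?case
  proof (rule kdiff_SucI[where G="\<lambda>x. deriv F x * G x + F x * deriv G x"])
    show "((\<lambda>x. F x * G x) has_real_derivative deriv F x * G x + F x * deriv G x) (at x)" for x
      using DERIV_mult[OF real_differentiable_deriv[OF d(1)] real_differentiable_deriv[OF d(2)], of x]
      by (simp add: mult.commute)
    show "kdiff n (\<lambda>x. deriv F x * G x + F x * deriv G x)"
      by (intro kdiff_add Suc.IH d) (rule kdiff_SucD, rule Suc.prems)+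
  qed
qed simp

lemma kdiff_compose: "kdiff n F \<Longrightarrow> kdiff n G \<Longrightarrow> kdiff n (\<lambda>x. F (G x))"
proof (induction n arbitrary: F)
  case (Suc n)
  have d: "\<And>x. F differentiable (at x)" "\<And>x. G differentiable (at x)"
    "kdiff n (deriv F)" "kdiff n (deriv G)"
    using Suc.prems by (auto simp: kdiff_Suc)
  show ?case
  proof (rule kdiff_SucI[where G="\<lambda>x. deriv F (G x) * deriv G x"])
    show "((\<lambda>x. F (G x)) has_real_derivative deriv F (G x) * deriv G x) (at x)" for x
      using DERIV_chain2[OF real_differentiable_deriv[OF d(1)] real_differentiable_deriv[OF d(2)]]
      by simp
    show "kdiff n (\<lambda>x. deriv F (G x) * deriv G x)"
      using Suc.IH[OF d(3) kdiff_SucD[OF Suc.prems(2)]] d(4) by (rule kdiff_mult)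
  qed
qed simp

lemma kdiff_inverse:
  assumes "\<And>x. F x \<noteq> 0"
  shows "kdiff n F \<Longrightarrow> kdiff n (\<lambda>x. inverse (F x))"
proof (induction n)
  case (Suc n)
  have d: "\<And>x. F differentiable (at x)" "kdiff n (deriv F)" "kdiff n F"
    using Suc.prems kdiff_SucD[OF Suc.prems] by (auto simp: kdiff_Suc)
  show ?case
  proof (rule kdiff_SucI[where G="\<lambda>x. (-1) * (deriv F x * (inverse (F x) * inverse (F x)))"])
    show "((\<lambda>x. inverse (F x)) has_real_derivative (-1) * (deriv F x * (inverse (F x) * inverse (F x)))) (at x)" for x
      using DERIV_inverse_fun[OF real_differentiable_deriv[OF d(1)] assms, of x]
      by (simp add: power2_eq_square mult_ac)
  qed (intro kdiff_mult kdiff_const d Suc.IH)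
qed simp

lemma kdiff_ln:
  assumes "\<And>x. F x > 0"
  shows "kdiff n F \<Longrightarrow> kdiff n (\<lambda>x. ln (F x))"
proof (cases n)
  case (Suc k)
  assume "kdiff n F"
  then have d: "\<And>x. F differentiable (at x)" "kdiff k (deriv F)" "kdiff k F"
    using Suc kdiff_SucD[of k F] by (auto simp: kdiff_Suc)
  have nz: "F x \<noteq> 0" for x using assms[of x] by simp
  show ?thesis unfolding Suc
  proof (rule kdiff_SucI[where G="\<lambda>x. deriv F x * inverse (F x)"])
    show "((\<lambda>x. ln (F x)) has_real_derivative deriv F x * inverse (F x)) (at x)" for x
      using DERIV_chain2[OF DERIV_ln_divide[OF assms] real_differentiable_deriv[OF d(1)], of x]
      by (simp add: divide_inverse mult.commute)
  qed (intro kdiff_mult kdiff_inverse d nz)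
qed simp

lemma kdiff_exp: "kdiff n F \<Longrightarrow> kdiff n (\<lambda>x. exp (F x))"
proof (induction n)
  case (Suc n)
  have d: "\<And>x. F differentiable (at x)" "kdiff n (deriv F)" "kdiff n F"
    using Suc.prems kdiff_SucD[OF Suc.prems] by (auto simp: kdiff_Suc)
  show ?case
  proof (rule kdiff_SucI[where G="\<lambda>x. deriv F x * exp (F x)"])
    show "((\<lambda>x. exp (F x)) has_real_derivative deriv F x * exp (F x)) (at x)" for x
      using DERIV_chain2[OF DERIV_exp real_differentiable_deriv[OF d(1)], of x] by (simp add: mult.commute)
  qed (intro kdiff_mult d Suc.IH)
qed simp

lemma smooth_const [simp, intro]: "smooth_real (\<lambda>x. c)"
  and smooth_ident [simp, intro]: "smooth_real (\<lambda>x. x)"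
  and smooth_add [intro]: "smooth_real F \<Longrightarrow> smooth_real G \<Longrightarrow> smooth_real (\<lambda>x. F x + G x)"
  and smooth_mult [intro]: "smooth_real F \<Longrightarrow> smooth_real G \<Longrightarrow> smooth_real (\<lambda>x. F x * G x)"
  and smooth_compose: "smooth_real F \<Longrightarrow> smooth_real G \<Longrightarrow> smooth_real (\<lambda>x. F (G x))"
  and smooth_ln: "(\<And>x. F x > 0) \<Longrightarrow> smooth_real F \<Longrightarrow> smooth_real (\<lambda>x. ln (F x))"
  and smooth_exp [intro]: "smooth_real F \<Longrightarrow> smooth_real (\<lambda>x. exp (F x))"
  unfolding smooth_iff_kdiff
  using kdiff_add kdiff_mult kdiff_compose kdiff_ln kdiff_exp by auto

lemma smooth_cmult [intro]: "smooth_real F \<Longrightarrow> smooth_real (\<lambda>x. c * F x)"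
  by (rule smooth_mult) auto

lemma smooth_diff [intro]: "smooth_real F \<Longrightarrow> smooth_real G \<Longrightarrow> smooth_real (\<lambda>x. F x - G x)"
  using smooth_add[of F "\<lambda>x. (-1) * G x"] smooth_cmult[of G "-1"] by simp

lemma smooth_sum [intro]:
  "(\<And>i. i \<in> I \<Longrightarrow> smooth_real (F i)) \<Longrightarrow> smooth_real (\<lambda>x. \<Sum>i\<in>I. F i x)"
  by (induction I rule: infinite_finite_induct) auto

lemma smooth_deriv [intro]: "smooth_real F \<Longrightarrow> smooth_real (deriv F)"
  unfolding smooth_iff_kdiff using kdiff_Suc by blast

lemma smooth_funpow_deriv [intro]: "smooth_real F \<Longrightarrow> smooth_real ((deriv ^^ n) F)"
  by (induction n) auto

lemma smooth_has_derivative: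
  "smooth_real F \<Longrightarrow> (F has_real_derivative deriv F x) (at x)"
  unfolding smooth_real_def using real_differentiable_deriv[of F x]
  by (metis funpow_0)

lemma smooth_isCont: "smooth_real F \<Longrightarrow> isCont F x"
  using smooth_has_derivative DERIV_isCont by blast

lemma smooth_continuous_on: "smooth_real F \<Longrightarrow> continuous_on S F"
  using smooth_isCont continuous_at_imp_continuous_on by blast

text \<open>Since G' = 1/(F' o G), every order of differentiability already known for
  \<open>G\<close> yields the next one.\<close>

lemma smooth_inverse_function:
  assumes F: "smooth_real F" and pos: "\<And>x. deriv F x > 0" and inv: "\<And>y. F (G y) = y" "\<And>x. G (F x) = x"
  shows "smooth_real G" "\<And>y. (G has_real_derivative inverse (deriv F (G y))) (at y)"
proof -
  show D: "(G has_real_derivative inverse (deriv F (G y))) (at y)" for y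
  proof (rule DERIV_inverse_function[where a="y-1" and b="y+1"])
    show "(F has_real_derivative deriv F (G y)) (at (G y))" by (rule smooth_has_derivative[OF F])
    show "deriv F (G y) \<noteq> 0" using pos[of "G y"] by simp
    have sm: "strict_mono F"
      by (rule strict_monoI) (use DERIV_pos_imp_increasing smooth_has_derivative[OF F] pos in blast)
    have "isCont G (F (G y))"
      by (rule isCont_inverse_function[where d=1]) (auto simp: inv smooth_isCont[OF F])
    then show "isCont G y" by (simp add: inv)
  qed (auto simp: inv)
  have nz: "deriv F (G y) \<noteq> 0" for y using pos[of "G y"] by simp
  have dF: "kdiff n (deriv F)" for n using smooth_deriv[OF F] by (simp add: smooth_iff_kdiff)
  have "kdiff n G" for n
  proof (induction n)
    case (Suc n)
    show ?case by (rule kdiff_SucI[OF D]) (intro kdiff_inverse nz kdiff_compose[OF dF Suc])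
  qed simp
  then show "smooth_real G" by (simp add: smooth_iff_kdiff)
qed

section \<open>Iterated derivatives, periodicity and mean values\<close>

lemma deriv_add_smooth: "smooth_real F \<Longrightarrow> smooth_real G \<Longrightarrow> deriv (\<lambda>x. F x + G x) = (\<lambda>x. deriv F x + deriv G x)"
  by (rule ext, rule DERIV_imp_deriv) (intro DERIV_add smooth_has_derivative)

lemma deriv_diff_smooth: "smooth_real F \<Longrightarrow> smooth_real G \<Longrightarrow> deriv (\<lambda>x. F x - G x) = (\<lambda>x. deriv F x - deriv G x)"
  by (rule ext, rule DERIV_imp_deriv) (intro DERIV_diff smooth_has_derivative)

lemma deriv_mult_smooth:
  "smooth_real F \<Longrightarrow> smooth_real G \<Longrightarrow> deriv (\<lambda>x. F x * G x) = (\<lambda>x. deriv F x * G x + F x * deriv G x)"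
  using DERIV_mult[OF smooth_has_derivative smooth_has_derivative]
  by (intro ext DERIV_imp_deriv) (simp add: mult.commute)

lemma deriv_compose_smooth:
  "smooth_real F \<Longrightarrow> smooth_real G \<Longrightarrow> deriv (\<lambda>x. F (G x)) = (\<lambda>x. deriv F (G x) * deriv G x)"
  using DERIV_chain2[OF smooth_has_derivative smooth_has_derivative] by (intro ext DERIV_imp_deriv) simp

lemma deriv_exp_smooth: "smooth_real F \<Longrightarrow> deriv (\<lambda>x. exp (F x)) = (\<lambda>x. deriv F x * exp (F x))"
  using DERIV_chain2[OF DERIV_exp smooth_has_derivative] by (intro ext DERIV_imp_deriv) (simp add: mult.commute)

lemma deriv_cmult_smooth: "smooth_real F \<Longrightarrow> deriv (\<lambda>x. c * F x) = (\<lambda>x. c * deriv F x)"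
  by (rule ext, rule DERIV_imp_deriv) (intro DERIV_cmult smooth_has_derivative)

lemma funpow_deriv_add:
  "smooth_real F \<Longrightarrow> smooth_real G \<Longrightarrow>
    (deriv ^^ n) (\<lambda>x. F x + G x) = (\<lambda>x. (deriv ^^ n) F x + (deriv ^^ n) G x)"
  by (induction n) (auto simp: deriv_add_smooth smooth_funpow_deriv)

lemma funpow_deriv_diff:
  "smooth_real F \<Longrightarrow> smooth_real G \<Longrightarrow>
    (deriv ^^ n) (\<lambda>x. F x - G x) = (\<lambda>x. (deriv ^^ n) F x - (deriv ^^ n) G x)"
  by (induction n) (auto simp: deriv_diff_smooth smooth_funpow_deriv)

lemma funpow_deriv_cmult:
  "smooth_real F \<Longrightarrow> (deriv ^^ n) (\<lambda>x. c * F x) = (\<lambda>x. c * (deriv ^^ n) F x)"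
  by (induction n) (auto simp: deriv_cmult_smooth smooth_funpow_deriv)

lemma funpow_deriv_const: "(deriv ^^ n) (\<lambda>x. c::real) = (\<lambda>x. if n = 0 then c else 0)"
  by (induction n) auto

lemma funpow_deriv_sum:
  "finite I \<Longrightarrow> (\<And>i. i \<in> I \<Longrightarrow> smooth_real (F i)) \<Longrightarrow>
    (deriv ^^ n) (\<lambda>x. \<Sum>i\<in>I. F i x) = (\<lambda>x. \<Sum>i\<in>I. (deriv ^^ n) (F i) x)"
  by (induction I rule: finite_induct) (auto simp: funpow_deriv_const funpow_deriv_add smooth_sum)

text \<open>No differentiability is assumed: the derivative relation is the same at both points, so
  \<open>deriv\<close>, being a choice from it, returns the same value even where no derivative
  exists.\<close>

lemma deriv_periodic:
  assumes "\<And>x. F (x + 1) = F x + (c::real)"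
  shows "deriv F (x + 1) = deriv F x"
proof -
  have "(F has_real_derivative D) (at (x + 1)) \<longleftrightarrow> (F has_real_derivative D) (at x)" for D
  proof -
    have "(F has_real_derivative D) (at (x + 1)) \<longleftrightarrow> ((\<lambda>t. F (t + 1)) has_real_derivative D) (at x)"
      by (rule DERIV_shift)
    also have "\<dots> \<longleftrightarrow> ((\<lambda>t. F t + c) has_real_derivative D) (at x)" by (simp add: assms)
    also have "\<dots> \<longleftrightarrow> (F has_real_derivative D) (at x)"
      using DERIV_add[of F D x UNIV "\<lambda>_. c" 0] DERIV_add[of "\<lambda>t. F t + c" D x UNIV "\<lambda>_. -c" 0] by auto
    finally show ?thesis .
  qed
  then show ?thesis by (simp add: deriv_def)
qed

lemma funpow_deriv_periodic:
  assumes "\<And>x. F (x + 1) = F x"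
  shows "(deriv ^^ n) F (x + 1) = (deriv ^^ n) F (x::real)"
proof (induction n arbitrary: x)
  case (Suc n)
  then show ?case using deriv_periodic[of "(deriv ^^ n) F" 0] by simp
qed (simp add: assms)

lemma periodic_int:
  assumes "\<And>x::real. F (x + 1) = (F x :: real) + c"
  shows "F (x + of_int p) = F x + of_int p * c"
proof -
  have n: "F (x + of_nat n) = F x + of_nat n * c" for n x
  proof (induction n)
    case (Suc n)
    have "F (x + of_nat (Suc n)) = F ((x + of_nat n) + 1)" by (simp add: algebra_simps)
    also have "\<dots> = F x + of_nat n * c + c" using Suc by (simp only: assms)
    finally show ?case by (simp add: algebra_simps)
  qed simp
  show ?thesis
  proof (cases "p \<ge> 0")
    case True then show ?thesis using n[of x "nat p"] by simp
  next
    case False then show ?thesis using n[of "x + of_int p" "nat (-p)"] by simp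
  qed
qed

lemma periodic_attains_max:
  assumes "continuous_on UNIV F" "\<And>x. F (x + 1) = F (x::real)"
  obtains x0 where "\<And>x. F x \<le> (F x0 :: real)"
proof -
  obtain x0 where x0: "\<forall>x\<in>{0..1}. F x \<le> F x0"
    using continuous_attains_sup[of "{0..1::real}" F] continuous_on_subset[OF assms(1)] by auto
  have "F x \<le> F x0" for x
  proof -
    have "F (frac x + of_int \<lfloor>x\<rfloor>) = F (frac x)" using periodic_int[of F 0] assms(2) by simp
    then have "F x = F (frac x)" by (simp add: frac_def)
    then show ?thesis using x0 by (simp add: frac_ge_0 frac_lt_1 less_imp_le)
  qed
  then show ?thesis by (rule that)
qed

lemma periodic_bounded:
  assumes "continuous_on UNIV F" "\<And>x. F (x + 1) = F (x::real)"
  obtains B where "\<And>x. \<bar>F x :: real\<bar> \<le> B"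
proof (rule periodic_attains_max[of "\<lambda>x. \<bar>F x\<bar>"])
  show "continuous_on UNIV (\<lambda>x. \<bar>F x\<bar>)" using assms(1) by (rule continuous_on_rabs)
qed (use assms(2) that in auto)

lemma smooth_mvt:
  assumes "smooth_real F" "a < b"
  obtains z where "a < z" "z < b" "F b - F a = (b - a) * deriv F z"
  using MVT2[OF assms(2), of F "deriv F"] smooth_has_derivative[OF assms(1)] by blast

lemma smooth_diff_le:
  assumes "smooth_real F" "a \<le> b" "\<And>z. a \<le> z \<Longrightarrow> z \<le> b \<Longrightarrow> \<bar>deriv F z\<bar> \<le> B"
  shows "\<bar>F b - F a\<bar> \<le> B * (b - a)"
proof (cases "a = b")
  case False
  then obtain z where "a < z" "z < b" "F b - F a = (b - a) * deriv F z"
    using smooth_mvt[of F a b] assms by auto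
  then show ?thesis using assms(3)[of z] False assms(2) by (simp add: abs_mult mult.commute mult_right_mono)
qed simp

section \<open>Bounds on jets\<close>

text \<open>\<open>E\<close> is a size and \<open>K\<close> an inverse length. The bound is
  pointwise because the natural inverse length, later \<eta> divided by \<open>m \<alpha> x\<close>,
  varies with the point.\<close>

definition jb :: "nat \<Rightarrow> real \<Rightarrow> real \<Rightarrow> (real \<Rightarrow> real) \<Rightarrow> real \<Rightarrow> bool" where
  "jb n E K F x \<longleftrightarrow> (\<forall>i\<le>n. \<bar>(deriv ^^ i) F x\<bar> \<le> E * K ^ i)"

lemma jb_0: "jb 0 E K F x \<longleftrightarrow> \<bar>F x\<bar> \<le> E"
  by (simp add: jb_def)

lemma jb_Suc: "jb (Suc n) E K F x \<longleftrightarrow> \<bar>F x\<bar> \<le> E \<and> jb n (E * K) K (deriv F) x"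
proof -
  have "(\<forall>i\<le>Suc n. \<bar>(deriv ^^ i) F x\<bar> \<le> E * K ^ i) \<longleftrightarrow>
      \<bar>F x\<bar> \<le> E \<and> (\<forall>i\<le>n. \<bar>(deriv ^^ Suc i) F x\<bar> \<le> E * K ^ Suc i)"
    by (auto simp: less_Suc_eq_le[symmetric] All_less_Suc2 simp del: funpow.simps(2) power_Suc)
  then show ?thesis by (simp add: jb_def funpow_swap1 mult.assoc)
qed

lemma jb_mono: "jb n E K F x \<Longrightarrow> E \<le> E' \<Longrightarrow> 0 \<le> K \<Longrightarrow> m \<le> n \<Longrightarrow> jb m E' K F x"
  unfolding jb_def
  by (auto intro!: order_trans[of "\<bar>(deriv ^^ i) F x\<bar>" "E * K ^ i" "E' * K ^ i" for i] mult_right_mono)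

lemma jb_nonneg: "jb n E K F x \<Longrightarrow> 0 \<le> E"
  unfolding jb_def by (metis abs_ge_zero le0 mult.right_neutral order_trans power_0)

lemma jbD: "jb n E K F x \<Longrightarrow> i \<le> n \<Longrightarrow> \<bar>(deriv ^^ i) F x\<bar> \<le> E * K ^ i"
  by (simp add: jb_def)

lemma jb_add:
  "smooth_real F \<Longrightarrow> smooth_real G \<Longrightarrow> jb n E1 K F x \<Longrightarrow> jb n E2 K G x \<Longrightarrow> jb n (E1 + E2) K (\<lambda>x. F x + G x) x"
  unfolding jb_def funpow_deriv_add
  by (auto simp: funpow_deriv_add distrib_right intro!: order_trans[OF abs_triangle_ineq] add_mono)

lemma jb_cmult:
  "smooth_real F \<Longrightarrow> jb n E K F x \<Longrightarrow> jb n (\<bar>c\<bar> * E) K (\<lambda>x. c * F x) x"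
  unfolding jb_def by (auto simp: funpow_deriv_cmult abs_mult mult.assoc intro!: mult_left_mono)

lemma jb_sum:
  assumes "finite I" "\<And>i. i \<in> I \<Longrightarrow> smooth_real (F i)" "\<And>i. i \<in> I \<Longrightarrow> jb n (E i) K (F i) x"
  shows "jb n (\<Sum>i\<in>I. E i) K (\<lambda>x. \<Sum>i\<in>I. F i x) x"
  using assms(3)
  by (auto simp: jb_def funpow_deriv_sum[OF assms(1,2)] sum_distrib_right intro!: order_trans[OF sum_abs] sum_mono)

lemma jb_mult:
  assumes "smooth_real F" "smooth_real G" "jb n E1 K F x" "jb n E2 K G x" "0 \<le> K"
  shows "jb n (2 ^ n * E1 * E2) K (\<lambda>x. F x * G x) x"
  using assms
proof (induction n arbitrary: F G E1 E2)
  case 0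
  then show ?case by (simp add: jb_0 abs_mult mult_mono')
next
  case (Suc n)
  have e: "0 \<le> E1" "0 \<le> E2" using Suc.prems jb_nonneg by blast+
  have F: "\<bar>F x\<bar> \<le> E1" "jb n (E1 * K) K (deriv F) x" "jb n E1 K F x"
    and G: "\<bar>G x\<bar> \<le> E2" "jb n (E2 * K) K (deriv G) x" "jb n E2 K G x"
    using Suc.prems jb_mono[OF Suc.prems(3) order_refl Suc.prems(5), of n]
      jb_mono[OF Suc.prems(4) order_refl Suc.prems(5), of n] by (simp_all add: jb_Suc)
  have "jb n (2 ^ n * (E1 * K) * E2 + 2 ^ n * E1 * (E2 * K)) K (\<lambda>x. deriv F x * G x + F x * deriv G x) x"
    by (intro jb_add Suc.IH smooth_mult smooth_deriv Suc.prems F G)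
  moreover have "\<bar>F x * G x\<bar> \<le> 2 ^ Suc n * E1 * E2"
  proof -
    have "\<bar>F x * G x\<bar> \<le> 1 * (E1 * E2)" using F(1) G(1) by (simp add: abs_mult mult_mono')
    also have "\<dots> \<le> 2 ^ Suc n * (E1 * E2)" using e by (intro mult_right_mono one_le_power) auto
    finally show ?thesis by (simp add: mult.assoc)
  qed
  ultimately show ?case
    using Suc.prems by (simp add: jb_Suc deriv_mult_smooth algebra_simps)
qed

text \<open>From (exp F)' = F' exp F. The size \<open>Z\<close> of the exponential is kept apart
  from the jets of F', since the derivative of a word may be far from 1 while its logarithm varies
  only at the length 1/K. \<open>E\<close> depends on \<open>n\<close> and \<open>C\<close> alone,
  which gives uniformity over all scales and words.\<close>

lemma jb_exp:
  "\<exists>E\<ge>1. \<forall>F K x Z. smooth_real F \<longrightarrow> 0 \<le> K \<longrightarrow> (n > 0 \<longrightarrow> jb (n - 1) (C * K) K (deriv F) x) \<longrightarrow> exp (F x) \<le> Z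
     \<longrightarrow> jb n (E * Z) K (\<lambda>x. exp (F x)) x"
proof (induction n)
  case 0
  then show ?case by (intro exI[of _ 1]) (simp add: jb_0)
next
  case (Suc n)
  then obtain E where E: "E \<ge> 1" "\<And>F K x Z. smooth_real F \<Longrightarrow> 0 \<le> K \<Longrightarrow> (n > 0 \<longrightarrow> jb (n - 1) (C * K) K (deriv F) x) \<Longrightarrow> exp (F x) \<le> Z
     \<Longrightarrow> jb n (E * Z) K (\<lambda>x. exp (F x)) x" by blast
  show ?case
  proof (intro exI[of _ "max 1 (2 ^ n * C * E)"] conjI allI impI)
    fix F K x Z
    assume F: "smooth_real F" "0 \<le> (K::real)" "Suc n > 0 \<longrightarrow> jb (Suc n - 1) (C * K) K (deriv F) x" and Z: "exp (F x) \<le> Z"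
    have Z0: "0 < Z" using Z by (metis exp_gt_zero less_le_trans)
    have 1: "jb n (C * K) K (deriv F) x" using F by simp
    have 2: "jb n (E * Z) K (\<lambda>x. exp (F x)) x"
      using E(2)[OF F(1,2) _ Z] jb_mono[OF 1 order_refl F(2)] by simp
    have "jb n (2 ^ n * (C * K) * (E * Z)) K (\<lambda>x. deriv F x * exp (F x)) x"
      using F by (intro jb_mult 1 2) auto
    moreover have "2 ^ n * (C * K) * (E * Z) \<le> max 1 (2 ^ n * C * E) * Z * K"
    proof -
      have "(2 ^ n * C * E) * (Z * K) \<le> max 1 (2 ^ n * C * E) * (Z * K)" using Z0 F(2) by (intro mult_right_mono) auto
      then show ?thesis by (simp only: mult_ac)
    qed
    ultimately have "jb n (max 1 (2 ^ n * C * E) * Z * K) K (\<lambda>x. deriv F x * exp (F x)) x"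
      using jb_mono F(2) by blast
    moreover have "exp (F x) \<le> max 1 (2 ^ n * C * E) * Z"
      using Z Z0 mult_right_mono[of 1 "max 1 (2 ^ n * C * E)" Z] by linarith
    ultimately show "jb (Suc n) (max 1 (2 ^ n * C * E) * Z) K (\<lambda>x. exp (F x)) x"
      using F by (simp add: jb_Suc deriv_exp_smooth)
  qed simp
qed

text \<open>The outer function will come from a fixed generator with bounded jets, so its bound
  \<open>W\<close> carries no powers of \<open>K\<close>; all the growth is due to the inner
  function.\<close>

lemma jb_compose:
  "\<exists>E\<ge>0. \<forall>V F K x W. smooth_real V \<longrightarrow> smooth_real F \<longrightarrow> 0 \<le> K \<longrightarrow> (n > 0 \<longrightarrow> jb (n - 1) (C * K) K (deriv F) x) \<longrightarrow>
     (\<forall>i\<le>n. \<bar>(deriv ^^ i) V (F x)\<bar> \<le> W) \<longrightarrow> jb n (E * W) K (\<lambda>x. V (F x)) x"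
proof (induction n)
  case 0
  then show ?case by (intro exI[of _ 1]) (simp add: jb_0)
next
  case (Suc n)
  then obtain E where E: "E \<ge> 0" "\<And>V F K x W. smooth_real V \<Longrightarrow> smooth_real F \<Longrightarrow> 0 \<le> K \<Longrightarrow> (n > 0 \<longrightarrow> jb (n - 1) (C * K) K (deriv F) x)
      \<Longrightarrow> (\<forall>i\<le>n. \<bar>(deriv ^^ i) V (F x)\<bar> \<le> W) \<Longrightarrow> jb n (E * W) K (\<lambda>x. V (F x)) x" by blast
  show ?case
  proof (intro exI[of _ "max 1 (2 ^ n * E * C)"] conjI allI impI)
    fix V F K x W
    assume F: "smooth_real V" "smooth_real F" "0 \<le> (K::real)" "Suc n > 0 \<longrightarrow> jb (Suc n - 1) (C * K) K (deriv F) x"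
      and W: "\<forall>i\<le>Suc n. \<bar>(deriv ^^ i) V (F x)\<bar> \<le> W"
    have 1: "jb n (C * K) K (deriv F) x" using F by simp
    have W0: "0 \<le> W" using W[rule_format, of 0] by simp
    have W': "\<forall>i\<le>n. \<bar>(deriv ^^ i) (deriv V) (F x)\<bar> \<le> W"
    proof (intro allI impI)
      fix i assume "i \<le> n"
      then show "\<bar>(deriv ^^ i) (deriv V) (F x)\<bar> \<le> W" using W[rule_format, of "Suc i"] by (simp add: funpow_swap1)
    qed
    have 2: "jb n (E * W) K (\<lambda>x. deriv V (F x)) x"
      using E(2)[OF smooth_deriv[OF F(1)] F(2,3) _ W'] jb_mono[OF 1 order_refl F(3)] by simp
    have "jb n (2 ^ n * (E * W) * (C * K)) K (\<lambda>x. deriv V (F x) * deriv F x) x"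
      by (rule jb_mult[OF smooth_compose[OF smooth_deriv[OF F(1)] F(2)] smooth_deriv[OF F(2)] 2 1 F(3)])
    moreover have "2 ^ n * (E * W) * (C * K) \<le> max 1 (2 ^ n * E * C) * W * K"
    proof -
      have "(2 ^ n * E * C) * (W * K) \<le> max 1 (2 ^ n * E * C) * (W * K)" using W0 F(3) by (intro mult_right_mono) auto
      then show ?thesis by (simp only: mult_ac)
    qed
    ultimately have "jb n (max 1 (2 ^ n * E * C) * W * K) K (\<lambda>x. deriv V (F x) * deriv F x) x"
      using jb_mono F(3) order_refl by metis
    moreover have "\<bar>V (F x)\<bar> \<le> max 1 (2 ^ n * E * C) * W"
    proof -
      have "1 * W \<le> max 1 (2 ^ n * E * C) * W" using W0 by (intro mult_right_mono) auto
      then show ?thesis using W[rule_format, of 0] by simp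
    qed
    ultimately show "jb (Suc n) (max 1 (2 ^ n * E * C) * W) K (\<lambda>x. V (F x)) x"
      using F by (simp add: jb_Suc deriv_compose_smooth)
  qed simp
qed

text \<open>From $2^n$ separated points at which $\varphi$ is small one passes to $2^{n-1}$ separated points at which
  the derivative is small; after $n$ steps only the bound on the $n$-th derivative is left.\<close>

lemma interpolation_nodes:
  "\<exists>C\<ge>0. \<forall>\<phi> p q s H e (x :: nat \<Rightarrow> real). smooth_real \<phi> \<longrightarrow> 0 < s \<longrightarrow> q - p \<le> \<Lambda> * s \<longrightarrow> 0 \<le> H \<longrightarrow> 0 \<le> e \<longrightarrow>
     (\<forall>i<2^n. p \<le> x i \<and> x i \<le> q \<and> \<bar>\<phi> (x i)\<bar> \<le> e) \<longrightarrow> (\<forall>i. Suc i < 2^n \<longrightarrow> x i + s \<le> x (Suc i)) \<longrightarrow>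
     (\<forall>y. p \<le> y \<and> y \<le> q \<longrightarrow> \<bar>(deriv ^^ n) \<phi> y\<bar> \<le> H) \<longrightarrow>
     (\<forall>j\<le>n. \<forall>y. p \<le> y \<and> y \<le> q \<longrightarrow> \<bar>(deriv ^^ j) \<phi> y\<bar> \<le> C * (e / s ^ j + H * s ^ (n - j)))"
proof (induction n)
  case 0
  then show ?case by (intro exI[of _ 1]) auto
next
  case (Suc n)
  then obtain C where C0: "C \<ge> 0" and C: "\<And>\<phi> p q s H e (x :: nat \<Rightarrow> real). smooth_real \<phi> \<Longrightarrow> 0 < s \<Longrightarrow> q - p \<le> \<Lambda> * s \<Longrightarrow> 0 \<le> H \<Longrightarrow> 0 \<le> e \<Longrightarrow>
     (\<forall>i<2^n. p \<le> x i \<and> x i \<le> q \<and> \<bar>\<phi> (x i)\<bar> \<le> e) \<Longrightarrow> (\<forall>i. Suc i < 2^n \<longrightarrow> x i + s \<le> x (Suc i)) \<Longrightarrow>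
     (\<forall>y. p \<le> y \<and> y \<le> q \<longrightarrow> \<bar>(deriv ^^ n) \<phi> y\<bar> \<le> H) \<Longrightarrow>
     (\<forall>j\<le>n. \<forall>y. p \<le> y \<and> y \<le> q \<longrightarrow> \<bar>(deriv ^^ j) \<phi> y\<bar> \<le> C * (e / s ^ j + H * s ^ (n - j)))" by blast
  show ?case
  \<comment> \<open>The summand 2C pays for halving the nodes, where the value bound e becomes 2e/s
    for the derivative. The last summand pays for integrating the derivative away from a node over
    an interval of length at most \<Lambda>s, where the 1 covers the value at the node.\<close>
  proof (intro exI[of _ "1 + 2 * C + \<bar>\<Lambda>\<bar> * (2 * C)"] conjI allI impI)
    fix \<phi> p q s H e j y and x :: "nat \<Rightarrow> real"
    assume \<phi>: "smooth_real \<phi>" and s: "0 < (s::real)" and pq: "q - p \<le> \<Lambda> * s" and H: "0 \<le> (H::real)" and e: "0 \<le> (e::real)"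
      and x: "\<forall>i<2^Suc n. p \<le> x i \<and> x i \<le> q \<and> \<bar>\<phi> (x i)\<bar> \<le> e"
      and sep: "\<forall>i. Suc i < 2^Suc n \<longrightarrow> x i + s \<le> x (Suc i)"
      and bnd: "\<forall>y. p \<le> y \<and> y \<le> q \<longrightarrow> \<bar>(deriv ^^ Suc n) \<phi> y\<bar> \<le> H"
      and j: "j \<le> Suc n" and y: "p \<le> y \<and> y \<le> q"
    have "\<exists>z. x (2*i) < z \<and> z < x (Suc (2*i)) \<and> \<bar>deriv \<phi> z\<bar> \<le> 2 * e / s" if i: "i < 2^n" for i
    proof -
      have i2: "2*i < 2^Suc n" "Suc (2*i) < 2^Suc n" using i by auto
      have gap: "x (2*i) + s \<le> x (Suc (2*i))" using sep i2 by blast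
      then obtain z where z: "x (2*i) < z" "z < x (Suc (2*i))"
        "\<phi> (x (Suc (2*i))) - \<phi> (x (2*i)) = (x (Suc (2*i)) - x (2*i)) * deriv \<phi> z"
        using smooth_mvt[OF \<phi>, of "x (2*i)" "x (Suc (2*i))"] s by auto
      have "s * \<bar>deriv \<phi> z\<bar> \<le> (x (Suc (2*i)) - x (2*i)) * \<bar>deriv \<phi> z\<bar>"
        using gap by (intro mult_right_mono) auto
      also have "\<dots> = \<bar>\<phi> (x (Suc (2*i))) - \<phi> (x (2*i))\<bar>" using z gap s by (simp add: abs_mult)
      also have "\<dots> \<le> 2 * e"
        using x[rule_format, OF i2(1)] x[rule_format, OF i2(2)] by linarith
      finally show ?thesis using z s by (auto simp: field_simps)
    qed
    then obtain z where z: "\<And>i. i < 2^n \<Longrightarrow> x (2*i) < z i \<and> z i < x (Suc (2*i)) \<and> \<bar>deriv \<phi> (z i)\<bar> \<le> 2 * e / s"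
      by metis
    have IH: "\<forall>j\<le>n. \<forall>y. p \<le> y \<and> y \<le> q \<longrightarrow> \<bar>(deriv ^^ j) (deriv \<phi>) y\<bar> \<le> C * ((2 * e / s) / s ^ j + H * s ^ (n - j))"
    proof (rule C[of "deriv \<phi>" s q p H "2 * e / s" z])
      show "\<forall>i<2 ^ n. p \<le> z i \<and> z i \<le> q \<and> \<bar>deriv \<phi> (z i)\<bar> \<le> 2 * e / s"
      proof (intro allI impI)
        fix i :: nat assume i: "i < 2^n"
        have i2: "2*i < 2^Suc n" "Suc (2*i) < 2^Suc n" using i by auto
        have "p \<le> x (2*i)" "x (Suc (2*i)) \<le> q" using x i2 by blast+
        then show "p \<le> z i \<and> z i \<le> q \<and> \<bar>deriv \<phi> (z i)\<bar> \<le> 2 * e / s" using z[OF i] by simp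
      qed
      \<comment> \<open>The new points remain \<open>s\<close> apart because the untouched gap from
        x(2i+1) to x(2i+2) lies between two of them.\<close>
      show "\<forall>i. Suc i < 2 ^ n \<longrightarrow> z i + s \<le> z (Suc i)"
      proof (intro allI impI)
        fix i :: nat assume i: "Suc i < 2^n"
        have "Suc (Suc (2*i)) < 2^Suc n" using i by auto
        then have "x (Suc (2*i)) + s \<le> x (2 * Suc i)" using sep by auto
        then show "z i + s \<le> z (Suc i)" using z[of i] z[of "Suc i"] i by auto
      qed
      show "\<forall>y. p \<le> y \<and> y \<le> q \<longrightarrow> \<bar>(deriv ^^ n) (deriv \<phi>) y\<bar> \<le> H"
        using bnd by (simp add: funpow_swap1)
    qed (use \<phi> s pq H e in auto)
    show "\<bar>(deriv ^^ j) \<phi> y\<bar> \<le> (1 + 2 * C + \<bar>\<Lambda>\<bar> * (2 * C)) * (e / s ^ j + H * s ^ (Suc n - j))"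
    proof (cases j)
      case (Suc i)
      have "\<bar>(deriv ^^ j) \<phi> y\<bar> \<le> C * ((2 * e / s) / s ^ i + H * s ^ (n - i))"
        using IH[rule_format, of i y] j y Suc by (simp add: funpow_swap1)
      also have "\<dots> \<le> C * (2 * (e / s ^ j + H * s ^ (Suc n - j)))"
        using C0 s H e Suc by (intro mult_left_mono) (auto simp: field_simps)
      also have "\<dots> \<le> (1 + 2 * C + \<bar>\<Lambda>\<bar> * (2 * C)) * (e / s ^ j + H * s ^ (Suc n - j))"
      proof -
        have "C * 2 \<le> 1 + 2 * C + \<bar>\<Lambda>\<bar> * (2 * C)" using C0 by simp
        then show ?thesis unfolding mult.assoc[symmetric] using s H e by (intro mult_right_mono) auto
      qed
      finally show ?thesis .
    next
      case 0
      let ?B = "C * (2 * e / s + H * s ^ n)"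
      have B: "\<bar>deriv \<phi> y\<bar> \<le> ?B" if "p \<le> y" "y \<le> q" for y using IH[rule_format, of 0 y] that by simp
      have x0: "p \<le> x 0 \<and> x 0 \<le> q \<and> \<bar>\<phi> (x 0)\<bar> \<le> e" using x by simp
      have B0: "0 \<le> ?B" using C0 s H e by simp
      have "\<bar>\<phi> y - \<phi> (x 0)\<bar> \<le> ?B * \<bar>y - x 0\<bar>"
      proof (cases "x 0 \<le> y")
        case True then show ?thesis using smooth_diff_le[OF \<phi>, of "x 0" y ?B] B x0 y by auto
      next
        case False then show ?thesis using smooth_diff_le[OF \<phi>, of y "x 0" ?B] B x0 y by auto
      qed
      also have "\<dots> \<le> ?B * (\<bar>\<Lambda>\<bar> * s)"
      proof -
        have "\<Lambda> * s \<le> \<bar>\<Lambda>\<bar> * s" using s by simp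
        then show ?thesis using x0 y pq B0 by (intro mult_left_mono) auto
      qed
      also have "\<dots> = \<bar>\<Lambda>\<bar> * C * (2 * e + H * s ^ Suc n)" using s by (simp add: field_simps)
      also have "\<dots> \<le> \<bar>\<Lambda>\<bar> * C * (2 * (e + H * s ^ Suc n))"
        using s H e C0 by (intro mult_left_mono) auto
      finally have "\<bar>\<phi> y\<bar> \<le> e + \<bar>\<Lambda>\<bar> * (2 * C) * (e + H * s ^ Suc n)"
        using x0 by (simp only: mult_ac) linarith
      also have "\<dots> \<le> (1 + 2 * C + \<bar>\<Lambda>\<bar> * (2 * C)) * (e + H * s ^ Suc n)"
      proof -
        have "0 \<le> H * s ^ Suc n" "0 \<le> C * (e + H * s ^ Suc n)" using s H e C0 by auto
        then show ?thesis by (simp add: algebra_simps)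
      qed
      finally show ?thesis using 0 by simp
    qed
  qed (use C0 in auto)
qed

section \<open>Flows conjugate to translations\<close>

lemma dist_int_le: "dist_int x \<le> \<bar>x - of_int p\<bar>"
  unfolding dist_int_def by (rule round_diff_minimal)

lemma dist_int_attained: "\<exists>p. dist_int x = \<bar>x + of_int p\<bar>"
  unfolding dist_int_def by (rule exI[of _ "- round x"]) simp

lemma dist_int_minus [simp]: "dist_int (- x) = dist_int x"
proof -
  have "dist_int (- y) \<le> dist_int y" for y
  proof -
    obtain p where "dist_int y = \<bar>y + of_int p\<bar>" using dist_int_attained by blast
    then show ?thesis using dist_int_le[of "- y" p] by (simp add: abs_minus_commute add.commute)
  qed
  from this[of x] this[of "-x"] show ?thesis by simp
qed

lemma packing:
  assumes "finite I" "\<And>i. i \<in> I \<Longrightarrow> u i < v i" "\<And>i. i \<in> I \<Longrightarrow> a \<le> u i" "\<And>i. i \<in> I \<Longrightarrow> v i \<le> b" "a \<le> (b::real)"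
    and "\<And>i j. i \<in> I \<Longrightarrow> j \<in> I \<Longrightarrow> i \<noteq> j \<Longrightarrow> v i \<le> u j \<or> v j \<le> u i"
  shows "(\<Sum>i\<in>I. v i - u i) \<le> b - a"
  using assms
proof (induction "card I" arbitrary: I b)
  case 0
  then show ?case by simp
next
  case (Suc n)
  have "I \<noteq> {}" using Suc.hyps(2) by auto
  then obtain k where k: "k \<in> I" "\<And>i. i \<in> I \<Longrightarrow> v i \<le> v k"
  proof -
    have "Max (v ` I) \<in> v ` I" using \<open>I \<noteq> {}\<close> Suc.prems(1) by (intro Max_in) auto
    then obtain k where "k \<in> I" "Max (v ` I) = v k" by auto
    moreover have "v i \<le> Max (v ` I)" if "i \<in> I" for i using that Suc.prems(1) by simp
    ultimately show ?thesis using that by auto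
  qed
  have IH: "(\<Sum>i\<in>I - {k}. v i - u i) \<le> u k - a"
  proof (rule Suc.hyps(1))
    fix i assume i: "i \<in> I - {k}"
    have "v k \<le> u i \<or> v i \<le> u k" using Suc.prems(6) k(1) i by blast
    then show "v i \<le> u k" using Suc.prems(2)[of i] k(2)[of i] i by fastforce
  qed (use Suc k in auto)
  have "(\<Sum>i\<in>I. v i - u i) = (v k - u k) + (\<Sum>i\<in>I - {k}. v i - u i)"
    using Suc.prems(1) k(1) by (simp add: sum.remove)
  then show ?case using IH Suc.prems(4)[OF k(1)] by linarith
qed

text \<open>The fundamental domain is cut at the left end of one of the intervals, \<open>k\<close>.
  The translates of that interval act as walls, so no interval, once moved so as to start in the
  domain, can cross its right end.\<close>

lemma packing_mod1:
  fixes u v :: "'a \<Rightarrow> real"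
  assumes fin: "finite I" and uv: "\<And>i. i \<in> I \<Longrightarrow> u i < v i"
    and sep: "\<And>i j p. i \<in> I \<Longrightarrow> j \<in> I \<Longrightarrow> i \<noteq> j \<or> p \<noteq> 0 \<Longrightarrow> v i + of_int p \<le> u j \<or> v j \<le> u i + of_int p"
  shows "(\<Sum>i\<in>I. v i - u i) \<le> 1"
proof (cases "I = {}")
  case False
  then obtain k where k: "k \<in> I" by auto
  define p where "p i = \<lfloor>u i - u k\<rfloor>" for i
  have p: "u k \<le> u i - of_int (p i)" "u i - of_int (p i) < u k + 1" for i
    unfolding p_def by linarith+
  have "(\<Sum>i\<in>I. (v i - of_int (p i)) - (u i - of_int (p i))) \<le> (u k + 1) - u k"
  proof (rule packing)
    fix i assume i: "i \<in> I"
    show "v i - of_int (p i) \<le> u k + 1"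
    proof (cases "i = k \<and> p i = -1")
      case True
      then have False using p[of i] by auto
      then show ?thesis ..
    next
      case False
      then have "k \<noteq> i \<or> 1 + p i \<noteq> 0" by auto
      then have "v k + of_int (1 + p i) \<le> u i \<or> v i \<le> u k + of_int (1 + p i)" by (rule sep[OF k i])
      then show ?thesis using p[of i] uv[OF k] by auto
    qed
  next
    fix i j assume ij: "i \<in> I" "j \<in> I" "i \<noteq> j"
    then show "v i - of_int (p i) \<le> u j - of_int (p j) \<or> v j - of_int (p j) \<le> u i - of_int (p i)"
      using sep[of i j "p j - p i"] by auto
  qed (use fin uv p in auto)
  then show ?thesis by simp
qed simp

text \<open>\<open>h\<close> is only a homeomorphism; continuity of \<open>h\<close> and
  \<open>\<xi>\<close> follows from monotonicity and surjectivity. All regularity enters through the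
  set of times for which \<open>good\<close> holds.\<close>

locale flow =
  fixes h \<xi> :: "real \<Rightarrow> real"
  assumes h_mono: "strict_mono h" and h_\<xi> [simp]: "h (\<xi> y) = y" and \<xi>_h [simp]: "\<xi> (h x) = x"
    and h_1: "h (x + 1) = h x + 1"
begin

definition \<Phi> :: "real \<Rightarrow> real \<Rightarrow> real" where "\<Phi> r x = \<xi> (h x + r)"
definition m :: "real \<Rightarrow> real \<Rightarrow> real" where "m r x = \<Phi> r x - x"
definition good :: "real \<Rightarrow> bool" where "good r \<longleftrightarrow> smooth_real (\<Phi> r) \<and> (\<forall>x. deriv (\<Phi> r) x > 0)"
definition A :: "real \<Rightarrow> real \<Rightarrow> real" where "A r x = ln (deriv (\<Phi> r) x)"

lemma \<xi>_less_iff [simp]: "\<xi> a < \<xi> b \<longleftrightarrow> a < b"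
  using strict_mono_less[OF h_mono, of "\<xi> a" "\<xi> b"] by simp

lemma \<xi>_le_iff [simp]: "\<xi> a \<le> \<xi> b \<longleftrightarrow> a \<le> b"
  using strict_mono_less_eq[OF h_mono, of "\<xi> a" "\<xi> b"] by simp

lemma h_less_iff [simp]: "h a < h b \<longleftrightarrow> a < b" and h_le_iff [simp]: "h a \<le> h b \<longleftrightarrow> a \<le> b"
  using strict_mono_less[OF h_mono] strict_mono_less_eq[OF h_mono] by auto

lemma \<xi>_1: "\<xi> (y + 1) = \<xi> y + 1"
  using \<xi>_h[of "\<xi> y + 1"] by (simp add: h_1)

lemma h_int: "h (x + of_int p) = h x + of_int p" and \<xi>_int: "\<xi> (y + of_int p) = \<xi> y + of_int p"
  using periodic_int[of h 1, OF h_1] periodic_int[of \<xi> 1, OF \<xi>_1] by simp_all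

lemma continuous_\<xi>: "continuous_on UNIV \<xi>"
proof (rule continuous_onI_mono)
  have "range \<xi> = UNIV" using \<xi>_h by (metis surjI)
  then show "open (range \<xi>)" by simp
qed simp

lemma continuous_h: "continuous_on UNIV h"
proof (rule continuous_onI_mono)
  have "range h = UNIV" using h_\<xi> by (metis surjI)
  then show "open (range h)" by simp
qed simp

lemma h_\<Phi> [simp]: "h (\<Phi> r x) = h x + r"
  by (simp add: \<Phi>_def)

lemma \<Phi>_add: "\<Phi> (r + s) x = \<Phi> r (\<Phi> s x)"
  by (simp add: \<Phi>_def algebra_simps)

lemma \<Phi>_0 [simp]: "\<Phi> 0 x = x" and \<Phi>_int: "\<Phi> (r + of_int p) x = \<Phi> r x + of_int p"
  by (simp_all add: \<Phi>_def \<xi>_int flip: add.assoc)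

lemma \<Phi>_1: "\<Phi> r (x + 1) = \<Phi> r x + 1"
proof -
  have "h x + 1 + r = h x + r + 1" by simp
  then show ?thesis by (simp only: \<Phi>_def h_1 \<xi>_1)
qed

lemma \<Phi>_less_iff [simp]: "\<Phi> r x < \<Phi> r y \<longleftrightarrow> x < y" and \<Phi>_le_iff [simp]: "\<Phi> r x \<le> \<Phi> r y \<longleftrightarrow> x \<le> y"
  by (simp_all add: \<Phi>_def)

lemma \<Phi>_less_time_iff [simp]: "\<Phi> r x < \<Phi> s x \<longleftrightarrow> r < s" and \<Phi>_le_time_iff [simp]: "\<Phi> r x \<le> \<Phi> s x \<longleftrightarrow> r \<le> s"
  by (simp_all add: \<Phi>_def)

lemma \<Phi>_gt_iff [simp]: "x < \<Phi> s x \<longleftrightarrow> 0 < s" and \<Phi>_ge_iff [simp]: "x \<le> \<Phi> s x \<longleftrightarrow> 0 \<le> s"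
  using \<Phi>_less_time_iff[of 0 x s] \<Phi>_le_time_iff[of 0 x s] by simp_all

lemma \<Phi>_interval: "\<Phi> a x \<le> y \<Longrightarrow> y \<le> \<Phi> b x \<Longrightarrow> \<exists>s. a \<le> s \<and> s \<le> b \<and> y = \<Phi> s x"
proof -
  assume "\<Phi> a x \<le> y" "y \<le> \<Phi> b x"
  then have "h (\<Phi> a x) \<le> h y" "h y \<le> h (\<Phi> b x)" by (simp_all del: h_\<Phi>)
  then show ?thesis by (intro exI[of _ "h y - h x"]) (simp add: \<Phi>_def)
qed

lemma \<Phi>_commute: "\<Phi> r (\<Phi> s x) = \<Phi> s (\<Phi> r x)"
  by (metis \<Phi>_add add.commute)

lemma continuous_\<Phi>: "continuous_on UNIV (\<Phi> r)" and continuous_\<Phi>_time: "continuous_on UNIV (\<lambda>r. \<Phi> r x)"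
  unfolding \<Phi>_def
  by (intro continuous_on_compose2[OF continuous_\<xi>] continuous_intros continuous_h; simp)+

lemma m_pos: "0 < r \<Longrightarrow> 0 < m r x"
  by (simp add: m_def)

lemma m_nonneg: "0 \<le> r \<Longrightarrow> 0 \<le> m r x"
  by (simp add: m_def)

lemma m_add: "m (r + s) x = m r (\<Phi> s x) + m s x"
  by (simp add: m_def \<Phi>_add)

lemma m_mono: "r \<le> s \<Longrightarrow> m r x \<le> m s x"
  by (simp add: m_def)

lemma m_1: "m r (x + 1) = m r x"
  by (simp add: m_def \<Phi>_1)

lemma continuous_m: "continuous_on UNIV (m r)"
  unfolding m_def by (intro continuous_intros continuous_\<Phi>)

lemma m_sum: "m (real n * r) x = (\<Sum>i<n. m r (\<Phi> (real i * r) x))"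
proof (induction n)
  case (Suc n)
  have "m (real (Suc n) * r) x = m (r + real n * r) x" by (simp add: algebra_simps)
  then show ?case using Suc by (simp add: m_add)
qed (simp add: m_def)

lemma goodD: "good r \<Longrightarrow> smooth_real (\<Phi> r)" "good r \<Longrightarrow> deriv (\<Phi> r) x > 0"
  by (auto simp: good_def)

lemma exp_A: "good r \<Longrightarrow> exp (A r x) = deriv (\<Phi> r) x"
  by (simp add: A_def goodD)

lemma DERIV_\<Phi>: "good r \<Longrightarrow> (\<Phi> r has_real_derivative exp (A r x)) (at x)"
  by (simp add: exp_A smooth_has_derivative goodD)

lemma smooth_A: "good r \<Longrightarrow> smooth_real (A r)"
  unfolding A_def by (intro smooth_ln smooth_deriv) (auto simp: goodD)

lemma A_1: "A r (x + 1) = A r x"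
  unfolding A_def using deriv_periodic[of "\<Phi> r" 1, OF \<Phi>_1] by simp

text \<open>The chain rule makes \<open>A\<close> an additive cocycle over the flow, so that a long
  word is handled as a Birkhoff sum of its generator.\<close>

lemma good_add_A:
  assumes "good r" "good s"
  shows "good (r + s)" "A (r + s) x = A r (\<Phi> s x) + A s x"
proof -
  have eq: "\<Phi> (r + s) = (\<lambda>x. \<Phi> r (\<Phi> s x))" by (auto simp: \<Phi>_add)
  have d: "deriv (\<Phi> (r + s)) = (\<lambda>x. deriv (\<Phi> r) (\<Phi> s x) * deriv (\<Phi> s) x)"
    unfolding eq by (rule deriv_compose_smooth) (simp_all add: goodD assms)
  show "good (r + s)" unfolding good_def d
    unfolding eq using smooth_compose[of "\<Phi> r" "\<Phi> s"] goodD assms by simp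
  show "A (r + s) x = A r (\<Phi> s x) + A s x"
    unfolding A_def d using goodD(2)[OF assms(1), of "\<Phi> s x"] goodD(2)[OF assms(2), of x] by (simp add: ln_mult)
qed

lemma \<Phi>_of_int: "\<Phi> (of_int p) = (\<lambda>x. x + of_int p)"
  using \<Phi>_int[of 0 p] by auto

lemma good_int: "good (of_int p)" "A (of_int p) x = 0"
proof -
  have d: "deriv (\<lambda>x. x + real_of_int p) x = 1" for x
    by (rule DERIV_imp_deriv) (auto intro!: derivative_eq_intros)
  show "good (of_int p)" "A (of_int p) x = 0"
    by (auto simp: good_def A_def \<Phi>_of_int d)
qed

lemma good_add_int: "good r \<Longrightarrow> good (r + of_int p)" "good r \<Longrightarrow> A (r + of_int p) = A r"
proof -
  assume r: "good r"
  show "good (r + of_int p)" using good_add_A[OF r good_int(1)[of p]] by simp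
  have "A (of_int p + r) x = A r x" for x using good_add_A(2)[OF good_int(1)[of p] r] by (simp add: good_int)
  then show "A (r + of_int p) = A r" by (auto simp: add.commute)
qed

lemma good_0: "good 0" "A 0 x = 0"
  using good_int[of 0] by simp_all

lemma good_mult: "good c \<Longrightarrow> good (real n * c)"
proof (induction n)
  case (Suc n)
  then show ?case using good_add_A(1)[of c "real n * c"] by (simp add: algebra_simps)
qed (simp add: good_0)

lemma A_mult_Suc: "good c \<Longrightarrow> A (real (Suc n) * c) x = A c (\<Phi> (real n * c) x) + A (real n * c) x"
  using good_add_A(2)[of c "real n * c" x] good_mult[of c n] by (simp add: algebra_simps)

lemma A_mult: "good c \<Longrightarrow> A (real n * c) x = (\<Sum>j<n. A c (\<Phi> (real j * c) x))"
proof (induction n)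
  case (Suc n)
  then show ?case using A_mult_Suc[of c n x] by simp
qed (simp add: good_0)

lemma good_minus:
  assumes "good r"
  shows "good (- r)"
proof -
  have inv: "\<Phi> r (\<Phi> (- r) y) = y" "\<Phi> (- r) (\<Phi> r y) = y" for y
    by (simp_all flip: \<Phi>_add)
  note * = smooth_inverse_function[of "\<Phi> r" "\<Phi> (- r)", OF goodD(1)[OF assms] goodD(2)[OF assms] inv]
  have "deriv (\<Phi> (- r)) y > 0" for y
    using DERIV_imp_deriv[OF *(2)[of y]] goodD(2)[OF assms, of "\<Phi> (- r) y"] by simp
  then show ?thesis using *(1) by (simp add: good_def)
qed

lemma A_minus: "good r \<Longrightarrow> A (- r) x = - A r (\<Phi> (- r) x)"
  using good_add_A(2)[of r "- r" x] good_minus[of r] by (simp add: good_0)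

lemma smooth_m: "good r \<Longrightarrow> smooth_real (m r)"
  unfolding m_def by (intro smooth_diff) (auto simp: goodD)

lemma deriv_m: "good r \<Longrightarrow> deriv (m r) = (\<lambda>x. exp (A r x) - 1)"
  unfolding m_def
  by (intro ext DERIV_imp_deriv DERIV_diff DERIV_\<Phi> DERIV_ident)

text \<open>By commutation \<open>\<Phi> r\<close> maps the segment from x to
  \<open>\<Phi> \<beta> x\<close> onto the segment of the same time \<beta> at
  \<open>\<Phi> r x\<close>. Displacements are therefore transported by the derivative of
  \<open>\<Phi> r\<close> at an intermediate point.\<close>

lemma m_\<Phi>_bounds:
  assumes "good r" "0 < \<beta>" and lo: "\<And>z. x \<le> z \<Longrightarrow> z \<le> \<Phi> \<beta> x \<Longrightarrow> lo \<le> A r z"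
    and up: "\<And>z. x \<le> z \<Longrightarrow> z \<le> \<Phi> \<beta> x \<Longrightarrow> A r z \<le> up"
  shows "exp lo * m \<beta> x \<le> m \<beta> (\<Phi> r x)" "m \<beta> (\<Phi> r x) \<le> exp up * m \<beta> x"
proof -
  have "x < \<Phi> \<beta> x" using assms by simp
  then obtain z where z: "x < z" "z < \<Phi> \<beta> x" "\<Phi> r (\<Phi> \<beta> x) - \<Phi> r x = (\<Phi> \<beta> x - x) * deriv (\<Phi> r) z"
    using smooth_mvt[OF goodD(1)[OF assms(1)]] by blast
  have "m \<beta> (\<Phi> r x) = exp (A r z) * m \<beta> x"
    using z(3) by (simp add: m_def exp_A[OF assms(1)] \<Phi>_commute[of \<beta> r] mult.commute)
  moreover have "exp lo \<le> exp (A r z)" "exp (A r z) \<le> exp up" using lo[of z] up[of z] z by auto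
  ultimately show "exp lo * m \<beta> x \<le> m \<beta> (\<Phi> r x)" "m \<beta> (\<Phi> r x) \<le> exp up * m \<beta> x"
    using m_pos[OF assms(2), of x] by (simp_all add: mult_right_mono)
qed

lemma m_max:
  obtains x0 where "\<And>x. m r x \<le> m r x0"
  using periodic_attains_max[of "m r"] continuous_m m_1 by blast

subsection \<open>Disjoint orbit segments\<close>

text \<open>In the coordinate \<open>h\<close> the segments of time \<delta> are intervals of length
  \<delta> whose left ends are at least \<delta> apart modulo 1. A segment of time J\<delta> is cut
  into J such pieces, and each of the J families has total length at most 1.\<close>

lemma orbit_packing:
  assumes \<delta>: "0 < \<delta>" "\<delta> \<le> 1" and c: "\<And>j. 1 \<le> j \<Longrightarrow> j < l \<Longrightarrow> \<delta> \<le> dist_int (real j * c)"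
  shows "(\<Sum>j<l. \<Phi> (real j * c + real J * \<delta>) x - \<Phi> (real j * c) x) \<le> real J"
proof -
  have 1: "(\<Sum>j<l. \<Phi> (real j * c + real (Suc i) * \<delta>) x - \<Phi> (real j * c + real i * \<delta>) x) \<le> 1" for i
  proof (rule packing_mod1)
    fix j k and p :: int assume jk: "j \<in> {..<l}" "k \<in> {..<l}" "j \<noteq> k \<or> p \<noteq> 0"
    have far: "\<delta> \<le> \<bar>real j * c + of_int p - real k * c\<bar>"
    proof (cases "j = k")
      case True
      then show ?thesis using jk \<delta> by simp
    next
      case False
      define n where "n = (if j < k then k - j else j - k)"
      have "\<delta> \<le> dist_int (real n * c)" using False jk by (intro c) (auto simp: n_def)
      also have "\<dots> \<le> \<bar>real n * c - of_int (if j < k then p else - p)\<bar>" by (rule dist_int_le)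
      also have "\<dots> = \<bar>real j * c + of_int p - real k * c\<bar>"
        using False by (auto simp: n_def of_nat_diff algebra_simps)
      finally show ?thesis .
    qed
    have "\<Phi> (real j * c + real (Suc i) * \<delta>) x + of_int p = \<xi> (h x + (real j * c + real (Suc i) * \<delta>) + of_int p)"
      "\<Phi> (real j * c + real i * \<delta>) x + of_int p = \<xi> (h x + (real j * c + real i * \<delta>) + of_int p)"
      by (simp_all only: \<Phi>_def \<xi>_int)
    then show "\<Phi> (real j * c + real (Suc i) * \<delta>) x + of_int p \<le> \<Phi> (real k * c + real i * \<delta>) x \<or>
       \<Phi> (real k * c + real (Suc i) * \<delta>) x \<le> \<Phi> (real j * c + real i * \<delta>) x + of_int p"
      using far by (auto simp: \<Phi>_def algebra_simps)
  qed (use \<delta> in \<open>auto simp: algebra_simps\<close>)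
  have "(\<Sum>j<l. \<Phi> (real j * c + real J * \<delta>) x - \<Phi> (real j * c) x)
      = (\<Sum>j<l. \<Sum>i<J. \<Phi> (real j * c + real (Suc i) * \<delta>) x - \<Phi> (real j * c + real i * \<delta>) x)"
    using sum_lessThan_telescope[of "\<lambda>i. \<Phi> (real j * c + real i * \<delta>) x" J for j]
    by (intro sum.cong refl) simp
  also have "\<dots> = (\<Sum>i<J. \<Sum>j<l. \<Phi> (real j * c + real (Suc i) * \<delta>) x - \<Phi> (real j * c + real i * \<delta>) x)"
    by (rule sum.swap)
  also have "\<dots> \<le> (\<Sum>i<J. 1)" by (intro sum_mono 1)
  finally show ?thesis by simp
qed

text \<open>Denjoy's distortion argument: two Birkhoff sums differ by at most the Lipschitz constant
  times the total length of the packed segments.\<close>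

lemma orbit_distortion:
  assumes \<delta>: "0 < \<delta>" "\<delta> \<le> 1" and c: "\<And>j. 1 \<le> j \<Longrightarrow> j < l \<Longrightarrow> \<delta> \<le> dist_int (real j * c)"
    and "good c" and V: "\<And>x y. \<bar>A c x - A c y\<bar> \<le> V * \<bar>x - y\<bar>" and "n \<le> l"
    and y: "x \<le> y" "y \<le> \<Phi> (real J * \<delta>) x"
  shows "\<bar>A (real n * c) y - A (real n * c) x\<bar> \<le> V * real J"
proof -
  have V0: "0 \<le> V" using V[of 1 0] by simp
  have "\<bar>A (real n * c) y - A (real n * c) x\<bar> = \<bar>\<Sum>j<n. A c (\<Phi> (real j * c) y) - A c (\<Phi> (real j * c) x)\<bar>"
    by (simp add: A_mult[OF \<open>good c\<close>] sum_subtractf)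
  also have "\<dots> \<le> (\<Sum>j<n. V * (\<Phi> (real j * c + real J * \<delta>) x - \<Phi> (real j * c) x))"
  proof (rule order_trans[OF sum_abs sum_mono])
    fix j
    have "\<bar>\<Phi> (real j * c) y - \<Phi> (real j * c) x\<bar> \<le> \<Phi> (real j * c + real J * \<delta>) x - \<Phi> (real j * c) x"
      using y by (simp add: \<Phi>_add)
    then show "\<bar>A c (\<Phi> (real j * c) y) - A c (\<Phi> (real j * c) x)\<bar> \<le> V * (\<Phi> (real j * c + real J * \<delta>) x - \<Phi> (real j * c) x)"
      using V[of "\<Phi> (real j * c) y" "\<Phi> (real j * c) x"] mult_left_mono[OF _ V0] by (meson order_trans)
  qed
  also have "\<dots> = V * (\<Sum>j<n. \<Phi> (real j * c + real J * \<delta>) x - \<Phi> (real j * c) x)" by (simp add: sum_distrib_left)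
  also have "\<dots> \<le> V * real J"
    using orbit_packing[OF \<delta>, of n c J x] c \<open>n \<le> l\<close> V0 by (intro mult_left_mono) auto
  finally show ?thesis .
qed

end

section \<open>Estimates at one scale\<close>

lemma quadratic_bound:
  assumes "b\<^sup>2 / 2 \<le> p * b + q" "0 \<le> p" "0 \<le> q"
  shows "b \<le> 2 * p + sqrt (2 * q)"
proof (rule ccontr)
  assume "\<not> ?thesis"
  then have b: "b > 2 * p + sqrt (2 * q)" by simp
  have s: "sqrt (2 * q) * sqrt (2 * q) = 2 * q" using assms by simp
  have s0: "0 \<le> sqrt (2 * q)" using assms by simp
  have b0: "b > 0" "b > sqrt (2 * q)" using b assms s0 by linarith+
  have "b * b > b * (2 * p + sqrt (2 * q))" using b b0 by simp
  moreover have "b * sqrt (2 * q) \<ge> sqrt (2 * q) * sqrt (2 * q)" using b0 s0 by (intro mult_right_mono) auto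
  ultimately show False using assms(1) s by (simp add: power2_eq_square algebra_simps)
qed

lemma abs_exp_minus_1: "\<bar>x\<bar> \<le> V \<Longrightarrow> \<bar>exp x - 1\<bar> \<le> exp V * \<bar>x\<bar>" for x V :: real
proof -
  assume x: "\<bar>x\<bar> \<le> V"
  have "exp x - 1 \<le> exp V * \<bar>x\<bar>"
  proof -
    have "1 - x \<le> exp (- x)" using exp_ge_add_one_self[of "- x"] by simp
    then have "exp x * (1 - x) \<le> exp x * exp (- x)" by (intro mult_left_mono) auto
    then have "exp x - 1 \<le> exp x * x" by (simp add: exp_minus algebra_simps)
    also have "\<dots> \<le> exp x * \<bar>x\<bar>" by simp
    also have "\<dots> \<le> exp V * \<bar>x\<bar>" using x by (intro mult_right_mono) auto
    finally show ?thesis .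
  qed
  moreover have "1 - exp x \<le> exp V * \<bar>x\<bar>"
  proof -
    have "1 - exp x \<le> 1 * \<bar>x\<bar>" using exp_ge_add_one_self[of x] by linarith
    also have "\<dots> \<le> exp V * \<bar>x\<bar>" using x by (intro mult_right_mono) auto
    finally show ?thesis .
  qed
  ultimately show ?thesis by simp
qed

text \<open>\<open>Cs\<close> will consist of the rotation numbers and their negatives.
  \<open>\<Sigma>0\<close> bounds the Schwarzian derivatives of the generators. \<open>V1\<close> is
  an a priori bound for \<open>A\<close> at the scales in use; it will come from a Denjoy-Koksma
  estimate and then be preserved from scale to scale.\<close>

locale flow_gens = flow +
  fixes Cs :: "real set" and V0 V1 \<Sigma>0 :: real
  assumes gens: "c \<in> Cs \<Longrightarrow> good c"
    and V0: "c \<in> Cs \<Longrightarrow> \<bar>A c x - A c y\<bar> \<le> V0 * \<bar>x - y\<bar>" "0 \<le> V0"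
    and \<Sigma>0: "c \<in> Cs \<Longrightarrow> \<bar>deriv (deriv (A c)) x - (deriv (A c) x)\<^sup>2 / 2\<bar> \<le> \<Sigma>0" "0 \<le> \<Sigma>0"
    and V1: "0 \<le> V1"
begin

definition lev :: "real \<Rightarrow> bool" where
  "lev \<alpha> \<longleftrightarrow> good \<alpha> \<and> 0 < \<alpha> \<and> \<alpha> \<le> 1 \<and> (\<forall>x. \<bar>A \<alpha> x\<bar> \<le> V1)"

text \<open>The multiples of \<open>c\<close> below \<open>l\<close> stay \<alpha>/8 away from the
  integers, so that segments of time \<alpha>, being eight such pieces, have multiplicity at most 8
  along the word. The second factor 8 ensures that \<alpha> contains at least eight steps of time
  \<alpha>'.\<close>

definition step :: "real \<Rightarrow> real \<Rightarrow> real \<Rightarrow> nat \<Rightarrow> bool" where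
  "step \<alpha> \<alpha>' c l \<longleftrightarrow> c \<in> Cs \<and> 0 < \<alpha>' \<and> \<alpha>' \<le> \<alpha> / 8 \<and> \<alpha> \<le> 1 \<and> (\<exists>p. \<alpha>' = real l * c + of_int p) \<and>
     (\<forall>j. 1 \<le> j \<longrightarrow> j < l \<longrightarrow> \<alpha> / 8 \<le> dist_int (real j * c))"

text \<open>\<open>E0\<close> is the distortion of a word over the eight pieces of a segment of time
  \<alpha>; \<open>F0\<close> compares two adjacent segments of time \<alpha> with one of
  them.\<close>

definition E0 :: real where "E0 = exp (V0 * 8)"
definition F0 :: real where "F0 = 1 + exp V1"

lemma E0: "E0 \<ge> 1" and F0: "F0 \<ge> 1"
  by (simp_all add: E0_def F0_def V0)

lemma levD: "lev \<alpha> \<Longrightarrow> good \<alpha>" "lev \<alpha> \<Longrightarrow> 0 < \<alpha>" "lev \<alpha> \<Longrightarrow> \<alpha> \<le> 1" "lev \<alpha> \<Longrightarrow> \<bar>A \<alpha> x\<bar> \<le> V1"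
  by (auto simp: lev_def)

lemma stepD:
  assumes "step \<alpha> \<alpha>' c l"
  shows "c \<in> Cs" "0 < \<alpha>'" "\<alpha>' \<le> \<alpha> / 8" "\<alpha> \<le> 1" "0 < \<alpha>" "good c" "good \<alpha>'" "A \<alpha>' = A (real l * c)"
    "\<And>j. 1 \<le> j \<Longrightarrow> j < l \<Longrightarrow> \<alpha> / 8 \<le> dist_int (real j * c)"
proof -
  show 1: "c \<in> Cs" "0 < \<alpha>'" "\<alpha>' \<le> \<alpha> / 8" "\<alpha> \<le> 1" "\<And>j. 1 \<le> j \<Longrightarrow> j < l \<Longrightarrow> \<alpha> / 8 \<le> dist_int (real j * c)"
    using assms by (auto simp: step_def)
  then show "0 < \<alpha>" by simp
  show c: "good c" using gens 1 by simp
  obtain p where "\<alpha>' = real l * c + of_int p" using assms by (auto simp: step_def)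
  then show "good \<alpha>'" "A \<alpha>' = A (real l * c)" using good_add_int good_mult[OF c] by auto
qed

section \<open>Distortion and sums of derivatives along a word\<close>

lemma word_distortion:
  assumes "step \<alpha> \<alpha>' c l" "n \<le> l" "x \<le> y" "y \<le> \<Phi> (real J * (\<alpha> / 8)) x"
  shows "\<bar>A (real n * c) y - A (real n * c) x\<bar> \<le> V0 * real J"
proof (rule orbit_distortion[where \<delta>="\<alpha>/8" and l=l])
  note s = stepD[OF assms(1)]
  show "\<And>x y. \<bar>A c x - A c y\<bar> \<le> V0 * \<bar>x - y\<bar>" using V0 s by blast
qed (use assms stepD[OF assms(1)] in auto)

lemma word_deriv:
  assumes "step \<alpha> \<alpha>' c l" "n \<le> l"
  shows "exp (A (real n * c) x) * m \<alpha> x \<le> E0 * m \<alpha> (\<Phi> (real n * c) x)"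
proof -
  note s = stepD[OF assms(1)]
  have "exp (A (real n * c) x - V0 * 8) * m \<alpha> x \<le> m \<alpha> (\<Phi> (real n * c) x)"
  proof (rule m_\<Phi>_bounds(1)[where up="A (real n * c) x + V0 * 8"])
    fix z assume "x \<le> z" "z \<le> \<Phi> \<alpha> x"
    then have "\<bar>A (real n * c) z - A (real n * c) x\<bar> \<le> V0 * 8"
      using word_distortion[OF assms, of x z 8] by simp
    then show "A (real n * c) x - V0 * 8 \<le> A (real n * c) z" "A (real n * c) z \<le> A (real n * c) x + V0 * 8"
      by simp_all
  qed (use s good_mult in auto)
  then show ?thesis by (simp add: exp_diff E0_def field_simps)
qed

text \<open>Up to distortion, derivative times displacement is the length of the image segment, and
  these lengths are bounded by packing.\<close>

lemma word_sum:
  assumes "step \<alpha> \<alpha>' c l" "n \<le> l"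
  shows "(\<Sum>j<n. exp (A (real j * c) x)) * m \<alpha> x \<le> 8 * E0"
proof -
  note s = stepD[OF assms(1)]
  have "(\<Sum>j<n. exp (A (real j * c) x)) * m \<alpha> x \<le> (\<Sum>j<n. E0 * m \<alpha> (\<Phi> (real j * c) x))"
    unfolding sum_distrib_right using assms by (intro sum_mono word_deriv[OF assms(1)]) auto
  also have "\<dots> = E0 * (\<Sum>j<n. \<Phi> (real j * c + real 8 * (\<alpha> / 8)) x - \<Phi> (real j * c) x)"
    by (simp add: sum_distrib_left m_def \<Phi>_add[of \<alpha>, symmetric] add.commute)
  also have "\<dots> \<le> E0 * real 8"
    using orbit_packing[of "\<alpha>/8" n c 8 x] s assms E0 by (intro mult_left_mono) auto
  finally show ?thesis by simp
qed

lemma word_sup: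
  assumes "step \<alpha> \<alpha>' c l" "n \<le> l" and M: "\<And>y. m \<alpha> y \<le> M"
  shows "exp (A (real n * c) x) \<le> E0 * M / m \<alpha> x"
proof -
  note s = stepD[OF assms(1)]
  have "E0 * m \<alpha> (\<Phi> (real n * c) x) \<le> E0 * M" using E0 M by (intro mult_left_mono) auto
  then show ?thesis using word_deriv[OF assms(1,2), of x] m_pos[OF s(5), of x]
    by (simp add: pos_le_divide_eq)
qed

text \<open>A segment of time \<alpha> that starts at most \<alpha> away from x is contained in two
  consecutive segments of time \<alpha>, one of them based at x.\<close>

lemma m_near1:
  assumes "lev \<alpha>" "\<bar>s\<bar> \<le> \<alpha>"
  shows "m \<alpha> (\<Phi> s x) \<le> F0 * m \<alpha> x"
proof -
  note l = levD[OF assms(1)]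
  have up: "m \<alpha> (\<Phi> \<alpha> y) \<le> exp V1 * m \<alpha> y" and dn: "exp (- V1) * m \<alpha> y \<le> m \<alpha> (\<Phi> \<alpha> y)" for y
    using m_\<Phi>_bounds[OF l(1,2), of y "- V1" V1] l(4) by (auto simp: abs_le_iff minus_le_iff)
  show ?thesis
  proof (cases "s \<ge> 0")
    case True
    have "m \<alpha> (\<Phi> s x) \<le> m (\<alpha> + \<alpha>) x"
      using assms True unfolding m_def by (simp flip: \<Phi>_add) (smt (verit) \<Phi>_ge_iff \<Phi>_le_time_iff)
    also have "\<dots> = m \<alpha> (\<Phi> \<alpha> x) + m \<alpha> x" by (rule m_add)
    also have "\<dots> \<le> F0 * m \<alpha> x" using up[of x] by (simp add: F0_def distrib_right)
    finally show ?thesis .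
  next
    case False
    have "\<Phi> (- \<alpha>) x \<le> \<Phi> s x" using assms by simp
    moreover have "\<Phi> \<alpha> (\<Phi> s x) \<le> \<Phi> \<alpha> x" using False \<Phi>_le_time_iff[of s x 0] by simp
    ultimately have "m \<alpha> (\<Phi> s x) \<le> \<Phi> \<alpha> x - \<Phi> (- \<alpha>) x" unfolding m_def by linarith
    also have "\<dots> = m \<alpha> (\<Phi> (- \<alpha>) x) + m \<alpha> x" by (simp add: m_def flip: \<Phi>_add)
    also have "m \<alpha> (\<Phi> (- \<alpha>) x) \<le> exp V1 * m \<alpha> x"
      using dn[of "\<Phi> (- \<alpha>) x"] by (simp add: exp_minus field_simps flip: \<Phi>_add)
    finally show ?thesis by (simp add: F0_def algebra_simps)
  qed
qed

lemma m_near: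
  assumes "lev \<alpha>" "\<bar>s\<bar> \<le> real J * \<alpha>"
  shows "m \<alpha> (\<Phi> s x) \<le> F0 ^ J * m \<alpha> x"
  using assms(2)
proof (induction J arbitrary: s)
  case 0
  then show ?case by simp
next
  case (Suc J)
  note l = levD[OF assms(1)]
  define t where "t = (if \<bar>s\<bar> \<le> \<alpha> then s else if s > 0 then \<alpha> else - \<alpha>)"
  have t: "\<bar>t\<bar> \<le> \<alpha>" "\<bar>s - t\<bar> \<le> real J * \<alpha>"
  proof -
    show "\<bar>t\<bar> \<le> \<alpha>" using l(2) by (auto simp: t_def)
    show "\<bar>s - t\<bar> \<le> real J * \<alpha>" using Suc.prems l(2) by (auto simp: t_def algebra_simps abs_if split: if_splits)
  qed
  have "m \<alpha> (\<Phi> s x) = m \<alpha> (\<Phi> t (\<Phi> (s - t) x))" by (simp flip: \<Phi>_add)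
  also have "\<dots> \<le> F0 * m \<alpha> (\<Phi> (s - t) x)" using m_near1[OF assms(1) t(1)] .
  also have "\<dots> \<le> F0 * (F0 ^ J * m \<alpha> x)" using Suc.IH[OF t(2)] F0 by (intro mult_left_mono) auto
  finally show ?case by simp
qed

lemma m_near_lower:
  assumes "lev \<alpha>" "\<bar>s\<bar> \<le> real J * \<alpha>"
  shows "m \<alpha> x \<le> F0 ^ J * m \<alpha> (\<Phi> s x)"
  using m_near[OF assms(1), of "- s" J "\<Phi> s x"] assms(2) by (simp flip: \<Phi>_add)

text \<open>The Schwarzian derivative of \<open>\<Phi> r\<close>, written through the logarithm of
  its first derivative.\<close>

definition Sch :: "real \<Rightarrow> real \<Rightarrow> real" where
  "Sch r x = deriv (deriv (A r)) x - (deriv (A r) x)\<^sup>2 / 2"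

text \<open>The Schwarzian of an iterate is a sum of terms weighted by the square of the derivative; this is what
  makes the cost of a derivative smaller than the inverse length scale.\<close>

lemma Sch_mult:
  assumes "good c"
  shows "Sch (real n * c) x = (\<Sum>j<n. Sch c (\<Phi> (real j * c) x) * exp (2 * A (real j * c) x))"
proof (induction n)
  case 0
  have "A 0 = (\<lambda>x. 0)" by (auto simp: good_0)
  then show ?case by (simp add: Sch_def)
next
  case (Suc n)
  let ?w = "A c" and ?F = "\<Phi> (real n * c)" and ?B = "A (real n * c)"
  have gn: "good (real n * c)" using assms by (rule good_mult)
  have sm: "smooth_real ?w" "smooth_real ?B" "smooth_real ?F" using assms gn by (simp_all add: smooth_A goodD)
  have eq: "A (real (Suc n) * c) = (\<lambda>x. ?w (?F x) + ?B x)" using A_mult_Suc[OF assms, of n] by (intro ext)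
  have dF: "deriv ?F = (\<lambda>x. exp (?B x))" by (simp add: exp_A[OF gn])
  have d1: "deriv (A (real (Suc n) * c)) = (\<lambda>x. deriv ?w (?F x) * exp (?B x) + deriv ?B x)"
    unfolding eq using sm
    by (simp add: deriv_add_smooth smooth_compose[OF sm(1,3)] deriv_compose_smooth[OF sm(1,3)] dF)
  have d2: "deriv (deriv (A (real (Suc n) * c))) = (\<lambda>x. (deriv (deriv ?w) (?F x) * exp (?B x) * exp (?B x)
     + deriv ?w (?F x) * (deriv ?B x * exp (?B x))) + deriv (deriv ?B) x)"
    unfolding d1 using sm
    by (simp add: deriv_add_smooth deriv_mult_smooth smooth_mult smooth_deriv smooth_exp smooth_compose[OF smooth_deriv[OF sm(1)] sm(3)]
        deriv_compose_smooth[OF smooth_deriv[OF sm(1)] sm(3)] dF deriv_exp_smooth)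
  have "Sch (real (Suc n) * c) x = Sch (real n * c) x + Sch c (?F x) * exp (2 * ?B x)"
    by (simp only: Sch_def fun_cong[OF d2, of x] fun_cong[OF d1, of x] exp_double)
      (simp add: power2_eq_square algebra_simps)
  then show ?case using Suc by simp
qed

text \<open>Of the two derivative factors in each weight, one is bounded by its supremum E0 M/m, and
  the other is summed to 8 E0/m by packing.\<close>

lemma Sch_bound:
  assumes "step \<alpha> \<alpha>' c l" "n \<le> l" and M: "\<And>y. m \<alpha> y \<le> M"
  shows "\<bar>Sch (real n * c) x\<bar> \<le> 8 * \<Sigma>0 * E0\<^sup>2 * M / (m \<alpha> x)\<^sup>2"
proof -
  note s = stepD[OF assms(1)]
  have mp: "0 < m \<alpha> x" using m_pos s by simp
  have M0: "0 \<le> M" using M[of x] mp by simp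
  have "\<bar>Sch (real n * c) x\<bar> \<le> (\<Sum>j<n. \<Sigma>0 * (exp (A (real j * c) x) * (E0 * M / m \<alpha> x)))"
    unfolding Sch_mult[OF s(6)]
  proof (rule order_trans[OF sum_abs sum_mono])
    fix j assume "j \<in> {..<n}"
    then have "exp (A (real j * c) x) \<le> E0 * M / m \<alpha> x" using word_sup[OF assms(1) _ M, of j] assms(2) by simp
    then have "exp (2 * A (real j * c) x) \<le> exp (A (real j * c) x) * (E0 * M / m \<alpha> x)"
      unfolding exp_double power2_eq_square by (intro mult_left_mono) auto
    then show "\<bar>Sch c (\<Phi> (real j * c) x) * exp (2 * A (real j * c) x)\<bar> \<le> \<Sigma>0 * (exp (A (real j * c) x) * (E0 * M / m \<alpha> x))"
      unfolding abs_mult using \<Sigma>0(1)[OF s(1)] \<Sigma>0(2) by (intro mult_mono) (auto simp: Sch_def)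
  qed
  also have "\<dots> = \<Sigma>0 * E0 * M / (m \<alpha> x)\<^sup>2 * ((\<Sum>j<n. exp (A (real j * c) x)) * m \<alpha> x)"
    using mp by (simp add: sum_distrib_right sum_distrib_left power2_eq_square field_simps)
  also have "\<dots> \<le> \<Sigma>0 * E0 * M / (m \<alpha> x)\<^sup>2 * (8 * E0)"
    using \<Sigma>0 E0 M0 by (intro mult_left_mono word_sum[OF assms(1,2)]) auto
  finally show ?thesis by (simp add: power2_eq_square mult_ac)
qed

text \<open>Collects the coefficients of 2p + sqrt(2q) from \<open>quadratic_bound\<close>, where p
  = e^V1 a and q = 8 \<Sigma>0 E0^2 M.\<close>

definition C1 :: real where "C1 = 2 * exp V1 + 4 * E0 * sqrt \<Sigma>0 + 1"

text \<open>A maximum principle for G = m B'. Where G^2 is largest, G = 0 or G' = 0; in the latter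
  case replacing B'' by S + B'^2/2 gives a quadratic inequality for the absolute value of G, with
  linear coefficient O(a) and constant term O(M).\<close>

lemma first_deriv_bound:
  assumes "lev \<alpha>" "step \<alpha> \<alpha>' c l" "n \<le> l" and M: "\<And>y. m \<alpha> y \<le> M"
    and a: "\<And>y. \<bar>A \<alpha> y\<bar> \<le> a" "a \<le> V1"
  shows "m \<alpha> x * \<bar>deriv (A (real n * c)) x\<bar> \<le> C1 * (a + sqrt M)"
proof -
  note s = stepD[OF assms(2)] and l = levD[OF assms(1)]
  let ?B = "A (real n * c)"
  have gn: "good (real n * c)" using s good_mult by simp
  have sB: "smooth_real ?B" "smooth_real (m \<alpha>)" using gn l smooth_A smooth_m by auto
  define G where "G x = m \<alpha> x * deriv ?B x" for x
  have sG: "smooth_real G" unfolding G_def using sB by auto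
  have M0: "0 \<le> M" using M[of 0] m_pos[OF s(5), of 0] by simp
  have a0: "0 \<le> a" using a(1)[of 0] by simp
  have "continuous_on UNIV (\<lambda>x. (G x)\<^sup>2)" using smooth_continuous_on[OF sG] by (intro continuous_intros)
  moreover have "(G (x + 1))\<^sup>2 = (G x)\<^sup>2" for x
    unfolding G_def using deriv_periodic[of ?B 0] by (simp add: m_1 A_1)
  ultimately obtain x0 where x0: "\<And>x. (G x)\<^sup>2 \<le> (G x0)\<^sup>2" using periodic_attains_max[of "\<lambda>x. (G x)\<^sup>2"] by blast
  have dG: "deriv G = (\<lambda>x. deriv (m \<alpha>) x * deriv ?B x + m \<alpha> x * deriv (deriv ?B) x)"
    unfolding G_def using sB by (simp add: deriv_mult_smooth smooth_deriv)
  have "((\<lambda>x. (G x)\<^sup>2) has_real_derivative 2 * G x0 * deriv G x0) (at x0)"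
    using smooth_has_derivative[OF sG] by (auto intro!: derivative_eq_intros)
  from DERIV_local_max[OF this, of 1] x0 have "G x0 = 0 \<or> deriv G x0 = 0" by auto
  moreover have "\<bar>G x0\<bar> \<le> C1 * (a + sqrt M)" if "deriv G x0 = 0"
  proof -
    let ?p = "exp V1 * a" and ?q = "8 * \<Sigma>0 * E0\<^sup>2 * M" and ?m = "m \<alpha> x0" and ?D = "deriv ?B x0"
    have mp: "0 < ?m" using m_pos s by simp
    have m': "\<bar>deriv (m \<alpha>) x0\<bar> \<le> ?p"
    proof -
      have "\<bar>deriv (m \<alpha>) x0\<bar> \<le> exp V1 * \<bar>A \<alpha> x0\<bar>"
        using abs_exp_minus_1[of "A \<alpha> x0" V1] l by (simp add: deriv_m[OF l(1)])
      also have "\<dots> \<le> ?p" using a by simp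
      finally show ?thesis .
    qed
    have "\<bar>?m\<^sup>2 * Sch (real n * c) x0\<bar> \<le> ?q"
      using Sch_bound[OF assms(2,3) M, of x0] mp by (simp add: abs_mult field_simps)
    moreover have "deriv (m \<alpha>) x0 * ?D + ?m * (Sch (real n * c) x0 + ?D\<^sup>2 / 2) = 0"
      using that unfolding dG Sch_def by simp
    \<comment> \<open>The extra factor m turns every occurrence of B' into G.\<close>
    then have "?m * (deriv (m \<alpha>) x0 * ?D + ?m * (Sch (real n * c) x0 + ?D\<^sup>2 / 2)) = 0" by simp
    then have "(G x0)\<^sup>2 / 2 = - (deriv (m \<alpha>) x0 * G x0) - ?m\<^sup>2 * Sch (real n * c) x0"
      unfolding G_def by (simp add: power2_eq_square algebra_simps)
    moreover have "\<bar>deriv (m \<alpha>) x0 * G x0\<bar> \<le> ?p * \<bar>G x0\<bar>" using m' by (simp add: abs_mult mult_right_mono)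
    ultimately have "\<bar>G x0\<bar>\<^sup>2 / 2 \<le> ?p * \<bar>G x0\<bar> + ?q" unfolding power2_abs by linarith
    then have "\<bar>G x0\<bar> \<le> 2 * ?p + sqrt (2 * ?q)"
      by (rule quadratic_bound) (use a0 M0 \<Sigma>0 in auto)
    also have "sqrt (2 * ?q) = 4 * E0 * sqrt \<Sigma>0 * sqrt M"
    proof -
      have "2 * ?q = (4 * E0)\<^sup>2 * (\<Sigma>0 * M)" by (simp add: power2_eq_square)
      then show ?thesis using E0 by (simp add: real_sqrt_mult)
    qed
    also have "2 * ?p + 4 * E0 * sqrt \<Sigma>0 * sqrt M \<le> C1 * a + C1 * sqrt M"
    proof (rule add_mono)
      have "0 \<le> E0 * sqrt \<Sigma>0" using E0 \<Sigma>0 by simp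
      then have "2 * exp V1 \<le> C1" "4 * E0 * sqrt \<Sigma>0 \<le> C1" by (simp_all add: C1_def)
      then have "2 * exp V1 * a \<le> C1 * a" "4 * E0 * sqrt \<Sigma>0 * sqrt M \<le> C1 * sqrt M"
        using a0 M0 by (simp_all add: mult_right_mono)
      then show "2 * ?p \<le> C1 * a" "4 * E0 * sqrt \<Sigma>0 * sqrt M \<le> C1 * sqrt M" by simp_all
    qed
    finally show ?thesis by (simp add: algebra_simps)
  qed
  moreover have "0 \<le> C1 * (a + sqrt M)" using a0 M0 E0 \<Sigma>0 by (simp add: C1_def)
  ultimately have "\<bar>G x0\<bar> \<le> C1 * (a + sqrt M)" by auto
  moreover have "\<bar>G x\<bar> \<le> \<bar>G x0\<bar>" using x0[of x] by (simp add: abs_le_square_iff)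
  ultimately show ?thesis using m_pos[OF s(5), of x] by (simp add: G_def abs_mult)
qed

text \<open>This is T E0^2 L^2 / M in the proof below: \<open>F0 ^ 4\<close> carries the Schwarzian
  bound to the critical point, (F0 + 1)^2 comes from the length of a segment of time 2\<alpha>, and
  the last E0^2 bounds the distortion of u.\<close>

definition C2 :: real where "C2 = 8 * \<Sigma>0 * E0\<^sup>2 * F0 ^ 4 * (F0 + 1)\<^sup>2 * E0\<^sup>2"

lemma C2: "0 \<le> C2"
  using E0 F0 \<Sigma>0 by (simp add: C2_def)

text \<open>With $u = e^{-A/2}$ one has $u'' = -S u/2$, so near a critical point of $A$ only the Schwarzian enters.\<close>

lemma flat_near_critical:
  assumes "lev \<alpha>" "step \<alpha> \<alpha>' c l" and M: "\<And>y. m \<alpha> y \<le> M" and crit: "deriv (A \<alpha>') x0 = 0"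
    and y: "x0 \<le> y" "y \<le> \<Phi> (2 * \<alpha>) x0"
  shows "\<bar>A \<alpha>' y - A \<alpha>' x0\<bar> \<le> C2 * M"
proof -
  note s = stepD[OF assms(2)] and l = levD[OF assms(1)]
  let ?B = "A \<alpha>'"
  have sB: "smooth_real ?B" using s(7) by (rule smooth_A)
  have mp: "0 < m \<alpha> z" for z using m_pos s by simp
  have M0: "0 \<le> M" using M[of 0] mp[of 0] by simp
  define u where "u x = exp (- (1/2) * ?B x)" for x
  have su: "smooth_real u" unfolding u_def by (intro smooth_exp smooth_cmult sB)
  have du: "deriv u = (\<lambda>x. (- (1/2) * deriv ?B x) * u x)"
    unfolding u_def deriv_exp_smooth[OF smooth_cmult[OF sB]] deriv_cmult_smooth[OF sB] ..
  have ddu: "deriv (deriv u) x = - (1/2) * Sch \<alpha>' x * u x" for x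
  proof -
    have "deriv (deriv u) = (\<lambda>x. (- (1/2) * deriv (deriv ?B) x) * u x + (- (1/2) * deriv ?B x) * deriv u x)"
      unfolding du using sB su
      by (simp only: deriv_mult_smooth deriv_cmult_smooth smooth_cmult smooth_deriv) (simp only: du)
    from fun_cong[OF this, of x] show ?thesis
      by (simp only: fun_cong[OF du, of x] Sch_def) (simp add: power2_eq_square algebra_simps)
  qed
  \<comment> \<open>A segment of time 2\<alpha> has 16 pieces, hence distortion 16 V0; the factor
    1/2 in u brings this back to \<open>E0\<close> = e^(8 V0).\<close>
  have near: "\<bar>?B z - ?B z'\<bar> \<le> V0 * 16" if "x0 \<le> z" "z \<le> z'" "z' \<le> \<Phi> (2 * \<alpha>) x0" for z z'
  proof -
    have "z' \<le> \<Phi> (real 16 * (\<alpha> / 8)) z"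
      using that order_trans[of z' "\<Phi> (2 * \<alpha>) x0" "\<Phi> (2 * \<alpha>) z"] by simp
    then show ?thesis
      using word_distortion[OF assms(2) order_refl that(2), of 16] s(8) by (simp add: abs_minus_commute)
  qed
  have u_le: "u z \<le> E0 * u z'" if "x0 \<le> z" "z \<le> z'" "z' \<le> \<Phi> (2 * \<alpha>) x0" for z z'
  proof -
    have "- (1/2) * ?B z \<le> V0 * 8 - (1/2) * ?B z'" using near[OF that] by linarith
    then show ?thesis by (simp add: u_def E0_def flip: exp_add)
  qed
  define L where "L = (F0 + 1) * m \<alpha> x0"
  have len: "z - x0 \<le> L" if "z \<le> \<Phi> (2 * \<alpha>) x0" for z
  proof -
    have "z - x0 \<le> m (\<alpha> + \<alpha>) x0" using that by (simp add: m_def)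
    also have "\<dots> = m \<alpha> (\<Phi> \<alpha> x0) + m \<alpha> x0" by (rule m_add)
    also have "\<dots> \<le> F0 * m \<alpha> x0 + m \<alpha> x0" using m_near1[OF assms(1), of \<alpha> x0] l by simp
    finally show ?thesis by (simp add: L_def distrib_right)
  qed
  have L0: "0 \<le> L" using F0 mp[of x0] by (simp add: L_def)
  define T where "T = 8 * \<Sigma>0 * E0\<^sup>2 * M * F0 ^ 4 / (m \<alpha> x0)\<^sup>2"
  have T0: "0 \<le> T" using \<Sigma>0 M0 F0 by (simp add: T_def)
  have Sb: "\<bar>Sch \<alpha>' z\<bar> \<le> T" if z: "x0 \<le> z" "z \<le> \<Phi> (2 * \<alpha>) x0" for z
  proof -
    obtain r where r: "0 \<le> r" "r \<le> 2 * \<alpha>" "z = \<Phi> r x0" using \<Phi>_interval[of 0 x0 z "2 * \<alpha>"] z by auto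
    have "m \<alpha> x0 \<le> F0\<^sup>2 * m \<alpha> z" using m_near_lower[OF assms(1), of r 2 x0] r by simp
    then have "(m \<alpha> x0)\<^sup>2 \<le> (F0\<^sup>2 * m \<alpha> z)\<^sup>2" using mp[of x0] by (intro power_mono) auto
    then have "1 / (m \<alpha> z)\<^sup>2 \<le> F0 ^ 4 / (m \<alpha> x0)\<^sup>2"
      using mp[of x0] mp[of z] by (simp add: power_mult_distrib field_simps flip: power_mult)
    then have "8 * \<Sigma>0 * E0\<^sup>2 * M * (1 / (m \<alpha> z)\<^sup>2) \<le> 8 * \<Sigma>0 * E0\<^sup>2 * M * (F0 ^ 4 / (m \<alpha> x0)\<^sup>2)"
      using \<Sigma>0 M0 by (intro mult_left_mono) auto
    then show ?thesis using Sch_bound[OF assms(2) order_refl M, of z] s(8) by (simp add: T_def Sch_def)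
  qed
  \<comment> \<open>u' vanishes at x0, so integrating u'' bounds u'; since u' = -B' u/2, this bounds
    B'.\<close>
  have B': "\<bar>deriv ?B z\<bar> \<le> T * E0\<^sup>2 * L" if z: "x0 \<le> z" "z \<le> \<Phi> (2 * \<alpha>) x0" for z
  proof -
    have "\<bar>deriv u z - deriv u x0\<bar> \<le> (1/2 * T * (E0\<^sup>2 * u z)) * (z - x0)"
    proof (rule smooth_diff_le[OF smooth_deriv[OF su] z(1)])
      fix w assume w: "x0 \<le> w" "w \<le> z"
      have "\<bar>deriv (deriv u) w\<bar> = 1/2 * \<bar>Sch \<alpha>' w\<bar> * u w" by (simp add: ddu abs_mult u_def)
      also have "\<dots> \<le> 1/2 * T * (E0 * u z)"
        using Sb[of w] w z u_le[of w z] T0 by (intro mult_mono) (auto simp: u_def)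
      also have "\<dots> \<le> 1/2 * T * (E0\<^sup>2 * u z)"
        using E0 T0 by (intro mult_left_mono mult_right_mono) (auto simp: u_def power2_eq_square)
      finally show "\<bar>deriv (deriv u) w\<bar> \<le> 1/2 * T * (E0\<^sup>2 * u z)" .
    qed
    also have "\<dots> \<le> (1/2 * T * (E0\<^sup>2 * u z)) * L"
      using len[OF z(2)] T0 by (intro mult_left_mono) (auto simp: u_def)
    finally have "1/2 * \<bar>deriv ?B z\<bar> * u z \<le> (1/2 * T * E0\<^sup>2 * L) * u z"
      by (simp add: du crit abs_mult mult_ac) (simp add: u_def)
    then show ?thesis by (simp add: u_def)
  qed
  have "\<bar>?B y - ?B x0\<bar> \<le> (T * E0\<^sup>2 * L) * (y - x0)"
    by (rule smooth_diff_le[OF sB y(1)]) (use B' y in auto)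
  also have "\<dots> \<le> (T * E0\<^sup>2 * L) * L" using len[OF y(2)] T0 L0 by (intro mult_left_mono) auto
  also have "\<dots> = C2 * M" using mp[of x0] unfolding T_def L_def C2_def
    by (simp add: power2_eq_square field_simps)
  finally show ?thesis .
qed

lemma m_chain:
  assumes "good \<alpha>'" "0 < \<alpha>'" and A: "\<And>z. x \<le> z \<Longrightarrow> z \<le> \<Phi> (real n * \<alpha>') x \<Longrightarrow> lo \<le> A \<alpha>' z \<and> A \<alpha>' z \<le> up"
  shows "exp (real n * lo) * m \<alpha>' x \<le> m \<alpha>' (\<Phi> (real n * \<alpha>') x)"
    "m \<alpha>' (\<Phi> (real n * \<alpha>') x) \<le> exp (real n * up) * m \<alpha>' x"
proof -
  have "exp (real n * lo) * m \<alpha>' x \<le> m \<alpha>' (\<Phi> (real n * \<alpha>') x) \<and> m \<alpha>' (\<Phi> (real n * \<alpha>') x) \<le> exp (real n * up) * m \<alpha>' x"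
    using A
  proof (induction n)
    case (Suc n)
    let ?y = "\<Phi> (real n * \<alpha>') x"
    have Sy: "\<Phi> (real (Suc n) * \<alpha>') x = \<Phi> \<alpha>' ?y" by (simp add: algebra_simps flip: \<Phi>_add)
    have le: "?y \<le> \<Phi> (real (Suc n) * \<alpha>') x" using assms(2) by simp
    have "lo \<le> A \<alpha>' z \<and> A \<alpha>' z \<le> up" if "x \<le> z" "z \<le> ?y" for z
      using Suc.prems[OF that(1) order_trans[OF that(2) le]] .
    then have IH: "exp (real n * lo) * m \<alpha>' x \<le> m \<alpha>' ?y" "m \<alpha>' ?y \<le> exp (real n * up) * m \<alpha>' x"
      using Suc.IH by auto
    have xy: "x \<le> ?y" using assms(2) by simp
    have "lo \<le> A \<alpha>' z \<and> A \<alpha>' z \<le> up" if "?y \<le> z" "z \<le> \<Phi> \<alpha>' ?y" for z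
      using Suc.prems[OF order_trans[OF xy that(1)]] that(2) unfolding Sy .
    then have st: "exp lo * m \<alpha>' ?y \<le> m \<alpha>' (\<Phi> \<alpha>' ?y)" "m \<alpha>' (\<Phi> \<alpha>' ?y) \<le> exp up * m \<alpha>' ?y"
      using m_\<Phi>_bounds[OF assms(1,2), of ?y lo up] by auto
    have *: "exp lo * (exp (real n * lo) * m \<alpha>' x) \<le> exp lo * m \<alpha>' ?y"
      "exp up * m \<alpha>' ?y \<le> exp up * (exp (real n * up) * m \<alpha>' x)" using IH by (auto intro: mult_left_mono)
    have "exp (real (Suc n) * r) = exp r * exp (real n * r)" for r by (simp add: distrib_right exp_add)
    then show ?case unfolding Sy
      using order_trans[OF *(1) st(1)] order_trans[OF st(2) *(2)] by (simp only: mult.assoc)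
  qed simp
  then show "exp (real n * lo) * m \<alpha>' x \<le> m \<alpha>' (\<Phi> (real n * \<alpha>') x)"
    "m \<alpha>' (\<Phi> (real n * \<alpha>') x) \<le> exp (real n * up) * m \<alpha>' x" by auto
qed

text \<open>To the right of its maximum the slope \<open>A \<alpha>'\<close> stays within C2 M of
  the maximum, so along t successive steps the displacement of time \<alpha>' grows each time by
  nearly the exponential of the maximum. Over the time \<alpha> it can grow by at most e^a, because
  \<open>\<Phi> \<alpha>\<close> transports displacements. Hence t times the maximum is at most a,
  up to the error C2 M inside the maximum. The minimum is treated symmetrically.\<close>

lemma slope_recursion:
  assumes "lev \<alpha>" "step \<alpha> \<alpha>' c l" and M: "\<And>y. m \<alpha> y \<le> M" and a: "\<And>y. \<bar>A \<alpha> y\<bar> \<le> a"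
    and t: "1 \<le> t" "real t * \<alpha>' \<le> \<alpha>" "\<alpha> < real (Suc t) * \<alpha>'"
  shows "\<bar>A \<alpha>' x\<bar> \<le> a / real t + C2 * M"
proof -
  note s = stepD[OF assms(2)] and l = levD[OF assms(1)]
  have sB: "smooth_real (A \<alpha>')" using s(7) by (rule smooth_A)
  have mp: "0 < m \<alpha>' z" for z using m_pos s by simp
  have M0: "0 \<le> M" using M[of 0] m_pos[OF s(5), of 0] by simp
  have a0: "0 \<le> a" using a[of 0] by simp
  have t0: "0 < real t" using t by simp
  have sub: "\<Phi> (real t * \<alpha>') z \<le> \<Phi> (2 * \<alpha>) z" "\<Phi> \<alpha> z \<le> \<Phi> (2 * \<alpha>) z" "\<Phi> (real t * \<alpha>') z \<le> \<Phi> \<alpha> z" for z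
    using t(2) l(2) by auto
  have Ga: "exp (- a) * m \<alpha>' z \<le> m \<alpha>' (\<Phi> \<alpha> z)" "m \<alpha>' (\<Phi> \<alpha> z) \<le> exp a * m \<alpha>' z" for z
    using m_\<Phi>_bounds[OF l(1) s(2), of z "- a" a] a by (auto simp: abs_le_iff minus_le_iff)
  have upper: "A \<alpha>' x \<le> a / real t + C2 * M" for x
  proof -
    obtain x0 where x0: "\<And>x. A \<alpha>' x \<le> A \<alpha>' x0"
      using periodic_attains_max[of "A \<alpha>'"] smooth_continuous_on[OF sB] A_1 by blast
    have crit: "deriv (A \<alpha>') x0 = 0"
      using DERIV_local_max[OF smooth_has_derivative[OF sB, of x0], of 1] x0 by simp
    define w where "w = A \<alpha>' x0 - C2 * M"
    have wI: "w \<le> A \<alpha>' z \<and> A \<alpha>' z \<le> A \<alpha>' x0" if "x0 \<le> z" "z \<le> \<Phi> (2 * \<alpha>) x0" for z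
      using flat_near_critical[OF assms(1,2) M crit that] x0 by (auto simp: w_def)
    have "w \<le> a / real t"
    proof (cases "w \<le> 0")
      case True then show ?thesis using a0 t0 order_trans[of w 0 "a / real t"] by simp
    next
      case False
      have "exp (real t * w) * m \<alpha>' x0 \<le> m \<alpha>' (\<Phi> (real t * \<alpha>') x0)"
        by (rule m_chain(1)[OF s(7,2)]) (rule wI, assumption, erule order_trans, rule sub)
      also have "\<dots> \<le> m \<alpha>' (\<Phi> \<alpha> x0)"
      \<comment> \<open>The t steps may stop short of time \<alpha>. On the remaining piece the
        slope is still at least w > 0, so the displacement does not decrease there.\<close>
      proof (rule DERIV_nonneg_imp_nondecreasing[OF sub(3)])
        fix z assume "\<Phi> (real t * \<alpha>') x0 \<le> z" "z \<le> \<Phi> \<alpha> x0"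
        moreover have "x0 \<le> \<Phi> (real t * \<alpha>') x0" using s(2) by simp
        ultimately have "w \<le> A \<alpha>' z" using wI[of z] sub(2)[of x0] by linarith
        then have "0 \<le> exp (A \<alpha>' z) - 1" using False by simp
        then show "\<exists>y. (m \<alpha>' has_real_derivative y) (at z) \<and> 0 \<le> y"
          using smooth_has_derivative[OF smooth_m[OF s(7)], of z] deriv_m[OF s(7)] by auto
      qed
      also have "\<dots> \<le> exp a * m \<alpha>' x0" by (rule Ga)
      finally have "real t * w \<le> a" using mp by simp
      then show ?thesis using t0 by (simp add: field_simps)
    qed
    then show ?thesis using x0[of x] by (simp add: w_def)
  qed
  have lower: "- A \<alpha>' x \<le> a / real t + C2 * M" for x
  proof -
    obtain x0 where x0: "\<And>x. - A \<alpha>' x \<le> - A \<alpha>' x0"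
      using periodic_attains_max[of "\<lambda>x. - A \<alpha>' x"] smooth_continuous_on[OF sB] A_1
      by (metis continuous_on_minus)
    have crit: "deriv (A \<alpha>') x0 = 0"
      using DERIV_local_min[OF smooth_has_derivative[OF sB, of x0], of 1] x0 by simp
    define w where "w = - A \<alpha>' x0 - C2 * M"
    have wI: "A \<alpha>' x0 \<le> A \<alpha>' z \<and> A \<alpha>' z \<le> - w" if "x0 \<le> z" "z \<le> \<Phi> (2 * \<alpha>) x0" for z
      using flat_near_critical[OF assms(1,2) M crit that] x0[of z] by (auto simp: w_def)
    have "w \<le> a / real t"
    proof (cases "w \<le> 0")
      case True then show ?thesis using a0 t0 order_trans[of w 0 "a / real t"] by simp
    next
      case False
      have "exp (- a) * m \<alpha>' x0 \<le> m \<alpha>' (\<Phi> \<alpha> x0)" by (rule Ga)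
      also have "\<dots> \<le> m \<alpha>' (\<Phi> (real t * \<alpha>') x0)"
      proof (rule DERIV_nonpos_imp_nonincreasing[OF sub(3)])
        fix z assume "\<Phi> (real t * \<alpha>') x0 \<le> z" "z \<le> \<Phi> \<alpha> x0"
        moreover have "x0 \<le> \<Phi> (real t * \<alpha>') x0" using s(2) by simp
        ultimately have "A \<alpha>' z \<le> - w" using wI[of z] sub(2)[of x0] by linarith
        then have "exp (A \<alpha>' z) - 1 \<le> 0" using False by simp
        then show "\<exists>y. (m \<alpha>' has_real_derivative y) (at z) \<and> y \<le> 0"
          using smooth_has_derivative[OF smooth_m[OF s(7)], of z] deriv_m[OF s(7)] by auto
      qed
      also have "\<dots> \<le> exp (real t * - w) * m \<alpha>' x0"
        by (rule m_chain(2)[OF s(7,2)]) (rule wI, assumption, erule order_trans, rule sub)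
      finally have "real t * w \<le> a" using mp by simp
      then show ?thesis using t0 by (simp add: field_simps)
    qed
    then show ?thesis using x0[of x] by (simp add: w_def)
  qed
  show ?thesis using upper[of x] lower[of x] by simp
qed

end

lemma jb_const_mult_le: "jb n E K F x \<Longrightarrow> E \<le> E' \<Longrightarrow> 0 \<le> K \<Longrightarrow> jb n E' K F x"
  by (rule jb_mono) auto

locale flow_jets = flow_gens +
  assumes jets: "\<exists>W. \<forall>c\<in>Cs. \<forall>x. \<bar>(deriv ^^ i) (A c) x\<bar> \<le> W"
begin

text \<open>\<eta> is the dimensionless smallness of a scale: one derivative of a word will cost
  \<eta>/m instead of 1/m. The normalization m \<le> \<eta>^2 is what the Schwarzian terms
  require.\<close>

definition lvl :: "real \<Rightarrow> real \<Rightarrow> real \<Rightarrow> nat \<Rightarrow> real \<Rightarrow> bool" where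
  "lvl \<alpha> \<alpha>' c l \<eta> \<longleftrightarrow> lev \<alpha> \<and> step \<alpha> \<alpha>' c l \<and> 0 < \<eta> \<and> \<eta> \<le> 1 \<and> (\<forall>y. m \<alpha> y \<le> \<eta>\<^sup>2) \<and>
     (\<forall>k y. k \<le> l \<longrightarrow> m \<alpha> y * \<bar>deriv (A (real k * c)) y\<bar> \<le> \<eta>)"

lemma lvlD:
  assumes "lvl \<alpha> \<alpha>' c l \<eta>"
  shows "lev \<alpha>" "step \<alpha> \<alpha>' c l" "0 < \<eta>" "\<eta> \<le> 1" "\<And>y. m \<alpha> y \<le> \<eta>\<^sup>2"
    "\<And>k y. k \<le> l \<Longrightarrow> m \<alpha> y * \<bar>deriv (A (real k * c)) y\<bar> \<le> \<eta>"
  using assms by (auto simp: lvl_def)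

lemma jets_upto: "\<exists>W\<ge>1. \<forall>c\<in>Cs. \<forall>x. \<forall>i\<le>n. \<bar>(deriv ^^ i) (A c) x\<bar> \<le> W"
proof (induction n)
  case 0
  obtain W where "\<forall>c\<in>Cs. \<forall>x. \<bar>(deriv ^^ 0) (A c) x\<bar> \<le> W" using jets[of 0] by blast
  then show ?case by (intro exI[of _ "max 1 W"]) (auto simp: le_max_iff_disj)
next
  case (Suc n)
  then obtain W where W: "W \<ge> 1" "\<forall>c\<in>Cs. \<forall>x. \<forall>i\<le>n. \<bar>(deriv ^^ i) (A c) x\<bar> \<le> W" by blast
  obtain W' where W': "\<forall>c\<in>Cs. \<forall>x. \<bar>(deriv ^^ Suc n) (A c) x\<bar> \<le> W'" using jets[of "Suc n"] by blast
  show ?case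
    by (rule exI[of _ "max W W'"]) (use W W' in \<open>auto simp: le_Suc_eq le_max_iff_disj simp del: funpow.simps\<close>)
qed

lemma Sch_smooth: "good r \<Longrightarrow> smooth_real (Sch r)"
  unfolding Sch_def power2_eq_square divide_inverse mult.commute[of _ "inverse 2"]
  by (intro smooth_diff smooth_mult smooth_deriv smooth_const smooth_A)

lemma Sch_jets: "\<exists>W\<ge>0. \<forall>c\<in>Cs. \<forall>x. \<forall>i\<le>n. \<bar>(deriv ^^ i) (Sch c) x\<bar> \<le> W"
proof -
  obtain W where W: "W \<ge> 1" "\<forall>c\<in>Cs. \<forall>x. \<forall>i\<le>n+2. \<bar>(deriv ^^ i) (A c) x\<bar> \<le> W" using jets_upto by blast
  show ?thesis
  proof (intro exI[of _ "W + 2 ^ n * W * W"] conjI ballI allI impI)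
    fix c x i assume c: "c \<in> Cs" and i: "i \<le> n"
    have sA: "smooth_real (A c)" using gens[OF c] by (rule smooth_A)
    have 1: "jb n W 1 (deriv (A c)) x"
      unfolding jb_def
    proof (intro allI impI)
      fix k assume "k \<le> n"
      then have "\<bar>(deriv ^^ Suc k) (A c) x\<bar> \<le> W" by (intro W(2)[rule_format, OF c]) simp
      then show "\<bar>(deriv ^^ k) (deriv (A c)) x\<bar> \<le> W * 1 ^ k" by (simp add: funpow_swap1)
    qed
    have 2: "jb n W 1 (deriv (deriv (A c))) x"
      unfolding jb_def
    proof (intro allI impI)
      fix k assume "k \<le> n"
      then have "\<bar>(deriv ^^ Suc (Suc k)) (A c) x\<bar> \<le> W" by (intro W(2)[rule_format, OF c]) simp
      then show "\<bar>(deriv ^^ k) (deriv (deriv (A c))) x\<bar> \<le> W * 1 ^ k" by (simp add: funpow_swap1)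
    qed
    have "jb n (W + \<bar>- (1/2)\<bar> * (2 ^ n * W * W)) 1 (\<lambda>x. deriv (deriv (A c)) x + (- (1/2)) * (deriv (A c) x * deriv (A c) x)) x"
      by (intro jb_add jb_cmult jb_mult 1 2 smooth_deriv sA smooth_cmult smooth_mult) auto
    then have "jb n (W + \<bar>- (1/2)\<bar> * (2 ^ n * W * W)) 1 (Sch c) x"
      by (simp add: Sch_def[abs_def] power2_eq_square)
    from jbD[OF this i] have "\<bar>(deriv ^^ i) (Sch c) x\<bar> \<le> W + 1/2 * (2 ^ n * W * W)" by simp
    also have "\<dots> \<le> W + 2 ^ n * W * W" using W(1) by simp
    finally show "\<bar>(deriv ^^ i) (Sch c) x\<bar> \<le> W + 2 ^ n * W * W" .
  qed (use W(1) in auto)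
qed

text \<open>Induction through A'' = S + A'^2/2. The jets of S are sums of generator terms composed
  with shorter words, whose jets are already known to the order needed. The weights e^(2A) sum to
  O(K^2) with K = \<eta>/m, which is exactly the size allowed for A''.\<close>

lemma word_jets:
  "\<exists>C\<ge>1. \<forall>\<alpha> \<alpha>' c l \<eta> n x. lvl \<alpha> \<alpha>' c l \<eta> \<longrightarrow> n \<le> l \<longrightarrow>
     jb r (C * (\<eta> / m \<alpha> x)) (\<eta> / m \<alpha> x) (deriv (A (real n * c))) x"
proof (induction r)
  case 0
  show ?case
  proof (intro exI[of _ 1] conjI allI impI)
    fix \<alpha> \<alpha>' c l \<eta> n x assume L: "lvl \<alpha> \<alpha>' c l \<eta>" and n: "n \<le> l"
    have "0 < m \<alpha> x" using m_pos stepD(5)[OF lvlD(2)[OF L]] by simp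
    then show "jb 0 (1 * (\<eta> / m \<alpha> x)) (\<eta> / m \<alpha> x) (deriv (A (real n * c))) x"
      using lvlD(6)[OF L n, of x] by (simp add: jb_0 field_simps)
  qed simp
next
  case (Suc r)
  then obtain C where C1: "C \<ge> 1" and C: "\<And>\<alpha> \<alpha>' c l \<eta> n x. lvl \<alpha> \<alpha>' c l \<eta> \<Longrightarrow> n \<le> l \<Longrightarrow>
     jb r (C * (\<eta> / m \<alpha> x)) (\<eta> / m \<alpha> x) (deriv (A (real n * c))) x" by blast
  obtain W where W0: "W \<ge> 0" and W: "\<And>c x i. c \<in> Cs \<Longrightarrow> i \<le> r \<Longrightarrow> \<bar>(deriv ^^ i) (Sch c) x\<bar> \<le> W"
    using Sch_jets[of r] by blast
  obtain E2 where E2: "E2 \<ge> 1" "\<And>F K x Z. smooth_real F \<Longrightarrow> 0 \<le> K \<Longrightarrow> (r - 1 > 0 \<longrightarrow> jb (r - 1 - 1) (C * K) K (deriv F) x) \<Longrightarrow> exp (F x) \<le> Z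
     \<Longrightarrow> jb (r - 1) (E2 * Z) K (\<lambda>x. exp (F x)) x" using jb_exp[of "r - 1" C] by blast
  obtain E3 where E3: "E3 \<ge> 1" "\<And>F K x Z. smooth_real F \<Longrightarrow> 0 \<le> K \<Longrightarrow> (r > 0 \<longrightarrow> jb (r - 1) (2 * C * K) K (deriv F) x) \<Longrightarrow> exp (F x) \<le> Z
     \<Longrightarrow> jb r (E3 * Z) K (\<lambda>x. exp (F x)) x" using jb_exp[of r "2 * C"] by blast
  obtain E1 where E1: "E1 \<ge> 0" "\<And>V F K x W. smooth_real V \<Longrightarrow> smooth_real F \<Longrightarrow> 0 \<le> K \<Longrightarrow> (r > 0 \<longrightarrow> jb (r - 1) ((E2 * E0) * K) K (deriv F) x) \<Longrightarrow>
     (\<forall>i\<le>r. \<bar>(deriv ^^ i) V (F x)\<bar> \<le> W) \<Longrightarrow> jb r (E1 * W) K (\<lambda>x. V (F x)) x" using jb_compose[of r "E2 * E0"] by blast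
  define D where "D = 2 ^ r * (E1 * W) * E3 * (8 * E0\<^sup>2) + 1/2 * (2 ^ r * C * C)"
  have D0: "0 \<le> D" using E1(1) W0 E3(1) C1 by (simp add: D_def)
  show ?case
  proof (intro exI[of _ "max 1 D"] conjI allI impI)
    fix \<alpha> \<alpha>' c l \<eta> n x assume L: "lvl \<alpha> \<alpha>' c l \<eta>" and n: "n \<le> l"
    note s = stepD[OF lvlD(2)[OF L]]
    let ?m = "m \<alpha> x" let ?K = "\<eta> / ?m"
    have mp: "0 < ?m" using m_pos s by simp
    have K0: "0 \<le> ?K" using mp lvlD(3)[OF L] by simp
    have gj: "good (real j * c)" for j using s(6) by (rule good_mult)
    have M: "\<And>y. m \<alpha> y \<le> \<eta>\<^sup>2" by (rule lvlD(5)[OF L])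
    have term_j: "jb r (2 ^ r * (E1 * W) * (E3 * exp (2 * A (real j * c) x))) ?K
        (\<lambda>x. Sch c (\<Phi> (real j * c) x) * exp (2 * A (real j * c) x)) x" if j: "j \<le> l" for j
    proof (rule jb_mult)
      have jA: "jb r (C * ?K) ?K (deriv (A (real j * c))) x" by (rule C[OF L j])
      have sA: "smooth_real (A (real j * c))" by (rule smooth_A[OF gj])
      \<comment> \<open>Here \<eta> \<le> 1 turns \<eta>^2/m into K, so that the derivative of the
        inner word has size K, as the composition estimate demands.\<close>
      have Z: "exp (A (real j * c) x) \<le> E0 * ?K"
      proof -
        have "exp (A (real j * c) x) \<le> E0 * \<eta>\<^sup>2 / ?m" by (rule word_sup[OF lvlD(2)[OF L] j M])
        also have "\<dots> \<le> E0 * \<eta> / ?m"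
          using lvlD(3,4)[OF L] E0 mp by (intro divide_right_mono mult_left_mono) (auto simp: power2_eq_square)
        finally show ?thesis by simp
      qed
      have "jb (r - 1) (E2 * (E0 * ?K)) ?K (\<lambda>x. exp (A (real j * c) x)) x"
        using jb_mono[OF jA order_refl K0, of "r - 1 - 1"] by (intro E2(2)[OF sA K0 _ Z]) auto
      then have dF: "jb (r - 1) ((E2 * E0) * ?K) ?K (deriv (\<Phi> (real j * c))) x"
        by (simp add: exp_A[OF gj] mult.assoc)
      show "jb r (E1 * W) ?K (\<lambda>x. Sch c (\<Phi> (real j * c) x)) x"
        using dF W[OF s(1)] by (intro E1(2) Sch_smooth s(6) goodD(1)[OF gj] K0) auto
      have "jb (r - 1) (\<bar>2\<bar> * (C * ?K)) ?K (\<lambda>x. 2 * deriv (A (real j * c)) x) x"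
        using jb_mono[OF jA order_refl K0, of "r - 1"] by (intro jb_cmult smooth_deriv sA) auto
      then have "jb (r - 1) (2 * C * ?K) ?K (deriv (\<lambda>x. 2 * A (real j * c) x)) x"
        by (simp add: deriv_cmult_smooth[OF sA] mult.assoc)
      then show "jb r (E3 * exp (2 * A (real j * c) x)) ?K (\<lambda>x. exp (2 * A (real j * c) x)) x"
        by (intro E3(2) smooth_cmult sA K0) auto
      show "smooth_real (\<lambda>x. Sch c (\<Phi> (real j * c) x))"
        by (rule smooth_compose[OF Sch_smooth[OF s(6)] goodD(1)[OF gj]])
      show "smooth_real (\<lambda>x. exp (2 * A (real j * c) x))" by (intro smooth_exp smooth_cmult sA)
    qed (rule K0)
    have smt: "smooth_real (\<lambda>x. Sch c (\<Phi> (real j * c) x) * exp (2 * A (real j * c) x))" for j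
      by (intro smooth_mult smooth_exp smooth_cmult smooth_A gj smooth_compose[OF Sch_smooth[OF s(6)] goodD(1)[OF gj]])
    have s1: "jb r (\<Sum>j<n. 2 ^ r * (E1 * W) * (E3 * exp (2 * A (real j * c) x))) ?K
        (\<lambda>x. \<Sum>j<n. Sch c (\<Phi> (real j * c) x) * exp (2 * A (real j * c) x)) x"
      using n by (intro jb_sum smt term_j) auto
    have s2: "(\<lambda>x. \<Sum>j<n. Sch c (\<Phi> (real j * c) x) * exp (2 * A (real j * c) x)) = Sch (real n * c)"
      using Sch_mult[OF s(6), of n] by (intro ext) simp
    have s3: "(\<Sum>j<n. 2 ^ r * (E1 * W) * (E3 * exp (2 * A (real j * c) x))) \<le> 2 ^ r * (E1 * W) * E3 * (8 * E0\<^sup>2) * ?K\<^sup>2"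
    proof -
      have "(\<Sum>j<n. exp (2 * A (real j * c) x)) \<le> (\<Sum>j<n. exp (A (real j * c) x)) * (E0 * \<eta>\<^sup>2 / ?m)"
        unfolding sum_distrib_right
      proof (rule sum_mono)
        fix j assume "j \<in> {..<n}"
        then have "exp (A (real j * c) x) \<le> E0 * \<eta>\<^sup>2 / ?m" using word_sup[OF lvlD(2)[OF L] _ M, of j] n by simp
        then show "exp (2 * A (real j * c) x) \<le> exp (A (real j * c) x) * (E0 * \<eta>\<^sup>2 / ?m)"
          unfolding exp_double power2_eq_square[of "exp _"] by (intro mult_left_mono) auto
      qed
      also have "\<dots> = ((\<Sum>j<n. exp (A (real j * c) x)) * ?m) * (E0 * ?K\<^sup>2)"
        using mp by (simp add: power2_eq_square)
      also have "\<dots> \<le> (8 * E0) * (E0 * ?K\<^sup>2)"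
        using E0 by (intro mult_right_mono word_sum[OF lvlD(2)[OF L] n]) auto
      finally have *: "(\<Sum>j<n. exp (2 * A (real j * c) x)) \<le> (8 * E0\<^sup>2) * ?K\<^sup>2" by (simp add: power2_eq_square)
      have "(\<Sum>j<n. 2 ^ r * (E1 * W) * (E3 * exp (2 * A (real j * c) x))) = 2 ^ r * (E1 * W) * E3 * (\<Sum>j<n. exp (2 * A (real j * c) x))"
        by (simp only: sum_distrib_left mult.assoc)
      also have "\<dots> \<le> 2 ^ r * (E1 * W) * E3 * ((8 * E0\<^sup>2) * ?K\<^sup>2)"
        using E1(1) W0 E3(1) * by (intro mult_left_mono) auto
      finally show ?thesis by (simp only: mult.assoc)
    qed
    have S: "jb r (2 ^ r * (E1 * W) * E3 * (8 * E0\<^sup>2) * ?K\<^sup>2) ?K (Sch (real n * c)) x"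
      by (rule jb_const_mult_le[OF s1[unfolded s2] s3 K0])
    let ?A' = "deriv (A (real n * c))"
    have jA: "jb r (C * ?K) ?K ?A' x" by (rule C[OF L n])
    have sA: "smooth_real ?A'" by (intro smooth_deriv smooth_A gj)
    have "jb r (2 ^ r * (E1 * W) * E3 * (8 * E0\<^sup>2) * ?K\<^sup>2 + \<bar>1/2\<bar> * (2 ^ r * (C * ?K) * (C * ?K))) ?K
       (\<lambda>x. Sch (real n * c) x + 1/2 * (?A' x * ?A' x)) x"
      by (intro jb_add jb_cmult jb_mult S jA sA smooth_cmult smooth_mult Sch_smooth gj K0)
    moreover have "(\<lambda>x. Sch (real n * c) x + 1/2 * (?A' x * ?A' x)) = deriv ?A'"
      by (intro ext) (simp add: Sch_def power2_eq_square)
    moreover have "2 ^ r * (E1 * W) * E3 * (8 * E0\<^sup>2) * ?K\<^sup>2 + \<bar>1/2\<bar> * (2 ^ r * (C * ?K) * (C * ?K)) = D * ?K * ?K"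
      by (simp add: D_def power2_eq_square algebra_simps)
    ultimately have D1: "jb r (D * ?K * ?K) ?K (deriv ?A') x" by simp
    have D2: "D * ?K * ?K \<le> max 1 D * ?K * ?K" using K0 by (intro mult_right_mono) auto
    have "jb r (max 1 D * ?K * ?K) ?K (deriv ?A') x" by (rule jb_const_mult_le[OF D1 D2 K0])
    moreover have "\<bar>?A' x\<bar> \<le> max 1 D * ?K"
    proof -
      have "\<bar>?A' x\<bar> \<le> 1 * ?K" using lvlD(6)[OF L n, of x] mp by (simp add: field_simps)
      also have "\<dots> \<le> max 1 D * ?K" using K0 by (intro mult_right_mono) auto
      finally show ?thesis .
    qed
    ultimately show "jb (Suc r) (max 1 D * ?K) ?K ?A' x" by (simp add: jb_Suc)
  qed simp
qed

section \<open>Near constancy of the displacement of the next scale\<close>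

lemma m_transport:
  assumes "good \<alpha>" "0 < \<alpha>'" and a: "\<And>y. \<bar>A \<alpha> y\<bar> \<le> a" "a \<le> V1" and i: "i \<le> N"
  shows "\<bar>m \<alpha>' (\<Phi> (real i * \<alpha>) x) - m \<alpha>' x\<bar> \<le> exp (real N * V1) * (real N * a) * m \<alpha>' x"
proof -
  have a0: "0 \<le> a" using a(1)[of 0] by simp
  have "\<bar>A (real i * \<alpha>) z\<bar> \<le> real N * a" for z
  proof -
    have "\<bar>A (real i * \<alpha>) z\<bar> \<le> (\<Sum>j<i. a)" unfolding A_mult[OF assms(1)]
      using a by (intro order_trans[OF sum_abs] sum_mono)
    also have "\<dots> \<le> real N * a" using i a0 by (simp add: mult_right_mono)
    finally show ?thesis .
  qed
  then have b: "- (real N * a) \<le> A (real i * \<alpha>) z" "A (real i * \<alpha>) z \<le> real N * a" for z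
    by (auto simp: abs_le_iff minus_le_iff)
  note B = m_\<Phi>_bounds[OF good_mult[OF assms(1)] assms(2), of x "- (real N * a)" i "real N * a"]
  have mp: "0 < m \<alpha>' x" using assms(2) by (rule m_pos)
  have NV: "\<bar>real N * a\<bar> \<le> real N * V1" using a0 a(2) by (simp add: mult_left_mono)
  have "(exp (- (real N * a)) - 1) * m \<alpha>' x \<le> m \<alpha>' (\<Phi> (real i * \<alpha>) x) - m \<alpha>' x"
    "m \<alpha>' (\<Phi> (real i * \<alpha>) x) - m \<alpha>' x \<le> (exp (real N * a) - 1) * m \<alpha>' x"
    using B b by (simp_all add: left_diff_distrib)
  moreover have "\<bar>exp (real N * a) - 1\<bar> \<le> exp (real N * V1) * (real N * a)"
    "\<bar>exp (- (real N * a)) - 1\<bar> \<le> exp (real N * V1) * (real N * a)"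
    using abs_exp_minus_1[OF NV] abs_exp_minus_1[of "- (real N * a)" "real N * V1"] NV a0 by auto
  then have "(exp (real N * a) - 1) * m \<alpha>' x \<le> exp (real N * V1) * (real N * a) * m \<alpha>' x"
    "- (exp (real N * V1) * (real N * a)) * m \<alpha>' x \<le> (exp (- (real N * a)) - 1) * m \<alpha>' x"
    using mp by (intro mult_right_mono; linarith)+
  ultimately show ?thesis by simp
qed

text \<open>The displacement of \<alpha>' minus its value at x is small at the points
  \<open>\<Phi> (real i * \<alpha>) x\<close>, since \<open>\<Phi> \<alpha>\<close> transports it
  with a factor within O(a) of 1. Its derivative of order R+1 is O((\<eta>/m)^R). As the nodes are
  about m apart, interpolation leaves a m'/m from the nodes and \<eta>^R from the top derivative,
  where m' is the displacement of \<alpha>'.\<close>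

lemma displacement_nearly_constant:
  assumes "1 \<le> R"
  shows "\<exists>C\<ge>1. \<forall>\<alpha> \<alpha>' c l \<eta> a x y. lvl \<alpha> \<alpha>' c l \<eta> \<longrightarrow> (\<forall>y. \<bar>A \<alpha> y\<bar> \<le> a) \<longrightarrow> a \<le> V1 \<longrightarrow> (\<forall>y. \<bar>A \<alpha>' y\<bar> \<le> V1) \<longrightarrow>
     x \<le> y \<longrightarrow> y \<le> \<Phi> \<alpha> x \<longrightarrow> \<bar>deriv (m \<alpha>') y\<bar> \<le> C * (a * m \<alpha>' x / m \<alpha> x + \<eta> ^ R)"
proof -
  \<comment> \<open>Interpolation of order R+1 consumes 2^(R+1) nodes; the point with i = N only
    closes the interval.\<close>
  define N :: nat where "N = 2 ^ Suc R"
  have N2: "2 \<le> N" unfolding N_def by simp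
  \<comment> \<open>The interval has length at most N F0^N m, and the nodes are at least m/F0^N
    apart.\<close>
  define \<Lambda> where "\<Lambda> = real N * F0 ^ (2 * N)"
  obtain Cw where Cw: "Cw \<ge> 1" "\<And>\<alpha> \<alpha>' c l \<eta> n x. lvl \<alpha> \<alpha>' c l \<eta> \<Longrightarrow> n \<le> l \<Longrightarrow>
     jb R (Cw * (\<eta> / m \<alpha> x)) (\<eta> / m \<alpha> x) (deriv (A (real n * c))) x" using word_jets[of R] by blast
  obtain Ee where Ee: "Ee \<ge> 1" "\<And>F K x Z. smooth_real F \<Longrightarrow> 0 \<le> K \<Longrightarrow> (R > 0 \<longrightarrow> jb (R - 1) (Cw * K) K (deriv F) x) \<Longrightarrow> exp (F x) \<le> Z
     \<Longrightarrow> jb R (Ee * Z) K (\<lambda>x. exp (F x)) x" using jb_exp[of R Cw] by blast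
  obtain Cn where Cn: "Cn \<ge> 0" "\<And>\<phi> p q s H e (x :: nat \<Rightarrow> real). smooth_real \<phi> \<Longrightarrow> 0 < s \<Longrightarrow> q - p \<le> \<Lambda> * s \<Longrightarrow> 0 \<le> H \<Longrightarrow> 0 \<le> e \<Longrightarrow>
     (\<forall>i<2^Suc R. p \<le> x i \<and> x i \<le> q \<and> \<bar>\<phi> (x i)\<bar> \<le> e) \<Longrightarrow> (\<forall>i. Suc i < 2^Suc R \<longrightarrow> x i + s \<le> x (Suc i)) \<Longrightarrow>
     (\<forall>y. p \<le> y \<and> y \<le> q \<longrightarrow> \<bar>(deriv ^^ Suc R) \<phi> y\<bar> \<le> H) \<Longrightarrow>
     (\<forall>j\<le>Suc R. \<forall>y. p \<le> y \<and> y \<le> q \<longrightarrow> \<bar>(deriv ^^ j) \<phi> y\<bar> \<le> Cn * (e / s ^ j + H * s ^ (Suc R - j)))"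
    using interpolation_nodes[where n="Suc R" and \<Lambda>=\<Lambda>] by blast
  define C where "C = 1 + Cn * (exp (real N * V1) * real N * F0 ^ N) + Cn * (Ee * exp V1 * (F0 ^ N) ^ R)"
  show ?thesis
  proof (intro exI[of _ C] conjI allI impI)
    show "1 \<le> C" using Cn(1) F0 Ee(1) by (simp add: C_def)
    fix \<alpha> \<alpha>' c l \<eta> a x y
    assume L: "lvl \<alpha> \<alpha>' c l \<eta>" and a: "\<forall>y. \<bar>A \<alpha> y\<bar> \<le> a" "a \<le> V1" and a': "\<forall>y. \<bar>A \<alpha>' y\<bar> \<le> V1"
      and y: "x \<le> y" "y \<le> \<Phi> \<alpha> x"
    note s = stepD[OF lvlD(2)[OF L]] and lv = levD[OF lvlD(1)[OF L]]
    have a0: "0 \<le> a" using a(1)[rule_format, of 0] by simp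
    have mp: "0 < m \<alpha> z" "0 < m \<alpha>' z" for z using m_pos s by simp_all
    have \<eta>0: "0 < \<eta>" by (rule lvlD(3)[OF L])
    define sp where "sp = m \<alpha> x / F0 ^ N"
    have FN: "1 \<le> F0 ^ N" using F0 by (simp add: one_le_power)
    have sp0: "0 < sp" and sp_le: "sp \<le> m \<alpha> x" using mp FN by (auto simp: sp_def field_simps)
    define \<phi> where "\<phi> z = m \<alpha>' z - m \<alpha>' x" for z
    have s\<phi>: "smooth_real \<phi>" unfolding \<phi>_def by (intro smooth_diff smooth_m s smooth_const)
    have d\<phi>: "deriv \<phi> = (\<lambda>z. exp (A \<alpha>' z) + - 1)"
      unfolding \<phi>_def using smooth_m[OF s(7)] by (simp add: deriv_diff_smooth deriv_m[OF s(7)])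
    have sE: "smooth_real (\<lambda>z. exp (A \<alpha>' z))" by (intro smooth_exp smooth_A s)
    define H where "H = Ee * exp V1 * (F0 ^ N * \<eta> / m \<alpha> x) ^ R"
    define e where "e = exp (real N * V1) * (real N * a) * m \<alpha>' x"
    have near: "m \<alpha> z \<le> F0 ^ N * m \<alpha> x" "m \<alpha> x \<le> F0 ^ N * m \<alpha> z" if zz: "x \<le> z" "z \<le> \<Phi> (real N * \<alpha>) x" for z
    proof -
      obtain r where "0 \<le> r" "r \<le> real N * \<alpha>" "z = \<Phi> r x" using \<Phi>_interval[of 0 x z "real N * \<alpha>"] zz by auto
      then show "m \<alpha> z \<le> F0 ^ N * m \<alpha> x" "m \<alpha> x \<le> F0 ^ N * m \<alpha> z"
        using m_near[OF lvlD(1)[OF L], of r N x] m_near_lower[OF lvlD(1)[OF L], of r N x] by auto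
    qed
    have key: "\<forall>j\<le>Suc R. \<forall>y. x \<le> y \<and> y \<le> \<Phi> (real N * \<alpha>) x \<longrightarrow> \<bar>(deriv ^^ j) \<phi> y\<bar> \<le> Cn * (e / sp ^ j + H * sp ^ (Suc R - j))"
    proof (rule Cn(2)[OF s\<phi> sp0, where x="\<lambda>i. \<Phi> (real i * \<alpha>) x"])
      have "m (real N * \<alpha>) x \<le> (\<Sum>i<N. F0 ^ N * m \<alpha> x)"
        unfolding m_sum using s(5) by (intro sum_mono near(1)) auto
      also have "\<dots> = \<Lambda> * sp" using FN by (simp add: \<Lambda>_def sp_def mult_2 power_add)
      finally show "\<Phi> (real N * \<alpha>) x - x \<le> \<Lambda> * sp" by (simp add: m_def)
      show "0 \<le> H" using Ee(1) F0 \<eta>0 mp by (simp add: H_def less_imp_le)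
      show "0 \<le> e" using a0 mp by (simp add: e_def less_imp_le)
      show "\<forall>i<2 ^ Suc R. x \<le> \<Phi> (real i * \<alpha>) x \<and> \<Phi> (real i * \<alpha>) x \<le> \<Phi> (real N * \<alpha>) x \<and> \<bar>\<phi> (\<Phi> (real i * \<alpha>) x)\<bar> \<le> e"
      proof (intro allI impI conjI)
        fix i :: nat assume "i < 2 ^ Suc R"
        then have i: "i \<le> N" by (simp add: N_def)
        then show "x \<le> \<Phi> (real i * \<alpha>) x" "\<Phi> (real i * \<alpha>) x \<le> \<Phi> (real N * \<alpha>) x" using s(5) by auto
        show "\<bar>\<phi> (\<Phi> (real i * \<alpha>) x)\<bar> \<le> e"
          unfolding \<phi>_def e_def by (rule m_transport[OF lv(1) s(2) _ a(2) i]) (use a in blast)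
      qed
      show "\<forall>i. Suc i < 2 ^ Suc R \<longrightarrow> \<Phi> (real i * \<alpha>) x + sp \<le> \<Phi> (real (Suc i) * \<alpha>) x"
      proof (intro allI impI)
        fix i :: nat assume "Suc i < 2 ^ Suc R"
        then have "i \<le> N" by (simp add: N_def)
        then have "real i \<le> real N" by simp
        then have "m \<alpha> x \<le> F0 ^ N * m \<alpha> (\<Phi> (real i * \<alpha>) x)" using s(5) by (intro near(2)) auto
        then have "sp \<le> m \<alpha> (\<Phi> (real i * \<alpha>) x)" using FN by (simp add: sp_def field_simps)
        also have "\<dots> = \<Phi> (real (Suc i) * \<alpha>) x - \<Phi> (real i * \<alpha>) x"
          by (simp add: m_def algebra_simps flip: \<Phi>_add)
        finally show "\<Phi> (real i * \<alpha>) x + sp \<le> \<Phi> (real (Suc i) * \<alpha>) x" by simp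
      qed
      show "\<forall>z. x \<le> z \<and> z \<le> \<Phi> (real N * \<alpha>) x \<longrightarrow> \<bar>(deriv ^^ Suc R) \<phi> z\<bar> \<le> H"
      proof (intro allI impI)
        fix z assume z: "x \<le> z \<and> z \<le> \<Phi> (real N * \<alpha>) x"
        let ?K = "\<eta> / m \<alpha> z"
        have K0: "0 \<le> ?K" using \<eta>0 mp[of z] by simp
        have "jb R (Ee * exp V1) ?K (\<lambda>x. exp (A \<alpha>' x)) z"
        proof (rule Ee(2))
          show "smooth_real (A \<alpha>')" by (rule smooth_A[OF s(7)])
          show "0 < R \<longrightarrow> jb (R - 1) (Cw * ?K) ?K (deriv (A \<alpha>')) z"
            using jb_mono[OF Cw(2)[OF L order_refl, of z] order_refl K0, of "R - 1"] s(8) by simp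
          show "exp (A \<alpha>' z) \<le> exp V1" using a'[rule_format, of z] by simp
        qed (rule K0)
        from jbD[OF this order_refl] have "\<bar>(deriv ^^ R) (\<lambda>x. exp (A \<alpha>' x)) z\<bar> \<le> Ee * exp V1 * ?K ^ R" .
        also have "\<dots> \<le> H"
        proof -
          have "?K \<le> F0 ^ N * \<eta> / m \<alpha> x" using near(2)[of z] z \<eta>0 mp[of x] mp[of z] by (simp add: field_simps)
          then show ?thesis unfolding H_def using Ee(1) K0 by (intro mult_left_mono power_mono) auto
        qed
        also have "(deriv ^^ R) (\<lambda>x. exp (A \<alpha>' x)) z = (deriv ^^ Suc R) \<phi> z"
        proof -
          have "(deriv ^^ Suc R) \<phi> = (deriv ^^ R) (deriv \<phi>)" by (simp add: funpow_swap1)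
          then show ?thesis unfolding d\<phi> using \<open>1 \<le> R\<close> by (simp add: funpow_deriv_diff[OF sE smooth_const] funpow_deriv_const)
        qed
        finally show "\<bar>(deriv ^^ Suc R) \<phi> z\<bar> \<le> H" .
      qed
    qed
    have "y \<le> \<Phi> (real N * \<alpha>) x"
    proof -
      have "1 * \<alpha> \<le> real N * \<alpha>" using N2 s(5) by (intro mult_right_mono) auto
      then have "\<Phi> \<alpha> x \<le> \<Phi> (real N * \<alpha>) x" by simp
      then show ?thesis using y by linarith
    qed
    then have "\<bar>deriv \<phi> y\<bar> \<le> Cn * (e / sp + H * sp ^ R)" using key[rule_format, of 1 y] y by simp
    moreover have "deriv \<phi> y = deriv (m \<alpha>') y" by (simp add: d\<phi> deriv_m[OF s(7)])
    moreover have "Cn * (e / sp + H * sp ^ R) \<le> C * (a * m \<alpha>' x / m \<alpha> x + \<eta> ^ R)"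
    proof -
      let ?P = "a * m \<alpha>' x / m \<alpha> x" and ?Q = "\<eta> ^ R"
      have PQ: "0 \<le> ?P" "0 \<le> ?Q" using a0 mp \<eta>0 by (simp_all add: less_imp_le)
      have e1: "e / sp = (exp (real N * V1) * real N * F0 ^ N) * ?P"
        by (simp add: e_def sp_def)
      have "H * sp ^ R \<le> (Ee * exp V1 * (F0 ^ N) ^ R) * ?Q"
      proof -
        have "H * sp ^ R \<le> H * m \<alpha> x ^ R" using sp0 sp_le Ee(1) F0 \<eta>0 mp
          by (intro mult_left_mono power_mono) (auto simp: H_def less_imp_le)
        also have "\<dots> = (Ee * exp V1 * (F0 ^ N) ^ R) * ?Q"
          using mp[of x] by (simp add: H_def power_mult_distrib power_divide)
        finally show ?thesis .
      qed
      then have "Cn * (e / sp + H * sp ^ R) \<le> Cn * (exp (real N * V1) * real N * F0 ^ N) * ?P + Cn * (Ee * exp V1 * (F0 ^ N) ^ R) * ?Q"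
        unfolding e1 using Cn(1) by (simp add: distrib_left mult.assoc mult_left_mono)
      also have "\<dots> \<le> C * ?P + C * ?Q"
        using PQ Cn(1) F0 Ee(1) by (intro add_mono mult_right_mono) (auto simp: C_def)
      finally show ?thesis by (simp only: distrib_left)
    qed
    ultimately show "\<bar>deriv (m \<alpha>') y\<bar> \<le> C * (a * m \<alpha>' x / m \<alpha> x + \<eta> ^ R)" by simp
  qed
qed

end

section \<open>Passing through the scales\<close>

context flow
begin

text \<open>Both maxima are written as the value at a chosen maximizer, so that attainment is
  immediate; for \<open>a\<close> a maximizer is known to exist once \<open>good\<close>
  holds.\<close>

definition M :: "real \<Rightarrow> real" where "M \<alpha> = m \<alpha> (SOME x0. \<forall>x. m \<alpha> x \<le> m \<alpha> x0)"
definition a :: "real \<Rightarrow> real" where "a r = \<bar>A r (SOME x0. \<forall>x. \<bar>A r x\<bar> \<le> \<bar>A r x0\<bar>)\<bar>"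

lemma m_le_M: "m \<alpha> x \<le> M \<alpha>"
proof -
  have "\<exists>x0. \<forall>x. m \<alpha> x \<le> m \<alpha> x0" using m_max[of \<alpha>] by blast
  then have "\<forall>x. m \<alpha> x \<le> m \<alpha> (SOME x0. \<forall>x. m \<alpha> x \<le> m \<alpha> x0)" by (rule someI_ex)
  then show ?thesis by (simp add: M_def)
qed

lemma M_attained: "\<exists>x. M \<alpha> = m \<alpha> x"
  unfolding M_def by blast

lemma M_nonneg: "0 \<le> \<alpha> \<Longrightarrow> 0 \<le> M \<alpha>"
  using m_le_M[of \<alpha> 0] m_nonneg[of \<alpha> 0] by simp

lemma M_pos: "0 < \<alpha> \<Longrightarrow> 0 < M \<alpha>"
  using m_le_M[of \<alpha> 0] m_pos[of \<alpha> 0] by simp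

lemma abs_A_le_a: "good r \<Longrightarrow> \<bar>A r x\<bar> \<le> a r"
proof -
  assume r: "good r"
  have "continuous_on UNIV (\<lambda>x. \<bar>A r x\<bar>)" using smooth_continuous_on[OF smooth_A[OF r]] by (rule continuous_on_rabs)
  then have "\<exists>x0. \<forall>x. \<bar>A r x\<bar> \<le> \<bar>A r x0\<bar>" using periodic_attains_max[of "\<lambda>x. \<bar>A r x\<bar>"] A_1 by metis
  then have "\<forall>x. \<bar>A r x\<bar> \<le> \<bar>A r (SOME x0. \<forall>x. \<bar>A r x\<bar> \<le> \<bar>A r x0\<bar>)\<bar>" by (rule someI_ex)
  then show ?thesis by (simp add: a_def)
qed

lemma a_nonneg: "0 \<le> a r"
  by (simp add: a_def)

lemma a_le: "(\<And>x. \<bar>A r x\<bar> \<le> b) \<Longrightarrow> a r \<le> b"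
  by (simp add: a_def)

lemma M_small:
  assumes "0 < e"
  shows "\<exists>\<beta>>0. \<forall>\<alpha>. 0 \<le> \<alpha> \<longrightarrow> \<alpha> \<le> \<beta> \<longrightarrow> M \<alpha> \<le> e"
proof -
  have "uniformly_continuous_on {0..2} \<xi>"
    using compact_uniformly_continuous[of "{0..2}" \<xi>] continuous_on_subset[OF continuous_\<xi>] by auto
  then obtain d where d: "d > 0" "\<And>y z. y \<in> {0..2} \<Longrightarrow> z \<in> {0..2} \<Longrightarrow> dist z y < d \<Longrightarrow> dist (\<xi> z) (\<xi> y) < e"
    using assms unfolding uniformly_continuous_on_def by metis
  show ?thesis
  proof (intro exI[of _ "min 1 (d/2)"] conjI allI impI)
    fix \<alpha> assume al: "0 \<le> \<alpha>" "\<alpha> \<le> min 1 (d/2)"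
    obtain x where x: "M \<alpha> = m \<alpha> x" using M_attained by blast
    let ?y = "frac (h x)"
    have "h x = ?y + of_int \<lfloor>h x\<rfloor>" "h x + \<alpha> = (?y + \<alpha>) + of_int \<lfloor>h x\<rfloor>" by (simp_all add: frac_def)
    then have "\<xi> (h x + \<alpha>) = \<xi> (?y + \<alpha>) + of_int \<lfloor>h x\<rfloor>" "\<xi> (h x) = \<xi> ?y + of_int \<lfloor>h x\<rfloor>"
      using \<xi>_int by metis+
    then have "m \<alpha> x = \<xi> (?y + \<alpha>) - \<xi> ?y" by (simp add: m_def \<Phi>_def)
    moreover have "dist (\<xi> (?y + \<alpha>)) (\<xi> ?y) < e"
      using al d(1) frac_lt_1[of "h x"] frac_ge_0[of "h x"] by (intro d(2)) (auto simp: dist_real_def)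
    ultimately show "M \<alpha> \<le> e" using x by (simp add: dist_real_def)
  qed (use d in auto)
qed

end

section \<open>The alternative between consecutive scales\<close>

context flow_jets
begin

lemma C1_ge1: "1 \<le> C1"
  using E0 \<Sigma>0 by (simp add: C1_def)

definition eta :: "real \<Rightarrow> real" where "eta \<alpha> = C1 * (a \<alpha> + sqrt (M \<alpha>))"

lemma eta_ge: "0 \<le> \<alpha> \<Longrightarrow> a \<alpha> \<le> eta \<alpha>" "0 \<le> \<alpha> \<Longrightarrow> sqrt (M \<alpha>) \<le> eta \<alpha>"
proof -
  assume "0 \<le> \<alpha>"
  then have *: "0 \<le> a \<alpha>" "0 \<le> sqrt (M \<alpha>)" using a_nonneg M_nonneg by auto
  have "1 * (a \<alpha> + sqrt (M \<alpha>)) \<le> eta \<alpha>" unfolding eta_def using C1_ge1 * by (intro mult_right_mono) auto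
  then have i: "a \<alpha> + sqrt (M \<alpha>) \<le> eta \<alpha>" by simp
  show "a \<alpha> \<le> eta \<alpha>" by (rule order_trans[OF _ i]) (use * in simp)
  show "sqrt (M \<alpha>) \<le> eta \<alpha>" by (rule order_trans[OF _ i]) (use * in simp)
qed

lemma lvl_eta:
  assumes "lev \<alpha>" "step \<alpha> \<alpha>' c l" "eta \<alpha> \<le> 1"
  shows "lvl \<alpha> \<alpha>' c l (eta \<alpha>)"
proof -
  note l = levD[OF assms(1)]
  have e: "0 < sqrt (M \<alpha>)" "sqrt (M \<alpha>) \<le> eta \<alpha>" using l M_pos eta_ge(2)[of \<alpha>] by auto
  have "m \<alpha> y \<le> (eta \<alpha>)\<^sup>2" for y
  proof -
    have "m \<alpha> y \<le> (sqrt (M \<alpha>))\<^sup>2" using m_le_M[of \<alpha> y] M_nonneg[of \<alpha>] l by simp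
    also have "\<dots> \<le> (eta \<alpha>)\<^sup>2" using e by (intro power_mono) auto
    finally show ?thesis .
  qed
  moreover have "m \<alpha> y * \<bar>deriv (A (real k * c)) y\<bar> \<le> eta \<alpha>" if "k \<le> l" for k y
    unfolding eta_def
    by (rule first_deriv_bound[OF assms(1,2) that m_le_M abs_A_le_a[OF l(1)]]) (use a_le l in auto)
  moreover have "0 < eta \<alpha>" using e by linarith
  ultimately show ?thesis using assms by (auto simp: lvl_def)
qed

lemma slope_recursion':
  assumes "lev \<alpha>" "step \<alpha> \<alpha>' c l" "real t * \<alpha>' \<le> \<alpha>" "\<alpha> < real (Suc t) * \<alpha>'"
  shows "a \<alpha>' \<le> a \<alpha> / real t + C2 * M \<alpha>" "8 \<le> t"
proof -
  note s = stepD[OF assms(2)] and l = levD[OF assms(1)]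
  have "8 * \<alpha>' < real (Suc t) * \<alpha>'" using s(3) assms(4) by linarith
  then have "8 < real (Suc t)" using s(2) by (simp only: mult_less_cancel_right_pos)
  then show t: "8 \<le> t" by linarith
  show "a \<alpha>' \<le> a \<alpha> / real t + C2 * M \<alpha>"
    by (rule a_le) (rule slope_recursion[OF assms(1,2) m_le_M abs_A_le_a[OF l(1)]], use t assms in auto)
qed

text \<open>Compare the displacement m' of \<alpha>' with \<eta>^R m at x. If it is not smaller, the
  interpolation error \<eta>^(R+1) is absorbed and m' is nearly constant on the segment. If it is
  smaller, m' is O(\<eta>^R m) on the whole segment, and since t+1 such displacements must cover m,
  the number t is at least of order \<eta>^(-R).\<close>

lemma dichotomy:
  assumes "1 \<le> R"
  shows "\<exists>C\<ge>1. \<forall>\<alpha> \<alpha>' c l t. lev \<alpha> \<longrightarrow> step \<alpha> \<alpha>' c l \<longrightarrow> a \<alpha>' \<le> V1 \<longrightarrow> C * eta \<alpha> \<le> 1 \<longrightarrow> real t * \<alpha>' \<le> \<alpha> \<longrightarrow> \<alpha> < real (Suc t) * \<alpha>' \<longrightarrow>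
    (\<forall>x. (\<forall>y. x \<le> y \<longrightarrow> y \<le> \<Phi> \<alpha> x \<longrightarrow> \<bar>deriv (m \<alpha>') y\<bar> \<le> C * eta \<alpha> * (m \<alpha>' x / m \<alpha> x) \<and>
           7/8 * m \<alpha>' x \<le> m \<alpha>' y \<and> m \<alpha>' y \<le> 9/8 * m \<alpha>' x)
       \<or> (m \<alpha>' x < eta \<alpha> ^ R * m \<alpha> x \<and> 1 \<le> C * eta \<alpha> ^ R * real (Suc t)))"
proof -
  obtain D where D1: "D \<ge> 1" and D: "\<And>\<alpha> \<alpha>' c l \<eta> b x y. lvl \<alpha> \<alpha>' c l \<eta> \<Longrightarrow> (\<forall>y. \<bar>A \<alpha> y\<bar> \<le> b) \<Longrightarrow> b \<le> V1 \<Longrightarrow> (\<forall>y. \<bar>A \<alpha>' y\<bar> \<le> V1) \<Longrightarrow>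
     x \<le> y \<Longrightarrow> y \<le> \<Phi> \<alpha> x \<Longrightarrow> \<bar>deriv (m \<alpha>') y\<bar> \<le> D * (b * m \<alpha>' x / m \<alpha> x + \<eta> ^ Suc R)"
    using displacement_nearly_constant[of "Suc R"] by auto
  show ?thesis
  \<comment> \<open>Interpolating to order \<open>Suc R\<close> leaves one factor \<eta> to spare,
    and 16 D \<eta> \<le> 1 makes the variation 2 D \<eta> m' at most m'/8; hence the bounds 7/8 and
    9/8.\<close>
  proof (intro exI[of _ "16 * D"] conjI allI impI)
    show "1 \<le> 16 * D" using D1 by simp
    fix \<alpha> \<alpha>' c l t x
    assume lev: "lev \<alpha>" and st: "step \<alpha> \<alpha>' c l" and a': "a \<alpha>' \<le> V1" and e1: "16 * D * eta \<alpha> \<le> 1"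
      and t: "real t * \<alpha>' \<le> \<alpha>" "\<alpha> < real (Suc t) * \<alpha>'"
    note s = stepD[OF st] and l = levD[OF lev]
    let ?e = "eta \<alpha>" and ?q = "m \<alpha>' x / m \<alpha> x"
    have mp: "0 < m \<alpha> z" "0 < m \<alpha>' z" for z using m_pos s by auto
    have e0: "0 \<le> ?e" using eta_ge(1)[of \<alpha>] a_nonneg[of \<alpha>] l by simp
    have "?e \<le> 16 * D * ?e" using D1 e0 mult_right_mono[of 1 "16 * D" ?e] by simp
    then have e2: "?e \<le> 1" using e1 by simp
    have L: "lvl \<alpha> \<alpha>' c l ?e" by (rule lvl_eta[OF lev st e2])
    have aV: "a \<alpha> \<le> V1" using a_le l by blast
    have der: "\<bar>deriv (m \<alpha>') y\<bar> \<le> D * (?e * ?q + ?e ^ Suc R)" if "x \<le> y" "y \<le> \<Phi> \<alpha> x" for y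
    proof -
      have "\<bar>deriv (m \<alpha>') y\<bar> \<le> D * (a \<alpha> * m \<alpha>' x / m \<alpha> x + ?e ^ Suc R)"
        using D[OF L _ aV _ that] abs_A_le_a[OF l(1)] abs_A_le_a[OF s(7)] a' order_trans by blast
      also have "\<dots> \<le> D * (?e * ?q + ?e ^ Suc R)"
        using D1 eta_ge(1)[of \<alpha>] l mp[of x] by (intro mult_left_mono add_right_mono)
          (auto simp: divide_right_mono mult_right_mono simp flip: times_divide_eq_right intro!: mult_right_mono divide_nonneg_pos less_imp_le[OF mp(2)])
      finally show ?thesis .
    qed
    have diff: "\<bar>m \<alpha>' y - m \<alpha>' x\<bar> \<le> D * (?e * ?q + ?e ^ Suc R) * m \<alpha> x" if "x \<le> y" "y \<le> \<Phi> \<alpha> x" for y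
    proof -
      have B0: "0 \<le> D * (?e * ?q + ?e ^ Suc R)" using D1 e0 mp[of x] by (simp add: less_imp_le)
      have "\<bar>m \<alpha>' y - m \<alpha>' x\<bar> \<le> D * (?e * ?q + ?e ^ Suc R) * (y - x)"
        by (rule smooth_diff_le[OF smooth_m[OF s(7)] that(1)]) (use der that in auto)
      also have "\<dots> \<le> D * (?e * ?q + ?e ^ Suc R) * m \<alpha> x"
        using that B0 by (intro mult_left_mono) (auto simp: m_def)
      finally show ?thesis .
    qed
    have qm: "?q * m \<alpha> x = m \<alpha>' x" using mp[of x] by simp
    show "(\<forall>y. x \<le> y \<longrightarrow> y \<le> \<Phi> \<alpha> x \<longrightarrow> \<bar>deriv (m \<alpha>') y\<bar> \<le> 16 * D * ?e * ?q \<and>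
           7/8 * m \<alpha>' x \<le> m \<alpha>' y \<and> m \<alpha>' y \<le> 9/8 * m \<alpha>' x)
       \<or> (m \<alpha>' x < ?e ^ R * m \<alpha> x \<and> 1 \<le> 16 * D * ?e ^ R * real (Suc t))"
    proof (cases "?e ^ R * m \<alpha> x \<le> m \<alpha>' x")
      case True
      then have "?e ^ R \<le> ?q" using mp by (simp add: field_simps)
      then have "?e * ?e ^ R \<le> ?e * ?q" using e0 by (intro mult_left_mono)
      then have "?e * ?q + ?e ^ Suc R \<le> 2 * (?e * ?q)" unfolding power_Suc by linarith
      then have "D * (?e * ?q + ?e ^ Suc R) \<le> D * (2 * (?e * ?q))" using D1 by (intro mult_left_mono) auto
      also have "\<dots> = 2 * D * ?e * ?q" by (simp only: mult_ac)
      finally have h2: "D * (?e * ?q + ?e ^ Suc R) \<le> 2 * D * ?e * ?q" .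
      have h3: "2 * D * ?e * ?q \<le> 16 * D * ?e * ?q"
        using D1 e0 mp[of x] by (intro mult_right_mono) auto
      have "2 * D * ?e * ?q * m \<alpha> x = 2 * D * ?e * m \<alpha>' x" by (simp only: mult.assoc qm)
      also have "\<dots> \<le> 1/8 * m \<alpha>' x" using e1 mp[of x] by (intro mult_right_mono) auto
      finally have h4: "2 * D * ?e * ?q * m \<alpha> x \<le> 1/8 * m \<alpha>' x" .
      have "D * (?e * ?q + ?e ^ Suc R) * m \<alpha> x \<le> 1/8 * m \<alpha>' x"
        using mult_right_mono[OF h2, of "m \<alpha> x"] mp[of x] h4 by linarith
      then have "7/8 * m \<alpha>' x \<le> m \<alpha>' y \<and> m \<alpha>' y \<le> 9/8 * m \<alpha>' x" if "x \<le> y" "y \<le> \<Phi> \<alpha> x" for y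
        using diff[OF that] by linarith
      moreover have "\<bar>deriv (m \<alpha>') y\<bar> \<le> 16 * D * ?e * ?q" if "x \<le> y" "y \<le> \<Phi> \<alpha> x" for y
        using der[OF that] h2 h3 by linarith
      ultimately show ?thesis by blast
    next
      case False
      then have q: "?q < ?e ^ R" using mp by (simp add: field_simps)
      have "?e * ?q \<le> ?e ^ Suc R" unfolding power_Suc using q e0 by (intro mult_left_mono) auto
      then have "D * (?e * ?q + ?e ^ Suc R) \<le> D * (2 * ?e ^ R)"
        using D1 e0 e2 mult_right_mono[OF e2, of "?e ^ R"] by (intro mult_left_mono) auto
      then have "D * (?e * ?q + ?e ^ Suc R) * m \<alpha> x \<le> D * (2 * ?e ^ R) * m \<alpha> x"
        using mp[of x] by (intro mult_right_mono) auto
      then have my: "m \<alpha>' y \<le> 3 * D * ?e ^ R * m \<alpha> x" if "x \<le> y" "y \<le> \<Phi> \<alpha> x" for y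
      proof -
        have "?e ^ R * m \<alpha> x \<le> D * (?e ^ R * m \<alpha> x)" using D1 e0 mp[of x] mult_right_mono[of 1 D "?e ^ R * m \<alpha> x"] by (simp add: less_imp_le)
        then show ?thesis using diff[OF that] False \<open>D * (?e * ?q + ?e ^ Suc R) * m \<alpha> x \<le> D * (2 * ?e ^ R) * m \<alpha> x\<close> by (simp add: abs_le_iff algebra_simps)
      qed
      have "m \<alpha> x \<le> m (real (Suc t) * \<alpha>') x" using t by (intro m_mono) simp
      also have "\<dots> = (\<Sum>i<Suc t. m \<alpha>' (\<Phi> (real i * \<alpha>') x))" by (rule m_sum)
      also have "\<dots> \<le> (\<Sum>i<Suc t. 3 * D * ?e ^ R * m \<alpha> x)"
      proof (intro sum_mono my)
        fix i assume "i \<in> {..<Suc t}"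
        then have "real i * \<alpha>' \<le> real t * \<alpha>'" using s(2) by (intro mult_right_mono) auto
        then have "real i * \<alpha>' \<le> \<alpha>" using t by linarith
        then show "\<Phi> (real i * \<alpha>') x \<le> \<Phi> \<alpha> x" "x \<le> \<Phi> (real i * \<alpha>') x" using s(2) by auto
      qed
      finally have "1 * m \<alpha> x \<le> (3 * D * ?e ^ R * real (Suc t)) * m \<alpha> x" by (simp add: mult_ac)
      then have "1 \<le> 3 * D * ?e ^ R * real (Suc t)" using mp[of x] by (simp only: mult_le_cancel_right_pos)
      also have "\<dots> \<le> 16 * D * ?e ^ R * real (Suc t)" using D1 e0 by (intro mult_right_mono) auto
      finally show ?thesis using False by simp
    qed
  qed
qed

lemma M_step:
  assumes "lev \<alpha>" "step \<alpha> \<alpha>' c l" "real t * \<alpha>' \<le> \<alpha>"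
    and "\<forall>y. x \<le> y \<longrightarrow> y \<le> \<Phi> \<alpha> x \<longrightarrow> 7/8 * m \<alpha>' x \<le> m \<alpha>' y"
  shows "7/8 * real t * m \<alpha>' x \<le> m \<alpha> x"
proof -
  note s = stepD[OF assms(2)]
  have "7/8 * real t * m \<alpha>' x = (\<Sum>i<t. 7/8 * m \<alpha>' x)" by simp
  also have "\<dots> \<le> (\<Sum>i<t. m \<alpha>' (\<Phi> (real i * \<alpha>') x))"
  proof (rule sum_mono)
    fix i assume "i \<in> {..<t}"
    then have "real i * \<alpha>' \<le> real t * \<alpha>'" using s(2) by (intro mult_right_mono) auto
    then have "real i * \<alpha>' \<le> \<alpha>" using assms(3) by linarith
    moreover have "0 \<le> real i * \<alpha>'" using s(2) by simp
    ultimately show "7/8 * m \<alpha>' x \<le> m \<alpha>' (\<Phi> (real i * \<alpha>') x)" using assms(4) by simp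
  qed
  also have "\<dots> = m (real t * \<alpha>') x" by (rule m_sum[symmetric])
  also have "\<dots> \<le> m \<alpha> x" by (rule m_mono[OF assms(3)])
  finally show ?thesis .
qed

end

lemma floor_steps:
  assumes "0 < (\<alpha>'::real)" "0 \<le> \<alpha>"
  obtains t where "real t * \<alpha>' \<le> \<alpha>" "\<alpha> < real (Suc t) * \<alpha>'"
proof
  let ?t = "nat \<lfloor>\<alpha> / \<alpha>'\<rfloor>"
  have "0 \<le> \<alpha> / \<alpha>'" using assms by simp
  then have "real ?t \<le> \<alpha> / \<alpha>'" "\<alpha> / \<alpha>' < real (Suc ?t)" by linarith+
  then show "real ?t * \<alpha>' \<le> \<alpha>" "\<alpha> < real (Suc ?t) * \<alpha>'"
    using assms by (simp_all only: pos_le_divide_eq pos_divide_less_eq)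
qed

text \<open>\<open>P\<close> is the polynomial loss granted by the arithmetic condition.
  \<open>start_ex\<close> supplies arbitrarily small scales with the a priori slope bound
  \<open>V1\<close>, but without any smallness of the slope.\<close>

locale flow_dio = flow_jets +
  fixes P :: nat and \<alpha>s :: real
  assumes P1: "1 \<le> P" and V1_ge: "1 \<le> V1" and \<alpha>s: "0 < \<alpha>s" "\<alpha>s \<le> 1"
    and step_ex: "0 < \<alpha> \<Longrightarrow> \<alpha> < \<alpha>s \<Longrightarrow> \<exists>\<alpha>' c l. step \<alpha> \<alpha>' c l \<and> \<alpha> ^ P \<le> \<alpha>'"
    and start_ex: "0 < e \<Longrightarrow> \<exists>\<alpha>. lev \<alpha> \<and> \<alpha> < e"
begin

definition nxt :: "real \<Rightarrow> real" where "nxt \<alpha> = (SOME \<alpha>'. \<exists>c l. step \<alpha> \<alpha>' c l \<and> \<alpha> ^ P \<le> \<alpha>')"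

lemma nxt: assumes "0 < \<alpha>" "\<alpha> < \<alpha>s" obtains c l where "step \<alpha> (nxt \<alpha>) c l" "\<alpha> ^ P \<le> nxt \<alpha>"
  using someI_ex[OF step_ex[OF assms]] that unfolding nxt_def by blast

lemma nxt_less: assumes "0 < \<alpha>" "\<alpha> < \<alpha>s" shows "0 < nxt \<alpha>" "nxt \<alpha> \<le> \<alpha> / 8" "good (nxt \<alpha>)"
  using nxt[OF assms] stepD by metis+

text \<open>Each step divides the slope by at least 8, up to an error C2 M that is small from the
  outset because M tends to 0 with the scale. Iterating makes the slope as small as desired.\<close>

lemma start_small:
  assumes e: "0 < e"
  shows "\<exists>\<alpha>. lev \<alpha> \<and> \<alpha> < e \<and> \<alpha> < \<alpha>s \<and> M \<alpha> \<le> e \<and> a \<alpha> \<le> e"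
proof -
  \<comment> \<open>With 4 C2 d \<le> min e V1 the accumulated errors, at most 2 C2 d, stay below
    e/2, and the bound V1 survives every step.\<close>
  define d where "d = min e (min e V1 / (4 * (C2 + 1)))"
  have d0: "0 < d" using e V1_ge C2 by (simp add: d_def)
  have "d \<le> min e V1 / (4 * (C2 + 1))" by (simp add: d_def)
  then have "4 * (C2 + 1) * d \<le> min e V1" using C2 by (simp add: field_simps)
  then have C2d: "4 * (C2 * d) \<le> e" "4 * (C2 * d) \<le> V1" using d0 by (simp_all add: algebra_simps)
  obtain \<beta> where \<beta>: "\<beta> > 0" "\<And>\<alpha>. 0 \<le> \<alpha> \<Longrightarrow> \<alpha> \<le> \<beta> \<Longrightarrow> M \<alpha> \<le> d" using M_small[OF d0] by blast
  obtain \<alpha>0 where \<alpha>0: "lev \<alpha>0" "\<alpha>0 < min \<beta> (min \<alpha>s e)" using start_ex[of "min \<beta> (min \<alpha>s e)"] \<beta> \<alpha>s e by auto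
  define s where "s n = (nxt ^^ n) \<alpha>0" for n
  have claim: "lev (s n) \<and> s n \<le> \<alpha>0 \<and> a (s n) \<le> V1 / 4 ^ n + 2 * (C2 * d)" for n
  proof (induction n)
    case 0
    have "0 \<le> C2 * d" using C2 d0 by simp
    moreover have "a \<alpha>0 \<le> V1" by (rule a_le) (rule levD(4)[OF \<alpha>0(1)])
    ultimately show ?case using \<alpha>0 by (simp add: s_def)
  next
    case (Suc n)
    note l = levD[OF Suc[THEN conjunct1]]
    have lt: "s n < \<alpha>s" using Suc \<alpha>0 by simp
    obtain c l where st: "step (s n) (nxt (s n)) c l" using nxt[OF l(2) lt] by blast
    have sS: "s (Suc n) = nxt (s n)" by (simp add: s_def)
    note sd = stepD[OF st]
    obtain t where t: "real t * nxt (s n) \<le> s n" "s n < real (Suc t) * nxt (s n)"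
      using floor_steps[OF sd(2), of "s n"] sd by auto
    note r = slope_recursion'[OF Suc[THEN conjunct1] st t]
    have "M (s n) \<le> d" using Suc \<alpha>0 l by (intro \<beta>(2)) auto
    then have "C2 * M (s n) \<le> C2 * d" using C2 by (rule mult_left_mono)
    moreover have "a (s n) / real t \<le> a (s n) / 8" using r(2) a_nonneg by (intro divide_left_mono) auto
    ultimately have a': "a (nxt (s n)) \<le> a (s n) / 8 + C2 * d" using r(1) by linarith
    have "a (s n) \<le> V1" by (rule a_le) (rule l(4))
    then have "a (nxt (s n)) \<le> V1" using a' C2d V1_ge by linarith
    then have "lev (nxt (s n))" using sd abs_A_le_a[OF sd(7)] order_trans unfolding lev_def by fastforce
    moreover have "a (nxt (s n)) \<le> V1 / 4 ^ Suc n + 2 * (C2 * d)"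
    proof -
      have "0 \<le> V1 / 4 ^ n" using V1_ge by simp
      moreover have "V1 / 4 ^ Suc n = V1 / 4 ^ n / 4" by simp
      moreover have "0 \<le> C2 * d" using C2 d0 by simp
      ultimately show ?thesis using a' Suc by linarith
    qed
    ultimately show ?case using sd Suc unfolding sS by simp
  qed
  obtain n where n: "2 * V1 / e < 4 ^ n" using real_arch_pow[of 4 "2 * V1 / e"] by auto
  then have "V1 / 4 ^ n \<le> e / 2" using e by (simp add: field_simps)
  then have "a (s n) \<le> e" using claim[of n] C2d by linarith
  moreover have "M (s n) \<le> e"
    using \<beta>(2)[of "s n"] claim[of n] levD(2)[of "s n"] \<alpha>0 by (simp add: d_def)
  ultimately show ?thesis using claim[of n] \<alpha>0 by (intro exI[of _ "s n"]) auto
qed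

text \<open>Induction over the scales with u = \<alpha>^c and the invariant M \<le> u^(2P), a \<le>
  Q u. If the displacement is nearly constant, M drops by a factor of order t, more than u^(2P) does
  since c is small. Otherwise M at the next scale is at most \<eta>^R, and \<eta> = O(u) together
  with u^P \<le> u' restores the invariant. So this weak decay holds through both
  alternatives.\<close>

lemma decay:
  "\<exists>s c C. 0 < c \<and> 0 < C \<and> (\<forall>k. lev (s k) \<and> s k < \<alpha>s \<and> s (Suc k) = nxt (s k) \<and> a (s k) \<le> 1 \<and> eta (s k) \<le> C * s k powr c)"
proof -
  \<comment> \<open>a/t \<le> Q u'/2 = (C2 + 1) u' and C2 M \<le> C2 u' add up to at most Q u',
    which closes the induction for the slope.\<close>
  define Q where "Q = 2 * (C2 + 1)"
  define C where "C = C1 * (Q + 1)"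
  \<comment> \<open>\<eta>^R \<le> (C u)^(4 P^2) \<le> u^(2 P^2) = (u^P)^(2P) \<le> u'^(2P): half of
    the exponent pays for the constant C, the other half for the worst loss \<alpha>' =
    \<alpha>^P.\<close>
  define R where "R = 4 * P\<^sup>2"
  have Q2: "2 \<le> Q" using C2 by (simp add: Q_def)
  have C1': "1 \<le> C" using C1_ge1 Q2 mult_mono[of 1 C1 1 "Q + 1"] by (simp add: C_def)
  have "1 \<le> R" using P1 by (simp add: R_def Suc_le_eq)
  then obtain D where D1: "D \<ge> 1" and D: "\<And>\<alpha> \<alpha>' c l t x. lev \<alpha> \<Longrightarrow> step \<alpha> \<alpha>' c l \<Longrightarrow> a \<alpha>' \<le> V1 \<Longrightarrow> D * eta \<alpha> \<le> 1 \<Longrightarrow> real t * \<alpha>' \<le> \<alpha> \<Longrightarrow> \<alpha> < real (Suc t) * \<alpha>' \<Longrightarrow>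
    (\<forall>y. x \<le> y \<longrightarrow> y \<le> \<Phi> \<alpha> x \<longrightarrow> \<bar>deriv (m \<alpha>') y\<bar> \<le> D * eta \<alpha> * (m \<alpha>' x / m \<alpha> x) \<and>
           7/8 * m \<alpha>' x \<le> m \<alpha>' y \<and> m \<alpha>' y \<le> 9/8 * m \<alpha>' x)
       \<or> (m \<alpha>' x < eta \<alpha> ^ R * m \<alpha> x \<and> 1 \<le> D * eta \<alpha> ^ R * real (Suc t))"
    using dichotomy[of R] by metis
  define d where "d = 1 / (D * C\<^sup>2 * Q)"
  have C21: "1 \<le> C\<^sup>2" using C1' by (simp add: one_le_power)
  have DCQ: "C\<^sup>2 \<le> D * C\<^sup>2 * Q" "D * C \<le> D * C\<^sup>2 * Q" "Q \<le> D * C\<^sup>2 * Q" "0 < D * C\<^sup>2 * Q"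
  proof -
    show p: "0 < D * C\<^sup>2 * Q" using D1 C21 Q2 by (intro mult_pos_pos) linarith+
    have "1 * C\<^sup>2 * 1 \<le> D * C\<^sup>2 * Q" using D1 C21 Q2 by (intro mult_mono) auto
    then show "C\<^sup>2 \<le> D * C\<^sup>2 * Q" by simp
    have "1 * 1 * Q \<le> D * C\<^sup>2 * Q" using D1 C21 Q2 by (intro mult_mono) auto
    then show "Q \<le> D * C\<^sup>2 * Q" by simp
    have "C \<le> C\<^sup>2" using C1' by (simp add: power2_eq_square)
    then have "D * C * 1 \<le> D * C\<^sup>2 * Q" using D1 C1' Q2 by (intro mult_mono) auto
    then show "D * C \<le> D * C\<^sup>2 * Q" by simp
  qed
  have d: "0 < d" "C\<^sup>2 * d \<le> 1" "D * C * d \<le> 1" "Q * d \<le> 1"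
    using DCQ by (simp_all only: d_def times_divide_eq_right mult_1_right divide_le_eq_1_pos zero_less_divide_1_iff)
  have d1: "d < 1"
  proof -
    have "2 * d \<le> Q * d" using Q2 d(1) by (intro mult_right_mono) auto
    then show ?thesis using d by linarith
  qed
  have dpow: "d ^ (4 * P) \<le> d ^ (2 * P)" "d ^ (4 * P) \<le> d" "0 < d ^ (4 * P)"
    using d d1 P1 power_decreasing[of 1 "4 * P" d] by (auto intro!: power_decreasing)
  \<comment> \<open>The initial scale, M and a all lie below d^(4P). The exponent c is then fixed by
    requiring u = d at \<beta>, and \<beta> < d^(4P) becomes 4 P c \<le> 1.\<close>
  obtain \<beta> where \<beta>: "lev \<beta>" "\<beta> < d ^ (4 * P)" "\<beta> < \<alpha>s" "M \<beta> \<le> d ^ (4 * P)" "a \<beta> \<le> d ^ (4 * P)"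
    using start_small[OF dpow(3)] by blast
  have \<beta>0: "0 < \<beta>" "\<beta> < 1" using levD(2)[OF \<beta>(1)] \<beta>(3) \<alpha>s by auto
  define c where "c = ln d / ln \<beta>"
  have lnb: "ln \<beta> < 0" "ln d < 0" using \<beta>0 d d1 by auto
  have c0: "0 < c" using lnb by (simp add: c_def divide_neg_neg)
  have c1: "4 * real P * c \<le> 1"
  proof -
    have "ln \<beta> < ln (d ^ (4 * P))" using \<beta>0 dpow \<beta>(2) by (subst ln_less_cancel_iff) auto
    then have "ln \<beta> < 4 * real P * ln d" using d by (simp add: ln_realpow)
    then show ?thesis using lnb by (simp add: c_def field_simps)
  qed
  define u where "u x = x powr c" for x :: real
  have u\<beta>: "u \<beta> = d" using \<beta>0 d lnb by (simp add: u_def powr_def c_def)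
  define s where "s k = (nxt ^^ k) \<beta>" for k
  have sS: "s (Suc k) = nxt (s k)" for k by (simp add: s_def)
  have eta_u: "eta \<alpha> \<le> C * u \<alpha>" if "M \<alpha> \<le> u \<alpha> ^ (2 * P)" "a \<alpha> \<le> Q * u \<alpha>" "0 < u \<alpha>" "u \<alpha> \<le> 1" for \<alpha>
  proof -
    have "sqrt (M \<alpha>) \<le> sqrt (u \<alpha> ^ (2 * P))" using that(1) by (rule real_sqrt_le_mono)
    also have "\<dots> = u \<alpha> ^ P" using that(3) by (simp add: power_mult power2_eq_square real_sqrt_mult power_mult_distrib flip: power_even_eq)
    also have "\<dots> \<le> u \<alpha>" using that P1 power_decreasing[of 1 P "u \<alpha>"] by simp
    finally have "a \<alpha> + sqrt (M \<alpha>) \<le> (Q + 1) * u \<alpha>" using that(2) by (simp add: distrib_right)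
    then show ?thesis unfolding eta_def C_def using C1_ge1 by (simp add: mult.assoc mult_left_mono)
  qed
  have claim: "lev (s k) \<and> s k \<le> \<beta> \<and> M (s k) \<le> u (s k) ^ (2 * P) \<and> a (s k) \<le> Q * u (s k)" for k
  proof (induction k)
    case 0
    have "d \<le> Q * d" using Q2 d(1) mult_right_mono[of 1 Q d] by simp
    then have "a \<beta> \<le> Q * d" using \<beta>(5) dpow(2) by linarith
    then show ?case using \<beta> dpow u\<beta> by (simp add: s_def)
  next
    case (Suc k)
    define \<alpha> where "\<alpha> = s k"
    define \<alpha>' where "\<alpha>' = nxt \<alpha>"
    have lv: "lev \<alpha>" and \<alpha>\<beta>: "\<alpha> \<le> \<beta>" and Mu: "M \<alpha> \<le> u \<alpha> ^ (2 * P)" and au: "a \<alpha> \<le> Q * u \<alpha>" using Suc by (auto simp: \<alpha>_def)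
    note l = levD[OF lv]
    have lt: "\<alpha> < \<alpha>s" using \<alpha>\<beta> \<beta> by simp
    obtain cc ll where st: "step \<alpha> \<alpha>' cc ll" and \<alpha>P: "\<alpha> ^ P \<le> \<alpha>'" using nxt[OF l(2) lt] unfolding \<alpha>'_def by blast
    note sd = stepD[OF st]
    obtain t where t: "real t * \<alpha>' \<le> \<alpha>" "\<alpha> < real (Suc t) * \<alpha>'" using floor_steps[OF sd(2), of \<alpha>] sd by auto
    note r = slope_recursion'[OF lv st t]
    have u0: "0 < u \<alpha>" "0 < u \<alpha>'" using l sd by (simp_all add: u_def)
    have ud: "u \<alpha> \<le> d" unfolding u\<beta>[symmetric] u_def using l \<alpha>\<beta> c0 by (intro powr_mono2) auto
    have u'u: "u \<alpha>' \<le> u \<alpha>" unfolding u_def using sd c0 by (intro powr_mono2) auto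
    have u1: "u \<alpha> \<le> 1" using ud d1 by simp
    have uP: "u \<alpha> ^ P \<le> u \<alpha>'"
    proof -
      have "u \<alpha> ^ P = (\<alpha> ^ P) powr c" using l by (simp add: u_def powr_powr powr_realpow[symmetric] mult.commute flip: powr_realpow)
      also have "\<dots> \<le> u \<alpha>'" unfolding u_def using \<alpha>P c0 l by (intro powr_mono2) auto
      finally show ?thesis .
    qed
    define \<tau> where "\<tau> = \<alpha> / \<alpha>'"
    have \<tau>8: "8 \<le> \<tau>" using sd by (simp add: \<tau>_def field_simps)
    have t\<tau>: "7/8 * \<tau> \<le> real t"
    proof -
      have "\<tau> < real t + 1" using t(2) sd(2) by (simp add: \<tau>_def field_simps)
      then show ?thesis using \<tau>8 by linarith
    qed
    have u\<tau>: "u \<alpha> = u \<alpha>' * \<tau> powr c" using l sd by (simp add: u_def \<tau>_def powr_divide)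
    \<comment> \<open>For \<tau> \<ge> 8 the square root of \<tau> is at most 7/16 of \<tau>, while
      t is at least 7/8 of \<tau>. Any power up to 1/2 of the ratio of scales is thus beaten by
      t/2.\<close>
    have pow_le: "\<tau> powr e \<le> real t / 2" if "e \<le> 1/2" for e
    proof -
      have "\<tau> powr e \<le> \<tau> powr (1/2)" using \<tau>8 that by (intro powr_mono) auto
      also have "\<dots> = sqrt \<tau>" using \<tau>8 by (simp add: powr_half_sqrt)
      finally have 1: "\<tau> powr e \<le> sqrt \<tau>" .
      have "(16/7)\<^sup>2 \<le> \<tau>" using \<tau>8 by (simp add: power2_eq_square)
      then have "16/7 \<le> sqrt \<tau>" using real_le_rsqrt by blast
      then have "16/7 * sqrt \<tau> \<le> sqrt \<tau> * sqrt \<tau>" using \<tau>8 by (intro mult_right_mono) auto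
      also have "\<dots> = \<tau>" using \<tau>8 by simp
      finally show ?thesis using 1 t\<tau> by linarith
    qed
    have t0: "0 < real t" using r(2) by simp
    have cP: "c \<le> 1/2" "c * real (2 * P) \<le> 1/2"
    proof -
      have "c * 1 \<le> c * real P" using c0 P1 by (intro mult_left_mono) auto
      then show "c \<le> 1/2" "c * real (2 * P) \<le> 1/2" using c1 by (auto simp: mult_ac)
    qed
    have ut: "u \<alpha> / real t \<le> u \<alpha>' / 2"
      using mult_left_mono[OF pow_le[OF cP(1)], of "u \<alpha>'"] u0 t0 by (simp add: u\<tau> field_simps)
    have "a \<alpha> / real t \<le> Q * u \<alpha> / real t" using au t0 by (intro divide_right_mono) auto
    also have "\<dots> \<le> Q * (u \<alpha>' / 2)" using ut Q2 mult_left_mono[OF ut, of Q] by simp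
    finally have a1: "a \<alpha> / real t \<le> (C2 + 1) * u \<alpha>'" by (simp only: Q_def)
    have "u \<alpha> ^ (2 * P) \<le> u \<alpha> ^ P" using u0 u1 by (intro power_decreasing) auto
    then have "M \<alpha> \<le> u \<alpha>'" using Mu uP by linarith
    then have "C2 * M \<alpha> \<le> C2 * u \<alpha>'" using C2 by (rule mult_left_mono)
    then have a': "a \<alpha>' \<le> Q * u \<alpha>'" using a1 r(1) u0 by (simp add: Q_def algebra_simps)
    have "Q * u \<alpha>' \<le> Q * d" using u'u ud Q2 by (intro mult_left_mono) auto
    then have aV: "a \<alpha>' \<le> V1" using a' d(4) V1_ge by linarith
    then have lv': "lev \<alpha>'" using sd abs_A_le_a[OF sd(7)] order_trans unfolding lev_def by fastforce
    have eu: "eta \<alpha> \<le> C * u \<alpha>" by (rule eta_u[OF Mu au u0(1) u1])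
    have e0: "0 \<le> eta \<alpha>" using eta_ge(1)[of \<alpha>] a_nonneg[of \<alpha>] l by linarith
    have "C * u \<alpha> \<le> C * d" using ud C1' by (intro mult_left_mono) auto
    then have "D * eta \<alpha> \<le> D * (C * d)" using eu D1 by (intro mult_left_mono) linarith+
    then have De: "D * eta \<alpha> \<le> 1" using d(3) by (simp add: mult.assoc)
    obtain x where x: "M \<alpha>' = m \<alpha>' x" using M_attained by blast
    have "M \<alpha>' \<le> u \<alpha>' ^ (2 * P)"
      using D[OF lv st aV De t, of x]
    proof
      assume G: "\<forall>y. x \<le> y \<longrightarrow> y \<le> \<Phi> \<alpha> x \<longrightarrow> \<bar>deriv (m \<alpha>') y\<bar> \<le> D * eta \<alpha> * (m \<alpha>' x / m \<alpha> x) \<and>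
           7/8 * m \<alpha>' x \<le> m \<alpha>' y \<and> m \<alpha>' y \<le> 9/8 * m \<alpha>' x"
      have "7/8 * real t * m \<alpha>' x \<le> m \<alpha> x" by (rule M_step[OF lv st t(1)]) (use G in blast)
      then have "7/8 * real t * M \<alpha>' \<le> u \<alpha> ^ (2 * P)" using m_le_M[of \<alpha> x] Mu x by simp
      also have "\<dots> = u \<alpha>' ^ (2 * P) * \<tau> powr (c * real (2 * P))"
        using \<tau>8 by (simp add: u\<tau> power_mult_distrib powr_powr[symmetric] powr_realpow power_mult)
      also have "\<dots> \<le> u \<alpha>' ^ (2 * P) * (real t / 2)" using u0 by (intro mult_left_mono pow_le cP) auto
      finally have "real t * (7/8 * M \<alpha>') \<le> real t * (1/2 * u \<alpha>' ^ (2 * P))" by (simp add: mult_ac)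
      then have "7/8 * M \<alpha>' \<le> 1/2 * u \<alpha>' ^ (2 * P)" using t0 by (simp only: mult_le_cancel_left_pos)
      moreover have "0 \<le> u \<alpha>' ^ (2 * P)" using u0 by simp
      ultimately show ?thesis by linarith
    next
      assume B: "m \<alpha>' x < eta \<alpha> ^ R * m \<alpha> x \<and> 1 \<le> D * eta \<alpha> ^ R * real (Suc t)"
      have "m \<alpha> x \<le> 1"
      proof -
        have "u \<alpha> ^ (2 * P) \<le> 1" using u0 u1 by (intro power_le_one) auto
        then show ?thesis using m_le_M[of \<alpha> x] Mu by linarith
      qed
      then have "eta \<alpha> ^ R * m \<alpha> x \<le> eta \<alpha> ^ R * 1" using e0 by (intro mult_left_mono) auto
      then have "M \<alpha>' \<le> eta \<alpha> ^ R" using B x by linarith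
      also have "\<dots> \<le> (C * u \<alpha>) ^ R" using eu e0 by (rule power_mono)
      also have "\<dots> = ((C * u \<alpha>)\<^sup>2) ^ (2 * P\<^sup>2)" by (simp add: R_def flip: power_mult)
      also have "\<dots> \<le> u \<alpha> ^ (2 * P\<^sup>2)"
      proof (rule power_mono)
        have "C\<^sup>2 * u \<alpha> \<le> C\<^sup>2 * d" using ud by (intro mult_left_mono) auto
        then have "(C\<^sup>2 * u \<alpha>) * u \<alpha> \<le> 1 * u \<alpha>" using d(2) u0 by (intro mult_right_mono) auto
        then show "(C * u \<alpha>)\<^sup>2 \<le> u \<alpha>" by (simp add: power2_eq_square mult_ac)
      qed simp
      also have "\<dots> = (u \<alpha> ^ P) ^ (2 * P)" by (simp add: power2_eq_square mult_ac flip: power_mult)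
      also have "\<dots> \<le> u \<alpha>' ^ (2 * P)" using uP u0 by (intro power_mono) auto
      finally show ?thesis .
    qed
    then show ?case unfolding sS using lv' a' \<alpha>\<beta> sd by (simp flip: \<alpha>_def \<alpha>'_def)
  qed
  have "lev (s k) \<and> s k < \<alpha>s \<and> s (Suc k) = nxt (s k) \<and> a (s k) \<le> 1 \<and> eta (s k) \<le> C * s k powr c" for k
  proof -
    note cl = claim[of k]
    have l: "0 < s k" using levD(2) cl by blast
    have ud: "u (s k) \<le> d" unfolding u\<beta>[symmetric] u_def using l cl c0 by (intro powr_mono2) auto
    have u0: "0 < u (s k)" using l by (simp add: u_def)
    have "Q * u (s k) \<le> Q * d" using ud Q2 by (intro mult_left_mono) auto
    then have "a (s k) \<le> 1" using cl d(4) by linarith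
    moreover have "eta (s k) \<le> C * u (s k)" using cl u0 ud d1 by (intro eta_u) auto
    ultimately show ?thesis using cl \<beta>(3) sS by (auto simp: u_def)
  qed
  then show ?thesis using c0 C1' by (intro exI[of _ s] exI[of _ c] exI[of _ C]) auto
qed

text \<open>In the second alternative of the dichotomy the number $t$ of steps is larger than every power of $1/\alpha$
  allowed by the arithmetic condition, once the powers of $\eta$ are known to be powers of $\alpha$.\<close>

theorem good_scales:
  "\<exists>s c C G. 0 < c \<and> 0 < C \<and> 1 \<le> G \<and> (\<forall>k. lev (s k) \<and> (\<exists>b l. step (s k) (s (Suc k)) b l) \<and> s k ^ P \<le> s (Suc k) \<and>
     eta (s k) \<le> C * s k powr c \<and> eta (s k) \<le> 1 \<and>
     (\<forall>x y. x \<le> y \<longrightarrow> y \<le> \<Phi> (s k) x \<longrightarrow> \<bar>deriv (m (s (Suc k))) y\<bar> \<le> G * eta (s k) * (m (s (Suc k)) x / m (s k) x) \<and>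
        7/8 * m (s (Suc k)) x \<le> m (s (Suc k)) y \<and> m (s (Suc k)) y \<le> 9/8 * m (s (Suc k)) x))"
proof -
  obtain s c C where c0: "0 < c" and C0: "0 < C" and sk: "\<And>k. lev (s k)" "\<And>k. s k < \<alpha>s" "\<And>k. s (Suc k) = nxt (s k)"
    "\<And>k. a (s k) \<le> 1" and eta: "\<And>k. eta (s k) \<le> C * s k powr c" using decay by blast
  have s0: "0 < s k" "s k \<le> 1" for k using levD[OF sk(1)] by auto
  \<comment> \<open>The exponent \<open>c\<close> is fixed by now, so R = 2n can be taken with c n
    \<ge> P + 1. Then \<eta>^R \<le> \<alpha>^(P+1) \<le> \<alpha> \<alpha>', whereas t + 1 \<le>
    2/\<alpha>': the second alternative would force 1 \<le> 2 D \<alpha>.\<close>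
  obtain n :: nat where n: "real P + 1 \<le> c * real n" and n0: "0 < n"
  proof -
    obtain n :: nat where "(real P + 1) / c \<le> real n" using real_arch_simple by blast
    then have "real P + 1 \<le> c * real n" using c0 by (simp add: field_simps)
    moreover from this have "0 < n" using c0 by (intro gr0I) auto
    ultimately show ?thesis using that by blast
  qed
  define R where "R = 2 * n"
  have "1 \<le> R" using n0 by (simp add: R_def)
  then obtain D where D1: "D \<ge> 1" and D: "\<And>\<alpha> \<alpha>' c l t x. lev \<alpha> \<Longrightarrow> step \<alpha> \<alpha>' c l \<Longrightarrow> a \<alpha>' \<le> V1 \<Longrightarrow> D * eta \<alpha> \<le> 1 \<Longrightarrow> real t * \<alpha>' \<le> \<alpha> \<Longrightarrow> \<alpha> < real (Suc t) * \<alpha>' \<Longrightarrow>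
    (\<forall>y. x \<le> y \<longrightarrow> y \<le> \<Phi> \<alpha> x \<longrightarrow> \<bar>deriv (m \<alpha>') y\<bar> \<le> D * eta \<alpha> * (m \<alpha>' x / m \<alpha> x) \<and>
           7/8 * m \<alpha>' x \<le> m \<alpha>' y \<and> m \<alpha>' y \<le> 9/8 * m \<alpha>' x)
       \<or> (m \<alpha>' x < eta \<alpha> ^ R * m \<alpha> x \<and> 1 \<le> D * eta \<alpha> ^ R * real (Suc t))"
    using dichotomy[of R] by metis
  have dec: "s k \<le> 1 / 8 ^ k" for k
  proof (induction k)
    case (Suc k)
    have "s (Suc k) \<le> s k / 8" using nxt_less(2)[OF s0(1) sk(2)] sk(3) by simp
    then show ?case using Suc by simp
  qed (use s0 in simp)
  have "s \<longlonglongrightarrow> 0"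
  proof (rule tendsto_sandwich[of "\<lambda>_. 0" _ _ "\<lambda>k. (1/8) ^ k"])
    show "(\<lambda>k. (1/8) ^ k :: real) \<longlonglongrightarrow> 0" by (rule LIMSEQ_realpow_zero) auto
  qed (use s0 dec in \<open>auto simp: power_one_over less_imp_le\<close>)
  then have "(\<lambda>k. s k powr c) \<longlonglongrightarrow> 0" using c0 tendsto_zero_powrI[of s sequentially "\<lambda>_. c" c] s0 by (auto simp: less_imp_le)
  then have "(\<lambda>k. (D * C + C\<^sup>2) * s k powr c) \<longlonglongrightarrow> 0" by (intro tendsto_mult_right_zero)
  moreover have "(\<lambda>k. (4 * D) * s k) \<longlonglongrightarrow> 0" using \<open>s \<longlonglongrightarrow> 0\<close> by (intro tendsto_mult_right_zero)
  ultimately have "\<forall>\<^sub>F k in sequentially. (D * C + C\<^sup>2) * s k powr c < 1 \<and> (4 * D) * s k < 1"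
    by (intro eventually_conj) (auto dest: order_tendstoD(2)[of _ _ _ 1])
  \<comment> \<open>Dropping the first K scales absorbs the constants C and D.\<close>
  then obtain K where K: "\<And>k. k \<ge> K \<Longrightarrow> (D * C + C\<^sup>2) * s k powr c < 1" "\<And>k. k \<ge> K \<Longrightarrow> (4 * D) * s k < 1"
    unfolding eventually_sequentially by blast
  define r where "r k = s (k + K)" for k
  have main: "lev (r k) \<and> (\<exists>b l. step (r k) (r (Suc k)) b l) \<and> r k ^ P \<le> r (Suc k) \<and>
     eta (r k) \<le> C * r k powr c \<and> eta (r k) \<le> 1 \<and>
     (\<forall>x y. x \<le> y \<longrightarrow> y \<le> \<Phi> (r k) x \<longrightarrow> \<bar>deriv (m (r (Suc k))) y\<bar> \<le> D * eta (r k) * (m (r (Suc k)) x / m (r k) x) \<and>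
        7/8 * m (r (Suc k)) x \<le> m (r (Suc k)) y \<and> m (r (Suc k)) y \<le> 9/8 * m (r (Suc k)) x)" for k
  proof -
    let ?\<alpha> = "r k" and ?\<alpha>' = "r (Suc k)"
    let ?u = "?\<alpha> powr c"
    have rS: "?\<alpha>' = nxt ?\<alpha>" using sk(3) by (simp add: r_def)
    have lv: "lev ?\<alpha>" and lt: "?\<alpha> < \<alpha>s" and eu: "eta ?\<alpha> \<le> C * ?u" and \<alpha>0: "0 < ?\<alpha>" "?\<alpha> \<le> 1" and aV: "a ?\<alpha>' \<le> V1"
      using sk(1,2) eta s0 order_trans[OF sk(4) V1_ge, of "Suc (k + K)"] by (simp_all add: r_def)
    have u0: "0 < ?u" using \<alpha>0 by simp
    have Ku: "(D * C + C\<^sup>2) * ?u < 1" "4 * D * ?\<alpha> < 1" using K[of "k + K"] by (auto simp: r_def)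
    have e0: "0 \<le> eta ?\<alpha>" using eta_ge(1)[of ?\<alpha>] a_nonneg[of ?\<alpha>] \<alpha>0 by linarith
    have p: "0 \<le> D * C * ?u" "0 \<le> C\<^sup>2 * ?u" using D1 C0 u0 by simp_all
    have DCu: "D * C * ?u \<le> 1" "C\<^sup>2 * ?u \<le> 1" using Ku(1) p unfolding distrib_right by - linarith+
    have "D * eta ?\<alpha> \<le> D * (C * ?u)" using eu D1 by (intro mult_left_mono) auto
    then have De: "D * eta ?\<alpha> \<le> 1" using DCu by (simp add: mult.assoc)
    have "1 * eta ?\<alpha> \<le> D * eta ?\<alpha>" using D1 e0 by (intro mult_right_mono) auto
    then have e1: "eta ?\<alpha> \<le> 1" using De by simp
    obtain b l where st: "step ?\<alpha> ?\<alpha>' b l" and \<alpha>P: "?\<alpha> ^ P \<le> ?\<alpha>'" using nxt[OF \<alpha>0(1) lt] rS by auto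
    note sd = stepD[OF st]
    obtain t where t: "real t * ?\<alpha>' \<le> ?\<alpha>" "?\<alpha> < real (Suc t) * ?\<alpha>'" using floor_steps[OF sd(2), of ?\<alpha>] sd by auto
    have noB: "\<not> 1 \<le> D * eta ?\<alpha> ^ R * real (Suc t)"
    proof -
      have "eta ?\<alpha> ^ R \<le> (C * ?u) ^ R" using eu e0 by (rule power_mono)
      also have "\<dots> = ((C * ?u)\<^sup>2) ^ n" by (simp add: R_def flip: power_mult)
      also have "\<dots> \<le> ?u ^ n"
      proof (rule power_mono)
        have "(C\<^sup>2 * ?u) * ?u \<le> 1 * ?u" using DCu u0 by (intro mult_right_mono) auto
        then show "(C * ?u)\<^sup>2 \<le> ?u" by (simp add: power2_eq_square mult_ac)
      qed simp
      also have "\<dots> = ?\<alpha> powr (c * real n)" using \<alpha>0 by (simp add: powr_powr[symmetric] powr_realpow)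
      also have "\<dots> \<le> ?\<alpha> powr (real P + 1)" using \<alpha>0 n by (intro powr_mono') auto
      also have "\<dots> = ?\<alpha> ^ P * ?\<alpha>" using \<alpha>0 by (simp add: powr_add powr_realpow)
      finally have e: "eta ?\<alpha> ^ R \<le> ?\<alpha> ^ P * ?\<alpha>" .
      have "8 \<le> t" using slope_recursion'(2)[OF lv st t] .
      have "real (Suc t) * ?\<alpha>' \<le> 2 * (real t * ?\<alpha>')" using \<open>8 \<le> t\<close> sd(2) by (simp add: algebra_simps)
      then have "real (Suc t) * ?\<alpha>' \<le> 2 * ?\<alpha>" using t(1) by linarith
      then have t2: "real (Suc t) * ?\<alpha>' \<le> 2" using \<alpha>0 by linarith
      have "real (Suc t) * eta ?\<alpha> ^ R \<le> real (Suc t) * (?\<alpha> ^ P * ?\<alpha>)" using e by (intro mult_left_mono) auto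
      also have "\<dots> \<le> real (Suc t) * (?\<alpha>' * ?\<alpha>)" using \<alpha>P \<alpha>0 by (intro mult_left_mono mult_right_mono) auto
      also have "\<dots> \<le> 2 * ?\<alpha>" using mult_right_mono[OF t2, of ?\<alpha>] \<alpha>0 by (simp add: mult_ac)
      finally have "D * (real (Suc t) * eta ?\<alpha> ^ R) \<le> D * (2 * ?\<alpha>)" using D1 by (intro mult_left_mono) auto
      also have "\<dots> < 1" using Ku(2) D1 \<alpha>0 by (simp add: mult.assoc)
      finally show ?thesis by (simp add: mult_ac)
    qed
    have G: "\<forall>x y. x \<le> y \<longrightarrow> y \<le> \<Phi> ?\<alpha> x \<longrightarrow> \<bar>deriv (m ?\<alpha>') y\<bar> \<le> D * eta ?\<alpha> * (m ?\<alpha>' x / m ?\<alpha> x) \<and>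
        7/8 * m ?\<alpha>' x \<le> m ?\<alpha>' y \<and> m ?\<alpha>' y \<le> 9/8 * m ?\<alpha>' x"
      using D[OF lv st aV De t] noB by blast
    show ?thesis using lv st \<alpha>P eu e1 G by blast
  qed
  show ?thesis
    by (rule exI[of _ r], rule exI[of _ c], rule exI[of _ C], rule exI[of _ D]) (use c0 C0 D1 main in blast)
qed

end

section \<open>The conjugacy is bi-Lipschitz\<close>

text \<open>Recovers a slope A from a bound on the derivative e^A - 1 of the displacement.\<close>

lemma abs_le_exp_minus_1: "\<bar>x\<bar> \<le> V \<Longrightarrow> \<bar>x\<bar> \<le> exp V * \<bar>exp x - 1\<bar>" for x V :: real
proof (cases "x \<ge> 0")
  case True
  assume x: "\<bar>x\<bar> \<le> V"
  have "x \<le> exp x - 1" unfolding le_diff_eq add.commute[of x] by (rule exp_ge_add_one_self)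
  then have "\<bar>x\<bar> \<le> 1 * \<bar>exp x - 1\<bar>" using True by simp
  also have "\<dots> \<le> exp V * \<bar>exp x - 1\<bar>" using x by (intro mult_right_mono) auto
  finally show ?thesis .
next
  case False
  assume x: "\<bar>x\<bar> \<le> V"
  have "\<bar>x\<bar> \<le> exp (- x) - 1" using False exp_ge_add_one_self[of "- x"] by linarith
  also have "\<dots> = exp (- x) * (1 - exp x)" by (simp add: algebra_simps exp_minus)
  also have "\<dots> \<le> exp V * \<bar>exp x - 1\<bar>" using x False by (intro mult_mono) auto
  finally show ?thesis .
qed

text \<open>A fixed sequence of scales on which only the favourable alternative occurs. Of the
  arithmetic there remain the steps and the polynomial loss \<open>s_P\<close>.\<close>

locale flow_scales = flow_jets +
  fixes s :: "nat \<Rightarrow> real" and c C G :: real and P :: nat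
  assumes s_lev: "lev (s k)" and s_step: "\<exists>b l. step (s k) (s (Suc k)) b l"
    and s_P: "s k ^ P \<le> s (Suc k)" and P1: "1 \<le> P"
    and s_eta: "eta (s k) \<le> C * s k powr c" "eta (s k) \<le> 1" and c0: "0 < c" and C0: "0 < C" and G1: "1 \<le> G"
    and s_G: "x \<le> y \<Longrightarrow> y \<le> \<Phi> (s k) x \<Longrightarrow> \<bar>deriv (m (s (Suc k))) y\<bar> \<le> G * eta (s k) * (m (s (Suc k)) x / m (s k) x)"
      "x \<le> y \<Longrightarrow> y \<le> \<Phi> (s k) x \<Longrightarrow> 7/8 * m (s (Suc k)) x \<le> m (s (Suc k)) y"
begin

section \<open>Geometric decay of the scales and expansions of times\<close>

lemma s_good: "good (s k)" and s_pos: "0 < s k" and s_le1: "s k \<le> 1" and s_V1: "\<bar>A (s k) x\<bar> \<le> V1"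
  using levD[OF s_lev] by auto

lemma s_Suc: "s (Suc k) \<le> s k / 8"
  using s_step[of k] stepD(3) by blast

lemma s_decr: "s (k + n) \<le> s k / 8 ^ n"
proof (induction n)
  case (Suc n)
  then show ?case using s_Suc[of "k + n"] by simp
qed simp

lemma s_antimono: "j \<le> k \<Longrightarrow> s k \<le> s j"
proof -
  assume "j \<le> k"
  then obtain n where "k = j + n" using le_Suc_ex by blast
  moreover have "s j / 8 ^ n \<le> s j" using s_pos[of j] by (simp add: field_simps)
  ultimately show ?thesis using s_decr[of j n] by simp
qed

lemma s_tendsto_0: "s \<longlonglongrightarrow> 0"
proof (rule tendsto_sandwich[of "\<lambda>_. 0" _ _ "\<lambda>k. s 0 * (1/8) ^ k"])
  have "(\<lambda>k. s 0 * (1/8) ^ k) \<longlonglongrightarrow> s 0 * 0"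
    by (intro tendsto_mult tendsto_const LIMSEQ_realpow_zero) auto
  then show "(\<lambda>k. s 0 * (1/8) ^ k) \<longlonglongrightarrow> 0" by simp
  show "\<forall>\<^sub>F k in sequentially. s k \<le> s 0 * (1 / 8) ^ k"
    using s_decr[of 0] by (simp add: power_one_over)
qed (use s_pos in \<open>auto simp: less_imp_le\<close>)

lemma powr_sum:
  assumes "0 < \<beta>"
  shows "\<exists>B>0. \<forall>n N. (\<Sum>k<N. s (n + k) powr \<beta>) \<le> B * s n powr \<beta>"
proof -
  define q where "q = (1/8 :: real) powr \<beta>"
  have q: "0 < q" "q < 1"
  proof -
    show "0 < q" by (simp add: q_def)
    have "(1/8 :: real) powr \<beta> < 1 powr \<beta>" using assms by (intro powr_less_mono2) auto
    then show "q < 1" by (simp add: q_def)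
  qed
  have "(\<Sum>k<N. s (n + k) powr \<beta>) \<le> 1 / (1 - q) * s n powr \<beta>" for n N
  proof -
    have "s (n + k) powr \<beta> \<le> s n powr \<beta> * q ^ k" for k
    proof (induction k)
      case (Suc k)
      have "s (n + Suc k) powr \<beta> \<le> (s (n + k) / 8) powr \<beta>"
        using s_Suc[of "n + k"] s_pos[of "Suc (n + k)"] assms by (intro powr_mono2) auto
      also have "\<dots> = s (n + k) powr \<beta> * q" by (simp add: q_def powr_divide s_pos less_imp_le)
      also have "\<dots> \<le> s n powr \<beta> * q ^ k * q" using Suc q by (intro mult_right_mono) auto
      finally show ?case by (simp add: mult_ac)
    qed simp
    then have "(\<Sum>k<N. s (n + k) powr \<beta>) \<le> (\<Sum>k<N. s n powr \<beta> * q ^ k)" by (rule sum_mono)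
    also have "\<dots> = s n powr \<beta> * ((1 - q ^ N) / (1 - q))"
      using q by (simp add: sum_gp_strict flip: sum_distrib_left)
    also have "\<dots> \<le> s n powr \<beta> * (1 / (1 - q))" using q by (intro mult_left_mono divide_right_mono) auto
    finally show ?thesis by (simp add: mult_ac)
  qed
  then show ?thesis using q by (intro exI[of _ "1 / (1 - q)"]) auto
qed

text \<open>Partial sums of greedy expansions of a time in [0, s n], a numeration of Ostrowski type:
  the digit b at the scale n + N + 1 is limited by b s(n + N + 1) \<le> s(n + N). All these times
  are good, and every real time in the interval is a limit of them.\<close>

primrec words :: "nat \<Rightarrow> nat \<Rightarrow> real set" where
  "words n 0 = {0}"
| "words n (Suc N) = {w + real b * s (Suc (n + N)) | w b. w \<in> words n N \<and> real b * s (Suc (n + N)) \<le> s (n + N)}"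

lemma words_approx:
  assumes "0 \<le> r" "r \<le> s n"
  shows "\<exists>v\<in>words n N. 0 \<le> r - v \<and> r - v \<le> s (n + N)"
proof (induction N)
  case 0
  then show ?case using assms by simp
next
  case (Suc N)
  then obtain v where v: "v \<in> words n N" "0 \<le> r - v" "r - v \<le> s (n + N)" by blast
  obtain b where b: "real b * s (Suc (n + N)) \<le> r - v" "r - v < real (Suc b) * s (Suc (n + N))"
    using floor_steps[OF s_pos v(2)] by blast
  then show ?case using v
    by (intro bexI[of _ "v + real b * s (Suc (n + N))"]) (auto simp: algebra_simps intro!: exI[of _ v] exI[of _ b])
qed

lemma words_good: "v \<in> words n N \<Longrightarrow> good v"
  by (induction N arbitrary: v) (auto simp: good_0 intro!: good_add_A good_mult s_good)

lemma slope_at: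
  assumes "x \<le> y" "y \<le> \<Phi> (s k) x"
  shows "\<bar>A (s (Suc k)) y\<bar> \<le> exp V1 * G * eta (s k) * (m (s (Suc k)) x / m (s k) x)"
proof -
  have "\<bar>A (s (Suc k)) y\<bar> \<le> exp V1 * \<bar>exp (A (s (Suc k)) y) - 1\<bar>"
    by (rule abs_le_exp_minus_1[OF s_V1])
  also have "\<dots> \<le> exp V1 * (G * eta (s k) * (m (s (Suc k)) x / m (s k) x))"
    using s_G(1)[OF assms] unfolding deriv_m[OF s_good] by (intro mult_left_mono) auto
  finally show ?thesis by (simp add: mult.assoc)
qed

lemma steps_le:
  assumes "real b * s (Suc k) \<le> s k"
  shows "real b * (m (s (Suc k)) x / m (s k) x) \<le> 8/7"
proof -
  obtain b' l where st: "step (s k) (s (Suc k)) b' l" using s_step by blast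
  have "7/8 * real b * m (s (Suc k)) x \<le> m (s k) x"
    by (rule M_step[OF s_lev st assms]) (use s_G(2) in blast)
  then show ?thesis using m_pos[OF s_pos, of k x] by (simp add: field_simps)
qed

text \<open>Each of the b steps has slope at most \<eta> times a ratio of displacements, up to
  constants, and b times that ratio is at most 8/7. The sum is O(\<eta>) whatever b is.\<close>

lemma A_power:
  assumes "real b * s (Suc k) \<le> s k"
  shows "\<bar>A (real b * s (Suc k)) x\<bar> \<le> 2 * exp V1 * G * eta (s k)"
proof -
  let ?q = "m (s (Suc k)) x / m (s k) x"
  have "\<bar>A (real b * s (Suc k)) x\<bar> \<le> (\<Sum>i<b. exp V1 * G * eta (s k) * ?q)"
    unfolding A_mult[OF s_good]
  proof (rule order_trans[OF sum_abs sum_mono])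
    fix i assume "i \<in> {..<b}"
    then have "real i * s (Suc k) \<le> real b * s (Suc k)" using s_pos[of "Suc k"] by (intro mult_right_mono) auto
    then have "real i * s (Suc k) \<le> s k" using assms by linarith
    moreover have "0 \<le> real i * s (Suc k)" using s_pos[of "Suc k"] by simp
    ultimately show "\<bar>A (s (Suc k)) (\<Phi> (real i * s (Suc k)) x)\<bar> \<le> exp V1 * G * eta (s k) * ?q"
      by (intro slope_at) auto
  qed
  also have "\<dots> = exp V1 * G * eta (s k) * (real b * ?q)" by simp
  also have "\<dots> \<le> exp V1 * G * eta (s k) * 2"
  proof (rule mult_left_mono)
    show "real b * ?q \<le> 2" using steps_le[OF assms, of x] by linarith
    have "0 \<le> eta (s k)" using eta_ge(1)[of "s k"] a_nonneg[of "s k"] s_pos[of k] by linarith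
    then show "0 \<le> exp V1 * G * eta (s k)" using G1 by simp
  qed
  finally show ?thesis by simp
qed

text \<open>Each digit contributes O(s_k^c) and the scales decay geometrically, so the bound does
  not depend on the length of the word.\<close>

lemma words_A: "\<exists>K>0. \<forall>n N v x. v \<in> words n N \<longrightarrow> \<bar>A v x\<bar> \<le> K * s n powr c"
proof -
  obtain B where B: "B > 0" "\<And>n N. (\<Sum>k<N. s (n + k) powr c) \<le> B * s n powr c" using powr_sum[OF c0] by blast
  let ?L = "2 * exp V1 * G * C"
  have L0: "0 < ?L" using G1 C0 by simp
  have "\<bar>A v x\<bar> \<le> ?L * (\<Sum>k<N. s (n + k) powr c)" if "v \<in> words n N" for n N v x
    using that
  proof (induction N arbitrary: v x)
    case 0
    then show ?case by (simp add: good_0)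
  next
    case (Suc N)
    then obtain w b where w: "w \<in> words n N" "real b * s (Suc (n + N)) \<le> s (n + N)" "v = w + real b * s (Suc (n + N))" by auto
    have g: "good w" "good (real b * s (Suc (n + N)))" using words_good[OF w(1)] good_mult[OF s_good] by auto
    have "\<bar>A (real b * s (Suc (n + N))) x\<bar> \<le> 2 * exp V1 * G * eta (s (n + N))" by (rule A_power[OF w(2)])
    also have "\<dots> \<le> 2 * exp V1 * G * (C * s (n + N) powr c)" using s_eta(1) G1 by (intro mult_left_mono) auto
    finally have "\<bar>A (real b * s (Suc (n + N))) x\<bar> \<le> ?L * s (n + N) powr c" by (simp add: mult.assoc)
    moreover have "\<bar>A w (\<Phi> (real b * s (Suc (n + N))) x)\<bar> \<le> ?L * (\<Sum>k<N. s (n + k) powr c)" by (rule Suc.IH[OF w(1)])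
    ultimately show ?case unfolding w(3) good_add_A(2)[OF g] sum.lessThan_Suc distrib_left by linarith
  qed
  then have "\<bar>A v x\<bar> \<le> (?L * B) * s n powr c" if "v \<in> words n N" for n N v x
  proof -
    have "\<bar>A v x\<bar> \<le> ?L * (\<Sum>k<N. s (n + k) powr c)" using that \<open>\<And>x v n N. v \<in> words n N \<Longrightarrow> \<bar>A v x\<bar> \<le> ?L * (\<Sum>k<N. s (n + k) powr c)\<close> by blast
    also have "\<dots> \<le> ?L * (B * s n powr c)" using B(2) L0 by (intro mult_left_mono) auto
    finally show ?thesis by (simp add: mult.assoc)
  qed
  then show ?thesis using L0 B(1) by (intro exI[of _ "?L * B"]) auto
qed

text \<open>Carries an estimate from good times to an arbitrary time \<open>r\<close>, at which
  nothing is known about \<open>\<Phi> r\<close> beyond continuity; the estimate must therefore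
  concern a continuous function of the endpoint.\<close>

lemma words_limit:
  assumes r: "0 \<le> r" "r \<le> s n" and cont: "continuous_on UNIV (f :: real \<Rightarrow> real)"
    and f: "\<And>N v. v \<in> words n N \<Longrightarrow> f (\<Phi> v x) \<le> B"
  shows "f (\<Phi> r x) \<le> B"
proof -
  have "\<forall>N. \<exists>v\<in>words n N. 0 \<le> r - v \<and> r - v \<le> s (n + N)" using words_approx[OF r] by blast
  then obtain v where v: "\<And>N. v N \<in> words n N" "\<And>N. 0 \<le> r - v N" "\<And>N. r - v N \<le> s (n + N)" by metis
  have "(\<lambda>N. s (n + N)) \<longlonglongrightarrow> 0" using LIMSEQ_ignore_initial_segment[OF s_tendsto_0, of n] by (simp add: add.commute)
  then have "(\<lambda>N. r - v N) \<longlonglongrightarrow> 0"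
    using tendsto_sandwich[of "\<lambda>_. 0" "\<lambda>N. r - v N" sequentially "\<lambda>N. s (n + N)" 0] v by simp
  then have "(\<lambda>N. r - (r - v N)) \<longlonglongrightarrow> r - 0" by (intro tendsto_intros)
  then have vr: "v \<longlonglongrightarrow> r" by simp
  have "continuous_on UNIV (\<lambda>t. f (\<Phi> t x))"
    by (rule continuous_on_compose2[OF cont continuous_\<Phi>_time]) auto
  then have "isCont (\<lambda>t. f (\<Phi> t x)) r" by (simp add: continuous_on_eq_continuous_at)
  then have "(\<lambda>N. f (\<Phi> (v N) x)) \<longlonglongrightarrow> f (\<Phi> r x)" using vr by (rule isCont_tendsto_compose)
  then show ?thesis by (rule LIMSEQ_le_const2) (use f v(1) in blast)
qed

text \<open>Words of time at most s 0 have bounded slope, so transport of displacements by any time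
  r \<le> s 0 costs a bounded factor in the limit. A fixed number J of such times leads from x to
  any other point of the circle.\<close>

lemma m_comparable: "\<exists>Q\<ge>1. \<forall>\<beta> x y. 0 < \<beta> \<longrightarrow> m \<beta> y \<le> Q * m \<beta> x"
proof -
  obtain K where K: "K > 0" "\<And>n N v x. v \<in> words n N \<Longrightarrow> \<bar>A v x\<bar> \<le> K * s n powr c" using words_A by blast
  define Q0 where "Q0 = exp (K * s 0 powr c)"
  have Q0: "1 \<le> Q0" using K(1) by (simp add: Q0_def)
  have one: "m \<beta> (\<Phi> r x) \<le> Q0 * m \<beta> x" if "0 < \<beta>" "0 \<le> r" "r \<le> s 0" for \<beta> r x
  proof (rule words_limit[OF that(2,3) continuous_m])
    fix N v assume v: "v \<in> words 0 N"
    show "m \<beta> (\<Phi> v x) \<le> Q0 * m \<beta> x" unfolding Q0_def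
      by (rule m_\<Phi>_bounds(2)[OF words_good[OF v] that(1), of x "- (K * s 0 powr c)"])
        (use K(2)[OF v] in \<open>auto simp: abs_le_iff minus_le_iff\<close>)
  qed
  obtain J :: nat where J: "1 / s 0 \<le> real J" using real_arch_simple by blast
  have J0: "0 < real J" using J s_pos[of 0] by (smt (verit) divide_pos_pos)
  have many: "m \<beta> (\<Phi> (real j * r) x) \<le> Q0 ^ j * m \<beta> x" if "0 < \<beta>" "0 \<le> r" "r \<le> s 0" for \<beta> r x j
  proof (induction j)
    case (Suc j)
    have "m \<beta> (\<Phi> (real (Suc j) * r) x) = m \<beta> (\<Phi> r (\<Phi> (real j * r) x))" by (simp add: algebra_simps flip: \<Phi>_add)
    also have "\<dots> \<le> Q0 * m \<beta> (\<Phi> (real j * r) x)" by (rule one[OF that])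
    also have "\<dots> \<le> Q0 * (Q0 ^ j * m \<beta> x)" using Suc Q0 by (intro mult_left_mono) auto
    finally show ?case by simp
  qed simp
  have "m \<beta> y \<le> Q0 ^ J * m \<beta> x" if "0 < \<beta>" for \<beta> x y
  proof -
    define r where "r = frac (h y - h x)"
    have r: "0 \<le> r / real J" "r / real J \<le> s 0"
    proof -
      show "0 \<le> r / real J" using J0 by (simp add: r_def frac_ge_0)
      have "r \<le> 1" unfolding r_def using frac_lt_1 less_imp_le by blast
      then have "r / real J \<le> 1 / real J" using J0 by (intro divide_right_mono) auto
      also have "\<dots> \<le> s 0" using J J0 s_pos[of 0] by (simp add: field_simps)
      finally show "r / real J \<le> s 0" .
    qed
    have "y = \<Phi> r x + of_int \<lfloor>h y - h x\<rfloor>"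
      using \<Phi>_int[of r "\<lfloor>h y - h x\<rfloor>" x] by (simp add: r_def frac_def \<Phi>_def)
    then have "m \<beta> y = m \<beta> (\<Phi> r x)" using periodic_int[of "m \<beta>" 0 "\<Phi> r x" "\<lfloor>h y - h x\<rfloor>"] m_1 by simp
    also have "\<dots> = m \<beta> (\<Phi> (real J * (r / real J)) x)" using J0 by simp
    also have "\<dots> \<le> Q0 ^ J * m \<beta> x" by (rule many[OF that r])
    finally show ?thesis .
  qed
  then show ?thesis using Q0 by (intro exI[of _ "Q0 ^ J"]) (simp add: one_le_power)
qed

text \<open>About 1/\<beta> displacements of time \<beta> add up to one full turn and are all
  comparable, so each is of order \<beta>.\<close>

lemma m_linear: "\<exists>Q\<ge>1. \<forall>\<beta> x. 0 < \<beta> \<longrightarrow> \<beta> \<le> 1 \<longrightarrow> \<beta> \<le> Q * m \<beta> x \<and> m \<beta> x \<le> Q * \<beta>"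
proof -
  obtain Q where Q: "Q \<ge> 1" "\<And>\<beta> x y. 0 < \<beta> \<Longrightarrow> m \<beta> y \<le> Q * m \<beta> x" using m_comparable by blast
  have "\<beta> \<le> 2 * Q * m \<beta> x \<and> m \<beta> x \<le> 2 * Q * \<beta>" if \<beta>: "0 < \<beta>" "\<beta> \<le> 1" for \<beta> x
  proof -
    obtain n where n: "real n * \<beta> \<le> 1" "1 < real (Suc n) * \<beta>" using floor_steps[OF \<beta>(1), of 1] by auto
    have n1: "1 \<le> real n" using n(2) \<beta>
      by (metis One_nat_def Suc_le_eq less_irrefl mult_1 not_less of_nat_1 of_nat_le_iff order_less_le_trans Suc_leI gr0I)
    have m1: "m 1 x = 1" using \<Phi>_of_int[of 1] by (simp add: m_def)
    have mp: "0 < m \<beta> x" using \<beta> by (simp add: m_pos)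
    have "real n * (m \<beta> x / Q) = (\<Sum>i<n. m \<beta> x / Q)" by simp
    also have "\<dots> \<le> (\<Sum>i<n. m \<beta> (\<Phi> (real i * \<beta>) x))"
      using Q(2)[OF \<beta>(1)] Q(1) by (intro sum_mono) (simp add: field_simps)
    also have "\<dots> = m (real n * \<beta>) x" by (rule m_sum[symmetric])
    also have "\<dots> \<le> 1" using m_mono[OF n(1), of x] m1 by simp
    finally have "real n * m \<beta> x \<le> Q" using Q(1) by (simp add: field_simps)
    moreover have "1 \<le> 2 * real n * \<beta>"
    proof -
      have "1 * \<beta> \<le> real n * \<beta>" using n1 \<beta> by (intro mult_right_mono) auto
      moreover have "real (Suc n) * \<beta> = real n * \<beta> + \<beta>" by (simp add: algebra_simps)
      ultimately show ?thesis using n(2) by linarith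
    qed
    then have "1 * m \<beta> x \<le> 2 * real n * \<beta> * m \<beta> x" using mp by (intro mult_right_mono) auto
    moreover have "2 * \<beta> * (real n * m \<beta> x) \<le> 2 * \<beta> * Q" using \<beta> calculation(1) by (intro mult_left_mono) auto
    ultimately have up: "m \<beta> x \<le> 2 * Q * \<beta>" by (simp add: mult_ac)
    have "1 \<le> m (real (Suc n) * \<beta>) x" using m_mono[of 1 "real (Suc n) * \<beta>" x] n m1 by simp
    also have "\<dots> = (\<Sum>i<Suc n. m \<beta> (\<Phi> (real i * \<beta>) x))" by (rule m_sum)
    also have "\<dots> \<le> (\<Sum>i<Suc n. Q * m \<beta> x)" by (intro sum_mono Q(2)[OF \<beta>(1)])
    also have "\<dots> = real (Suc n) * (Q * m \<beta> x)" by simp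
    finally have "\<beta> * 1 \<le> \<beta> * (real (Suc n) * (Q * m \<beta> x))" using \<beta> by (intro mult_left_mono) auto
    also have "\<dots> = (real (Suc n) * \<beta>) * (Q * m \<beta> x)" by (simp only: mult_ac)
    also have "\<dots> \<le> 2 * (Q * m \<beta> x)"
      using n(1) \<beta> Q(1) mp by (intro mult_right_mono) (auto simp: algebra_simps)
    finally show ?thesis using up by simp
  qed
  then show ?thesis using Q(1) by (intro exI[of _ "2 * Q"]) auto
qed

text \<open>Induction with two regimes. If \<alpha>' \<ge> \<alpha>^2, the error C2 M = O(\<alpha>)
  of the recursion is O(\<alpha>'^(1/2)). If \<alpha>' < \<alpha>^2, near constancy of the
  displacement gives the slope O(\<eta> \<alpha>'/\<alpha>), where \<alpha>'/\<alpha> \<le>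
  \<alpha>'^(1/2) and \<eta> is small.\<close>

lemma slope_sqrt: "\<exists>Q>0. \<forall>k. a (s k) \<le> Q * sqrt (s k)"
proof -
  obtain L where L: "L \<ge> 1" "\<And>\<beta> x. 0 < \<beta> \<Longrightarrow> \<beta> \<le> 1 \<Longrightarrow> \<beta> \<le> L * m \<beta> x" "\<And>\<beta> x. 0 < \<beta> \<Longrightarrow> \<beta> \<le> 1 \<Longrightarrow> m \<beta> x \<le> L * \<beta>"
    using m_linear by blast
  have Ms: "M (s k) \<le> L * s k" for k using M_attained[of "s k"] L(3)[OF s_pos s_le1] by metis
  define H where "H = exp V1 * G * L\<^sup>2"
  have H0: "0 < H" using G1 L(1) by (simp add: H_def)
  have eta0: "0 \<le> eta (s k)" for k using eta_ge(1)[of "s k"] a_nonneg[of "s k"] s_pos[of k] by linarith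
  have aH: "a (s (Suc k)) \<le> H * eta (s k) * (s (Suc k) / s k)" for k
  proof (rule a_le)
    fix x
    have mp: "0 < m (s k) x" using s_pos by (rule m_pos)
    have "\<bar>A (s (Suc k)) x\<bar> \<le> exp V1 * G * eta (s k) * (m (s (Suc k)) x / m (s k) x)"
      using s_pos[of k] by (intro slope_at) auto
    also have "\<dots> \<le> exp V1 * G * eta (s k) * ((L * s (Suc k)) / (s k / L))"
    proof (intro mult_left_mono frac_le)
      show "s k / L \<le> m (s k) x" using L(2)[OF s_pos s_le1, of k x] L(1) by (simp add: field_simps)
    qed (use L s_pos s_le1 G1 eta0[of k] in \<open>auto simp: less_imp_le\<close>)
    finally show "\<bar>A (s (Suc k)) x\<bar> \<le> H * eta (s k) * (s (Suc k) / s k)"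
      using G1 eta0[of k] by (simp add: H_def power2_eq_square mult_ac)
  qed
  have "(\<lambda>k. 2 * H * C1 * sqrt (s k)) \<longlonglongrightarrow> 2 * H * C1 * sqrt 0"
    by (intro tendsto_intros s_tendsto_0)
  then have "\<forall>\<^sub>F k in sequentially. 2 * H * C1 * sqrt (s k) < 1" by (auto dest: order_tendstoD(2)[of _ _ _ 1])
  then obtain K where K: "\<And>k. k \<ge> K \<Longrightarrow> 2 * H * C1 * sqrt (s k) < 1" unfolding eventually_sequentially by blast
  \<comment> \<open>The summands serve, in this order, the error C2 M of the recursion, the term
    sqrt M inside \<eta>, and the scales up to K.\<close>
  define Q where "Q = 2 * C2 * L + sqrt L + V1 / sqrt (s K) + 1"
  have sK: "0 < sqrt (s K)" using s_pos by simp
  have Q: "2 * (C2 * L) \<le> Q" "sqrt L \<le> Q" "V1 / sqrt (s K) \<le> Q" "0 < Q"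
  proof -
    have "0 \<le> C2 * L" "0 \<le> sqrt L" "0 \<le> V1 / sqrt (s K)" using C2 L(1) V1 sK by simp_all
    then show "2 * (C2 * L) \<le> Q" "sqrt L \<le> Q" "V1 / sqrt (s K) \<le> Q" "0 < Q" unfolding Q_def mult.assoc
      by (smt (verit))+
  qed
  have early: "a (s k) \<le> Q * sqrt (s k)" if "k \<le> K" for k
  proof -
    have "a (s k) \<le> V1" using a_le s_V1 by blast
    also have "\<dots> = V1 / sqrt (s K) * sqrt (s K)" using sK by simp
    also have "\<dots> \<le> Q * sqrt (s k)" using Q s_antimono[OF that] V1 less_imp_le[OF s_pos] by (intro mult_mono) auto
    finally show ?thesis .
  qed
  have late: "a (s (K + n)) \<le> Q * sqrt (s (K + n))" for n
  proof (induction n)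
    case 0
    then show ?case using early[of K] by simp
  next
    case (Suc n)
    define \<alpha> where "\<alpha> = s (K + n)"
    define \<alpha>' where "\<alpha>' = s (Suc (K + n))"
    have \<alpha>: "0 < \<alpha>" "\<alpha> \<le> 1" "0 < \<alpha>'" "\<alpha>' \<le> \<alpha> / 8" using s_pos s_le1 s_Suc by (auto simp: \<alpha>_def \<alpha>'_def)
    have IH: "a \<alpha> \<le> Q * sqrt \<alpha>" using Suc by (simp add: \<alpha>_def)
    have sq: "0 < sqrt \<alpha>" "0 < sqrt \<alpha>'" "sqrt \<alpha> * sqrt \<alpha> = \<alpha>" "sqrt \<alpha>' * sqrt \<alpha>' = \<alpha>'" using \<alpha> by simp_all
    show ?case
    proof (cases "\<alpha>\<^sup>2 \<le> \<alpha>'")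
      case True
      obtain b l where st: "step \<alpha> \<alpha>' b l" using s_step[of "K + n"] by (auto simp: \<alpha>_def \<alpha>'_def)
      obtain t where t: "real t * \<alpha>' \<le> \<alpha>" "\<alpha> < real (Suc t) * \<alpha>'" using floor_steps[OF \<alpha>(3), of \<alpha>] \<alpha> by auto
      have r: "a \<alpha>' \<le> a \<alpha> / real t + C2 * M \<alpha>" "8 \<le> t"
        using slope_recursion'[OF _ st t] s_lev[of "K + n"] by (auto simp: \<alpha>_def)
      have \<alpha>q: "\<alpha> \<le> sqrt \<alpha>'" using True \<alpha> by (simp add: real_le_rsqrt)
      have "sqrt \<alpha> \<le> real t / 2 * sqrt \<alpha>'"
      proof -
        have "real (Suc t) \<le> (real t / 2)\<^sup>2"
        proof -
          have "8 * real t \<le> real t * real t" using r(2) by (intro mult_right_mono) auto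
          moreover have "8 \<le> real t" using r(2) by simp
          ultimately have "4 + real t * 4 \<le> real t * real t" by linarith
          then show ?thesis by (simp add: power2_eq_square)
        qed
        then have "real (Suc t) * \<alpha>' \<le> (real t / 2)\<^sup>2 * \<alpha>'" using \<alpha> by (intro mult_right_mono) auto
        then have "\<alpha> \<le> (real t / 2)\<^sup>2 * \<alpha>'" using t(2) by linarith
        then have "sqrt \<alpha> \<le> sqrt ((real t / 2)\<^sup>2 * \<alpha>')" by (rule real_sqrt_le_mono)
        then show ?thesis by (simp add: real_sqrt_mult real_sqrt_divide)
      qed
      then have "Q * sqrt \<alpha> / real t \<le> Q / 2 * sqrt \<alpha>'" using r(2) Q(4) mult_left_mono[of "sqrt \<alpha>" "real t / 2 * sqrt \<alpha>'" Q]
        by (simp add: field_simps)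
      moreover have "a \<alpha> / real t \<le> Q * sqrt \<alpha> / real t" using IH by (intro divide_right_mono) auto
      moreover have "C2 * M \<alpha> \<le> Q / 2 * sqrt \<alpha>'"
      proof -
        have "C2 * M \<alpha> \<le> C2 * (L * \<alpha>)" using Ms[of "K + n"] C2 by (intro mult_left_mono) (auto simp: \<alpha>_def)
        also have "\<dots> = C2 * L * \<alpha>" by simp
        also have "\<dots> \<le> Q / 2 * sqrt \<alpha>'" using Q(1,4) \<alpha>q \<alpha> by (intro mult_mono) auto
        finally show ?thesis .
      qed
      ultimately have "a \<alpha>' \<le> Q / 2 * sqrt \<alpha>' + Q / 2 * sqrt \<alpha>'" using r(1) by linarith
      then have "a \<alpha>' \<le> Q * sqrt \<alpha>'" by simp
      then show ?thesis by (simp add: \<alpha>'_def)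
    next
      case False
      have "sqrt (M \<alpha>) \<le> sqrt (L * \<alpha>)" using Ms[of "K + n"] by (simp add: \<alpha>_def)
      also have "\<dots> = sqrt L * sqrt \<alpha>" by (rule real_sqrt_mult)
      also have "\<dots> \<le> Q * sqrt \<alpha>" using Q sq by (intro mult_right_mono) auto
      finally have "a \<alpha> + sqrt (M \<alpha>) \<le> 2 * Q * sqrt \<alpha>" using IH by simp
      then have e: "eta \<alpha> \<le> C1 * (2 * Q * sqrt \<alpha>)" unfolding eta_def using C1_ge1 by (intro mult_left_mono) auto
      have "a \<alpha>' \<le> H * eta \<alpha> * (\<alpha>' / \<alpha>)" using aH[of "K + n"] by (simp add: \<alpha>_def \<alpha>'_def)
      also have "\<dots> \<le> H * (C1 * (2 * Q * sqrt \<alpha>)) * (\<alpha>' / \<alpha>)"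
        using e H0 \<alpha> by (intro mult_right_mono mult_left_mono) auto
      also have "\<dots> = (2 * H * C1 * sqrt \<alpha>) * Q * (\<alpha>' / \<alpha>)" by simp
      also have "\<dots> \<le> 1 * Q * (\<alpha>' / \<alpha>)"
        using K[of "K + n"] Q(4) \<alpha> by (intro mult_right_mono) (auto simp: \<alpha>_def)
      also have "\<dots> \<le> Q * sqrt \<alpha>'"
      proof -
        have "\<alpha>' \<le> \<alpha> * sqrt \<alpha>'"
        proof -
          have "sqrt \<alpha>' \<le> sqrt (\<alpha>\<^sup>2)" using False by (intro real_sqrt_le_mono) auto
          then have "sqrt \<alpha>' \<le> \<alpha>" using \<alpha> by simp
          then have "sqrt \<alpha>' * sqrt \<alpha>' \<le> \<alpha> * sqrt \<alpha>'" using sq by (intro mult_right_mono) auto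
          then show ?thesis using sq by simp
        qed
        then have "\<alpha>' / \<alpha> \<le> sqrt \<alpha>'" using \<alpha> by (simp add: field_simps)
        then show ?thesis using Q(4) mult_left_mono[of "\<alpha>' / \<alpha>" "sqrt \<alpha>'" Q] by simp
      qed
      finally show ?thesis by (simp add: \<alpha>'_def)
    qed
  qed
  have "a (s k) \<le> Q * sqrt (s k)" for k
  proof (cases "k \<le> K")
    case False
    then show ?thesis using late[of "k - K"] by simp
  qed (rule early)
  then show ?thesis using Q(4) by blast
qed

text \<open>As m is comparable to the scale, one derivative of a word now costs \<eta>/m =
  O(s_k^(-1/2)).\<close>

lemma eta_sqrt: "\<exists>K>0. \<forall>k. eta (s k) \<le> K * sqrt (s k)"
proof -
  obtain Q where Q: "Q > 0" "\<And>k. a (s k) \<le> Q * sqrt (s k)" using slope_sqrt by blast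
  obtain L where L: "L \<ge> 1" "\<And>\<beta> x. 0 < \<beta> \<Longrightarrow> \<beta> \<le> 1 \<Longrightarrow> m \<beta> x \<le> L * \<beta>" using m_linear by blast
  have "eta (s k) \<le> C1 * (Q + sqrt L) * sqrt (s k)" for k
  proof -
    have "M (s k) \<le> L * s k" using M_attained[of "s k"] L(2)[OF s_pos s_le1] by metis
    then have "sqrt (M (s k)) \<le> sqrt L * sqrt (s k)" by (metis real_sqrt_le_mono real_sqrt_mult)
    then have "a (s k) + sqrt (M (s k)) \<le> (Q + sqrt L) * sqrt (s k)" using Q(2)[of k] by (simp add: distrib_right)
    then show ?thesis unfolding eta_def using C1_ge1 by (simp add: mult.assoc mult_left_mono)
  qed
  moreover have "0 < C1 * (Q + sqrt L)" using C1_ge1 Q L by (simp add: add_pos_nonneg)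
  ultimately show ?thesis by blast
qed

end

section \<open>Higher regularity\<close>

lemma compose_bound:
  "\<exists>E\<ge>1. \<forall>V F W x. smooth_real V \<longrightarrow> smooth_real F \<longrightarrow> (n > 0 \<longrightarrow> jb (n - 1) L 1 (deriv F) x) \<longrightarrow>
     (\<forall>i\<le>n. \<bar>(deriv ^^ i) V (F x)\<bar> \<le> W) \<longrightarrow> (\<forall>i\<le>n. \<bar>(deriv ^^ i) (\<lambda>x. V (F x)) x\<bar> \<le> E * W)"
proof -
  obtain E where E: "E \<ge> 0" "\<And>V F K x W. smooth_real V \<Longrightarrow> smooth_real F \<Longrightarrow> 0 \<le> K \<Longrightarrow> (n > 0 \<longrightarrow> jb (n - 1) (L * K) K (deriv F) x) \<Longrightarrow>
     (\<forall>i\<le>n. \<bar>(deriv ^^ i) V (F x)\<bar> \<le> W) \<Longrightarrow> jb n (E * W) K (\<lambda>x. V (F x)) x"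
    using jb_compose[of n L] by blast
  show ?thesis
  proof (intro exI[of _ "max 1 E"] conjI allI impI)
    fix V F W x i
    assume V: "smooth_real V" "smooth_real F" "n > 0 \<longrightarrow> jb (n - 1) L 1 (deriv F) x" and W: "\<forall>i\<le>n. \<bar>(deriv ^^ i) V (F x)\<bar> \<le> W" and i: "i \<le> n"
    have "jb n (E * W) 1 (\<lambda>x. V (F x)) x" using E(2)[OF V(1,2), of 1 x W] V(3) W by simp
    from jbD[OF this i] have "\<bar>(deriv ^^ i) (\<lambda>x. V (F x)) x\<bar> \<le> E * W" by simp
    also have "\<dots> \<le> max 1 E * W" using W[rule_format, of 0] by (intro mult_right_mono) auto
    finally show "\<bar>(deriv ^^ i) (\<lambda>x. V (F x)) x\<bar> \<le> max 1 E * W" .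
  qed simp
qed

text \<open>In contrast to \<open>jb_exp\<close> the bound is linear in the small size
  \<open>e\<close>, so smallness of A passes to \<Phi>' - 1.\<close>

lemma exp_jets1:
  "\<exists>E\<ge>1. \<forall>F x e. smooth_real F \<longrightarrow> e \<le> 1 \<longrightarrow> (\<forall>i\<le>n. \<bar>(deriv ^^ i) F x\<bar> \<le> e) \<longrightarrow> jb n (E * e) 1 (\<lambda>x. exp (F x) - 1) x"
proof (cases n)
  case 0
  have "jb 0 (exp 1 * e) 1 (\<lambda>x. exp (F x) - 1) x" if "e \<le> 1" "\<bar>F x\<bar> \<le> e" for F x and e :: real
  proof -
    have "\<bar>exp (F x) - 1\<bar> \<le> exp 1 * \<bar>F x\<bar>" using that by (intro abs_exp_minus_1 order_trans[OF that(2,1)])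
    also have "\<dots> \<le> exp 1 * e" using that by simp
    finally show ?thesis by (simp add: jb_0)
  qed
  then show ?thesis unfolding 0 by (intro exI[of _ "exp 1"]) auto
next
  case (Suc k)
  obtain E where E: "E \<ge> 1" and E': "\<forall>F K x Z. smooth_real F \<longrightarrow> 0 \<le> K \<longrightarrow> (k > 0 \<longrightarrow> jb (k - 1) (1 * K) K (deriv F) x) \<longrightarrow> exp (F x) \<le> Z
     \<longrightarrow> jb k (E * Z) K (\<lambda>x. exp (F x)) x" using jb_exp[where n=k and C=1] by (elim exE conjE)
  have E2: "jb k (E * Z) 1 (\<lambda>x. exp (F x)) x"
    if "smooth_real F" "k > 0 \<longrightarrow> jb (k - 1) 1 1 (deriv F) x" "exp (F x) \<le> Z" for F x Z
    using E'[rule_format, of F 1 x Z] that by simp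
  show ?thesis
  proof (intro exI[of _ "exp 1 + 2 ^ k * (E * exp 1)"] conjI allI impI)
    show "1 \<le> exp 1 + 2 ^ k * (E * exp 1)"
    proof -
      have "0 \<le> 2 ^ k * (E * exp 1)" using E by simp
      then show ?thesis using one_le_exp_iff[of 1] by linarith
    qed
    fix F x and e :: real
    assume F: "smooth_real F" and e: "e \<le> 1" and b: "\<forall>i\<le>n. \<bar>(deriv ^^ i) F x\<bar> \<le> e"
    have e0: "0 \<le> e" using b[rule_format, of 0] by simp
    have F0: "\<bar>F x\<bar> \<le> e" using b[rule_format, of 0] by simp
    have jd: "jb k e 1 (deriv F) x" unfolding jb_def
    proof (intro allI impI)
      fix i assume "i \<le> k"
      then show "\<bar>(deriv ^^ i) (deriv F) x\<bar> \<le> e * 1 ^ i" using b[rule_format, of "Suc i"] Suc by (simp add: funpow_swap1)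
    qed
    have je: "jb k (E * exp 1) 1 (\<lambda>x. exp (F x)) x"
      using jb_mono[OF jd e, of "k - 1"] F0 e by (intro E2 F) auto
    have "jb k (2 ^ k * e * (E * exp 1)) 1 (\<lambda>x. deriv F x * exp (F x)) x"
      by (intro jb_mult jd je smooth_deriv smooth_exp F) auto
    then have 1: "jb k (2 ^ k * e * (E * exp 1)) 1 (deriv (\<lambda>x. exp (F x) - 1)) x"
      using F by (simp add: deriv_diff_smooth smooth_exp deriv_exp_smooth)
    have c: "2 ^ k * e * (E * exp 1) \<le> (exp 1 + 2 ^ k * (E * exp 1)) * e * 1" "exp 1 * e \<le> (exp 1 + 2 ^ k * (E * exp 1)) * e"
      using e0 E by (simp_all add: algebra_simps)
    have "\<bar>exp (F x) - 1\<bar> \<le> exp 1 * \<bar>F x\<bar>" using F0 e by (intro abs_exp_minus_1) simp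
    also have "\<dots> \<le> exp 1 * e" using F0 by simp
    finally have "\<bar>exp (F x) - 1\<bar> \<le> (exp 1 + 2 ^ k * (E * exp 1)) * e" using c(2) by linarith
    then show "jb n ((exp 1 + 2 ^ k * (E * exp 1)) * e) 1 (\<lambda>x. exp (F x) - 1) x"
      unfolding Suc jb_Suc using jb_const_mult_le[OF 1 c(1)] by simp
  qed
qed

lemma deriv_minus_1:
  assumes "smooth_real F"
  shows "deriv (\<lambda>x. F x - x) = (\<lambda>x. deriv F x - 1)"
  by (intro ext DERIV_imp_deriv DERIV_diff smooth_has_derivative[OF assms] DERIV_ident)

text \<open>When F' - 1 is small, the only term in the n-th derivative of V o F that is not small is
  the n-th derivative of V evaluated at F.\<close>

lemma compose_diff_top:
  "\<exists>C\<ge>0. \<forall>V F e W x. smooth_real V \<longrightarrow> smooth_real F \<longrightarrow> e \<le> 1 \<longrightarrow> jb n e 1 (\<lambda>x. deriv F x - 1) x \<longrightarrow>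
     (\<forall>i\<le>n. \<bar>(deriv ^^ i) V (F x)\<bar> \<le> W) \<longrightarrow> \<bar>(deriv ^^ n) (\<lambda>x. V (F x)) x - (deriv ^^ n) V (F x)\<bar> \<le> C * e * W"
proof (induction n)
  case 0
  show ?case by (intro exI[of _ 0]) auto
next
  case (Suc n)
  then obtain C where C0: "C \<ge> 0" and C: "\<And>V F e W x. smooth_real V \<Longrightarrow> smooth_real F \<Longrightarrow> e \<le> 1 \<Longrightarrow> jb n e 1 (\<lambda>x. deriv F x - 1) x \<Longrightarrow>
     (\<forall>i\<le>n. \<bar>(deriv ^^ i) V (F x)\<bar> \<le> W) \<Longrightarrow> \<bar>(deriv ^^ n) (\<lambda>x. V (F x)) x - (deriv ^^ n) V (F x)\<bar> \<le> C * e * W" by blast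
  obtain E where E: "E \<ge> 0" "\<And>V F K x W. smooth_real V \<Longrightarrow> smooth_real F \<Longrightarrow> 0 \<le> K \<Longrightarrow> (n > 0 \<longrightarrow> jb (n - 1) (2 * K) K (deriv F) x) \<Longrightarrow>
     (\<forall>i\<le>n. \<bar>(deriv ^^ i) V (F x)\<bar> \<le> W) \<Longrightarrow> jb n (E * W) K (\<lambda>x. V (F x)) x" using jb_compose[of n 2] by blast
  show ?case
  proof (intro exI[of _ "2 ^ n * E + C"] conjI allI impI)
    show "0 \<le> 2 ^ n * E + C" using C0 E(1) by simp
    fix V F e W x
    assume V: "smooth_real V" "smooth_real F" and e: "e \<le> 1" and j: "jb (Suc n) e 1 (\<lambda>x. deriv F x - 1) x"
      and W: "\<forall>i\<le>Suc n. \<bar>(deriv ^^ i) V (F x)\<bar> \<le> W"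
    have e0: "0 \<le> e" using jb_nonneg[OF j] .
    have jn: "jb n e 1 (\<lambda>x. deriv F x - 1) x" using jb_mono[OF j] by simp
    have sF: "smooth_real (\<lambda>x. deriv F x - 1)" using V by (intro smooth_diff smooth_deriv smooth_const)
    have W': "\<forall>i\<le>n. \<bar>(deriv ^^ i) (deriv V) (F x)\<bar> \<le> W"
    proof (intro allI impI)
      fix i assume "i \<le> n"
      then show "\<bar>(deriv ^^ i) (deriv V) (F x)\<bar> \<le> W" using W[rule_format, of "Suc i"] by (simp add: funpow_swap1)
    qed
    have jdF: "jb n 2 1 (deriv F) x"
    proof -
      have "jb n (1 + 1) 1 (\<lambda>x. 1 + (deriv F x - 1)) x"
        by (intro jb_add smooth_const sF jb_mono[OF jn e]) (auto simp: jb_def funpow_deriv_const)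
      then show ?thesis by simp
    qed
    have sV: "smooth_real (\<lambda>x. deriv V (F x))" by (rule smooth_compose[OF smooth_deriv[OF V(1)] V(2)])
    have jV: "jb n (E * W) 1 (\<lambda>x. deriv V (F x)) x"
      using jb_mono[OF jdF order_refl, of "n - 1"] E(2)[OF smooth_deriv[OF V(1)] V(2), of 1 x W] W' by simp
    have p: "jb n (2 ^ n * (E * W) * e) 1 (\<lambda>x. deriv V (F x) * (deriv F x - 1)) x"
      by (intro jb_mult sV sF jV jn) auto
    have "deriv (\<lambda>x. V (F x)) = (\<lambda>x. deriv V (F x) * (deriv F x - 1) + deriv V (F x))"
      using V by (auto simp: deriv_compose_smooth algebra_simps)
    then have "(deriv ^^ Suc n) (\<lambda>x. V (F x)) = (\<lambda>x. (deriv ^^ n) (\<lambda>x. deriv V (F x) * (deriv F x - 1)) x + (deriv ^^ n) (\<lambda>x. deriv V (F x)) x)"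
      using funpow_deriv_add[OF smooth_mult[OF sV sF] sV, of n] by (simp add: funpow_swap1)
    moreover have "(deriv ^^ Suc n) V = (deriv ^^ n) (deriv V)" by (simp add: funpow_swap1)
    moreover have "\<bar>(deriv ^^ n) (\<lambda>x. deriv V (F x) * (deriv F x - 1)) x\<bar> \<le> 2 ^ n * (E * W) * e"
      using jbD[OF p order_refl] by simp
    moreover have "\<bar>(deriv ^^ n) (\<lambda>x. deriv V (F x)) x - (deriv ^^ n) (deriv V) (F x)\<bar> \<le> C * e * W"
      by (rule C[OF smooth_deriv[OF V(1)] V(2) e jn W'])
    note calculation = calculation this
    show "\<bar>(deriv ^^ Suc n) (\<lambda>x. V (F x)) x - (deriv ^^ Suc n) V (F x)\<bar> \<le> (2 ^ n * E + C) * e * W"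
    proof -
      have "(2 ^ n * E + C) * e * W = 2 ^ n * (E * W) * e + C * e * W" by (simp add: algebra_simps)
      then show ?thesis using calculation by (simp only:)
    qed
  qed
qed

text \<open>The bound is bilinear: the size of the derivatives of V times the distance of F from the
  identity. One derivative of V is lost.\<close>

lemma compose_diff_self:
  "\<exists>C\<ge>0. \<forall>V F e W x. smooth_real V \<longrightarrow> smooth_real F \<longrightarrow> (\<forall>x. jb n L 1 (deriv F) x) \<longrightarrow>
     (\<forall>i\<le>n. \<forall>y. \<bar>(deriv ^^ Suc i) V y\<bar> \<le> e) \<longrightarrow> (\<forall>i\<le>n. \<forall>y. \<bar>(deriv ^^ i) (\<lambda>x. F x - x) y\<bar> \<le> W) \<longrightarrow>
     \<bar>(deriv ^^ n) (\<lambda>x. V (F x) - V x) x\<bar> \<le> C * e * W"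
proof (induction n)
  case 0
  show ?case
  proof (intro exI[of _ 1] conjI allI impI)
    fix V F :: "real \<Rightarrow> real" and e W x :: real
    assume V: "smooth_real V" and e: "\<forall>i\<le>0. \<forall>y. \<bar>(deriv ^^ Suc i) V y\<bar> \<le> e" and W: "\<forall>i\<le>0. \<forall>y. \<bar>(deriv ^^ i) (\<lambda>x. F x - x) y\<bar> \<le> W"
    have e': "\<bar>deriv V y\<bar> \<le> e" for y using e by simp
    have W': "\<bar>F x - x\<bar> \<le> W" using W by simp
    have e0: "0 \<le> e" using e'[of 0] by linarith
    have "\<bar>V (F x) - V x\<bar> \<le> e * \<bar>F x - x\<bar>"
    proof (cases "x \<le> F x")
      case True then show ?thesis using smooth_diff_le[OF V True, of e] e' by simp
    next
      case False then show ?thesis using smooth_diff_le[OF V, of "F x" x e] e' by (simp add: abs_minus_commute)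
    qed
    also have "\<dots> \<le> e * W" using W' e0 by (rule mult_left_mono)
    finally show "\<bar>(deriv ^^ 0) (\<lambda>x. V (F x) - V x) x\<bar> \<le> 1 * e * W" by simp
  qed simp
next
  case (Suc n)
  then obtain C where C0: "C \<ge> 0" and C: "\<And>V F e W x. smooth_real V \<Longrightarrow> smooth_real F \<Longrightarrow> (\<forall>x. jb n L 1 (deriv F) x) \<Longrightarrow>
     (\<forall>i\<le>n. \<forall>y. \<bar>(deriv ^^ Suc i) V y\<bar> \<le> e) \<Longrightarrow> (\<forall>i\<le>n. \<forall>y. \<bar>(deriv ^^ i) (\<lambda>x. F x - x) y\<bar> \<le> W) \<Longrightarrow>
     \<bar>(deriv ^^ n) (\<lambda>x. V (F x) - V x) x\<bar> \<le> C * e * W" by blast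
  obtain E where E: "E \<ge> 0" "\<And>V F K x W. smooth_real V \<Longrightarrow> smooth_real F \<Longrightarrow> 0 \<le> K \<Longrightarrow> (n > 0 \<longrightarrow> jb (n - 1) (L * K) K (deriv F) x) \<Longrightarrow>
     (\<forall>i\<le>n. \<bar>(deriv ^^ i) V (F x)\<bar> \<le> W) \<Longrightarrow> jb n (E * W) K (\<lambda>x. V (F x)) x" using jb_compose[of n L] by blast
  show ?case
  proof (intro exI[of _ "C + 2 ^ n * E"] conjI allI impI)
    show "0 \<le> C + 2 ^ n * E" using C0 E(1) by simp
    fix V F e W x
    assume V: "smooth_real V" "smooth_real F" and L: "\<forall>x. jb (Suc n) L 1 (deriv F) x"
      and e: "\<forall>i\<le>Suc n. \<forall>y. \<bar>(deriv ^^ Suc i) V y\<bar> \<le> e" and W: "\<forall>i\<le>Suc n. \<forall>y. \<bar>(deriv ^^ i) (\<lambda>x. F x - x) y\<bar> \<le> W"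
    have Ln: "\<forall>x. jb n L 1 (deriv F) x" using L jb_mono[of "Suc n" L 1] by simp
    have sF: "smooth_real (\<lambda>x. deriv F x - 1)" using V by (intro smooth_diff smooth_deriv smooth_const)
    have sV: "smooth_real (\<lambda>x. deriv V (F x))" by (rule smooth_compose[OF smooth_deriv[OF V(1)] V(2)])
    have e': "\<bar>(deriv ^^ Suc i) (deriv V) y\<bar> \<le> e" if "i \<le> n" for i y
    proof -
      have "(deriv ^^ Suc (Suc i)) V = (deriv ^^ Suc i) (deriv V)" by (simp add: funpow_swap1)
      then show ?thesis using e[rule_format, of "Suc i" y] that by simp
    qed
    have e1: "\<bar>(deriv ^^ i) (deriv V) y\<bar> \<le> e" if "i \<le> n" for i y
      using e[rule_format, of i y] that by (simp add: funpow_swap1)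
    have jV: "jb n (E * e) 1 (\<lambda>x. deriv V (F x)) x"
      using jb_mono[OF Ln[rule_format, of x] order_refl, of "n - 1"] E(2)[OF smooth_deriv[OF V(1)] V(2), of 1 x e] e1 by simp
    have jW: "jb n W 1 (\<lambda>x. deriv F x - 1) x" unfolding jb_def
    proof (intro allI impI)
      fix i assume "i \<le> n"
      then have "\<bar>(deriv ^^ Suc i) (\<lambda>x. F x - x) x\<bar> \<le> W" using W by (meson Suc_le_mono)
      moreover have "(deriv ^^ Suc i) (\<lambda>x. F x - x) = (deriv ^^ i) (\<lambda>x. deriv F x - 1)"
        using deriv_minus_1[OF V(2)] by (simp add: funpow_swap1)
      ultimately show "\<bar>(deriv ^^ i) (\<lambda>x. deriv F x - 1) x\<bar> \<le> W * 1 ^ i" by simp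
    qed
    have p: "jb n (2 ^ n * (E * e) * W) 1 (\<lambda>x. deriv V (F x) * (deriv F x - 1)) x"
      by (intro jb_mult sV sF jV jW) auto
    have VF: "smooth_real (\<lambda>x. V (F x))" by (rule smooth_compose[OF V])
    have "deriv (\<lambda>x. V (F x) - V x) = (\<lambda>x. (deriv V (F x) - deriv V x) + deriv V (F x) * (deriv F x - 1))"
      using V VF by (auto simp: deriv_diff_smooth deriv_compose_smooth algebra_simps)
    then have "(deriv ^^ Suc n) (\<lambda>x. V (F x) - V x) = (\<lambda>x. (deriv ^^ n) (\<lambda>x. deriv V (F x) - deriv V x) x + (deriv ^^ n) (\<lambda>x. deriv V (F x) * (deriv F x - 1)) x)"
      using funpow_deriv_add[OF smooth_diff[OF sV smooth_deriv[OF V(1)]] smooth_mult[OF sV sF], of n] by (simp add: funpow_swap1)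
    moreover have "\<bar>(deriv ^^ n) (\<lambda>x. deriv V (F x) * (deriv F x - 1)) x\<bar> \<le> 2 ^ n * (E * e) * W"
      using jbD[OF p order_refl] by simp
    moreover have "\<bar>(deriv ^^ n) (\<lambda>x. deriv V (F x) - deriv V x) x\<bar> \<le> C * e * W"
      using W e' by (intro C[OF smooth_deriv[OF V(1)] V(2) Ln]) auto
    note calculation = calculation this
    show "\<bar>(deriv ^^ Suc n) (\<lambda>x. V (F x) - V x) x\<bar> \<le> (C + 2 ^ n * E) * e * W"
    proof -
      have "(C + 2 ^ n * E) * e * W = 2 ^ n * (E * e) * W + C * e * W" by (simp add: algebra_simps)
      then show ?thesis using calculation by (simp only:)
    qed
  qed
qed

context flow
begin

lemma \<Phi>_jets:
  "\<exists>E\<ge>1. \<forall>w x. good w \<longrightarrow> (\<forall>i\<le>n. \<bar>(deriv ^^ i) (A w) x\<bar> \<le> L) \<longrightarrow> jb n E 1 (deriv (\<Phi> w)) x"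
proof -
  obtain E where E: "E \<ge> 1" "\<And>F K x Z. smooth_real F \<Longrightarrow> 0 \<le> K \<Longrightarrow> (n > 0 \<longrightarrow> jb (n - 1) (L * K) K (deriv F) x) \<Longrightarrow> exp (F x) \<le> Z
     \<Longrightarrow> jb n (E * Z) K (\<lambda>x. exp (F x)) x" using jb_exp[of n L] by blast
  show ?thesis
  proof (intro exI[of _ "max 1 (E * exp L)"] conjI allI impI)
    fix w x assume w: "good w" and b: "\<forall>i\<le>n. \<bar>(deriv ^^ i) (A w) x\<bar> \<le> L"
    have "jb n (E * exp L) 1 (\<lambda>x. exp (A w x)) x"
    proof (rule E(2)[OF smooth_A[OF w]])
      show "n > 0 \<longrightarrow> jb (n - 1) (L * 1) 1 (deriv (A w)) x"
        unfolding jb_def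
      proof (intro impI allI)
        fix i assume "n > 0" "i \<le> n - 1"
        then have "Suc i \<le> n" by simp
        then have "\<bar>(deriv ^^ Suc i) (A w) x\<bar> \<le> L" using b by blast
        then show "\<bar>(deriv ^^ i) (deriv (A w)) x\<bar> \<le> L * 1 * 1 ^ i" by (simp add: funpow_swap1)
      qed
      show "exp (A w x) \<le> exp L" using b[rule_format, of 0] by simp
    qed simp
    then have "jb n (E * exp L) 1 (deriv (\<Phi> w)) x" by (simp add: exp_A[OF w])
    then show "jb n (max 1 (E * exp L)) 1 (deriv (\<Phi> w)) x" by (rule jb_const_mult_le) auto
  qed simp
qed

lemma deriv_m_eq: "good w \<Longrightarrow> deriv (m w) = (\<lambda>x. deriv (\<Phi> w) x - 1)"
  by (simp add: deriv_m exp_A)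

end

section \<open>Regularity of order n along the scales\<close>

context flow_scales
begin

text \<open>The powers of \<open>\<Phi> (s (Suc k))\<close> up to time s k are the digits of
  \<open>words\<close>, hence the blocks from which the jets of all words are summed. The positive
  exponent \<beta> makes these sums converge.\<close>

definition reg :: "nat \<Rightarrow> real \<Rightarrow> real \<Rightarrow> nat \<Rightarrow> bool" where
  "reg n \<beta> B K \<longleftrightarrow> (\<forall>k b i x. K \<le> k \<longrightarrow> real b * s (Suc k) \<le> s k \<longrightarrow> i \<le> n \<longrightarrow>
     \<bar>(deriv ^^ i) (A (real b * s (Suc k))) x\<bar> \<le> B * s k powr \<beta>)"

lemma regD: "reg n \<beta> B K \<Longrightarrow> K \<le> k \<Longrightarrow> real b * s (Suc k) \<le> s k \<Longrightarrow> i \<le> n \<Longrightarrow>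
     \<bar>(deriv ^^ i) (A (real b * s (Suc k))) x\<bar> \<le> B * s k powr \<beta>"
  by (simp add: reg_def)

lemma reg_mono: "reg n \<beta> B K \<Longrightarrow> j \<le> n \<Longrightarrow> reg j \<beta> B K"
  unfolding reg_def by (meson order_trans)

lemma s_powr_le1: "0 < \<beta> \<Longrightarrow> s k powr \<beta> \<le> 1"
  using powr_mono2[of \<beta> "s k" 1] s_pos[of k] s_le1[of k] by simp

lemma s_powr_small:
  assumes "0 < \<beta>" "0 < e"
  shows "\<exists>K. \<forall>k\<ge>K. D * s k powr \<beta> \<le> e"
proof -
  have "(\<lambda>k. s k powr \<beta>) \<longlonglongrightarrow> 0"
    using assms tendsto_zero_powrI[OF s_tendsto_0 tendsto_const[of \<beta>]] s_pos by (auto simp: less_imp_le)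
  then have "(\<lambda>k. D * s k powr \<beta>) \<longlonglongrightarrow> 0" by (rule tendsto_mult_right_zero)
  from order_tendstoD(2)[OF this assms(2)] show ?thesis
    unfolding eventually_sequentially by (meson less_imp_le)
qed

lemma reg_0: "\<exists>\<beta>>0. \<beta> \<le> 1 \<and> (\<exists>B>0. reg 0 \<beta> B 0)"
proof -
  let ?\<beta> = "min c 1"
  have "\<bar>A (real b * s (Suc k)) x\<bar> \<le> (2 * exp V1 * G * C) * s k powr ?\<beta>" if "real b * s (Suc k) \<le> s k" for b k x
  proof -
    have "s k powr c \<le> s k powr ?\<beta>" using s_pos[of k] s_le1[of k] by (intro powr_mono') auto
    then have "C * s k powr c \<le> C * s k powr ?\<beta>" using C0 by (intro mult_left_mono) auto
    then have "eta (s k) \<le> C * s k powr ?\<beta>" using s_eta(1)[of k] by linarith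
    then have e: "2 * exp V1 * G * eta (s k) \<le> 2 * exp V1 * G * (C * s k powr ?\<beta>)" using G1 by (intro mult_left_mono) auto
    show ?thesis using order_trans[OF A_power[OF that, of x] e] by (simp only: mult.assoc)
  qed
  then have "reg 0 ?\<beta> (2 * exp V1 * G * C) 0" by (simp add: reg_def)
  moreover have "0 < 2 * exp V1 * G * C" using G1 C0 by simp
  ultimately show ?thesis using c0 by (intro exI[of _ ?\<beta>] conjI exI[of _ "2 * exp V1 * G * C"]) auto
qed

text \<open>Digits are added one at a time at ever finer scales. The running total stays below 1 if
  the starting scale is fine enough, and this keeps the constants of composition uniform along the
  whole word.\<close>

lemma words_jets:
  assumes reg: "reg n \<beta> B K" and \<beta>: "0 < \<beta>" and B: "0 < B"
  shows "\<exists>E>0. \<exists>K'\<ge>K. \<forall>j\<ge>K'. E * s j powr \<beta> \<le> 1 \<and>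
    (\<forall>N v i x. v \<in> words j N \<longrightarrow> i \<le> n \<longrightarrow> \<bar>(deriv ^^ i) (A v) x\<bar> \<le> E * s j powr \<beta>)"
proof -
  obtain L where L: "L \<ge> 1" "\<And>w x. good w \<Longrightarrow> (\<forall>i\<le>n. \<bar>(deriv ^^ i) (A w) x\<bar> \<le> 1) \<Longrightarrow> jb n L 1 (deriv (\<Phi> w)) x"
    using \<Phi>_jets[of n 1] by blast
  obtain D where D: "D \<ge> 1" "\<And>V F W x. smooth_real V \<Longrightarrow> smooth_real F \<Longrightarrow> (n > 0 \<longrightarrow> jb (n - 1) L 1 (deriv F) x) \<Longrightarrow>
     (\<forall>i\<le>n. \<bar>(deriv ^^ i) V (F x)\<bar> \<le> W) \<Longrightarrow> (\<forall>i\<le>n. \<bar>(deriv ^^ i) (\<lambda>x. V (F x)) x\<bar> \<le> D * W)"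
    using compose_bound[of n L] by blast
  obtain T where T: "T > 0" "\<And>j N. (\<Sum>k<N. s (j + k) powr \<beta>) \<le> T * s j powr \<beta>" using powr_sum[OF \<beta>] by blast
  define E where "E = D * B * T"
  have E0: "0 < E" using D(1) B T by (simp add: E_def)
  obtain K1 where K1: "\<And>k. k \<ge> K1 \<Longrightarrow> E * s k powr \<beta> \<le> 1" using s_powr_small[OF \<beta>, of 1 E] by auto
  define K' where "K' = max K K1"
  have main: "\<forall>i\<le>n. \<bar>(deriv ^^ i) (A v) x\<bar> \<le> D * B * (\<Sum>k<N. s (j + k) powr \<beta>)" if j: "j \<ge> K'" and v: "v \<in> words j N" for j N v x
    using v
  proof (induction N arbitrary: v x)
    case 0
    have "A 0 = (\<lambda>x. 0)" by (auto simp: good_0)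
    then show ?case using 0 by (simp add: funpow_deriv_const)
  next
    case (Suc N)
    then obtain w b where w: "w \<in> words j N" "real b * s (Suc (j + N)) \<le> s (j + N)" "v = real b * s (Suc (j + N)) + w"
      by (auto simp: add.commute)
    let ?r = "real b * s (Suc (j + N))"
    have g: "good w" "good ?r" using words_good[OF w(1)] good_mult[OF s_good] by auto
    have IH: "\<forall>i\<le>n. \<bar>(deriv ^^ i) (A w) x\<bar> \<le> D * B * (\<Sum>k<N. s (j + k) powr \<beta>)" by (rule Suc.IH[OF w(1)])
    have "D * B * (\<Sum>k<N. s (j + k) powr \<beta>) \<le> D * B * (T * s j powr \<beta>)" using T(2) D(1) B by (intro mult_left_mono) auto
    also have "\<dots> \<le> 1" using K1[of j] j by (simp add: E_def K'_def mult.assoc)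
    finally have "\<forall>i\<le>n. \<bar>(deriv ^^ i) (A w) x\<bar> \<le> 1" using IH by (meson order_trans)
    then have "jb n L 1 (deriv (\<Phi> w)) x" by (rule L(2)[OF g(1)])
    then have jw: "n > 0 \<longrightarrow> jb (n - 1) L 1 (deriv (\<Phi> w)) x" using jb_mono by fastforce
    have "\<forall>i\<le>n. \<bar>(deriv ^^ i) (A ?r) (\<Phi> w x)\<bar> \<le> B * s (j + N) powr \<beta>"
      using regD[OF reg _ w(2)] j by (auto simp: K'_def)
    from D(2)[OF smooth_A[OF g(2)] goodD(1)[OF g(1)] jw this]
    have 1: "\<forall>i\<le>n. \<bar>(deriv ^^ i) (\<lambda>x. A ?r (\<Phi> w x)) x\<bar> \<le> D * (B * s (j + N) powr \<beta>)" .
    have "A v = (\<lambda>x. A ?r (\<Phi> w x) + A w x)" unfolding w(3) using good_add_A(2)[OF g(2,1)] by auto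
    then have eq: "(deriv ^^ i) (A v) x = (deriv ^^ i) (\<lambda>x. A ?r (\<Phi> w x)) x + (deriv ^^ i) (A w) x" for i
      using funpow_deriv_add[OF smooth_compose[OF smooth_A[OF g(2)] goodD(1)[OF g(1)]] smooth_A[OF g(1)], of i] by simp
    show ?case
    proof (intro allI impI)
      fix i assume i: "i \<le> n"
      have "\<bar>(deriv ^^ i) (A v) x\<bar> \<le> D * (B * s (j + N) powr \<beta>) + D * B * (\<Sum>k<N. s (j + k) powr \<beta>)"
        unfolding eq using 1[rule_format, OF i] IH[rule_format, OF i] by linarith
      then show "\<bar>(deriv ^^ i) (A v) x\<bar> \<le> D * B * (\<Sum>k<Suc N. s (j + k) powr \<beta>)" by (simp add: distrib_left mult.assoc add.commute)
    qed
  qed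
  have "\<bar>(deriv ^^ i) (A v) x\<bar> \<le> E * s j powr \<beta>" if "j \<ge> K'" "v \<in> words j N" "i \<le> n" for j N v i x
  proof -
    have "\<bar>(deriv ^^ i) (A v) x\<bar> \<le> D * B * (\<Sum>k<N. s (j + k) powr \<beta>)" using main[OF that(1,2)] that(3) by blast
    also have "\<dots> \<le> D * B * (T * s j powr \<beta>)" using T(2) D(1) B by (intro mult_left_mono) auto
    finally show ?thesis by (simp add: E_def mult.assoc)
  qed
  then show ?thesis using E0 K1 by (intro exI[of _ E] conjI exI[of _ K']) (auto simp: K'_def)
qed

text \<open>Since $\Phi_v$ and $\Phi_w$ commute, the displacement of $\Phi_w$ is almost invariant under $\Phi_v$.\<close>

lemma displacement_oscillation:
  assumes reg: "reg n \<beta> B K" and \<beta>: "0 < \<beta>" and B: "0 < B"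
  shows "\<exists>D\<ge>0. \<exists>K'\<ge>K. \<forall>k\<ge>K'. \<forall>j\<ge>K'. \<forall>r x W. 0 \<le> r \<longrightarrow> r \<le> s j \<longrightarrow> (\<forall>i\<le>n. \<forall>y. \<bar>(deriv ^^ i) (m (s (Suc k))) y\<bar> \<le> W) \<longrightarrow>
     \<bar>(deriv ^^ n) (m (s (Suc k))) (\<Phi> r x) - (deriv ^^ n) (m (s (Suc k))) x\<bar> \<le> D * s j powr \<beta> * W"
proof -
  obtain E K1 where E0: "E > 0" and K1: "K1 \<ge> K" and E1: "\<And>j. j \<ge> K1 \<Longrightarrow> E * s j powr \<beta> \<le> 1"
    and Ew: "\<And>j N v i x. j \<ge> K1 \<Longrightarrow> v \<in> words j N \<Longrightarrow> i \<le> n \<Longrightarrow> \<bar>(deriv ^^ i) (A v) x\<bar> \<le> E * s j powr \<beta>"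
    using words_jets[OF assms] by blast
  obtain F where F: "F \<ge> 1" "\<And>f x e. smooth_real f \<Longrightarrow> e \<le> 1 \<Longrightarrow> (\<forall>i\<le>n. \<bar>(deriv ^^ i) f x\<bar> \<le> e) \<Longrightarrow> jb n (F * e) 1 (\<lambda>x. exp (f x) - 1) x"
    using exp_jets1[of n] by blast
  obtain L where L: "L \<ge> 1" "\<And>w x. good w \<Longrightarrow> (\<forall>i\<le>n. \<bar>(deriv ^^ i) (A w) x\<bar> \<le> B) \<Longrightarrow> jb n L 1 (deriv (\<Phi> w)) x"
    using \<Phi>_jets[of n B] by blast
  obtain D1 where D1: "D1 \<ge> 0" "\<And>V F e W x. smooth_real V \<Longrightarrow> smooth_real F \<Longrightarrow> e \<le> 1 \<Longrightarrow> jb n e 1 (\<lambda>x. deriv F x - 1) x \<Longrightarrow>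
     (\<forall>i\<le>n. \<bar>(deriv ^^ i) V (F x)\<bar> \<le> W) \<Longrightarrow> \<bar>(deriv ^^ n) (\<lambda>x. V (F x)) x - (deriv ^^ n) V (F x)\<bar> \<le> D1 * e * W"
    using compose_diff_top[of n] by blast
  obtain D2 where D2: "D2 \<ge> 0" "\<And>V F e W x. smooth_real V \<Longrightarrow> smooth_real F \<Longrightarrow> (\<forall>x. jb n L 1 (deriv F) x) \<Longrightarrow>
     (\<forall>i\<le>n. \<forall>y. \<bar>(deriv ^^ Suc i) V y\<bar> \<le> e) \<Longrightarrow> (\<forall>i\<le>n. \<forall>y. \<bar>(deriv ^^ i) (\<lambda>x. F x - x) y\<bar> \<le> W) \<Longrightarrow>
     \<bar>(deriv ^^ n) (\<lambda>x. V (F x) - V x) x\<bar> \<le> D2 * e * W"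
    using compose_diff_self[of n L] by blast
  obtain K2 where K2: "\<And>k. k \<ge> K2 \<Longrightarrow> (F * E) * s k powr \<beta> \<le> 1" using s_powr_small[OF \<beta>, of 1 "F * E"] by auto
  define D where "D = (D1 + D2) * (F * E)"
  have D0: "0 \<le> D" using D1(1) D2(1) F(1) E0 by (simp add: D_def)
  have main: "\<bar>(deriv ^^ n) (m (s (Suc k))) (\<Phi> r x) - (deriv ^^ n) (m (s (Suc k))) x\<bar> \<le> D * s j powr \<beta> * W"
    if k: "k \<ge> max K1 K2" and j: "j \<ge> max K1 K2" and r: "0 \<le> r" "r \<le> s j"
      and W: "\<forall>i\<le>n. \<forall>y. \<bar>(deriv ^^ i) (m (s (Suc k))) y\<bar> \<le> W" for k j r x W
  proof -
    let ?w = "s (Suc k)"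
    let ?f = "(deriv ^^ n) (m ?w)"
    define e where "e = F * (E * s j powr \<beta>)"
    have e1: "e \<le> 1" using K2[of j] j by (simp add: e_def mult.assoc)
    have gw: "good ?w" by (rule s_good)
    have jw: "\<forall>x. jb n L 1 (deriv (\<Phi> ?w)) x"
    proof (intro allI L(2)[OF gw] impI)
      fix x i assume i: "i \<le> n"
      have "\<bar>(deriv ^^ i) (A (real 1 * ?w)) x\<bar> \<le> B * s k powr \<beta>"
        using k K1 s_Suc[of k] s_pos[of k] i by (intro regD[OF reg]) auto
      also have "\<dots> \<le> B * 1" using B s_powr_le1[OF \<beta>] by (intro mult_left_mono) auto
      finally show "\<bar>(deriv ^^ i) (A ?w) x\<bar> \<le> B" by simp
    qed
    have wd: "\<bar>?f (\<Phi> v x) - ?f x\<bar> \<le> D * s j powr \<beta> * W" if v: "v \<in> words j N" for v N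
    proof -
      have gv: "good v" by (rule words_good[OF v])
      have jv: "jb n e 1 (\<lambda>x. deriv (\<Phi> v) x - 1) y" for y
      proof -
        have "jb n (F * (E * s j powr \<beta>)) 1 (\<lambda>x. exp (A v x) - 1) y"
          using Ew[OF _ v] E1[of j] j by (intro F(2) smooth_A gv) auto
        then show ?thesis by (simp add: e_def exp_A[OF gv])
      qed
      have sm: "smooth_real (m ?w)" "smooth_real (m v)" using smooth_m gw gv by auto
      have 1: "\<bar>(deriv ^^ n) (\<lambda>x. m ?w (\<Phi> v x)) x - ?f (\<Phi> v x)\<bar> \<le> D1 * e * W"
        using W by (intro D1(2) sm goodD(1)[OF gv] e1 jv) auto
      have 2: "\<bar>(deriv ^^ n) (\<lambda>x. m v (\<Phi> ?w x) - m v x) x\<bar> \<le> D2 * e * W"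
      proof (rule D2(2)[OF sm(2) goodD(1)[OF gw] jw])
        show "\<forall>i\<le>n. \<forall>y. \<bar>(deriv ^^ Suc i) (m v) y\<bar> \<le> e"
        proof (intro allI impI)
          fix i y assume "i \<le> n"
          from jbD[OF jv this, of y] show "\<bar>(deriv ^^ Suc i) (m v) y\<bar> \<le> e"
            by (simp add: deriv_m_eq[OF gv] funpow_Suc_right del: funpow.simps)
        qed
        show "\<forall>i\<le>n. \<forall>y. \<bar>(deriv ^^ i) (\<lambda>x. \<Phi> ?w x - x) y\<bar> \<le> W" using W by (simp add: m_def[abs_def])
      qed
      \<comment> \<open>Commutation of \<open>\<Phi> v\<close> with \<open>\<Phi> ?w\<close>: the
        change of the displacement of ?w along v equals the change of the displacement of v along
        ?w, and the displacement of v has small derivatives.\<close>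
      have eq: "(\<lambda>x. m ?w (\<Phi> v x)) = (\<lambda>x. m ?w x + (m v (\<Phi> ?w x) - m v x))"
        by (auto simp: m_def \<Phi>_commute[of ?w v])
      have "(deriv ^^ n) (\<lambda>x. m ?w (\<Phi> v x)) x = ?f x + (deriv ^^ n) (\<lambda>x. m v (\<Phi> ?w x) - m v x) x"
        unfolding eq using funpow_deriv_add[OF sm(1) smooth_diff[OF smooth_compose[OF sm(2) goodD(1)[OF gw]] sm(2)], of n] by simp
      then have "\<bar>?f (\<Phi> v x) - ?f x\<bar> \<le> D1 * e * W + D2 * e * W" using 1 2 by linarith
      also have "\<dots> = D * s j powr \<beta> * W" by (simp add: D_def e_def algebra_simps)
      finally show ?thesis .
    qed
    have cf: "continuous_on UNIV ?f" using smooth_m[OF gw] by (intro smooth_continuous_on smooth_funpow_deriv)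
    have "?f (\<Phi> r x) - ?f x \<le> D * s j powr \<beta> * W"
    proof (rule words_limit[OF r, where f="\<lambda>y. ?f y - ?f x"])
      show "continuous_on UNIV (\<lambda>y. ?f y - ?f x)" by (intro continuous_on_diff cf continuous_on_const)
      show "?f (\<Phi> v x) - ?f x \<le> D * s j powr \<beta> * W" if "v \<in> words j N" for N v using wd[OF that] by linarith
    qed
    moreover have "- (?f (\<Phi> r x) - ?f x) \<le> D * s j powr \<beta> * W"
    proof (rule words_limit[OF r, where f="\<lambda>y. - (?f y - ?f x)"])
      show "continuous_on UNIV (\<lambda>y. - (?f y - ?f x))" by (intro continuous_on_minus continuous_on_diff cf continuous_on_const)
      show "- (?f (\<Phi> v x) - ?f x) \<le> D * s j powr \<beta> * W" if "v \<in> words j N" for N v using wd[OF that] by linarith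
    qed
    ultimately show ?thesis by linarith
  qed
  show ?thesis
  proof (intro exI[of _ D] conjI exI[of _ "max K1 K2"] allI impI)
    show "0 \<le> D" by (rule D0)
    show "K \<le> max K1 K2" using K1 by simp
  qed (rule main)
qed

text \<open>Induction on the order. On a segment of a fixed small time s j the top derivative
  oscillates by at most a quarter of the bound W, and by the mean value theorem it is O(s (Suc k))
  somewhere on that segment; so its supremum is O(s (Suc k)). Since j is fixed, 1/s j is a
  constant.\<close>

lemma displacement_derivs:
  assumes "reg n \<beta> B K" and \<beta>: "0 < \<beta>" and B: "0 < B"
  shows "\<exists>D>0. \<exists>K'\<ge>K. \<forall>k\<ge>K'. \<forall>i\<le>n. \<forall>y. \<bar>(deriv ^^ i) (m (s (Suc k))) y\<bar> \<le> D * s (Suc k)"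
  using assms(1)
proof (induction n)
  case 0
  obtain Q where "Q \<ge> 1" "\<And>\<beta> x. 0 < \<beta> \<Longrightarrow> \<beta> \<le> 1 \<Longrightarrow> m \<beta> x \<le> Q * \<beta>" using m_linear by blast
  then show ?case using s_pos s_le1 m_nonneg[OF less_imp_le[OF s_pos]]
    by (intro exI[of _ Q] conjI exI[of _ K]) auto
next
  case (Suc n)
  obtain D K1 where D: "D > 0" "K1 \<ge> K" "\<And>k i y. k \<ge> K1 \<Longrightarrow> i \<le> n \<Longrightarrow> \<bar>(deriv ^^ i) (m (s (Suc k))) y\<bar> \<le> D * s (Suc k)"
    using Suc.IH[OF reg_mono[OF Suc.prems]] by auto
  obtain E K2 where E: "E \<ge> 0" "K2 \<ge> K" "\<And>k j r x W. k \<ge> K2 \<Longrightarrow> j \<ge> K2 \<Longrightarrow> 0 \<le> r \<Longrightarrow> r \<le> s j \<Longrightarrow> (\<forall>i\<le>Suc n. \<forall>y. \<bar>(deriv ^^ i) (m (s (Suc k))) y\<bar> \<le> W) \<Longrightarrow>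
     \<bar>(deriv ^^ Suc n) (m (s (Suc k))) (\<Phi> r x) - (deriv ^^ Suc n) (m (s (Suc k))) x\<bar> \<le> E * s j powr \<beta> * W"
    using displacement_oscillation[OF Suc.prems \<beta> B] by (metis (no_types, lifting))
  obtain Q where Q: "Q \<ge> 1" "\<And>\<beta> x. 0 < \<beta> \<Longrightarrow> \<beta> \<le> 1 \<Longrightarrow> \<beta> \<le> Q * m \<beta> x" using m_linear by blast
  obtain K3 where K3: "\<And>k. k \<ge> K3 \<Longrightarrow> E * s k powr \<beta> \<le> 1/4" using s_powr_small[OF \<beta>, of "1/4" E] by auto
  define j where "j = max K2 K3"
  define T where "T = 2 * D * Q / s j"
  have T0: "0 < T" using D Q s_pos by (simp add: T_def)
  define D' where "D' = max D (2 * T)"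
  have "\<forall>i\<le>Suc n. \<forall>y. \<bar>(deriv ^^ i) (m (s (Suc k))) y\<bar> \<le> D' * s (Suc k)" if k: "k \<ge> max K1 K2" for k
  proof -
    let ?w = "s (Suc k)"
    let ?f = "(deriv ^^ Suc n) (m ?w)"
    have sm: "smooth_real (m ?w)" by (rule smooth_m[OF s_good])
    have per: "?f (x + 1) = ?f x" for x by (rule funpow_deriv_periodic) (rule m_1)
    have cf: "continuous_on UNIV ?f" using sm by (intro smooth_continuous_on smooth_funpow_deriv)
    obtain x where x: "\<And>y. \<bar>?f y\<bar> \<le> \<bar>?f x\<bar>"
      using periodic_attains_max[of "\<lambda>x. \<bar>?f x\<bar>"] per cf continuous_on_rabs by metis
    define S where "S = \<bar>?f x\<bar>"
    define W where "W = max S (D * ?w)"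
    have low: "\<bar>(deriv ^^ i) (m ?w) y\<bar> \<le> D * ?w" if "i \<le> n" for i y using D(3)[OF _ that] k by auto
    have W: "\<forall>i\<le>Suc n. \<forall>y. \<bar>(deriv ^^ i) (m ?w) y\<bar> \<le> W"
    proof (intro allI impI)
      fix i y assume "i \<le> Suc n"
      then consider "i \<le> n" | "i = Suc n" by linarith
      then show "\<bar>(deriv ^^ i) (m ?w) y\<bar> \<le> W"
        by cases (use low x in \<open>auto simp: W_def S_def le_max_iff_disj simp del: funpow.simps\<close>)
    qed
    have "x < \<Phi> (s j) x" using s_pos by simp
    then obtain z where z: "x < z" "z < \<Phi> (s j) x"
      "(deriv ^^ n) (m ?w) (\<Phi> (s j) x) - (deriv ^^ n) (m ?w) x = (\<Phi> (s j) x - x) * deriv ((deriv ^^ n) (m ?w)) z"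
      using smooth_mvt[OF smooth_funpow_deriv[OF sm, of n]] by blast
    have len: "s j / Q \<le> \<Phi> (s j) x - x" using Q(2)[OF s_pos s_le1, of j x] Q(1) by (simp add: m_def field_simps)
    have "s j / Q * \<bar>?f z\<bar> \<le> (\<Phi> (s j) x - x) * \<bar>?f z\<bar>" using len by (intro mult_right_mono) auto
    also have "\<dots> = \<bar>(deriv ^^ n) (m ?w) (\<Phi> (s j) x) - (deriv ^^ n) (m ?w) x\<bar>"
    proof -
      have "0 < \<Phi> (s j) x - x" using z(1,2) by linarith
      then show ?thesis unfolding z(3) by (simp add: abs_mult)
    qed
    also have "\<dots> \<le> 2 * (D * ?w)" using low[of n "\<Phi> (s j) x"] low[of n x] by linarith
    finally have fz: "\<bar>?f z\<bar> \<le> T * ?w" using s_pos[of j] Q(1) by (simp add: T_def field_simps)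
    obtain r where r: "0 \<le> r" "r \<le> s j" "z = \<Phi> r x" using \<Phi>_interval[of 0 x z "s j"] z by auto
    have "W \<ge> 0" using D(1) s_pos[of "Suc k"] by (simp add: W_def le_max_iff_disj)
    have "\<bar>?f z - ?f x\<bar> \<le> E * s j powr \<beta> * W" unfolding r(3) using k by (intro E(3) r W) (auto simp: j_def)
    also have "\<dots> \<le> 1/4 * W" using K3[of j] \<open>W \<ge> 0\<close> by (intro mult_right_mono) (auto simp: j_def)
    finally have "S \<le> 1/4 * W + T * ?w" using fz unfolding S_def by linarith
    then have S: "S \<le> D' * ?w"
    proof (cases "S \<le> D * ?w")
      case True
      have "D * ?w \<le> D' * ?w" using s_pos[of "Suc k"] by (intro mult_right_mono) (auto simp: D'_def)
      then show ?thesis using True by linarith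
    next
      case False
      then have "S \<le> 1/4 * S + T * ?w" using \<open>S \<le> 1/4 * W + T * ?w\<close> by (simp add: W_def)
      moreover have "0 \<le> T * ?w" using T0 s_pos[of "Suc k"] by simp
      ultimately have "S \<le> 2 * T * ?w" by linarith
      also have "\<dots> \<le> D' * ?w" using s_pos[of "Suc k"] by (intro mult_right_mono) (auto simp: D'_def)
      finally show ?thesis .
    qed
    have "D * ?w \<le> D' * ?w" using s_pos[of "Suc k"] by (intro mult_right_mono) (auto simp: D'_def)
    then have "W \<le> D' * ?w" using S by (simp add: W_def)
    then show ?thesis using W by (meson order_trans)
  qed
  then show ?case using D(1,2) by (intro exI[of _ D'] conjI exI[of _ "max K1 K2"]) (auto simp: D'_def less_max_iff_disj)
qed

end

section \<open>Gaining one order of regularity\<close>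

context flow_scales
begin

text \<open>From \<open>word_jets\<close>, at a cost of s_k^(-1/2) per derivative. Available for
  every order, independently of \<open>reg\<close>, but degenerate at small scales: it only serves
  as the top-order input of the interpolation.\<close>

lemma displacement_growth:
  "\<exists>D>0. \<forall>k y. \<bar>(deriv ^^ Suc (Suc i)) (m (s (Suc k))) y\<bar> \<le> D * s k powr (- (real (Suc i) / 2))"
proof -
  obtain Ke where Ke: "Ke > 0" "\<And>k. eta (s k) \<le> Ke * sqrt (s k)" using eta_sqrt by blast
  obtain Q where Q: "Q \<ge> 1" "\<And>\<beta> x. 0 < \<beta> \<Longrightarrow> \<beta> \<le> 1 \<Longrightarrow> \<beta> \<le> Q * m \<beta> x" using m_linear by blast
  obtain Cw where Cw: "Cw \<ge> 1" "\<And>\<alpha> \<alpha>' c l \<eta> n x. lvl \<alpha> \<alpha>' c l \<eta> \<Longrightarrow> n \<le> l \<Longrightarrow>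
     jb i (Cw * (\<eta> / m \<alpha> x)) (\<eta> / m \<alpha> x) (deriv (A (real n * c))) x" using word_jets[of i] by blast
  obtain E where E: "E \<ge> 1" "\<And>F K x Z. smooth_real F \<Longrightarrow> 0 \<le> K \<Longrightarrow> (Suc i > 0 \<longrightarrow> jb (Suc i - 1) (Cw * K) K (deriv F) x) \<Longrightarrow> exp (F x) \<le> Z
     \<Longrightarrow> jb (Suc i) (E * Z) K (\<lambda>x. exp (F x)) x" using jb_exp[of "Suc i" Cw] by blast
  have "\<bar>(deriv ^^ Suc (Suc i)) (m (s (Suc k))) y\<bar> \<le> (E * exp V1 * (Ke * Q) ^ Suc i) * s k powr (- (real (Suc i) / 2))" for k y
  proof -
    obtain b l where st: "step (s k) (s (Suc k)) b l" using s_step by blast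
    note sd = stepD[OF st]
    have L: "lvl (s k) (s (Suc k)) b l (eta (s k))" by (rule lvl_eta[OF s_lev st s_eta(2)])
    let ?K = "eta (s k) / m (s k) y"
    have mp: "0 < m (s k) y" by (rule m_pos[OF s_pos])
    have K0: "0 \<le> ?K" using lvlD(3)[OF L] mp by simp
    have "jb (Suc i) (E * exp V1) ?K (\<lambda>x. exp (A (s (Suc k)) x)) y"
    proof (rule E(2)[OF smooth_A[OF s_good] K0])
      show "Suc i > 0 \<longrightarrow> jb (Suc i - 1) (Cw * ?K) ?K (deriv (A (s (Suc k)))) y"
        using Cw(2)[OF L order_refl, of y] sd(8) by simp
      show "exp (A (s (Suc k)) y) \<le> exp V1" using s_V1[of "Suc k" y] by simp
    qed
    from jbD[OF this order_refl] have 1: "\<bar>(deriv ^^ Suc i) (\<lambda>x. exp (A (s (Suc k)) x)) y\<bar> \<le> E * exp V1 * ?K ^ Suc i" .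
    have sE: "smooth_real (\<lambda>x. exp (A (s (Suc k)) x))" by (intro smooth_exp smooth_A s_good)
    have "(deriv ^^ Suc (Suc i)) (m (s (Suc k))) = (deriv ^^ Suc i) (\<lambda>x. exp (A (s (Suc k)) x) - 1)"
      by (simp add: funpow_Suc_right deriv_m[OF s_good] del: funpow.simps)
    also have "\<dots> = (deriv ^^ Suc i) (\<lambda>x. exp (A (s (Suc k)) x))"
      using funpow_deriv_diff[OF sE smooth_const, of "Suc i" 1] by (simp add: funpow_deriv_const del: funpow.simps)
    finally have eq: "(deriv ^^ Suc (Suc i)) (m (s (Suc k))) = (deriv ^^ Suc i) (\<lambda>x. exp (A (s (Suc k)) x))" .
    have "?K \<le> (Ke * Q) * s k powr (-1/2)"
    proof -
      have "s k \<le> Q * m (s k) y" by (rule Q(2)[OF s_pos s_le1])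
      then have "1 / m (s k) y \<le> Q / s k" using mp s_pos[of k] by (simp add: field_simps)
      then have "eta (s k) * (1 / m (s k) y) \<le> (Ke * sqrt (s k)) * (Q / s k)"
        using Ke(2)[of k] lvlD(3)[OF L] mp s_pos[of k] Ke(1) by (intro mult_mono) auto
      also have "\<dots> = (Ke * Q) * (sqrt (s k) / s k)" by simp
      also have "sqrt (s k) / s k = s k powr (1/2 - 1)" using s_pos[of k] by (simp only: powr_diff) (simp add: powr_half_sqrt)
      finally show ?thesis by simp
    qed
    then have "?K ^ Suc i \<le> ((Ke * Q) * s k powr (-1/2)) ^ Suc i" using K0 by (intro power_mono)
    also have "\<dots> = (Ke * Q) ^ Suc i * (s k powr (-1/2)) ^ Suc i" by (rule power_mult_distrib)
    also have "(s k powr (-1/2)) ^ Suc i = s k powr (- (real (Suc i) / 2))"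
      using s_pos[of k] by (simp add: powr_realpow[symmetric] powr_powr del: power_Suc)
    finally have "E * exp V1 * ?K ^ Suc i \<le> E * exp V1 * ((Ke * Q) ^ Suc i * s k powr (- (real (Suc i) / 2)))"
      using E(1) by (intro mult_left_mono) auto
    then show ?thesis using 1 unfolding eq by (simp only: mult.assoc)
  qed
  moreover have "0 < E * exp V1 * (Ke * Q) ^ Suc i" using E(1) Ke(1) Q(1) by simp
  ultimately show ?thesis by blast
qed

lemma scale_below:
  assumes "0 < q" "q \<le> s K"
  shows "\<exists>j\<ge>K. q \<le> s j \<and> s (Suc j) < q"
proof -
  have "\<exists>j. s j < q" using order_tendstoD(2)[OF s_tendsto_0 assms(1)] eventually_happens by fastforce
  define j0 where "j0 = (LEAST j. s j < q)"
  have j0: "s j0 < q" unfolding j0_def using \<open>\<exists>j. s j < q\<close> by (rule LeastI_ex)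
  have "K < j0"
  proof (rule ccontr)
    assume "\<not> K < j0"
    then have "s K \<le> s j0" by (intro s_antimono) simp
    then show False using j0 assms by linarith
  qed
  then obtain j where j: "j0 = Suc j" by (cases j0) auto
  have "\<not> s j < q" using not_less_Least[of j "\<lambda>j. s j < q"] j by (simp add: j0_def)
  then show ?thesis using j j0 \<open>K < j0\<close> by (intro exI[of _ j]) auto
qed

text \<open>The n-th derivative of the displacement of w = s (Suc k) is interpolated over a length
  \<rho> slightly below \<alpha>^(1/2), with \<alpha> = s k. It oscillates there by w times a
  positive power of \<rho>, and since high derivatives grow by \<alpha>^(-1/2) per order only, their
  contribution is negligible for large R. Two more derivatives cost \<rho>^(-2), which is
  \<alpha>^(-1) up to a small power outweighed by the gain in oscillation.\<close>

lemma displacement_derivs_next: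
  assumes reg: "reg n \<beta> B K" and \<beta>: "0 < \<beta>" "\<beta> \<le> 1" and B: "0 < B"
  defines "\<gamma> \<equiv> \<beta> / real P / 4"
  shows "\<exists>D>0. \<exists>K'\<ge>K. \<forall>k\<ge>K'. \<forall>i\<le>n+2. \<forall>y. \<bar>(deriv ^^ i) (m (s (Suc k))) y\<bar> \<le> D * s (Suc k) * s k powr (-1 + \<gamma>)"
proof -
  define \<beta>' where "\<beta>' = \<beta> / real P"
  have \<beta>': "0 < \<beta>'" "\<beta>' \<le> 1" "\<gamma> = \<beta>' / 4"
    using \<beta> P1 by (auto simp: \<beta>'_def \<gamma>_def field_simps)
  \<comment> \<open>With \<rho> = \<alpha>^(1/2 + \<sigma>) the exponent (1/2 + \<sigma>)(\<beta>' -
    2) equals -1 + \<beta>'/4 + \<beta>'^2/8, which is at least -1 + \<gamma>.\<close>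
  define \<sigma> where "\<sigma> = \<beta>' / 8"
  obtain Q where Q: "Q \<ge> 1" "\<And>\<beta> x. 0 < \<beta> \<Longrightarrow> \<beta> \<le> 1 \<Longrightarrow> \<beta> \<le> Q * m \<beta> x" using m_linear by blast
  obtain D1 K1 where D1: "D1 > 0" "K1 \<ge> K" "\<And>k i y. k \<ge> K1 \<Longrightarrow> i \<le> n \<Longrightarrow> \<bar>(deriv ^^ i) (m (s (Suc k))) y\<bar> \<le> D1 * s (Suc k)"
    using displacement_derivs[OF reg \<beta>(1) B] by blast
  obtain E K2 where E: "E \<ge> 0" "K2 \<ge> K" and Eo: "\<forall>k\<ge>K2. \<forall>j\<ge>K2. \<forall>r x W. 0 \<le> r \<longrightarrow> r \<le> s j \<longrightarrow> (\<forall>i\<le>n. \<forall>y. \<bar>(deriv ^^ i) (m (s (Suc k))) y\<bar> \<le> W) \<longrightarrow>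
     \<bar>(deriv ^^ n) (m (s (Suc k))) (\<Phi> r x) - (deriv ^^ n) (m (s (Suc k))) x\<bar> \<le> E * s j powr \<beta> * W"
    using displacement_oscillation[OF reg \<beta>(1) B] by blast
  define J where "J = max K1 K2"
  \<comment> \<open>Chosen so that H \<alpha>^(-(R+n-1)/2) \<rho>^(R-2) = H \<alpha>^(\<sigma>(R-2)
    - (n+1)/2) is at most H \<alpha>^P, hence at most H w.\<close>
  obtain R :: nat where R: "2 \<le> R" "real P + (real n + 1) / 2 \<le> \<sigma> * (real R - 2)"
  proof -
    obtain r :: nat where "(real P + (real n + 1) / 2) / \<sigma> \<le> real r" using real_arch_simple by blast
    then have "real P + (real n + 1) / 2 \<le> \<sigma> * real r" using \<beta>' by (simp add: \<sigma>_def field_simps)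
    then show ?thesis using that[of "r + 2"] by simp
  qed
  obtain H where H: "H > 0" "\<And>k y. \<bar>(deriv ^^ (R + n)) (m (s (Suc k))) y\<bar> \<le> H * s k powr (- (real (R + n - 1) / 2))"
  proof -
    have "R + n = Suc (Suc (R + n - 2))" "R + n - 1 = Suc (R + n - 2)" using R(1) by auto
    then show ?thesis using displacement_growth[of "R + n - 2"] that by metis
  qed
  obtain Cn where Cn: "Cn \<ge> 0" and node: "\<And>\<phi> p q s H e (x :: nat \<Rightarrow> real). smooth_real \<phi> \<Longrightarrow> 0 < s \<Longrightarrow> q - p \<le> 2 ^ R * s \<Longrightarrow> 0 \<le> H \<Longrightarrow> 0 \<le> e \<Longrightarrow>
     (\<forall>i<2^R. p \<le> x i \<and> x i \<le> q \<and> \<bar>\<phi> (x i)\<bar> \<le> e) \<Longrightarrow> (\<forall>i. Suc i < 2^R \<longrightarrow> x i + s \<le> x (Suc i)) \<Longrightarrow>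
     (\<forall>y. p \<le> y \<and> y \<le> q \<longrightarrow> \<bar>(deriv ^^ R) \<phi> y\<bar> \<le> H) \<Longrightarrow>
     (\<forall>j\<le>R. \<forall>y. p \<le> y \<and> y \<le> q \<longrightarrow> \<bar>(deriv ^^ j) \<phi> y\<bar> \<le> Cn * (e / s ^ j + H * s ^ (R - j)))"
    using interpolation_nodes[where n=R and \<Lambda>="2 ^ R"] by blast
  obtain K3 where K3: "\<And>k. k \<ge> K3 \<Longrightarrow> Q * s k powr (1/2) \<le> s J" using s_powr_small[of "1/2" "s J" Q] s_pos[of J] by auto
  define D2 where "D2 = Cn * (E * D1 * Q * 4 ^ R) + Cn * H"
  have D20: "0 \<le> D2" using Cn E D1 Q H by (simp add: D2_def)
  have main: "\<bar>(deriv ^^ (n + j)) (m (s (Suc k))) x\<bar> \<le> D2 * (s (Suc k) * s k powr (-1 + \<gamma>))"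
    if k: "k \<ge> max J K3" and j: "1 \<le> j" "j \<le> 2" for k j x
  proof -
    define \<alpha> where "\<alpha> = s k"
    define w where "w = s (Suc k)"
    have \<alpha>: "0 < \<alpha>" "\<alpha> \<le> 1" and w0: "0 < w" and \<alpha>P: "\<alpha> ^ P \<le> w" using s_pos s_le1 s_P by (auto simp: \<alpha>_def w_def)
    define \<rho> where "\<rho> = \<alpha> powr (1/2 + \<sigma>)"
    have \<sigma>0: "0 < \<sigma>" using \<beta>' by (simp add: \<sigma>_def)
    have \<rho>: "0 < \<rho>" "\<rho> \<le> \<alpha> powr (1/2)" "\<rho> \<le> 1"
    proof -
      show "0 < \<rho>" using \<alpha> by (simp add: \<rho>_def)
      show *: "\<rho> \<le> \<alpha> powr (1/2)" unfolding \<rho>_def using \<alpha> \<sigma>0 by (intro powr_mono') auto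
      have "\<alpha> powr (1/2) \<le> 1" using s_powr_le1[of "1/2" k] by (simp add: \<alpha>_def)
      then show "\<rho> \<le> 1" using * by linarith
    qed
    have "Q * \<rho> \<le> Q * \<alpha> powr (1/2)" using \<rho>(2) Q(1) by (intro mult_left_mono) auto
    then have "Q * \<rho> \<le> s J" using K3[of k] k by (simp add: \<alpha>_def)
    then obtain i where i: "i \<ge> J" "Q * \<rho> \<le> s i" "s (Suc i) < Q * \<rho>" using scale_below[of "Q * \<rho>" J] \<rho> Q(1) by auto
    \<comment> \<open>s i is the last scale not below Q \<rho>, but it may exceed it greatly, as the
      next scale may be as small as its P-th power. Comparing through s i^P \<le> s (Suc i) < Q
      \<rho> replaces \<beta> by \<beta>/P.\<close>
    have si: "s i powr \<beta> \<le> Q * \<rho> powr \<beta>'"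
    proof -
      have "s i powr \<beta> = (s i ^ P) powr \<beta>'" using s_pos[of i] P1 by (simp add: \<beta>'_def powr_powr flip: powr_realpow)
      also have "\<dots> \<le> (Q * \<rho>) powr \<beta>'" using s_P[of i] i(3) \<beta>' s_pos[of i] by (intro powr_mono2) auto
      also have "\<dots> = Q powr \<beta>' * \<rho> powr \<beta>'" using Q(1) \<rho> by (simp add: powr_mult)
      also have "\<dots> \<le> Q powr 1 * \<rho> powr \<beta>'" using Q(1) \<beta>' by (intro mult_right_mono powr_mono) auto
      finally show ?thesis using Q(1) by simp
    qed
    let ?f = "(deriv ^^ n) (m w)"
    have sm: "smooth_real (m w)" unfolding w_def by (rule smooth_m[OF s_good])
    define e where "e = E * (Q * \<rho> powr \<beta>') * (D1 * w)"
    have e0: "0 \<le> e" using E(1) Q(1) D1(1) w0 by (simp add: e_def)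
    have osc: "\<bar>?f y - ?f x\<bar> \<le> e" if y: "x \<le> y" "y \<le> x + \<rho>" for y
    proof -
      have "\<rho> \<le> s i / Q" using i(2) Q(1) by (simp add: field_simps)
      also have "\<dots> \<le> m (s i) x" using Q(2)[OF s_pos s_le1, of i x] Q(1) by (simp add: field_simps)
      finally have "y \<le> \<Phi> (s i) x" using y by (simp add: m_def)
      then obtain r where r: "0 \<le> r" "r \<le> s i" "y = \<Phi> r x" using \<Phi>_interval[of 0 x y "s i"] y by auto
      have "\<forall>i\<le>n. \<forall>y. \<bar>(deriv ^^ i) (m (s (Suc k))) y\<bar> \<le> D1 * w" using D1(3)[of k] k by (auto simp: w_def J_def)
      then have "\<bar>?f y - ?f x\<bar> \<le> E * s i powr \<beta> * (D1 * w)"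
        using Eo[rule_format, of k i r "D1 * w" x] k i(1) r by (auto simp: w_def J_def)
      also have "\<dots> \<le> e" unfolding e_def using si E(1) D1(1) w0 by (intro mult_right_mono mult_left_mono) auto
      finally show ?thesis .
    qed
    define \<phi> where "\<phi> y = ?f y - ?f x" for y
    have s\<phi>: "smooth_real \<phi>" unfolding \<phi>_def using sm by (intro smooth_diff smooth_funpow_deriv smooth_const)
    have d\<phi>: "(deriv ^^ l) \<phi> = (deriv ^^ (n + l)) (m w)" if "1 \<le> l" for l
    proof -
      have "(deriv ^^ l) \<phi> = (\<lambda>y. (deriv ^^ l) ?f y - (if l = 0 then ?f x else 0))"
        unfolding \<phi>_def using funpow_deriv_diff[OF smooth_funpow_deriv[OF sm, of n] smooth_const, of l "?f x"] by (simp add: funpow_deriv_const)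
      then show ?thesis using that by (simp add: funpow_add add.commute)
    qed
    define sp where "sp = \<rho> / 2 ^ R"
    have sp: "0 < sp" "sp \<le> \<rho>" using \<rho> by (auto simp: sp_def field_simps)
    define HH where "HH = H * \<alpha> powr (- (real (R + n - 1) / 2))"
    have HH0: "0 \<le> HH" using H(1) by (simp add: HH_def)
    have key: "\<forall>j\<le>R. \<forall>y. x \<le> y \<and> y \<le> x + \<rho> \<longrightarrow> \<bar>(deriv ^^ j) \<phi> y\<bar> \<le> Cn * (e / sp ^ j + HH * sp ^ (R - j))"
    proof (rule node[OF s\<phi> sp(1), where x="\<lambda>i. x + real i * sp"])
      show "x + \<rho> - x \<le> 2 ^ R * sp" by (simp add: sp_def)
      show "\<forall>i<2 ^ R. x \<le> x + real i * sp \<and> x + real i * sp \<le> x + \<rho> \<and> \<bar>\<phi> (x + real i * sp)\<bar> \<le> e"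
      proof (intro allI impI)
        fix l :: nat assume "l < 2 ^ R"
        then have "real l \<le> real (2 ^ R)" by (subst of_nat_le_iff) simp
        then have "real l * sp \<le> 2 ^ R * sp" using sp by (intro mult_right_mono) auto
        then have l1: "real l * sp \<le> \<rho>" by (simp add: sp_def)
        moreover have l0: "0 \<le> real l * sp" using sp by simp
        ultimately show "x \<le> x + real l * sp \<and> x + real l * sp \<le> x + \<rho> \<and> \<bar>\<phi> (x + real l * sp)\<bar> \<le> e"
          using osc[of "x + real l * sp"] by (simp add: \<phi>_def)
      qed
      show "\<forall>i. Suc i < 2 ^ R \<longrightarrow> x + real i * sp + sp \<le> x + real (Suc i) * sp" by (simp add: algebra_simps)
      show "\<forall>y. x \<le> y \<and> y \<le> x + \<rho> \<longrightarrow> \<bar>(deriv ^^ R) \<phi> y\<bar> \<le> HH"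
        using H(2)[of k] R(1) by (simp add: d\<phi> HH_def w_def \<alpha>_def add.commute)
    qed (rule HH0 e0)+
    have "\<bar>(deriv ^^ j) \<phi> x\<bar> \<le> Cn * (e / sp ^ j + HH * sp ^ (R - j))" using key[rule_format, of j x] j R(1) \<rho> by auto
    then have k1: "\<bar>(deriv ^^ (n + j)) (m w) x\<bar> \<le> Cn * (e / sp ^ j) + Cn * (HH * sp ^ (R - j))"
      using d\<phi>[OF j(1)] by (simp add: distrib_left)
    let ?g = "\<alpha> powr (-1 + \<gamma>)"
    have g1: "1 \<le> ?g"
    proof -
      have "\<alpha> powr 0 \<le> ?g" using \<alpha> \<beta>' by (intro powr_mono') auto
      then show ?thesis using \<alpha> by simp
    qed
    have t1: "e / sp ^ j \<le> E * D1 * Q * 4 ^ R * (w * ?g)"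
    proof -
      have "\<rho>\<^sup>2 / 4 ^ R \<le> sp ^ j"
      proof -
        have "sp\<^sup>2 \<le> sp ^ j" using sp \<rho> j by (intro power_decreasing) auto
        moreover have "sp\<^sup>2 = \<rho>\<^sup>2 / 4 ^ R"
          by (simp add: sp_def power_divide power_mult[symmetric] mult.commute[of R 2]) (simp add: power_mult)
        ultimately show ?thesis by simp
      qed
      then have "e / sp ^ j \<le> e / (\<rho>\<^sup>2 / 4 ^ R)" using e0 \<rho> sp by (intro divide_left_mono) auto
      also have "\<dots> = E * D1 * Q * 4 ^ R * (w * (\<rho> powr \<beta>' / \<rho>\<^sup>2))" by (simp add: e_def)
      also have "\<rho> powr \<beta>' / \<rho>\<^sup>2 = \<rho> powr (\<beta>' - 2)" using \<rho> by (simp add: powr_diff)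
      also have "\<dots> = \<alpha> powr ((1/2 + \<sigma>) * (\<beta>' - 2))" by (simp add: \<rho>_def powr_powr)
      also have "E * D1 * Q * 4 ^ R * (w * (\<alpha> powr ((1/2 + \<sigma>) * (\<beta>' - 2)))) \<le> E * D1 * Q * 4 ^ R * (w * ?g)"
      proof -
        have "(1/2 + \<sigma>) * (\<beta>' - 2) = -1 + \<gamma> + \<beta>' * \<beta>' / 8" by (simp add: \<sigma>_def \<beta>'(3) field_simps)
        moreover have "0 \<le> \<beta>' * \<beta>' / 8" by simp
        ultimately have "-1 + \<gamma> \<le> (1/2 + \<sigma>) * (\<beta>' - 2)" by linarith
        then have "\<alpha> powr ((1/2 + \<sigma>) * (\<beta>' - 2)) \<le> ?g" using \<alpha> by (intro powr_mono') auto
        then show ?thesis using E(1) D1(1) Q(1) w0 by (intro mult_left_mono) auto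
      qed
      finally show ?thesis .
    qed
    have t2: "HH * sp ^ (R - j) \<le> H * (w * ?g)"
    proof -
      have "sp ^ (R - j) \<le> \<rho> ^ (R - j)" using sp by (intro power_mono) auto
      also have "\<dots> \<le> \<rho> ^ (R - 2)" using \<rho> j by (intro power_decreasing) auto
      also have "\<dots> = \<alpha> powr ((1/2 + \<sigma>) * (real R - 2))" using \<rho> R(1) by (simp add: \<rho>_def powr_powr of_nat_diff flip: powr_realpow)
      finally have "HH * sp ^ (R - j) \<le> HH * \<alpha> powr ((1/2 + \<sigma>) * (real R - 2))" using HH0 by (intro mult_left_mono)
      also have "\<dots> = H * \<alpha> powr (- (real (R + n - 1) / 2) + (1/2 + \<sigma>) * (real R - 2))" by (simp only: HH_def powr_add mult.assoc)
      also have "\<dots> \<le> H * \<alpha> powr (real P)"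
      proof -
        have eq: "- (real (R + n - 1) / 2) + (1/2 + \<sigma>) * (real R - 2) = \<sigma> * (real R - 2) - (real n + 1) / 2"
          using R(1) by (simp add: of_nat_diff field_simps)
        have "real P \<le> - (real (R + n - 1) / 2) + (1/2 + \<sigma>) * (real R - 2)" unfolding eq le_diff_eq by (rule R(2))
        then show ?thesis using \<alpha> H(1) by (intro mult_left_mono powr_mono') auto
      qed
      also have "\<dots> \<le> H * (w * ?g)"
      proof -
        have "\<alpha> powr real P \<le> w * 1" using \<alpha>P \<alpha> by (simp add: powr_realpow)
        also have "\<dots> \<le> w * ?g" using g1 w0 by (intro mult_left_mono) auto
        finally show ?thesis using H(1) by (intro mult_left_mono) auto
      qed
      finally show ?thesis .
    qed
    have "Cn * (e / sp ^ j) \<le> Cn * (E * D1 * Q * 4 ^ R * (w * ?g))" "Cn * (HH * sp ^ (R - j)) \<le> Cn * (H * (w * ?g))"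
      by (rule mult_left_mono[OF t1 Cn], rule mult_left_mono[OF t2 Cn])
    then have "\<bar>(deriv ^^ (n + j)) (m w) x\<bar> \<le> Cn * (E * D1 * Q * 4 ^ R * (w * ?g)) + Cn * (H * (w * ?g))" using k1 by linarith
    also have "\<dots> = D2 * (w * ?g)" by (simp only: D2_def distrib_right mult.assoc)
    finally show ?thesis by (simp add: w_def \<alpha>_def)
  qed
  define D where "D = D1 + D2"
  have "\<bar>(deriv ^^ i) (m (s (Suc k))) y\<bar> \<le> D * s (Suc k) * s k powr (-1 + \<gamma>)" if k: "k \<ge> max J K3" and i: "i \<le> n + 2" for k i y
  proof -
    let ?g = "s k powr (-1 + \<gamma>)"
    have g1: "1 \<le> ?g"
    proof -
      have "s k powr 0 \<le> ?g" using s_pos[of k] s_le1[of k] \<beta>' by (intro powr_mono') auto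
      then show ?thesis using s_pos[of k] by simp
    qed
    have w0: "0 < s (Suc k)" by (rule s_pos)
    have "\<bar>(deriv ^^ i) (m (s (Suc k))) y\<bar> \<le> D1 * (s (Suc k) * ?g) \<or> \<bar>(deriv ^^ i) (m (s (Suc k))) y\<bar> \<le> D2 * (s (Suc k) * ?g)"
    proof (cases "i \<le> n")
      case True
      have "\<bar>(deriv ^^ i) (m (s (Suc k))) y\<bar> \<le> D1 * (s (Suc k) * 1)" using D1(3)[OF _ True] k by (auto simp: J_def)
      also have "\<dots> \<le> D1 * (s (Suc k) * ?g)" using g1 w0 D1(1) by (intro mult_left_mono) auto
      finally show ?thesis by blast
    next
      case False
      then show ?thesis using main[OF k, of "i - n" y] i by auto
    qed
    moreover have "0 \<le> D1 * (s (Suc k) * ?g)" "0 \<le> D2 * (s (Suc k) * ?g)" using D1(1) D20 w0 by auto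
    ultimately show ?thesis unfolding D_def by (auto simp: distrib_right mult.assoc)
  qed
  moreover have "0 < D" using D1(1) D20 by (simp add: D_def)
  moreover have "K \<le> max J K3" using D1(2) by (auto simp: J_def le_max_iff_disj)
  ultimately show ?thesis by blast
qed

text \<open>One step has jets of A of size O(s (Suc k) s_k^(-1+\<gamma>)) up to order n+1. A power
  consists of b such steps with b s (Suc k) \<le> s k, which leaves s_k^\<gamma>. The exponent
  shrinks with each order but stays positive.\<close>

lemma reg_Suc:
  assumes reg: "reg n \<beta> B K" and \<beta>: "0 < \<beta>" "\<beta> \<le> 1" and B: "0 < B"
  shows "\<exists>\<gamma>>0. \<gamma> \<le> 1 \<and> (\<exists>B'>0. \<exists>K'. reg (Suc n) \<gamma> B' K')"
proof -
  define \<gamma> where "\<gamma> = \<beta> / real P / 4"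
  have \<gamma>: "0 < \<gamma>" "\<gamma> \<le> 1" using \<beta> P1 by (auto simp: \<gamma>_def field_simps)
  obtain D K1 where D: "D > 0" "K1 \<ge> K" "\<And>k i y. k \<ge> K1 \<Longrightarrow> i \<le> n + 2 \<Longrightarrow> \<bar>(deriv ^^ i) (m (s (Suc k))) y\<bar> \<le> D * s (Suc k) * s k powr (-1 + \<gamma>)"
    using displacement_derivs_next[OF assms, folded \<gamma>_def] by blast
  obtain E where E: "E \<ge> 1" "\<And>F K x Z. smooth_real F \<Longrightarrow> 0 \<le> K \<Longrightarrow> (n > 0 \<longrightarrow> jb (n - 1) (B * K) K (deriv F) x) \<Longrightarrow> exp (F x) \<le> Z
     \<Longrightarrow> jb n (E * Z) K (\<lambda>x. exp (F x)) x" using jb_exp[of n B] by blast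
  obtain L where L: "L \<ge> 1" "\<And>w x. good w \<Longrightarrow> (\<forall>i\<le>n. \<bar>(deriv ^^ i) (A w) x\<bar> \<le> B) \<Longrightarrow> jb n L 1 (deriv (\<Phi> w)) x"
    using \<Phi>_jets[of n B] by blast
  obtain T where T: "T \<ge> 1" and Tc: "\<And>V F W x. smooth_real V \<Longrightarrow> smooth_real F \<Longrightarrow> (Suc n > 0 \<longrightarrow> jb (Suc n - 1) L 1 (deriv F) x) \<Longrightarrow>
     (\<forall>i\<le>Suc n. \<bar>(deriv ^^ i) V (F x)\<bar> \<le> W) \<Longrightarrow> (\<forall>i\<le>Suc n. \<bar>(deriv ^^ i) (\<lambda>x. V (F x)) x\<bar> \<le> T * W)"
    using compose_bound[of "Suc n" L] by blast
  define D' where "D' = exp V1 * D + 2 ^ n * D * (E * exp B)"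
  have D'0: "0 < D'" using D E by (simp add: D'_def add_pos_pos)
  have AB: "\<bar>(deriv ^^ i) (A (real b * s (Suc k))) x\<bar> \<le> B" if "k \<ge> K" "real b * s (Suc k) \<le> s k" "i \<le> n" for k b i x
  proof -
    have "\<bar>(deriv ^^ i) (A (real b * s (Suc k))) x\<bar> \<le> B * s k powr \<beta>" by (rule regD[OF reg that])
    also have "\<dots> \<le> B * 1" using B s_powr_le1[OF \<beta>(1)] by (intro mult_left_mono) auto
    finally show ?thesis by simp
  qed
  have Aw: "\<bar>(deriv ^^ i) (A (s (Suc k))) x\<bar> \<le> D' * (s (Suc k) * s k powr (-1 + \<gamma>))" if k: "k \<ge> K1" and i: "i \<le> Suc n" for k i x
  proof -
    let ?w = "s (Suc k)"
    define W where "W = D * ?w * s k powr (-1 + \<gamma>)"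
    have W0: "0 \<le> W" using D(1) s_pos[of "Suc k"] by (simp add: W_def)
    have sA: "smooth_real (A ?w)" by (rule smooth_A[OF s_good])
    have sm: "smooth_real (m ?w)" by (rule smooth_m[OF s_good])
    have Ab: "\<bar>(deriv ^^ i) (A ?w) x\<bar> \<le> B" if "i \<le> n" for i
      using AB[of k 1 i x] k D(2) that s_Suc[of k] s_pos[of k] by simp
    show ?thesis
    proof (cases i)
      case 0
      have "\<bar>A ?w x\<bar> \<le> exp V1 * \<bar>exp (A ?w x) - 1\<bar>" by (rule abs_le_exp_minus_1[OF s_V1])
      also have "\<dots> \<le> exp V1 * W" using D(3)[OF k, of 1 x] by (intro mult_left_mono) (auto simp: deriv_m[OF s_good] W_def)
      also have "\<dots> = exp V1 * D * (?w * s k powr (-1 + \<gamma>))" by (simp add: W_def)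
      also have "\<dots> \<le> D' * (?w * s k powr (-1 + \<gamma>))"
        using D(1) E(1) s_pos[of "Suc k"] by (intro mult_right_mono) (auto simp: D'_def)
      finally show ?thesis using 0 by simp
    next
      case (Suc l)
      have l: "l \<le> n" using i Suc by simp
      have d1: "deriv (m ?w) = (\<lambda>x. exp (A ?w x) - 1)" by (rule deriv_m[OF s_good])
      have d2: "deriv (deriv (m ?w)) = (\<lambda>x. deriv (A ?w) x * exp (A ?w x))"
        unfolding d1 using sA by (simp add: deriv_diff_smooth smooth_exp deriv_exp_smooth)
      \<comment> \<open>In A' = m'' e^(-A) the n-th jet involves m up to order n+2 but the
        exponential only up to order n, where \<open>reg\<close> already applies.\<close>
      have eq: "deriv (A ?w) = (\<lambda>x. deriv (deriv (m ?w)) x * exp ((-1) * A ?w x))"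
        unfolding d2 by (auto simp: exp_minus)
      have j1: "jb n W 1 (deriv (deriv (m ?w))) x" unfolding jb_def
      proof (intro allI impI)
        fix q assume "q \<le> n"
        then have "\<bar>(deriv ^^ (q + 2)) (m ?w) x\<bar> \<le> W" unfolding W_def by (intro D(3)[OF k]) auto
        then show "\<bar>(deriv ^^ q) (deriv (deriv (m ?w))) x\<bar> \<le> W * 1 ^ q" by (simp add: funpow_swap1)
      qed
      have j2: "jb n (E * exp B) 1 (\<lambda>x. exp ((-1) * A ?w x)) x"
      proof (rule E(2))
        show "smooth_real (\<lambda>x. (-1) * A ?w x)" using sA by (rule smooth_cmult)
        show "n > 0 \<longrightarrow> jb (n - 1) (B * 1) 1 (deriv (\<lambda>x. (-1) * A ?w x)) x"
          unfolding jb_def deriv_cmult_smooth[OF sA]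
        proof (intro impI allI)
          fix q assume "n > 0" "q \<le> n - 1"
          then have "Suc q \<le> n" by simp
          from Ab[OF this] show "\<bar>(deriv ^^ q) (\<lambda>x. (-1) * deriv (A ?w) x) x\<bar> \<le> B * 1 * 1 ^ q"
            unfolding funpow_deriv_cmult[OF smooth_deriv[OF sA]] by (simp add: funpow_swap1)
        qed
        show "exp ((-1) * A ?w x) \<le> exp B" using Ab[of 0] by simp
      qed simp
      have "jb n (2 ^ n * W * (E * exp B)) 1 (\<lambda>x. deriv (deriv (m ?w)) x * exp ((-1) * A ?w x)) x"
        by (intro jb_mult j1 j2 smooth_deriv sm smooth_exp smooth_cmult sA) auto
      from jbD[OF this l] have "\<bar>(deriv ^^ l) (deriv (A ?w)) x\<bar> \<le> 2 ^ n * W * (E * exp B)" unfolding eq[symmetric] by simp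
      also have "\<dots> = 2 ^ n * D * (E * exp B) * (?w * s k powr (-1 + \<gamma>))" by (simp add: W_def)
      also have "\<dots> \<le> D' * (?w * s k powr (-1 + \<gamma>))"
        using D(1) E(1) s_pos[of "Suc k"] by (intro mult_right_mono) (auto simp: D'_def)
      finally show ?thesis unfolding Suc by (simp add: funpow_swap1)
    qed
  qed
  have "\<bar>(deriv ^^ i) (A (real b * s (Suc k))) x\<bar> \<le> (T * D') * s k powr \<gamma>"
    if k: "k \<ge> K1" and b: "real b * s (Suc k) \<le> s k" and i: "i \<le> Suc n" for k b i x
  proof -
    let ?w = "s (Suc k)"
    let ?W = "D' * (?w * s k powr (-1 + \<gamma>))"
    have gw: "good ?w" by (rule s_good)
    have gj: "good (real q * ?w)" for q by (rule good_mult[OF gw])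
    have sm: "smooth_real (\<lambda>x. A ?w (\<Phi> (real q * ?w) x))" for q by (rule smooth_compose[OF smooth_A[OF gw] goodD(1)[OF gj]])
    have "A (real b * ?w) = (\<lambda>x. \<Sum>q<b. A ?w (\<Phi> (real q * ?w) x))" using A_mult[OF gw] by auto
    then have "(deriv ^^ i) (A (real b * ?w)) x = (\<Sum>q<b. (deriv ^^ i) (\<lambda>x. A ?w (\<Phi> (real q * ?w) x)) x)"
      using funpow_deriv_sum[of "{..<b}" "\<lambda>q x. A ?w (\<Phi> (real q * ?w) x)" i] sm by simp
    also have "\<bar>\<dots>\<bar> \<le> (\<Sum>q<b. T * ?W)"
    proof (rule order_trans[OF sum_abs sum_mono])
      fix q assume "q \<in> {..<b}"
      then have "real q * ?w \<le> real b * ?w" using s_pos[of "Suc k"] by (intro mult_right_mono) auto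
      then have qb: "real q * ?w \<le> s k" using b by linarith
      \<comment> \<open>Jets of order n+1 of the composition involve \<Phi>' only up to order
        n.\<close>
      have "jb n L 1 (deriv (\<Phi> (real q * ?w))) x" using AB[OF _ qb] k D(2) by (intro L(2)[OF gj]) auto
      then have "\<forall>i\<le>Suc n. \<bar>(deriv ^^ i) (\<lambda>x. A ?w (\<Phi> (real q * ?w) x)) x\<bar> \<le> T * ?W"
        using Tc[OF smooth_A[OF gw] goodD(1)[OF gj], of q x ?W] Aw[OF k] by simp
      then show "\<bar>(deriv ^^ i) (\<lambda>x. A ?w (\<Phi> (real q * ?w) x)) x\<bar> \<le> T * ?W" using i by blast
    qed
    also have "\<dots> = (T * D') * ((real b * ?w) * s k powr (-1 + \<gamma>))" by simp
    also have "\<dots> \<le> (T * D') * (s k * s k powr (-1 + \<gamma>))" using b T D'0 by (intro mult_left_mono mult_right_mono) auto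
    also have "s k * s k powr (-1 + \<gamma>) = s k powr \<gamma>" using s_pos[of k] by (simp add: powr_mult_base)
    finally show ?thesis .
  qed
  then have "reg (Suc n) \<gamma> (T * D') K1" unfolding reg_def by blast
  moreover have "0 < T * D'" using T D'0 by simp
  ultimately show ?thesis using \<gamma> by blast
qed

lemma reg_all: "\<exists>\<beta>>0. \<beta> \<le> 1 \<and> (\<exists>B>0. \<exists>K. reg n \<beta> B K)"
proof (induction n)
  case 0
  then show ?case using reg_0 by blast
next
  case (Suc n)
  then show ?case using reg_Suc by blast
qed

end

section \<open>Smoothness of the conjugacy\<close>

text \<open>A bound on the second derivative turns uniform closeness of the approximants into
  uniform closeness of their derivatives, by difference quotients. The derivatives then converge to
  the derivative of the limit, and the same hypothesis holds for it with one order less.\<close>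

lemma kdiff_limit:
  fixes f :: "real \<Rightarrow> real"
  assumes "\<exists>E. \<forall>e>0. \<exists>v. smooth_real v \<and> (\<forall>x. \<bar>v x - f x\<bar> \<le> e) \<and> (\<forall>i x. 1 \<le> i \<longrightarrow> i \<le> Suc n \<longrightarrow> \<bar>(deriv ^^ i) v x\<bar> \<le> E)"
  shows "kdiff n f"
  using assms
proof (induction n arbitrary: f)
  case 0
  then show ?case by simp
next
  case (Suc n)
  then obtain E where "\<forall>e>0. \<exists>v. smooth_real v \<and> (\<forall>x. \<bar>v x - f x\<bar> \<le> e) \<and> (\<forall>i x. 1 \<le> i \<longrightarrow> i \<le> Suc (Suc n) \<longrightarrow> \<bar>(deriv ^^ i) v x\<bar> \<le> E)"
    by blast
  \<comment> \<open>Closeness t^2 with t = 1/(k+1) leaves an error O(t) in a difference quotient of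
    step t, the same order as the Taylor remainder.\<close>
  then have "\<forall>k::nat. \<exists>v. smooth_real v \<and> (\<forall>x. \<bar>v x - f x\<bar> \<le> (1 / real (Suc k))\<^sup>2) \<and> (\<forall>i x. 1 \<le> i \<longrightarrow> i \<le> Suc (Suc n) \<longrightarrow> \<bar>(deriv ^^ i) v x\<bar> \<le> E)"
    by simp
  then obtain v where v: "\<And>k. smooth_real (v k)" "\<And>k x. \<bar>v k x - f x\<bar> \<le> (1 / real (Suc k))\<^sup>2"
    "\<And>k i x. 1 \<le> i \<Longrightarrow> i \<le> Suc (Suc n) \<Longrightarrow> \<bar>(deriv ^^ i) (v k) x\<bar> \<le> E" by metis
  have E0: "0 \<le> E" using v(3)[of 1 0 0] by linarith
  have taylor: "\<bar>v k (x + t) - v k x - t * deriv (v k) x\<bar> \<le> E * t\<^sup>2" for k x t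
  proof -
    have D1: "\<bar>deriv (v k) y - deriv (v k) x\<bar> \<le> E * \<bar>y - x\<bar>" for y
    proof (cases "x \<le> y")
      case True
      then show ?thesis using smooth_diff_le[OF smooth_deriv[OF v(1)] True, of k E] v(3)[of 2 k] by (simp add: numeral_2_eq_2)
    next
      case False
      then show ?thesis using smooth_diff_le[OF smooth_deriv[OF v(1)], of y x k E] v(3)[of 2 k]
        by (simp add: numeral_2_eq_2 abs_minus_commute)
    qed
    have "\<exists>z. \<bar>z - x\<bar> \<le> \<bar>t\<bar> \<and> v k (x + t) - v k x = t * deriv (v k) z"
    proof -
      consider "t = 0" | "t > 0" | "t < 0" by linarith
      then show ?thesis
      proof cases
        case 2
        then obtain z where "x < z" "z < x + t" "v k (x + t) - v k x = (x + t - x) * deriv (v k) z"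
          using smooth_mvt[OF v(1), of x "x + t" k] by auto
        then show ?thesis by (intro exI[of _ z]) auto
      next
        case 3
        then obtain z where "x + t < z" "z < x" "v k x - v k (x + t) = (x - (x + t)) * deriv (v k) z"
          using smooth_mvt[OF v(1), of "x + t" x k] by auto
        then show ?thesis by (intro exI[of _ z]) (auto simp: algebra_simps)
      qed auto
    qed
    then obtain z where z: "\<bar>z - x\<bar> \<le> \<bar>t\<bar>" "v k (x + t) - v k x = t * deriv (v k) z" by blast
    have "\<bar>v k (x + t) - v k x - t * deriv (v k) x\<bar> = \<bar>t\<bar> * \<bar>deriv (v k) z - deriv (v k) x\<bar>"
      unfolding z(2) by (simp add: abs_mult[symmetric] algebra_simps)
    also have "\<dots> \<le> \<bar>t\<bar> * (E * \<bar>t\<bar>)"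
      using D1[of z] z(1) E0 mult_left_mono[OF z(1) E0] by (intro mult_left_mono) linarith+
    finally show ?thesis by (simp add: power2_eq_square mult_ac)
  qed
  have cauchy: "\<bar>deriv (v k) x - deriv (v l) x\<bar> \<le> (2 * E + 4) * (1 / real (Suc k))" if "k \<le> l" for k l x
  proof -
    define t where "t = 1 / real (Suc k)"
    have t0: "0 < t" by (simp add: t_def)
    have lk: "(1 / real (Suc l))\<^sup>2 \<le> t\<^sup>2" unfolding t_def using that by (intro power_mono divide_left_mono) auto
    have b: "\<bar>v k y - f y\<bar> \<le> t\<^sup>2" "\<bar>v l y - f y\<bar> \<le> t\<^sup>2" for y
      using v(2)[of k y] order_trans[OF v(2)[of l y] lk] by (simp_all only: t_def)
    have "t * \<bar>deriv (v k) x - deriv (v l) x\<bar> = \<bar>t * deriv (v k) x - t * deriv (v l) x\<bar>"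
      using t0 by (simp add: right_diff_distrib[symmetric] abs_mult)
    also have "\<dots> \<le> (2 * E + 4) * t\<^sup>2"
      using taylor[of k x t] taylor[of l x t] b[of x] b[of "x + t"] by (simp add: distrib_right)
    also have "\<dots> = t * ((2 * E + 4) * t)" by (simp add: power2_eq_square)
    finally show ?thesis using t0 unfolding t_def[symmetric] by (simp only: mult_le_cancel_left_pos)
  qed
  have small: "\<exists>K. \<forall>k\<ge>K. C * (1 / real (Suc k)) \<le> e" if "0 < e" for e C :: real
  proof -
    have "(\<lambda>k. C * (1 / real (Suc k))) \<longlonglongrightarrow> 0" using tendsto_mult_right_zero[OF LIMSEQ_inverse_real_of_nat, of C] by (simp add: inverse_eq_divide)
    from order_tendstoD(2)[OF this that] show ?thesis unfolding eventually_sequentially by (meson less_imp_le)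
  qed
  have conv: "\<exists>g. (\<lambda>k. deriv (v k) x) \<longlonglongrightarrow> g" for x
  proof -
    have "Cauchy (\<lambda>k. deriv (v k) x)"
    proof (rule metric_CauchyI)
      fix e :: real assume e: "0 < e"
      obtain K where K: "\<And>k. k \<ge> K \<Longrightarrow> (2 * E + 4) * (1 / real (Suc k)) \<le> e / 2" using small[of "e/2" "2 * E + 4"] e by auto
      show "\<exists>K. \<forall>a\<ge>K. \<forall>b\<ge>K. dist (deriv (v a) x) (deriv (v b) x) < e"
      proof (intro exI[of _ K] allI impI)
        fix a b assume ab: "K \<le> a" "K \<le> b"
        have "\<bar>deriv (v a) x - deriv (v b) x\<bar> \<le> e / 2"
        proof (cases "a \<le> b")
          case True
          then show ?thesis using cauchy[OF True, of x] K[OF ab(1)] by linarith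
        next
          case False
          then have "b \<le> a" by simp
          from cauchy[OF this, of x] K[OF ab(2)] show ?thesis by linarith
        qed
        then show "dist (deriv (v a) x) (deriv (v b) x) < e" using e by (simp add: dist_real_def)
      qed
    qed
    then show ?thesis using Cauchy_convergent convergentD by blast
  qed
  then obtain g where g: "\<And>x. (\<lambda>k. deriv (v k) x) \<longlonglongrightarrow> g x" by metis
  have gd: "\<bar>deriv (v k) x - g x\<bar> \<le> (2 * E + 4) * (1 / real (Suc k))" for k x
  proof (rule LIMSEQ_le_const2)
    show "(\<lambda>l. \<bar>deriv (v k) x - deriv (v l) x\<bar>) \<longlonglongrightarrow> \<bar>deriv (v k) x - g x\<bar>" by (intro tendsto_intros g)
    show "\<exists>N. \<forall>l\<ge>N. \<bar>deriv (v k) x - deriv (v l) x\<bar> \<le> (2 * E + 4) * (1 / real (Suc k))" using cauchy by blast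
  qed
  have vf: "(\<lambda>k. v k x) \<longlonglongrightarrow> f x" for x
  proof -
    have "(\<lambda>k. (inverse (real (Suc k)))\<^sup>2) \<longlonglongrightarrow> 0\<^sup>2" by (intro tendsto_power LIMSEQ_inverse_real_of_nat)
    then have "(\<lambda>k. (1 / real (Suc k))\<^sup>2) \<longlonglongrightarrow> 0" by (simp add: inverse_eq_divide)
    then have "(\<lambda>k. v k x - f x) \<longlonglongrightarrow> 0" by (rule Lim_null_comparison[rotated]) (use v(2) in auto)
    then show ?thesis by (simp add: LIM_zero_iff)
  qed
  have ft: "\<bar>f (x + t) - f x - t * g x\<bar> \<le> E * t\<^sup>2" for x t
  proof (rule LIMSEQ_le_const2)
    show "(\<lambda>k. \<bar>v k (x + t) - v k x - t * deriv (v k) x\<bar>) \<longlonglongrightarrow> \<bar>f (x + t) - f x - t * g x\<bar>" by (intro tendsto_intros g vf)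
    show "\<exists>N. \<forall>k\<ge>N. \<bar>v k (x + t) - v k x - t * deriv (v k) x\<bar> \<le> E * t\<^sup>2" using taylor by blast
  qed
  have der: "(f has_real_derivative g x) (at x)" for x
  proof -
    have "((\<lambda>t. (f (x + t) - f x) / t - g x) \<longlongrightarrow> 0) (at 0)"
    proof (rule Lim_null_comparison)
      show "\<forall>\<^sub>F t in at 0. norm ((f (x + t) - f x) / t - g x) \<le> E * \<bar>t\<bar>"
        unfolding eventually_at
      proof (intro exI[of _ 1] conjI ballI impI)
        fix t :: real assume "t \<noteq> 0 \<and> dist t 0 < 1"
        then have t: "t \<noteq> 0" by simp
        have "(f (x + t) - f x) / t - g x = (f (x + t) - f x - t * g x) / t" using t by (simp add: diff_divide_distrib)
        then have "norm ((f (x + t) - f x) / t - g x) = \<bar>f (x + t) - f x - t * g x\<bar> / \<bar>t\<bar>" by (simp add: abs_divide)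
        also have "\<dots> \<le> E * t\<^sup>2 / \<bar>t\<bar>" by (intro divide_right_mono ft) auto
        also have "\<dots> = E * \<bar>t\<bar>" using t by (simp add: power2_eq_square abs_if)
        finally show "norm ((f (x + t) - f x) / t - g x) \<le> E * \<bar>t\<bar>" .
      qed simp
      have "((\<lambda>t. E * \<bar>t\<bar>) \<longlongrightarrow> E * \<bar>0\<bar>) (at 0)" by (intro tendsto_intros)
      then show "((\<lambda>t. E * \<bar>t\<bar>) \<longlongrightarrow> 0) (at 0)" by simp
    qed
    then show ?thesis unfolding DERIV_def by (rule LIM_zero_cancel)
  qed
  have "kdiff n g"
  proof (rule Suc.IH, intro exI[of _ E] allI impI)
    fix e :: real assume "0 < e"
    then obtain k where k: "(2 * E + 4) * (1 / real (Suc k)) \<le> e" using small by blast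
    show "\<exists>v. smooth_real v \<and> (\<forall>x. \<bar>v x - g x\<bar> \<le> e) \<and> (\<forall>i x. 1 \<le> i \<longrightarrow> i \<le> Suc n \<longrightarrow> \<bar>(deriv ^^ i) v x\<bar> \<le> E)"
    proof (intro exI[of _ "deriv (v k)"] conjI allI impI)
      show "smooth_real (deriv (v k))" using v(1) by (rule smooth_deriv)
      show "\<bar>deriv (v k) x - g x\<bar> \<le> e" for x using gd[of k x] k by linarith
      show "\<bar>(deriv ^^ i) (deriv (v k)) x\<bar> \<le> E" if "1 \<le> i" "i \<le> Suc n" for i x
        using v(3)[of "Suc i" k x] that by (simp add: funpow_swap1)
    qed
  qed
  then show ?case by (rule kdiff_SucI[OF der])
qed

lemma monotone_quasi_linear:
  assumes mono: "\<And>y z. y \<le> z \<Longrightarrow> G y \<le> G z" and per: "\<And>z. G (z + 1 / real n) = G z + (1::real)" and n: "0 < n"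
  shows "\<bar>G y - G z - real n * (y - z)\<bar> \<le> 1"
proof -
  define p where "p = \<lfloor>real n * (y - z)\<rfloor>"
  have n0: "0 < real n" using n by simp
  have sh: "G (z + of_int q / real n) = G z + of_int q" for q
  proof -
    define F where "F x = G (x / real n)" for x
    have "F (x + 1) = F x + 1" for x using per[of "x / real n"] by (simp add: F_def add_divide_distrib)
    from periodic_int[of F 1, OF this, of "real n * z" q] show ?thesis
      using n0 by (simp add: F_def add_divide_distrib)
  qed
  have p: "of_int p \<le> real n * (y - z)" "real n * (y - z) < of_int (p + 1)" unfolding p_def by linarith+
  have "z + of_int p / real n \<le> y" "y \<le> z + of_int (p + 1) / real n" using p n0 by (simp_all add: field_simps)
  then have "G z + of_int p \<le> G y" "G y \<le> G z + of_int (p + 1)" using mono sh by metis+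
  then show ?thesis using p by (simp add: abs_le_iff)
qed

section \<open>Recovering the conjugacy from averages over the flow\<close>

context flow
begin

text \<open>Extends uniform bounds from times at most s j to times of order 1, by a fixed number of
  iterates.\<close>

lemma A_multiples:
  "\<exists>L\<ge>1. \<forall>v. good v \<longrightarrow> (\<forall>i\<le>n. \<forall>x. \<bar>(deriv ^^ i) (A v) x\<bar> \<le> 1) \<longrightarrow> (\<forall>i\<le>n. \<forall>x. \<bar>(deriv ^^ i) (A (real q * v)) x\<bar> \<le> L)"
proof (induction q)
  case 0
  have "A 0 = (\<lambda>x. 0)" by (auto simp: good_0)
  then show ?case by (intro exI[of _ 1]) (auto simp: funpow_deriv_const)
next
  case (Suc q)
  then obtain L where L: "L \<ge> 1" "\<And>v i x. good v \<Longrightarrow> (\<forall>i\<le>n. \<forall>x. \<bar>(deriv ^^ i) (A v) x\<bar> \<le> 1) \<Longrightarrow> i \<le> n \<Longrightarrow> \<bar>(deriv ^^ i) (A (real q * v)) x\<bar> \<le> L"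
    by blast
  obtain E where E: "E \<ge> 1" "\<And>w x. good w \<Longrightarrow> (\<forall>i\<le>n. \<bar>(deriv ^^ i) (A w) x\<bar> \<le> L) \<Longrightarrow> jb n E 1 (deriv (\<Phi> w)) x"
    using \<Phi>_jets[of n L] by blast
  obtain T where T: "T \<ge> 1" and Tc: "\<And>V F W x. smooth_real V \<Longrightarrow> smooth_real F \<Longrightarrow> (n > 0 \<longrightarrow> jb (n - 1) E 1 (deriv F) x) \<Longrightarrow>
     (\<forall>i\<le>n. \<bar>(deriv ^^ i) V (F x)\<bar> \<le> W) \<Longrightarrow> (\<forall>i\<le>n. \<bar>(deriv ^^ i) (\<lambda>x. V (F x)) x\<bar> \<le> T * W)"
    using compose_bound[of n E] by blast
  show ?case
  proof (intro exI[of _ "T + L"] conjI allI impI)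
    show "1 \<le> T + L" using T L by simp
    fix v i x assume v: "good v" and b: "\<forall>i\<le>n. \<forall>x. \<bar>(deriv ^^ i) (A v) x\<bar> \<le> 1" and i: "i \<le> n"
    let ?w = "real q * v"
    have gw: "good ?w" by (rule good_mult[OF v])
    have "jb n E 1 (deriv (\<Phi> ?w)) x" using L(2)[OF v b] by (intro E(2)[OF gw]) auto
    then have "n > 0 \<longrightarrow> jb (n - 1) E 1 (deriv (\<Phi> ?w)) x" using jb_mono by fastforce
    from Tc[OF smooth_A[OF v] goodD(1)[OF gw] this, of 1] b
    have 1: "\<bar>(deriv ^^ i) (\<lambda>x. A v (\<Phi> ?w x)) x\<bar> \<le> T" using i by simp
    have "A (real (Suc q) * v) = (\<lambda>x. A v (\<Phi> ?w x) + A ?w x)" using A_mult_Suc[OF v] by auto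
    then have "(deriv ^^ i) (A (real (Suc q) * v)) x = (deriv ^^ i) (\<lambda>x. A v (\<Phi> ?w x)) x + (deriv ^^ i) (A ?w) x"
      using funpow_deriv_add[OF smooth_compose[OF smooth_A[OF v] goodD(1)[OF gw]] smooth_A[OF gw], of i] by simp
    then show "\<bar>(deriv ^^ i) (A (real (Suc q) * v)) x\<bar> \<le> T + L" using 1 L(2)[OF v b i, of x] by linarith
  qed
qed

text \<open>In the coordinate z = h x the sum of \<xi>(z + q/n) over q < n is monotone and gains
  exactly 1 when z advances by 1/n; its increments are therefore n times those of z, up to an error
  1. Replacing q/n by a nearby time t q changes each term by at most d.\<close>

lemma h_from_orbit_averages:
  assumes n: "0 < n" and t: "\<And>q. q < n \<Longrightarrow> \<bar>t q - real q / real n\<bar> \<le> e" and M: "M e \<le> d" and e: "0 \<le> e"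
  defines "u \<equiv> \<lambda>x. \<Sum>q<n. (1 / real n) * \<Phi> (t q) x"
  shows "\<bar>(u x - u 0) - (h x - h 0)\<bar> \<le> 2 * d + 1 / real n"
proof -
  have n0: "0 < real n" using n by simp
  define S where "S x = (\<Sum>q<n. (1 / real n) * \<Phi> (real q / real n) x)" for x
  have near: "\<bar>\<Phi> (t q) x - \<Phi> (real q / real n) x\<bar> \<le> d" if "q < n" for q x
  proof -
    have gen: "\<bar>\<Phi> r x - \<Phi> r' x\<bar> \<le> d" if "r \<le> r'" "r' - r \<le> e" for r r'
    proof -
      have "\<Phi> r' x = \<Phi> (r' - r) (\<Phi> r x)" by (simp flip: \<Phi>_add)
      then have "\<bar>\<Phi> r x - \<Phi> r' x\<bar> = m (r' - r) (\<Phi> r x)" using m_nonneg[of "r' - r" "\<Phi> r x"] that by (simp add: m_def)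
      also have "\<dots> \<le> M e" using m_mono[OF that(2)] m_le_M order_trans by blast
      finally show ?thesis using M by linarith
    qed
    show ?thesis
    proof (cases "t q \<le> real q / real n")
      case True then show ?thesis using gen[OF True] t[OF that] by simp
    next
      case False
      then have "\<bar>\<Phi> (real q / real n) x - \<Phi> (t q) x\<bar> \<le> d" using gen[of "real q / real n" "t q"] t[OF that] by simp
      then show ?thesis by (simp add: abs_minus_commute)
    qed
  qed
  have uS: "\<bar>u x - S x\<bar> \<le> d" for x
  proof -
    have "\<bar>u x - S x\<bar> = \<bar>\<Sum>q<n. (1 / real n) * (\<Phi> (t q) x - \<Phi> (real q / real n) x)\<bar>"
      by (simp add: u_def S_def sum_subtractf right_diff_distrib)
    also have "\<dots> \<le> (\<Sum>q<n. (1 / real n) * d)"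
    proof (rule order_trans[OF sum_abs sum_mono])
      fix q assume "q \<in> {..<n}"
      then show "\<bar>(1 / real n) * (\<Phi> (t q) x - \<Phi> (real q / real n) x)\<bar> \<le> (1 / real n) * d"
        using near[of q x] n0 by (simp add: abs_mult divide_right_mono)
    qed
    finally show ?thesis using n0 by simp
  qed
  define G where "G z = (\<Sum>q<n. \<xi> (z + real q / real n))" for z
  have GS: "S x = G (h x) / real n" for x by (simp add: S_def G_def \<Phi>_def sum_divide_distrib)
  have "\<bar>G (h x) - G (h 0) - real n * (h x - h 0)\<bar> \<le> 1"
  proof (rule monotone_quasi_linear[OF _ _ n])
    show "G y \<le> G z" if "y \<le> z" for y z unfolding G_def using that by (intro sum_mono) simp
    show "G (z + 1 / real n) = G z + 1" for z
    proof -
      have "G (z + 1 / real n) - G z = (\<Sum>q<n. \<xi> (z + real (Suc q) / real n) - \<xi> (z + real q / real n))"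
        unfolding G_def by (simp add: sum_subtractf add_divide_distrib add.assoc)
      also have "\<dots> = \<xi> (z + real n / real n) - \<xi> (z + real 0 / real n)"
        using sum_lessThan_telescope[of "\<lambda>q. \<xi> (z + real q / real n)" n] by simp
      finally show ?thesis using n0 by (simp add: \<xi>_1)
    qed
  qed
  then have "\<bar>(S x - S 0) - (h x - h 0)\<bar> \<le> 1 / real n"
  proof -
    have "(S x - S 0) - (h x - h 0) = (G (h x) - G (h 0) - real n * (h x - h 0)) / real n"
      using n0 by (simp add: GS field_simps)
    then show ?thesis using \<open>\<bar>G (h x) - G (h 0) - real n * (h x - h 0)\<bar> \<le> 1\<close> n0 by (simp add: divide_right_mono)
  qed
  then show ?thesis using uS[of x] uS[of 0] by linarith
qed

end

context flow_scales
begin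

lemma kdiff_h: "kdiff n (\<lambda>x. h x - h 0)"
proof (rule kdiff_limit)
  obtain \<beta> B K where \<beta>: "\<beta> > 0" "B > 0" and reg: "reg n \<beta> B K" using reg_all[of n] by blast
  obtain j where j: "\<And>N v i x. v \<in> words j N \<Longrightarrow> i \<le> n \<Longrightarrow> \<bar>(deriv ^^ i) (A v) x\<bar> \<le> 1"
    using words_jets[OF reg \<beta>] by (meson order_refl order_trans)
  obtain J :: nat where J: "1 / s j \<le> real J" using real_arch_simple by blast
  have "0 < 1 / s j" using s_pos[of j] by simp
  then have J0: "0 < real J" using J by linarith
  obtain L where L: "L \<ge> 1" "\<And>v i x. good v \<Longrightarrow> (\<forall>i\<le>n. \<forall>x. \<bar>(deriv ^^ i) (A v) x\<bar> \<le> 1) \<Longrightarrow> i \<le> n \<Longrightarrow> \<bar>(deriv ^^ i) (A (real J * v)) x\<bar> \<le> L"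
    using A_multiples[of n J] by blast
  obtain E where E: "E \<ge> 1" "\<And>w x. good w \<Longrightarrow> (\<forall>i\<le>n. \<bar>(deriv ^^ i) (A w) x\<bar> \<le> L) \<Longrightarrow> jb n E 1 (deriv (\<Phi> w)) x"
    using \<Phi>_jets[of n L] by blast
  \<comment> \<open>Times in [0, 1] are approximated by J-fold multiples of words of time at most s
    j. Since j and J are fixed, the jets are bounded independently of the precision e.\<close>
  have approx: "\<exists>t. good t \<and> \<bar>t - r\<bar> \<le> e \<and> (\<forall>x. jb n E 1 (deriv (\<Phi> t)) x)" if r: "0 \<le> r" "r \<le> 1" and e: "0 < e" for r e
  proof -
    have rJ: "0 \<le> r / real J" "r / real J \<le> s j"
    proof -
      show "0 \<le> r / real J" using r J0 by simp
      have "r / real J \<le> 1 / real J" using r J0 by (intro divide_right_mono) auto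
      also have "\<dots> \<le> s j" using J J0 s_pos[of j] by (simp add: field_simps)
      finally show "r / real J \<le> s j" .
    qed
    have "0 < e / real J" using e J0 by simp
    from order_tendstoD(2)[OF s_tendsto_0 this] obtain N where N: "\<And>k. k \<ge> N \<Longrightarrow> s k < e / real J"
      unfolding eventually_sequentially by blast
    obtain v where v: "v \<in> words j N" "0 \<le> r / real J - v" "r / real J - v \<le> s (j + N)" using words_approx[OF rJ] by blast
    have gv: "good v" by (rule words_good[OF v(1)])
    have "r / real J - v \<le> e / real J" using v(3) N[of "j + N"] by simp
    then have "real J * (r / real J - v) \<le> e" "0 \<le> real J * (r / real J - v)" using J0 v(2) by (simp_all add: field_simps)
    then have "\<bar>real J * v - r\<bar> \<le> e" using J0 by (simp add: algebra_simps)
    moreover have "\<forall>x. jb n E 1 (deriv (\<Phi> (real J * v))) x"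
    proof
      fix x
      show "jb n E 1 (deriv (\<Phi> (real J * v))) x"
        using L(2)[OF gv] j[OF v(1)] by (intro E(2) good_mult gv) auto
    qed
    ultimately show ?thesis using good_mult[OF gv] by blast
  qed
  show "\<exists>E. \<forall>e>0. \<exists>v. smooth_real v \<and> (\<forall>x. \<bar>v x - (h x - h 0)\<bar> \<le> e) \<and> (\<forall>i x. 1 \<le> i \<longrightarrow> i \<le> Suc n \<longrightarrow> \<bar>(deriv ^^ i) v x\<bar> \<le> E)"
  proof (intro exI[of _ E] allI impI)
    fix e :: real assume e: "0 < e"
    obtain b where b: "b > 0" "\<And>\<alpha>. 0 \<le> \<alpha> \<Longrightarrow> \<alpha> \<le> b \<Longrightarrow> M \<alpha> \<le> e / 4" using M_small[of "e / 4"] e by auto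
    obtain N :: nat where N: "2 / e < real N" using reals_Archimedean2 by blast
    have N0: "0 < N" using N e by (metis divide_pos_pos gr0I less_trans of_nat_0 not_less_iff_gr_or_eq zero_less_numeral)
    have Ne: "1 / real N \<le> e / 2" using N N0 e by (simp add: field_simps)
    have "\<forall>q. \<exists>t. q < N \<longrightarrow> good t \<and> \<bar>t - real q / real N\<bar> \<le> b \<and> (\<forall>x. jb n E 1 (deriv (\<Phi> t)) x)"
    proof
      fix q
      show "\<exists>t. q < N \<longrightarrow> good t \<and> \<bar>t - real q / real N\<bar> \<le> b \<and> (\<forall>x. jb n E 1 (deriv (\<Phi> t)) x)"
        using approx[of "real q / real N" b] b(1) N0 by (cases "q < N") auto
    qed
    then obtain t where t: "\<And>q. q < N \<Longrightarrow> good (t q)" "\<And>q. q < N \<Longrightarrow> \<bar>t q - real q / real N\<bar> \<le> b"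
      "\<And>q x. q < N \<Longrightarrow> jb n E 1 (deriv (\<Phi> (t q))) x" by metis
    define u where "u x = (\<Sum>q<N. (1 / real N) * \<Phi> (t q) x)" for x
    have su: "smooth_real u" unfolding u_def by (intro smooth_sum smooth_cmult goodD t(1)) auto
    show "\<exists>v. smooth_real v \<and> (\<forall>x. \<bar>v x - (h x - h 0)\<bar> \<le> e) \<and> (\<forall>i x. 1 \<le> i \<longrightarrow> i \<le> Suc n \<longrightarrow> \<bar>(deriv ^^ i) v x\<bar> \<le> E)"
    proof (intro exI[of _ "\<lambda>x. u x - u 0"] conjI allI impI)
      show "smooth_real (\<lambda>x. u x - u 0)" using su by (intro smooth_diff smooth_const)
      show "\<bar>(u x - u 0) - (h x - h 0)\<bar> \<le> e" for x
        using h_from_orbit_averages[OF N0 t(2) b(2)[of b], of x] b(1) Ne unfolding u_def by simp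
      fix i x assume i: "1 \<le> i" "i \<le> Suc n"
      then obtain k where k: "i = Suc k" "k \<le> n" by (cases i) auto
      have "(deriv ^^ i) (\<lambda>x. u x - u 0) x = (deriv ^^ i) u x"
        using funpow_deriv_diff[OF su smooth_const, of i "u 0"] i by (simp add: funpow_deriv_const)
      also have "\<dots> = (\<Sum>q<N. (1 / real N) * (deriv ^^ i) (\<Phi> (t q)) x)"
        unfolding u_def using funpow_deriv_sum[of "{..<N}" "\<lambda>q x. (1 / real N) * \<Phi> (t q) x" i] t(1) smooth_cmult[OF goodD(1)]
        by (simp add: funpow_deriv_cmult[OF goodD(1)] del: times_divide_eq_left mult_1)
      also have "\<bar>\<dots>\<bar> \<le> (\<Sum>q<N. (1 / real N) * E)"
      proof (rule order_trans[OF sum_abs sum_mono])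
        fix q assume q: "q \<in> {..<N}"
        have "\<bar>(deriv ^^ i) (\<Phi> (t q)) x\<bar> \<le> E" using jbD[OF t(3), of q k x] q k by (simp add: funpow_swap1)
        then show "\<bar>(1 / real N) * (deriv ^^ i) (\<Phi> (t q)) x\<bar> \<le> (1 / real N) * E"
          by (simp add: abs_mult divide_right_mono)
      qed
      also have "\<dots> = E" using N0 by simp
      finally show "\<bar>(deriv ^^ i) (\<lambda>x. u x - u 0) x\<bar> \<le> E" .
    qed
  qed
qed

theorem conjugacy_smooth: "smooth_real h" "deriv h x > 0"
proof -
  have "smooth_real (\<lambda>x. h x - h 0)" using kdiff_h by (simp add: smooth_iff_kdiff)
  then have "smooth_real (\<lambda>x. (h x - h 0) + h 0)" by (intro smooth_add smooth_const)
  then show sh: "smooth_real h" by simp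
  obtain Q where Q: "Q \<ge> 1" "\<And>\<beta> x. 0 < \<beta> \<Longrightarrow> \<beta> \<le> 1 \<Longrightarrow> m \<beta> x \<le> Q * \<beta>" using m_linear by blast
  have "((\<lambda>t. h t - (1 / Q) * t) has_real_derivative (deriv h x - (1 / Q) * 1)) (at x)"
    by (intro DERIV_diff smooth_has_derivative[OF sh] DERIV_cmult DERIV_ident)
  moreover have "deriv h x - (1 / Q) * 1 \<ge> 0"
  proof (rule mono_on_imp_deriv_nonneg)
    \<comment> \<open>\<open>m_linear\<close> covers times up to 1, so h t - t/Q is shown to
      increase only where h differs from h x by less than 1/2.\<close>
    let ?U = "{t. \<bar>h t - h x\<bar> < 1/2}"
    show "mono_on ?U (\<lambda>t. h t - (1 / Q) * t)"
    proof (rule mono_onI)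
      fix r t assume rt: "r \<in> ?U" "t \<in> ?U" "r \<le> t"
      show "h r - (1 / Q) * r \<le> h t - (1 / Q) * t"
      proof (cases "r = t")
        case False
        then have "0 < h t - h r" using rt by simp
        moreover have "\<bar>h r - h x\<bar> < 1/2" "\<bar>h t - h x\<bar> < 1/2" using rt by simp_all
        then have "h t - h r \<le> 1" by linarith
        ultimately have "m (h t - h r) r \<le> Q * (h t - h r)" by (rule Q(2))
        then have "t - r \<le> Q * (h t - h r)" by (simp add: m_def \<Phi>_def)
        then have "(t - r) / Q \<le> h t - h r" using Q(1) by (simp add: pos_divide_le_eq mult.commute)
        then show ?thesis by (simp add: diff_divide_distrib)
      qed simp
    qed
    have "open ?U"
      by (intro open_Collect_less continuous_intros continuous_h)
    then show "x \<in> interior ?U" by (simp add: interior_open)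
    show "((\<lambda>t. h t - (1 / Q) * t) has_real_derivative (deriv h x - (1 / Q) * 1)) (at x)" by fact
  qed
  ultimately show "deriv h x > 0" using Q(1) by (smt (verit) divide_pos_pos mult_cancel_left2 zero_less_one)
qed

end

section \<open>Denjoy's theorem\<close>

lemma lift_deriv_pos:
  \<comment> \<open>Monotonicity gives F' \<ge> 0, and the chain rule for F^(-1) o F excludes
    0.\<close>
  assumes "circle_diffeo_lift F"
  shows "deriv F x > 0"
proof -
  have F: "smooth_real F" "smooth_real (inv F)" "strict_mono F" "bij F"
    using assms by (auto simp: circle_diffeo_lift_def)
  have "((\<lambda>y. inv F (F y)) has_real_derivative deriv (inv F) (F x) * deriv F x) (at x)"
    by (rule DERIV_chain2[OF smooth_has_derivative[OF F(2)] smooth_has_derivative[OF F(1)]])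
  then have "((\<lambda>y. y) has_real_derivative deriv (inv F) (F x) * deriv F x) (at x)"
    using F(4) by (simp add: bij_is_inj inv_f_f)
  then have "deriv (inv F) (F x) * deriv F x = 1" using DERIV_ident DERIV_unique by blast
  moreover have "deriv F x \<ge> 0"
    using mono_on_imp_deriv_nonneg[of UNIV F "deriv F x" x] smooth_has_derivative[OF F(1)] F(3)
    by (auto simp: strict_mono_mono mono_imp_mono_on)
  ultimately show ?thesis by (cases "deriv F x = 0") auto
qed

lemma funpow_shift_int:
  fixes F :: "real \<Rightarrow> real"
  assumes "\<And>x. F (x + 1) = F x + 1"
  shows "(F ^^ n) (x + of_int p) = (F ^^ n) x + of_int p"
proof (induction n)
  case (Suc n)
  then show ?case using periodic_int[of F 1, OF assms] by simp
qed simp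

lemma funpow_strict_mono: "strict_mono F \<Longrightarrow> strict_mono ((F :: real \<Rightarrow> real) ^^ n)"
  by (induction n) (auto simp: strict_mono_def)

text \<open>The displacement of F^n varies by at most 1 over the line, so a(kn) and k a(n) differ by
  at most k. This gives the Cauchy property with a rate, and with it the uniform deviation
  bound.\<close>

lemma translation_number:
  fixes F :: "real \<Rightarrow> real"
  assumes mono: "strict_mono F" and per: "\<And>x. F (x + 1) = F x + 1"
  shows "(\<lambda>n. (F ^^ n) 0 / real n) \<longlonglongrightarrow> rotation_number F"
    "\<bar>(F ^^ n) x - x - real n * rotation_number F\<bar> \<le> 2"
proof -
  define a where "a n = (F ^^ n) 0" for n
  have disp: "\<bar>(F ^^ n) x - x - a n\<bar> \<le> 1" for n x
  proof -
    let ?p = "\<lfloor>x\<rfloor>"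
    have m: "mono (F ^^ n)" using funpow_strict_mono[OF mono] strict_mono_mono by blast
    have "(F ^^ n) (0 + of_int ?p) \<le> (F ^^ n) x" "(F ^^ n) x \<le> (F ^^ n) (0 + of_int (?p + 1))"
      by (auto intro!: monoD[OF m])
    then have "a n + of_int ?p \<le> (F ^^ n) x" "(F ^^ n) x \<le> a n + of_int (?p + 1)"
      using funpow_shift_int[of F, OF per] by (simp_all only: a_def)
    moreover have "of_int ?p \<le> x" "x < of_int (?p + 1)" by linarith+
    ultimately show ?thesis unfolding abs_le_iff of_int_add of_int_1 by linarith
  qed
  have mult: "\<bar>a (k * n) - real k * a n\<bar> \<le> real k" for k n
  proof (induction k)
    case (Suc k)
    have "a (Suc k * n) = (F ^^ n) (a (k * n))" by (simp add: a_def funpow_add)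
    then have "\<bar>a (Suc k * n) - a (k * n) - a n\<bar> \<le> 1" using disp[of n "a (k * n)"] by simp
    then show ?case using Suc by (simp add: algebra_simps abs_le_iff)
  qed (simp add: a_def)
  have ratio: "\<bar>a (k * n) / real (k * n) - a n / real n\<bar> \<le> 1 / real n" if "0 < k" "0 < n" for k n
  proof -
    have "a (k * n) / real (k * n) - a n / real n = (a (k * n) - real k * a n) / real (k * n)"
      using that by (simp add: field_simps)
    also have "\<bar>\<dots>\<bar> \<le> real k / real (k * n)" unfolding abs_divide abs_of_nat using mult[of k n] by (rule divide_right_mono) simp
    finally show ?thesis using that by simp
  qed
  have close: "\<bar>a k / real k - a n / real n\<bar> \<le> 1 / real n + 1 / real k" if "0 < k" "0 < n" for k n
    using ratio[OF that] ratio[OF that(2,1)] by (simp add: mult.commute abs_le_iff)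
  have "Cauchy (\<lambda>n. a n / real n)"
  proof (rule metric_CauchyI)
    fix e :: real assume e: "0 < e"
    obtain N :: nat where N: "2 / e < real N" using reals_Archimedean2 by blast
    have N0: "0 < real N" using N e by (smt (verit) divide_pos_pos)
    have "1 / real n < e / 2" if "N \<le> n" for n
    proof -
      have "1 / real n \<le> 1 / real N" using that N0 by (intro divide_left_mono) auto
      also have "\<dots> < e / 2" using N N0 e by (simp add: field_simps)
      finally show ?thesis .
    qed
    moreover have "0 < n" if "N \<le> n" for n using that N0 by (cases n) auto
    ultimately show "\<exists>M. \<forall>m\<ge>M. \<forall>n\<ge>M. dist (a m / real m) (a n / real n) < e"
      using close by (intro exI[of _ N]) (smt (verit) dist_real_def field_sum_of_halves)
  qed
  then have "convergent (\<lambda>n. a n / real n)" by (rule Cauchy_convergent)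
  then have lim: "(\<lambda>n. a n / real n) \<longlonglongrightarrow> rotation_number F"
    unfolding rotation_number_def a_def by (simp add: convergent_LIMSEQ_iff)
  then show "(\<lambda>n. (F ^^ n) 0 / real n) \<longlonglongrightarrow> rotation_number F" by (simp add: a_def)
  have "\<bar>a n - real n * rotation_number F\<bar> \<le> 1"
  proof (cases "n = 0")
    case False
    have "\<bar>rotation_number F - a n / real n\<bar> \<le> 1 / real n"
    proof (rule LIMSEQ_le)
      show "(\<lambda>k. \<bar>a k / real k - a n / real n\<bar>) \<longlonglongrightarrow> \<bar>rotation_number F - a n / real n\<bar>" by (intro tendsto_intros lim)
      have "(\<lambda>k. 1 / real n + 1 / real k) \<longlonglongrightarrow> 1 / real n + 0" by (intro tendsto_intros lim_1_over_n)
      then show "(\<lambda>k. 1 / real n + 1 / real k) \<longlonglongrightarrow> 1 / real n" by simp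
      show "\<exists>N. \<forall>k\<ge>N. \<bar>a k / real k - a n / real n\<bar> \<le> 1 / real n + 1 / real k"
        using close False by (intro exI[of _ 1]) auto
    qed
    then have "real n * \<bar>rotation_number F - a n / real n\<bar> \<le> real n * (1 / real n)" by (rule mult_left_mono) simp
    moreover have "real n * \<bar>rotation_number F - a n / real n\<bar> = \<bar>real n * (rotation_number F - a n / real n)\<bar>"
      by (simp add: abs_mult)
    moreover have "real n * (rotation_number F - a n / real n) = real n * rotation_number F - a n"
      using False by (simp add: right_diff_distrib)
    ultimately show ?thesis using False by (simp add: abs_minus_commute)
  qed (simp add: a_def)
  then show "\<bar>(F ^^ n) x - x - real n * rotation_number F\<bar> \<le> 2" using disp[of n x] by linarith
qed

lemma int_multiples_dense:
  fixes \<tau> :: real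
  assumes "\<tau> \<notin> \<rat>" "y < z"
  obtains n :: nat and p :: int where "y < real n * \<tau> + of_int p" "real n * \<tau> + of_int p < z"
proof -
  obtain q k where k: "0 < k" "\<bar>of_int k * \<tau> - of_int q - (y + z) / 2\<bar> < (z - y) / 2"
    by (rule sequence_of_fractional_parts_is_dense[of \<tau> "(z - y) / 2" "(y + z) / 2"]) (use assms in auto)
  have nk: "real (nat k) = of_int k" using k(1) by simp
  have "y < of_int k * \<tau> - of_int q" "of_int k * \<tau> - of_int q < z"
    using k(2) by (simp_all add: abs_less_iff field_simps)
  then show ?thesis using that[of "nat k" "- q"] nk by simp
qed

lemma irrational_multiple: "\<tau> \<notin> \<rat> \<Longrightarrow> of_int j * \<tau> + of_int p = 0 \<Longrightarrow> j = 0" for \<tau> :: real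
proof (rule ccontr)
  assume t: "\<tau> \<notin> \<rat>" and e: "of_int j * \<tau> + of_int p = 0" and "j \<noteq> 0"
  then have "\<tau> = - of_int p / of_int j" by (simp add: field_simps)
  moreover have "(- of_int p / of_int j :: real) \<in> \<rat>" by simp
  ultimately show False using t by simp
qed

lemma dist_int_pos:
  assumes "\<tau> \<notin> \<rat>" "0 < j"
  shows "0 < dist_int (real j * \<tau>)"
proof (rule ccontr)
  assume "\<not> ?thesis"
  then have "real j * \<tau> - of_int (round (real j * \<tau>)) = 0" by (simp add: dist_int_def)
  then have "of_int (int j) * \<tau> + of_int (- round (real j * \<tau>)) = 0" by simp
  from irrational_multiple[OF assms(1) this] show False using assms(2) by simp
qed

text \<open>The least q for which q \<tau> is closer to the integers than e and than all multiples
  up to N beats every smaller denominator: a closest return time, as large as desired.\<close>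

lemma best_denominator:
  assumes "\<tau> \<notin> \<rat>" "0 < e"
  obtains q where "N < q" "dist_int (real q * \<tau>) < e" "\<And>j. 0 < j \<Longrightarrow> j < q \<Longrightarrow> dist_int (real q * \<tau>) < dist_int (real j * \<tau>)"
proof -
  define \<delta> where "\<delta> = Min (insert e ((\<lambda>j. dist_int (real j * \<tau>)) ` {1..N}))"
  have \<delta>0: "0 < \<delta>" unfolding \<delta>_def using assms dist_int_pos by (subst Min_gr_iff) auto
  have \<delta>e: "\<delta> \<le> e" and \<delta>N: "\<And>j. 1 \<le> j \<Longrightarrow> j \<le> N \<Longrightarrow> \<delta> \<le> dist_int (real j * \<tau>)"
    unfolding \<delta>_def by (rule Min_le, simp, simp)+
  have "\<exists>q. 0 < q \<and> dist_int (real q * \<tau>) < \<delta>"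
  proof -
    obtain q k where k: "0 < k" "\<bar>of_int k * \<tau> - of_int q - 0\<bar> < \<delta>"
      by (rule sequence_of_fractional_parts_is_dense[of \<tau> \<delta> 0]) (use assms \<delta>0 in auto)
    then have "dist_int (real (nat k) * \<tau>) < \<delta>" using dist_int_le[of "real (nat k) * \<tau>" q] by simp
    then show ?thesis using k(1) by (intro exI[of _ "nat k"]) auto
  qed
  define q where "q = (LEAST q. 0 < q \<and> dist_int (real q * \<tau>) < \<delta>)"
  have q: "0 < q" "dist_int (real q * \<tau>) < \<delta>" using LeastI_ex[OF \<open>\<exists>q. 0 < q \<and> dist_int (real q * \<tau>) < \<delta>\<close>] by (auto simp: q_def)
  have min: "\<delta> \<le> dist_int (real j * \<tau>)" if "0 < j" "j < q" for j
    using not_less_Least[of j "\<lambda>q. 0 < q \<and> dist_int (real q * \<tau>) < \<delta>"] that by (auto simp: q_def)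
  have "N < q"
  proof (rule ccontr)
    assume "\<not> N < q"
    then show False using \<delta>N[of q] q by simp
  qed
  moreover have "dist_int (real q * \<tau>) < e" using q \<delta>e by linarith
  moreover have "dist_int (real q * \<tau>) < dist_int (real j * \<tau>)" if "0 < j" "j < q" for j
    using min[OF that] q by linarith
  ultimately show ?thesis by (rule that)
qed

text \<open>Comparing the orbit of $0$ with iterates of $x$ on both sides avoids negative powers of $F$.\<close>

lemma semiconjugacy:
  fixes F :: "real \<Rightarrow> real"
  assumes mono: "strict_mono F" and per: "\<And>x. F (x + 1) = F x + 1" and irr: "rotation_number F \<notin> \<rat>"
  obtains H where "mono H" "\<And>x. H (x + 1) = H x + 1" "\<And>x. H (F x) = H x + rotation_number F"
    "continuous_on UNIV H" "surj H"
proof -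
  define \<tau> where "\<tau> = rotation_number F"
  note tn = translation_number(2)[OF mono per, folded \<tau>_def]
  \<comment> \<open>Formally F^(a-b)(0) + p \<le> x: the supremum runs over the positions that the
    orbit points of 0 to the left of x would have under the rotation.\<close>
  define S where "S x = {(real a - real b) * \<tau> + of_int p | a b p. (F ^^ a) 0 + of_int p \<le> (F ^^ b) x}" for x
  define H where "H x = Sup (S x)" for x
  have ne: "S x \<noteq> {}" for x unfolding S_def by (auto intro!: exI[of _ 0] exI[of _ "\<lfloor>x\<rfloor>"])
  have bd: "bdd_above (S x)" for x
  proof (rule bdd_aboveI[of _ "x + 4"])
    fix y assume "y \<in> S x"
    then obtain a b p where y: "y = (real a - real b) * \<tau> + of_int p" "(F ^^ a) 0 + of_int p \<le> (F ^^ b) x" by (auto simp: S_def)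
    then show "y \<le> x + 4" using tn[of a 0] tn[of b x] by (simp add: abs_le_iff algebra_simps)
  qed
  have tr: "H y = H x + k" if "S y = (\<lambda>z. z + k) ` S x" for x y k
  proof (rule antisym)
    show "H y \<le> H x + k" unfolding H_def that using ne bd by (auto intro!: cSup_least cSup_upper)
    have "z \<le> H y - k" if "z \<in> S x" for z
    proof -
      have "z + k \<in> S y" using that \<open>S y = (\<lambda>z. z + k) ` S x\<close> by blast
      then have "z + k \<le> H y" unfolding H_def using bd by (rule cSup_upper)
      then show ?thesis by simp
    qed
    then have "H x \<le> H y - k" unfolding H_def[of x] using ne by (intro cSup_least)
    then show "H x + k \<le> H y" by simp
  qed
  have Hm: "H x \<le> H y" if "x \<le> y" for x y
  proof -
    have "(F ^^ b) x \<le> (F ^^ b) y" for b using that strict_mono_less_eq[OF funpow_strict_mono[OF mono]] by simp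
    then have "S x \<subseteq> S y" unfolding S_def using order_trans by fast
    then show ?thesis unfolding H_def using ne bd by (intro cSup_subset_mono)
  qed
  have H1: "H (x + 1) = H x + 1" for x
  proof (rule tr)
    have sh: "(F ^^ b) (x + 1) = (F ^^ b) x + 1" for b using funpow_shift_int[of F b x 1, OF per] by simp
    show "S (x + 1) = (\<lambda>z. z + 1) ` S x"
    proof (intro equalityI subsetI)
      fix y assume "y \<in> S (x + 1)"
      then obtain a b p where y: "y = (real a - real b) * \<tau> + of_int p" "(F ^^ a) 0 + of_int p \<le> (F ^^ b) x + 1" unfolding S_def sh by blast
      then have "(F ^^ a) 0 + of_int (p - 1) \<le> (F ^^ b) x" by simp
      then have "(real a - real b) * \<tau> + of_int (p - 1) \<in> S x" unfolding S_def by blast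
      then show "y \<in> (\<lambda>z. z + 1) ` S x" using y by (intro image_eqI[of _ _ "(real a - real b) * \<tau> + of_int (p - 1)"]) auto
    next
      fix y assume "y \<in> (\<lambda>z. z + 1) ` S x"
      then obtain a b p where y: "y = (real a - real b) * \<tau> + of_int p + 1" "(F ^^ a) 0 + of_int p \<le> (F ^^ b) x" unfolding S_def by auto
      then have "y = (real a - real b) * \<tau> + of_int (p + 1)" "(F ^^ a) 0 + of_int (p + 1) \<le> (F ^^ b) (x + 1)" by (simp_all add: sh)
      then show "y \<in> S (x + 1)" unfolding S_def by blast
    qed
  qed
  have HF: "H (F x) = H x + \<tau>" for x
  proof (rule tr)
    have sh: "(F ^^ b) (F x) = (F ^^ Suc b) x" for b by (simp add: funpow_swap1)
    show "S (F x) = (\<lambda>z. z + \<tau>) ` S x"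
    proof (intro equalityI subsetI)
      fix y assume "y \<in> S (F x)"
      then obtain a b p where y: "y = (real a - real b) * \<tau> + of_int p" "(F ^^ a) 0 + of_int p \<le> (F ^^ Suc b) x" unfolding S_def sh by blast
      then have "(real a - real (Suc b)) * \<tau> + of_int p \<in> S x" unfolding S_def by blast
      then show "y \<in> (\<lambda>z. z + \<tau>) ` S x" using y(1)
        by (intro image_eqI[of _ _ "(real a - real (Suc b)) * \<tau> + of_int p"]) (auto simp: algebra_simps)
    next
      fix y assume "y \<in> (\<lambda>z. z + \<tau>) ` S x"
      then obtain a b p where y: "y = (real a - real b) * \<tau> + of_int p + \<tau>" "(F ^^ a) 0 + of_int p \<le> (F ^^ b) x" unfolding S_def by auto
      have "F ((F ^^ a) 0 + of_int p) \<le> F ((F ^^ b) x)" using y(2) strict_mono_less_eq[OF mono] by simp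
      then have "(F ^^ Suc a) 0 + of_int p \<le> (F ^^ b) (F x)" using periodic_int[of F 1, OF per] by (simp add: funpow_swap1)
      moreover have "y = (real (Suc a) - real b) * \<tau> + of_int p" using y(1) by (simp add: algebra_simps)
      ultimately show "y \<in> S (F x)" unfolding S_def by blast
    qed
  qed
  have Hn: "H ((F ^^ n) x) = H x + real n * \<tau>" for n x
    by (induction n) (auto simp: HF algebra_simps)
  have Hp: "H (x + of_int p) = H x + of_int p" for x p using periodic_int[of H 1, OF H1] by simp
  \<comment> \<open>The values on the orbit of 0 are dense already, and a monotone function with
    dense image has no jumps.\<close>
  have dense: "\<exists>x. y < H x \<and> H x < z" if yz: "y < z" for y z
  proof -
    obtain n p where "y - H 0 < real n * \<tau> + of_int p" "real n * \<tau> + of_int p < z - H 0"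
      by (rule int_multiples_dense[of \<tau> "y - H 0" "z - H 0"]) (use irr yz in \<open>auto simp: \<tau>_def\<close>)
    then show ?thesis by (intro exI[of _ "(F ^^ n) 0 + of_int p"]) (auto simp: Hn Hp)
  qed
  have lt: "x < y" if "H x < H y" for x y using Hm[of y x] that by linarith
  have "isCont H x" for x
    unfolding continuous_at_eps_delta
  proof (intro allI impI)
    fix e :: real assume e: "0 < e"
    obtain y1 y2 where y: "H x - e < H y1" "H y1 < H x" "H x < H y2" "H y2 < H x + e"
      using dense[of "H x - e" "H x"] dense[of "H x" "H x + e"] e by auto
    show "\<exists>d>0. \<forall>x'. dist x' x < d \<longrightarrow> dist (H x') (H x) < e"
    proof (intro exI[of _ "min (x - y1) (y2 - x)"] conjI allI impI)
      show "0 < min (x - y1) (y2 - x)" using lt y by auto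
      fix x' assume "dist x' x < min (x - y1) (y2 - x)"
      then have "y1 \<le> x'" "x' \<le> y2" by (auto simp: dist_real_def)
      then have "H y1 \<le> H x'" "H x' \<le> H y2" by (auto intro: Hm)
      then show "dist (H x') (H x) < e" using y by (auto simp: dist_real_def abs_less_iff)
    qed
  qed
  then have cont: "continuous_on UNIV H" by (simp add: continuous_at_imp_continuous_on)
  have "\<exists>x. H x = y" for y
  proof -
    define p where "p = \<lfloor>y - H 0\<rfloor>"
    have "H (0 + of_int p) \<le> y" "y \<le> H (0 + of_int (p + 1))" unfolding Hp p_def by linarith+
    then show ?thesis using IVT'[of H "0 + of_int p" y "0 + of_int (p + 1)"] continuous_on_subset[OF cont] by auto
  qed
  then have "surj H" by (metis surjI)
  then show ?thesis using that[of H] Hm H1 HF cont by (auto simp: mono_def \<tau>_def)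
qed

lemma funpow_smooth_deriv:
  fixes F :: "real \<Rightarrow> real"
  assumes "smooth_real F" "\<And>x. 0 < deriv F x"
  shows "smooth_real (F ^^ n)" "deriv (F ^^ n) x = exp (\<Sum>i<n. ln (deriv F ((F ^^ i) x)))"
proof -
  have "smooth_real (F ^^ n) \<and> (\<forall>x. deriv (F ^^ n) x = exp (\<Sum>i<n. ln (deriv F ((F ^^ i) x))))"
  proof (induction n)
    case 0
    have "F ^^ 0 = (\<lambda>x. x)" by auto
    then show ?case by (simp only: smooth_ident) simp
  next
    case (Suc n)
    have e: "F ^^ Suc n = (\<lambda>x. F ((F ^^ n) x))" by auto
    have "smooth_real (F ^^ Suc n)" unfolding e using smooth_compose[of F "F ^^ n"] assms(1) Suc by simp
    moreover have "deriv (F ^^ Suc n) x = exp (\<Sum>i<Suc n. ln (deriv F ((F ^^ i) x)))" for x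
    proof -
      have "deriv (F ^^ Suc n) = (\<lambda>x. deriv F ((F ^^ n) x) * deriv (F ^^ n) x)"
        unfolding e by (rule deriv_compose_smooth) (use assms(1) Suc in auto)
      then show ?thesis using Suc assms(2) by (simp add: exp_add)
    qed
    ultimately show ?case by blast
  qed
  then show "smooth_real (F ^^ n)" "deriv (F ^^ n) x = exp (\<Sum>i<n. ln (deriv F ((F ^^ i) x)))" by auto
qed

lemma smooth_lipschitz:
  assumes "smooth_real w" "\<And>x. \<bar>deriv w x\<bar> \<le> V"
  shows "\<bar>w x - w y\<bar> \<le> V * \<bar>x - y\<bar>"
proof (cases "y \<le> x")
  case True
  then show ?thesis using smooth_diff_le[OF assms(1) True assms(2)] by simp
next
  case False
  then have "x \<le> y" by simp
  then show ?thesis using smooth_diff_le[OF assms(1) \<open>x \<le> y\<close> assms(2)] by (simp add: abs_minus_commute)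
qed

lemma smooth_periodic_lipschitz:
  assumes "smooth_real w" "\<And>x. w (x + 1) = w x"
  obtains V where "0 \<le> V" "\<And>x y. \<bar>w x - w y\<bar> \<le> V * \<bar>x - y\<bar>"
proof -
  have p: "deriv w (x + 1) = deriv w x" for x using deriv_periodic[of w 0] assms(2) by simp
  obtain V where V: "\<And>x. \<bar>deriv w x\<bar> \<le> V"
    using periodic_bounded[of "deriv w"] smooth_continuous_on[OF smooth_deriv[OF assms(1)]] p by blast
  have "\<bar>w x - w y\<bar> \<le> V * \<bar>x - y\<bar>" for x y by (rule smooth_lipschitz[OF assms(1) V])
  moreover have "0 \<le> V" using V[of 0] by linarith
  ultimately show ?thesis using that by blast
qed

text \<open>If $H$ collapsed $[a, b]$, then $F^q(a, b)$ and $F^{-q}(a, b)$ would have lengths whose product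
  stays bounded below along best denominators $q$, because the segments joining $F^i x$ to $F^{i-q} y$
  for $i < q$ are disjoint modulo 1; but the lengths of the disjoint intervals $F^n(a, b)$ tend to 0.\<close>

lemma denjoy_injective:
  assumes F: "circle_diffeo_lift F" and irr: "\<tau> \<notin> \<rat>"
    and Hm: "mono H" and H1: "\<And>x. H (x + 1) = H x + (1 :: real)" and HF: "\<And>x. H (F x) = H x + \<tau>"
  shows "inj H"
proof (rule ccontr)
  assume "\<not> inj H"
  then obtain a b where ab: "a < b" "H a = H b" unfolding inj_def by (metis linorder_neq_iff)
  have Fs: "smooth_real F" and Fm: "strict_mono F" and Fb: "bij F" and F1: "\<And>x. F (x + 1) = F x + 1"
    using F by (auto simp: circle_diffeo_lift_def)
  have d0: "0 < deriv F x" for x by (rule lift_deriv_pos[OF F])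
  define w where "w x = ln (deriv F x)" for x
  have ws: "smooth_real w" unfolding w_def by (intro smooth_ln smooth_deriv Fs d0)
  have w1: "w (x + 1) = w x" for x unfolding w_def using deriv_periodic[of F 1] F1 by simp
  have wp: "w (x + of_int p) = w x" for x p using periodic_int[of w 0] w1 by simp
  obtain V where V: "0 \<le> V" "\<And>x y. \<bar>w x - w y\<bar> \<le> V * \<bar>x - y\<bar>"
    using smooth_periodic_lipschitz[of w] ws w1 by blast
  have Hn: "H ((F ^^ n) x) = H x + real n * \<tau>" for n x
    by (induction n) (auto simp: HF algebra_simps)
  have Hp: "H (x + of_int p) = H x + of_int p" for x p using periodic_int[of H 1, OF H1] by simp
  have lt: "x < y" if "H x < H y" for x y
    using monoD[OF Hm, of y x] that by (meson linorder_not_less)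
  have Fn: "(F ^^ n) x < (F ^^ n) y \<longleftrightarrow> x < y" for n x y
    using strict_mono_less[OF funpow_strict_mono[OF Fm]] .
  \<comment> \<open>H takes a single value on each of these intervals, and the values are distinct
    modulo 1, so the intervals are disjoint modulo 1.\<close>
  have "(\<Sum>n<N. (F ^^ n) b - (F ^^ n) a) \<le> 1" for N
  proof (rule packing_mod1)
    fix i j and p :: int assume ij: "i \<in> {..<N}" "j \<in> {..<N}" "i \<noteq> j \<or> p \<noteq> 0"
    have "real i * \<tau> + of_int p \<noteq> real j * \<tau>"
    proof
      assume e: "real i * \<tau> + of_int p = real j * \<tau>"
      then have "of_int (int i - int j) * \<tau> + of_int p = 0" by (simp add: algebra_simps)
      then have "int i - int j = 0" by (rule irrational_multiple[OF irr])
      then show False using e ij(3) by simp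
    qed
    then have "H ((F ^^ i) b + of_int p) < H ((F ^^ j) a) \<or> H ((F ^^ j) b) < H ((F ^^ i) a + of_int p)"
      by (simp add: Hn Hp ab(2)) linarith
    then show "(F ^^ i) b + of_int p \<le> (F ^^ j) a \<or> (F ^^ j) b \<le> (F ^^ i) a + of_int p"
      using lt by (meson less_imp_le)
  qed (use ab Fn in auto)
  then have "summable (\<lambda>n. (F ^^ n) b - (F ^^ n) a)"
    using Fn ab by (intro bounded_imp_summable[of _ 1]) (simp_all only: flip: lessThan_Suc_atMost, simp add: less_imp_le)
  then have "(\<lambda>n. (F ^^ n) b - (F ^^ n) a) \<longlonglongrightarrow> 0" by (rule summable_LIMSEQ_zero)
  then have "\<forall>\<^sub>F n in sequentially. (F ^^ n) b - (F ^^ n) a < exp (- V) * (b - a)^2"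
    using ab by (intro order_tendstoD) auto
  then obtain N where N: "\<And>n. N \<le> n \<Longrightarrow> (F ^^ n) b - (F ^^ n) a < exp (- V) * (b - a)^2"
    unfolding eventually_sequentially by blast
  obtain q where q: "N < q" "\<And>j. 0 < j \<Longrightarrow> j < q \<Longrightarrow> dist_int (real q * \<tau>) < dist_int (real j * \<tau>)"
    using best_denominator[OF irr zero_less_one] by blast
  have "surj (F ^^ q)" using bij_is_surj[OF bij_fn[OF Fb]] .
  \<comment> \<open>The interval (a', b') plays the role of F^(-q)(a, b); H collapses it too, so its
    length is at most 1.\<close>
  then obtain a' b' where "a = (F ^^ q) a'" "b = (F ^^ q) b'" using surjD[of "F ^^ q"] by blast
  then have a': "(F ^^ q) a' = a" "(F ^^ q) b' = b" by simp_all
  have Ha': "H a' = H a - real q * \<tau>" "H b' = H a - real q * \<tau>"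
    using Hn[of q a'] Hn[of q b'] a' ab(2) by simp_all
  have a'b': "a' < b'" using Fn[of q a' b'] a' ab(1) by simp
  have "b' - a' \<le> 1" using lt[of b' "a' + 1"] Ha' H1[of a'] by simp
  have Fq: "smooth_real (F ^^ q)" by (rule funpow_smooth_deriv(1)[OF Fs d0])
  have Dq: "deriv (F ^^ q) z = exp (\<Sum>i<q. w ((F ^^ i) z))" for z
    unfolding w_def by (rule funpow_smooth_deriv(2)[OF Fs d0])
  obtain x where x: "a < x" "x < b" "(F ^^ q) b - (F ^^ q) a = (b - a) * deriv (F ^^ q) x"
    using smooth_mvt[OF Fq ab(1)] by blast
  obtain y where y: "a' < y" "y < b'" "b - a = (b' - a') * deriv (F ^^ q) y"
    using smooth_mvt[OF Fq a'b'] unfolding a' by blast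
  have "H x = H a" using monoD[OF Hm, of a x] monoD[OF Hm, of x b] x ab by simp
  have "H y = H a - real q * \<tau>" using monoD[OF Hm, of a' y] monoD[OF Hm, of y b'] y Ha' by simp
  obtain p where p: "dist_int (real q * \<tau>) = \<bar>real q * \<tau> + of_int p\<bar>" using dist_int_attained by blast
  \<comment> \<open>With this p the points X i and Y i are, in H, as far apart as q \<tau> is from
    the integers, which is less than the distance modulo 1 between different multiples i \<tau> with
    i < q.\<close>
  define X Y where "X i = (F ^^ i) x" and "Y i = (F ^^ i) y - of_int p" for i
  have HX: "H (X i) = H a + real i * \<tau>" for i by (simp add: X_def Hn \<open>H x = H a\<close>)
  have HY: "H (Y i) = H a + real i * \<tau> - (real q * \<tau> + of_int p)" for i
    using Hp[of "(F ^^ i) y" "- p"] by (simp add: Y_def Hn \<open>H y = H a - real q * \<tau>\<close>)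
  have \<epsilon>0: "0 < dist_int (real q * \<tau>)" using dist_int_pos[OF irr, of q] q(1) by simp
  have XY: "X i \<noteq> Y i" for i
  proof
    assume "X i = Y i"
    then have "H (X i) = H (Y i)" by simp
    then show False using \<epsilon>0 p by (simp add: HX HY)
  qed
  have lessXY: "min (X i) (Y i) < max (X i) (Y i)" for i using XY[of i] by linarith
  have "(\<Sum>i<q. max (X i) (Y i) - min (X i) (Y i)) \<le> 1"
  proof (rule packing_mod1)
    fix i j and r :: int assume ij: "i \<in> {..<q}" "j \<in> {..<q}" "i \<noteq> j \<or> r \<noteq> 0"
    have far: "dist_int (real q * \<tau>) < \<bar>real i * \<tau> + of_int r - real j * \<tau>\<bar>"
    proof (cases "i = j")
      case True
      have "dist_int (real q * \<tau>) \<le> 1 / 2" unfolding dist_int_def using of_int_round_abs_le[of "real q * \<tau>"] by (simp add: abs_minus_commute)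
      then show ?thesis using ij True by simp
    next
      case False
      define n where "n = (if i < j then j - i else i - j)"
      have "dist_int (real q * \<tau>) < dist_int (real n * \<tau>)" using False ij by (intro q) (auto simp: n_def)
      also have "\<dots> \<le> \<bar>real n * \<tau> - of_int (if i < j then r else - r)\<bar>" by (rule dist_int_le)
      also have "\<dots> = \<bar>real i * \<tau> + of_int r - real j * \<tau>\<bar>"
        using False by (auto simp: n_def of_nat_diff algebra_simps)
      finally show ?thesis .
    qed
    let ?d = "real q * \<tau> + of_int p"
    have sep: "X i + of_int r < X j \<and> X i + of_int r < Y j \<and> Y i + of_int r < X j \<and> Y i + of_int r < Y j"
      if "real i * \<tau> + of_int r + \<bar>?d\<bar> < real j * \<tau>"
      by (intro conjI; rule lt; unfold HX HY Hp; use that in linarith)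
    have sep': "X j < X i + of_int r \<and> Y j < X i + of_int r \<and> X j < Y i + of_int r \<and> Y j < Y i + of_int r"
      if "real j * \<tau> + \<bar>?d\<bar> < real i * \<tau> + of_int r"
      by (intro conjI; rule lt; unfold HX HY Hp; use that in linarith)
    have "real i * \<tau> + of_int r + \<bar>?d\<bar> < real j * \<tau> \<or> real j * \<tau> + \<bar>?d\<bar> < real i * \<tau> + of_int r"
      using far p by linarith
    then show "max (X i) (Y i) + of_int r \<le> min (X j) (Y j) \<or> max (X j) (Y j) \<le> min (X i) (Y i) + of_int r"
      using sep sep' by (auto simp: max_def min_def)
  qed (rule finite_lessThan, rule lessXY)
  moreover have "max (X i) (Y i) - min (X i) (Y i) = \<bar>X i - Y i\<bar>" for i by (auto simp: max_def min_def)
  ultimately have XY1: "(\<Sum>i<q. \<bar>X i - Y i\<bar>) \<le> 1" by simp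
  have "\<bar>(\<Sum>i<q. w ((F ^^ i) y)) - (\<Sum>i<q. w ((F ^^ i) x))\<bar> = \<bar>\<Sum>i<q. w (X i) - w (Y i)\<bar>"
    using wp[of "(F ^^ i) y" "- p" for i] by (simp add: X_def Y_def sum_subtractf abs_minus_commute)
  also have "\<dots> \<le> (\<Sum>i<q. V * \<bar>X i - Y i\<bar>)" by (intro order_trans[OF sum_abs] sum_mono V)
  also have "\<dots> = V * (\<Sum>i<q. \<bar>X i - Y i\<bar>)" by (simp add: sum_distrib_left)
  also have "\<dots> \<le> V" using mult_left_mono[OF XY1 V(1)] by simp
  finally have "(\<Sum>i<q. w ((F ^^ i) y)) - V \<le> (\<Sum>i<q. w ((F ^^ i) x))" by linarith
  then have "exp ((\<Sum>i<q. w ((F ^^ i) y)) + - V) \<le> deriv (F ^^ q) x" unfolding Dq by simp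
  then have D: "deriv (F ^^ q) y * exp (- V) \<le> deriv (F ^^ q) x" unfolding exp_add Dq .
  \<comment> \<open>The two mean values combine to show that the lengths of F^q(a, b) and F^(-q)(a,
    b) have product at least e^(-V) (b - a)^2; the second length is at most 1, against the choice of
    N.\<close>
  have "b - a \<le> 1 * deriv (F ^^ q) y" unfolding y(3) using \<open>b' - a' \<le> 1\<close> by (intro mult_right_mono) (auto simp: Dq)
  then have "(b - a) * exp (- V) \<le> deriv (F ^^ q) y * exp (- V)" by (intro mult_right_mono) auto
  then have "(b - a) * exp (- V) \<le> deriv (F ^^ q) x" using D by linarith
  then have "(b - a) * ((b - a) * exp (- V)) \<le> (b - a) * deriv (F ^^ q) x" using ab by (intro mult_left_mono) auto
  then have "exp (- V) * (b - a)^2 \<le> (F ^^ q) b - (F ^^ q) a" unfolding x(3) by (simp add: power2_eq_square mult_ac)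
  then show False using N[of q] q(1) by simp
qed

section \<open>Arithmetic of the rotation numbers\<close>

lemma dist_int_add_int: "dist_int (x + of_int p) = dist_int x"
proof -
  have "dist_int (y + of_int n) \<le> dist_int y" for y n
  proof -
    obtain k where "dist_int y = \<bar>y + of_int k\<bar>" using dist_int_attained by blast
    then show ?thesis using dist_int_le[of "y + of_int n" "n - k"] by simp
  qed
  from this[of x p] this[of "x + of_int p" "- p"] show ?thesis by simp
qed

lemma dist_int_mult_le: "dist_int (real n * x) \<le> real n * dist_int x"
proof -
  obtain k where k: "dist_int x = \<bar>x + of_int k\<bar>" using dist_int_attained by blast
  have "dist_int (real n * x) \<le> \<bar>real n * x - of_int (- int n * k)\<bar>" by (rule dist_int_le)
  also have "\<dots> = \<bar>real n * (x + of_int k)\<bar>" by (simp add: algebra_simps)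
  finally show ?thesis by (simp add: k abs_mult)
qed

lemma common_denominator:
  fixes \<theta> :: "'a \<Rightarrow> real"
  assumes "finite I" "\<And>i. i \<in> I \<Longrightarrow> \<theta> i \<in> \<rat>"
  shows "\<exists>k>0. \<forall>i\<in>I. real k * \<theta> i \<in> \<int>"
  using assms
proof (induction I rule: finite_induct)
  case empty
  then show ?case by (intro exI[of _ 1]) auto
next
  case (insert j I)
  then obtain k where k: "0 < k" "\<forall>i\<in>I. real k * \<theta> i \<in> \<int>" by auto
  have "\<theta> j \<in> \<rat>" using insert by simp
  then obtain a b where ab: "0 < b" "\<theta> j = of_int a / of_int b"
    by (rule Rats_cases')
  then have b: "real (nat b) * \<theta> j = of_int a" by simp
  have "real (k * nat b) * \<theta> i \<in> \<int>" if "i \<in> insert j I" for i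
  proof (cases "i = j")
    case True
    have e: "real (k * nat b) * \<theta> i = real k * of_int a" unfolding b[symmetric] by (simp add: True)
    show ?thesis unfolding e by (intro Ints_mult) auto
  next
    case False
    have "real (k * nat b) * \<theta> i = real (nat b) * (real k * \<theta> i)" by (simp add: mult_ac)
    then show ?thesis using False that k(2) by (simp only:) (auto intro!: Ints_mult)
  qed
  then show ?case using k(1) ab(1) by (intro exI[of _ "k * nat b"]) auto
qed

text \<open>For each $i$ let $L_i \le 9/\alpha$ be the first denominator with $\|L_i c_i\| \le \alpha/8$;
  the Diophantine condition at the product of the $L_i$ bounds some $\|L_i c_i\|$ from below.\<close>

lemma diophantine_step:
  fixes c :: "nat \<Rightarrow> real"
  assumes \<nu>: "0 < \<nu>" and C: "0 < C"
    and dio: "\<And>k. 0 < k \<Longrightarrow> \<exists>i<d. C * real k powr (- \<nu>) \<le> dist_int (real k * c i)"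
  obtains P \<alpha>s where "1 \<le> P" "0 < \<alpha>s" "\<alpha>s \<le> 1"
    "\<And>\<alpha>. 0 < \<alpha> \<Longrightarrow> \<alpha> < \<alpha>s \<Longrightarrow> \<exists>i<d. \<exists>l. dist_int (real l * c i) \<le> \<alpha> / 8 \<and> \<alpha> ^ P \<le> dist_int (real l * c i) \<and>
       (\<forall>j. 1 \<le> j \<longrightarrow> j < l \<longrightarrow> \<alpha> / 8 \<le> dist_int (real j * c i))"
proof -
  \<comment> \<open>With k \<le> (9/\<alpha>)^d, the distance of k c_i from the integers is at most
    k times that of L_i c_i; the latter is thus at least C k^(-(\<nu>+1)), of order
    \<alpha>^D.\<close>
  define D where "D = real d * (\<nu> + 1)"
  define n where "n = nat \<lceil>D\<rceil>"
  \<comment> \<open>Below \<open>\<alpha>s\<close> one more power of \<alpha> absorbs the constant C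
    9^(-D), hence the exponent n + 1.\<close>
  define \<alpha>s where "\<alpha>s = min 1 (C * 9 powr (- D))"
  have D0: "0 \<le> D" using \<nu> by (simp add: D_def)
  show ?thesis
  proof (rule that[of "Suc n" \<alpha>s])
    show "0 < \<alpha>s" "\<alpha>s \<le> 1" using C by (simp_all add: \<alpha>s_def)
    fix \<alpha> :: real assume \<alpha>: "0 < \<alpha>" "\<alpha> < \<alpha>s"
    then have \<alpha>1: "\<alpha> \<le> 1" by (simp add: \<alpha>s_def)
    have ex: "\<exists>l. 0 < l \<and> real l \<le> 9 / \<alpha> \<and> dist_int (real l * c i) \<le> \<alpha> / 8" for i
    proof -
      \<comment> \<open>Dirichlet's theorem at N yields a multiple within 1/N \<le> \<alpha>/8 of an
        integer, and N \<le> 8/\<alpha> + 1 \<le> 9/\<alpha>.\<close>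
      define N where "N = nat \<lceil>8 / \<alpha>\<rceil>"
      have N: "8 / \<alpha> \<le> real N" "real N \<le> 8 / \<alpha> + 1" unfolding N_def using \<alpha> by (simp_all add: of_nat_ceiling) 
      have N0: "0 < N" using N(1) \<alpha> by (cases N) (auto simp: divide_le_0_iff)
      obtain p k where k: "0 < k" "k \<le> int N" "\<bar>of_int k * c i - of_int p\<bar> < 1 / real N"
        using Dirichlet_approx[OF N0, of "c i"] by blast
      have "1 / real N \<le> \<alpha> / 8" using N(1) N0 \<alpha>(1) by (simp add: field_simps)
      then have "dist_int (real (nat k) * c i) \<le> \<alpha> / 8"
        using dist_int_le[of "real (nat k) * c i" p] k by simp
      moreover have "real (nat k) \<le> 9 / \<alpha>"
      proof -
        have "real (nat k) \<le> real N" using k by simp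
        also have "\<dots> \<le> 8 / \<alpha> + 1 / \<alpha>" using N(2) \<alpha>(1) \<alpha>1 by (simp add: field_simps)
        finally show ?thesis by (simp add: add_divide_distrib[symmetric])
      qed
      ultimately show ?thesis using k(1) by (intro exI[of _ "nat k"]) auto
    qed
    have "\<exists>l. (0 < l \<and> dist_int (real l * c i) \<le> \<alpha> / 8) \<and> real l \<le> 9 / \<alpha> \<and>
        (\<forall>j. 1 \<le> j \<longrightarrow> j < l \<longrightarrow> \<alpha> / 8 \<le> dist_int (real j * c i))" for i
    proof -
      let ?Q = "\<lambda>l. 0 < l \<and> dist_int (real l * c i) \<le> \<alpha> / 8"
      obtain l where l: "?Q l" "real l \<le> 9 / \<alpha>" using ex by blast
      have "?Q (Least ?Q)" using l(1) by (rule LeastI)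
      moreover have "real (Least ?Q) \<le> 9 / \<alpha>"
      proof -
        have "Least ?Q \<le> l" using l(1) by (rule Least_le)
        then show ?thesis using l(2) by linarith
      qed
      moreover have "\<alpha> / 8 \<le> dist_int (real j * c i)" if "1 \<le> j" "j < Least ?Q" for j
      proof -
        have "\<not> ?Q j" using that(2) by (rule not_less_Least)
        then show ?thesis using that(1) by auto
      qed
      ultimately show ?thesis by blast
    qed
    then obtain L where L: "\<And>i. 0 < L i" "\<And>i. dist_int (real (L i) * c i) \<le> \<alpha> / 8" "\<And>i. real (L i) \<le> 9 / \<alpha>"
      "\<And>i j. 1 \<le> j \<Longrightarrow> j < L i \<Longrightarrow> \<alpha> / 8 \<le> dist_int (real j * c i)" by metis
    define k where "k = (\<Prod>i<d. L i)"
    have k0: "0 < k" unfolding k_def using L(1) by (intro prod_pos) auto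
    have kle: "real k \<le> (9 / \<alpha>) ^ d"
    proof -
      have "real k = (\<Prod>i<d. real (L i))" by (simp add: k_def)
      also have "\<dots> \<le> (\<Prod>i<d. 9 / \<alpha>)" using L(3) by (intro prod_mono) auto
      finally show ?thesis by simp
    qed
    obtain i where i: "i < d" "C * real k powr (- \<nu>) \<le> dist_int (real k * c i)" using dio[OF k0] by blast
    let ?\<delta> = "dist_int (real (L i) * c i)"
    have \<delta>0: "0 \<le> ?\<delta>" by (simp add: dist_int_def)
    have "L i dvd k" unfolding k_def using i by (intro dvd_prodI) auto
    then obtain n' where n': "k = L i * n'" by (auto simp: dvd_def)
    have "dist_int (real k * c i) = dist_int (real n' * (real (L i) * c i))" by (simp add: n' mult_ac)
    also have "\<dots> \<le> real n' * ?\<delta>" by (rule dist_int_mult_le)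
    also have "\<dots> \<le> real k * ?\<delta>"
    proof (rule mult_right_mono[OF _ \<delta>0])
      have "n' \<le> k" using n' L(1)[of i] by (cases "L i") auto
      then show "real n' \<le> real k" by simp
    qed
    finally have "C * real k powr (- \<nu>) \<le> real k * ?\<delta>" using i(2) by linarith
    then have "real k powr (-1) * (C * real k powr (- \<nu>)) \<le> real k powr (-1) * (real k * ?\<delta>)"
      by (rule mult_left_mono) simp
    moreover have "real k powr (-1) * (real k * ?\<delta>) = ?\<delta>" using k0 by (simp add: powr_minus field_simps)
    moreover have "real k powr (-1) * (C * real k powr (- \<nu>)) = C * real k powr (- (\<nu> + 1))"
    proof -
      have "- (\<nu> + 1) = -1 + - \<nu>" by simp
      then show ?thesis by (simp only: powr_add mult.left_commute)
    qed
    ultimately have 1: "C * real k powr (- (\<nu> + 1)) \<le> ?\<delta>" by simp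
    have "((9 / \<alpha>) ^ d) powr (- (\<nu> + 1)) \<le> real k powr (- (\<nu> + 1))"
      using kle k0 \<nu> by (intro powr_mono2') auto
    moreover have "((9 / \<alpha>) ^ d) powr (- (\<nu> + 1)) = 9 powr (- D) * \<alpha> powr D"
    proof -
      have "((9 / \<alpha>) ^ d) powr (- (\<nu> + 1)) = (9 / \<alpha>) powr (- D)"
        using \<alpha> by (simp add: powr_realpow[symmetric] powr_powr D_def algebra_simps)
      also have "\<dots> = 9 powr (- D) * \<alpha> powr D"
        using \<alpha> by (simp add: powr_divide powr_minus_divide)
      finally show ?thesis .
    qed
    ultimately have "C * (9 powr (- D) * \<alpha> powr D) \<le> C * real k powr (- (\<nu> + 1))"
      using C by (intro mult_left_mono) auto
    then have 2: "(C * 9 powr (- D)) * \<alpha> powr D \<le> ?\<delta>" using 1 by (simp add: mult.assoc)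
    have "\<alpha> ^ Suc n = \<alpha> * \<alpha> powr real n" using \<alpha> by (simp add: powr_realpow)
    also have "\<dots> \<le> \<alpha> * \<alpha> powr D"
    proof (rule mult_left_mono)
      have "D \<le> real n" unfolding n_def by linarith
      then show "\<alpha> powr real n \<le> \<alpha> powr D" using \<alpha> \<alpha>1 by (intro powr_mono') auto
    qed (use \<alpha> in simp)
    also have "\<dots> \<le> (C * 9 powr (- D)) * \<alpha> powr D" using \<alpha> by (intro mult_right_mono) (auto simp: \<alpha>s_def)
    finally have "\<alpha> ^ Suc n \<le> ?\<delta>" using 2 by linarith
    then show "\<exists>i<d. \<exists>l. dist_int (real l * c i) \<le> \<alpha> / 8 \<and> \<alpha> ^ Suc n \<le> dist_int (real l * c i) \<and>
       (\<forall>j. 1 \<le> j \<longrightarrow> j < l \<longrightarrow> \<alpha> / 8 \<le> dist_int (real j * c i))"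
      using i(1) L(2,4) by blast
  qed simp
qed

text \<open>From a point $ic + p$ with $i < q$ one reaches another such point strictly to the right, by
  adding $q'c$ or $(q' - q)c$; both displacements are less than $2\delta$.\<close>

lemma orbit_gaps_aux:
  assumes "0 < q'" "q' < q" and \<delta>: "real q' * c + of_int p' = \<delta>" "0 < \<delta>" and \<epsilon>: "\<bar>real q * c + of_int p''\<bar> < \<delta>"
  shows "\<exists>i<q. \<exists>p. \<bar>r - real i * c - of_int p\<bar> \<le> 2 * \<delta>"
proof -
  define X where "X i = real i * c + of_int \<lfloor>r - real i * c\<rfloor>" for i
  have Xr: "X i \<le> r" for i unfolding X_def by linarith
  have Xmax: "real i * c + of_int p \<le> X i" if "real i * c + of_int p \<le> r" for i p
  proof -
    have "of_int p \<le> r - real i * c" using that by linarith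
    then have "p \<le> \<lfloor>r - real i * c\<rfloor>" by (simp add: le_floor_iff)
    then show ?thesis unfolding X_def by simp
  qed
  have ne: "X ` {..<q} \<noteq> {}" "finite (X ` {..<q})" using assms by auto
  have "Max (X ` {..<q}) \<in> X ` {..<q}" using ne by (intro Max_in)
  then obtain i where i: "i < q" "Max (X ` {..<q}) = X i" by auto
  have max: "X j \<le> X i" if "j < q" for j using that ne Max_ge[of "X ` {..<q}" "X j"] i by auto
  define s where "s = \<lfloor>r - real i * c\<rfloor>"
  have Xi: "X i = real i * c + of_int s" by (simp add: X_def s_def)
  have "r < X i + 2 * \<delta>"
  proof (cases "i + q' < q")
    case True
    have e: "real (i + q') * c + of_int (s + p') = X i + \<delta>" using \<delta>(1) by (simp add: Xi algebra_simps)
    have "\<not> X i + \<delta> \<le> r" using Xmax[of "i + q'" "s + p'"] max[OF True] \<delta>(2) unfolding e by linarith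
    then show ?thesis using \<delta>(2) by linarith
  next
    case False
    let ?j = "i + q' - q"
    have j: "?j < q" using i assms by linarith
    have e: "real ?j * c + of_int (s + p' - p'') = X i + \<delta> - (real q * c + of_int p'')"
      using \<delta>(1) False by (simp add: Xi of_nat_diff algebra_simps)
    have "\<not> X i + \<delta> - (real q * c + of_int p'') \<le> r"
      using Xmax[of ?j "s + p' - p''"] max[OF j] \<epsilon> unfolding e by linarith
    then show ?thesis using \<epsilon> by linarith
  qed
  then have "\<bar>r - real i * c - of_int s\<bar> \<le> 2 * \<delta>" using Xr[of i] Xi \<delta>(2) by linarith
  then show ?thesis using i(1) by blast
qed

text \<open>\<delta> is the smallest distance to the integers among the multiples below q, attained
  at q'. The multiple q c is closer still, so the orbit can wrap around without leaving large gaps.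
  The sign of the return at q' is normalized by passing to -c.\<close>

lemma orbit_gaps:
  assumes q: "1 < q" and best: "\<And>j. 0 < j \<Longrightarrow> j < q \<Longrightarrow> dist_int (real q * c) < dist_int (real j * c)"
  obtains \<delta> where "0 < \<delta>" "\<delta> \<le> 1" "dist_int (real q * c) \<le> \<delta>" "\<And>j. 1 \<le> j \<Longrightarrow> j < q \<Longrightarrow> \<delta> \<le> dist_int (real j * c)"
    "\<And>r. \<exists>i<q. \<exists>p. \<bar>r - real i * c - of_int p\<bar> \<le> 2 * \<delta>"
proof -
  define f where "f j = dist_int (real j * c)" for j
  have ne: "f ` {1..<q} \<noteq> {}" "finite (f ` {1..<q})" using q by auto
  have "Min (f ` {1..<q}) \<in> f ` {1..<q}" using ne by (intro Min_in)
  then obtain q' where q': "1 \<le> q'" "q' < q" "Min (f ` {1..<q}) = f q'" by auto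
  have min: "f q' \<le> f j" if "1 \<le> j" "j < q" for j
  proof -
    have "f j \<in> f ` {1..<q}" using that by simp
    then show ?thesis unfolding q'(3)[symmetric] by (rule Min_le[OF ne(2)])
  qed
  have lt: "f q < f q'" using best[of q'] q' by (simp add: f_def)
  have nn: "0 \<le> f q" by (simp add: f_def dist_int_def)
  obtain p' where p': "f q' = \<bar>real q' * c + of_int p'\<bar>" unfolding f_def using dist_int_attained by blast
  obtain p'' where p'': "f q = \<bar>real q * c + of_int p''\<bar>" unfolding f_def using dist_int_attained by blast
  have dense: "\<exists>i<q. \<exists>p. \<bar>r - real i * c - of_int p\<bar> \<le> 2 * f q'" for r
  proof (cases "0 \<le> real q' * c + of_int p'")
    case True
    show ?thesis by (rule orbit_gaps_aux[of q' q c p' _ p'']) (use True p' p'' lt nn q' in auto)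
  next
    case False
    have "\<exists>i<q. \<exists>p. \<bar>- r - real i * (- c) - of_int p\<bar> \<le> 2 * f q'"
    proof (rule orbit_gaps_aux[of q' q "- c" "- p'" _ "- p''"])
      show "real q' * - c + of_int (- p') = f q'" using False p' by simp
      have "real q * - c + of_int (- p'') = - (real q * c + of_int p'')" by simp
      then show "\<bar>real q * - c + of_int (- p'')\<bar> < f q'" using p'' lt by (simp only: abs_minus_cancel)
    qed (use q' lt nn in auto)
    then obtain i p where ip: "i < q" "\<bar>- r - real i * (- c) - of_int p\<bar> \<le> 2 * f q'" by blast
    then have "\<bar>r - real i * c - of_int (- p)\<bar> \<le> 2 * f q'" by (simp add: abs_le_iff)
    then show ?thesis using ip(1) by blast
  qed
  have "f q' \<le> 1" unfolding f_def dist_int_def using of_int_round_abs_le[of "real q' * c"] by (simp add: abs_minus_commute)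
  then show ?thesis using that[of "f q'"] lt nn min dense by (auto simp: f_def)
qed

section \<open>Commuting diffeomorphisms as a flow\<close>

context flow begin

text \<open>\<open>\<Phi> (real q * c)\<close> has derivative 1 at some z. Any x is within time
  2\<delta> of some \<open>\<Phi> t z\<close> with t = i c + p and i < q, at a cost of 2V. There the
  cocycle identity exchanges the roles of q c and t and leaves the difference of A (i c) between z
  and a point at most time \<delta> away modulo 1, at a cost of V.\<close>

lemma denjoy_koksma:
  assumes c: "good c" and V: "\<And>x y. \<bar>A c x - A c y\<bar> \<le> V * \<bar>x - y\<bar>"
    and q: "1 < q" and best: "\<And>j. 0 < j \<Longrightarrow> j < q \<Longrightarrow> dist_int (real q * c) < dist_int (real j * c)"
  shows "\<bar>A (real q * c) x\<bar> \<le> 3 * V"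
proof -
  obtain \<delta> where \<delta>: "0 < \<delta>" "\<delta> \<le> 1" "dist_int (real q * c) \<le> \<delta>" "\<And>j. 1 \<le> j \<Longrightarrow> j < q \<Longrightarrow> \<delta> \<le> dist_int (real j * c)"
    and dense: "\<And>r. \<exists>i<q. \<exists>p. \<bar>r - real i * c - of_int p\<bar> \<le> 2 * \<delta>"
    using orbit_gaps[OF q best] by blast
  have up: "\<bar>A (real n * c) (\<Phi> r y) - A (real n * c) y\<bar> \<le> V * real J" if "n \<le> q" "0 \<le> r" "r \<le> real J * \<delta>" for n r J y
    by (rule orbit_distortion[OF \<delta>(1,2,4) c V that(1)]) (use that in auto)
  have dis: "\<bar>A (real n * c) (\<Phi> r y) - A (real n * c) y\<bar> \<le> V * real J" if "n \<le> q" "\<bar>r\<bar> \<le> real J * \<delta>" for n r J y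
  proof (cases "0 \<le> r")
    case False
    have "\<Phi> (- r) (\<Phi> r y) = y" by (simp flip: \<Phi>_add)
    then show ?thesis using up[OF that(1), of "- r" J "\<Phi> r y"] False that(2) by (simp add: abs_minus_commute)
  qed (use up that in auto)
  have gq: "good (real q * c)" by (rule good_mult[OF c])
  obtain z where z: "\<Phi> (real q * c) 1 - \<Phi> (real q * c) 0 = (1 - 0) * deriv (\<Phi> (real q * c)) z"
    using smooth_mvt[OF goodD(1)[OF gq] zero_less_one] by blast
  then have z0: "A (real q * c) z = 0" using \<Phi>_1[of "real q * c" 0] by (simp add: A_def)
  obtain i p where ip: "i < q" "\<bar>(h x - h z) - real i * c - of_int p\<bar> \<le> 2 * \<delta>" using dense by blast
  define t where "t = real i * c + of_int p"
  have gi: "good (real i * c)" by (rule good_mult[OF c])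
  have gt: "good t" and At: "A t = A (real i * c)" unfolding t_def using good_add_int[OF gi] by auto
  have "x = \<Phi> ((h x - h z) - t) (\<Phi> t z)" by (simp add: \<Phi>_def flip: \<Phi>_add)
  then have 1: "\<bar>A (real q * c) x - A (real q * c) (\<Phi> t z)\<bar> \<le> V * real 2"
    using dis[of q "(h x - h z) - t" 2 "\<Phi> t z"] ip(2) by (simp add: t_def algebra_simps)
  have "A (real q * c) (\<Phi> t z) + A t z = A t (\<Phi> (real q * c) z) + A (real q * c) z"
    using good_add_A(2)[OF gq gt, of z] good_add_A(2)[OF gt gq, of z] by (simp add: add.commute)
  then have 2: "A (real q * c) (\<Phi> t z) = A (real i * c) (\<Phi> (real q * c) z) - A (real i * c) z" by (simp add: z0 At)
  obtain p' where p': "dist_int (real q * c) = \<bar>real q * c + of_int p'\<bar>" using dist_int_attained by blast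
  have "A (real i * c) (\<Phi> (real q * c) z) = A (real i * c) (\<Phi> (real q * c + of_int p') z)"
    unfolding \<Phi>_int using periodic_int[of "A (real i * c)" 0] A_1 by simp
  then have "\<bar>A (real q * c) (\<Phi> t z)\<bar> \<le> V * real 1"
    unfolding 2 using dis[of i "real q * c + of_int p'" 1 z] ip(1) p' \<delta>(3) by simp
  then show ?thesis using 1 by simp
qed


lemma funpow_\<Phi>: "(\<Phi> c ^^ n) x = \<Phi> (real n * c) x"
proof (induction n)
  case (Suc n)
  have "\<Phi> (real (Suc n) * c) x = \<Phi> (c + real n * c) x" by (simp add: algebra_simps)
  then show ?case using Suc by (simp add: \<Phi>_add)
qed simp

lemma rotation_number_\<Phi>: "rotation_number (\<Phi> c) = c"
proof -
  have "strict_mono (\<Phi> c)" by (simp add: strict_mono_def)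
  note tn = translation_number(2)[OF this \<Phi>_1]
  have "continuous_on UNIV (\<lambda>y. h y - y)" by (intro continuous_intros continuous_h)
  then obtain B where B: "\<And>y. \<bar>h y - y\<bar> \<le> B"
    by (rule periodic_bounded) (auto simp: h_1)
  define e where "e = c - rotation_number (\<Phi> c)"
  have "real n * \<bar>e\<bar> \<le> 2 * B + 2" for n
  proof -
    have "\<bar>\<Phi> (real n * c) 0 - real n * rotation_number (\<Phi> c)\<bar> \<le> 2" using tn[of n 0] by (simp add: funpow_\<Phi>)
    moreover have "\<bar>h 0 + real n * c - \<Phi> (real n * c) 0\<bar> \<le> B" using B[of "\<Phi> (real n * c) 0"] by simp
    moreover have "\<bar>h 0\<bar> \<le> B" using B[of 0] by simp
    ultimately have "\<bar>real n * e\<bar> \<le> 2 * B + 2" unfolding e_def right_diff_distrib by linarith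
    then show ?thesis by (simp add: abs_mult)
  qed
  then have "e = 0" using reals_Archimedean3[of "\<bar>e\<bar>"] by (metis abs_ge_zero abs_le_zero_iff linorder_not_less order_le_less)
  then show ?thesis by (simp add: e_def)
qed

text \<open>A map commuting with an irrational $\Phi_\tau$ becomes, in the coordinate $h$, a map whose displacement
  is invariant under a dense set of translations.\<close>

lemma centralizer:
  assumes \<tau>: "\<tau> \<notin> \<rat>" and g: "continuous_on UNIV g" "\<And>x. g (x + 1) = g x + 1"
    and comm: "\<And>x. g (\<Phi> \<tau> x) - \<Phi> \<tau> (g x) \<in> \<int>"
  obtains c where "g = \<Phi> c"
proof -
  define D where "D x = g (\<Phi> \<tau> x) - \<Phi> \<tau> (g x)" for x
  define u where "u y = h (g (\<xi> y)) - y" for y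
  \<comment> \<open>The commutation defect is continuous and integer-valued, hence a constant k.
    Since u is bounded and gains k at each translation by \<tau>, this k must be 0.\<close>
  have "D constant_on UNIV"
  proof (rule continuous_discrete_range_constant)
    show "continuous_on UNIV D" unfolding D_def
      by (intro continuous_on_diff continuous_on_compose2[OF g(1)] continuous_on_compose2[OF continuous_\<Phi>] continuous_\<Phi> g(1)) auto
    fix x
    have "1 \<le> norm (D y - D x)" if "D y \<noteq> D x" for y
    proof -
      have "D y - D x \<in> \<int>" using comm by (auto simp: D_def)
      then show ?thesis using Ints_nonzero_abs_ge1[of "D y - D x"] that by simp
    qed
    then show "\<exists>e>0. \<forall>y. y \<in> UNIV \<and> D y \<noteq> D x \<longrightarrow> e \<le> norm (D y - D x)" by (intro exI[of _ 1]) auto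
  qed simp
  then obtain k0 where "\<And>x. D x = k0" by (auto simp: constant_on_def)
  moreover have "D 0 \<in> \<int>" using comm by (simp add: D_def)
  ultimately obtain k where k: "\<And>x. D x = of_int k" by (metis Ints_cases)
  have u\<tau>: "u (y + \<tau>) = u y + of_int k" for y
  proof -
    have "g (\<xi> (y + \<tau>)) = \<Phi> \<tau> (g (\<xi> y)) + of_int k" using k[of "\<xi> y"] by (simp add: D_def \<Phi>_def)
    then show ?thesis by (simp add: u_def h_int)
  qed
  have u1: "u (y + 1) = u y" for y by (simp add: u_def \<xi>_1 g(2) h_1)
  have cu: "continuous_on UNIV u" unfolding u_def
    by (intro continuous_on_diff continuous_on_compose2[OF continuous_h] continuous_on_compose2[OF g(1)] continuous_\<xi> continuous_on_id) auto
  obtain B where B: "\<And>y. \<bar>u y\<bar> \<le> B" using periodic_bounded[OF cu u1] by blast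
  have un: "u (y + real n * \<tau>) = u y + real n * of_int k" for n y
  proof (induction n)
    case (Suc n)
    then show ?case using u\<tau>[of "y + real n * \<tau>"] by (simp add: algebra_simps)
  qed simp
  have "real n * \<bar>of_int k\<bar> \<le> 2 * B" for n
  proof -
    have "\<bar>real n * of_int k\<bar> \<le> 2 * B" using un[of 0 n] B[of 0] B[of "0 + real n * \<tau>"] by linarith
    then show ?thesis by (simp add: abs_mult)
  qed
  then have "k = 0" using reals_Archimedean3[of "\<bar>real_of_int k\<bar>"] by (metis abs_ge_zero abs_le_zero_iff linorder_not_less of_int_eq_0_iff order_le_less)
  have un0: "u (real n * \<tau> + of_int p) = u 0" for n p
    using un[of 0 n] periodic_int[of u 0 "real n * \<tau>" p] u1 by (simp add: \<open>k = 0\<close>)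
  have "u z = u 0" for z
  proof (rule ccontr)
    assume "u z \<noteq> u 0"
    have "isCont u z" using cu by (simp add: continuous_on_eq_continuous_at)
    then obtain d where d: "0 < d" "\<And>y. \<bar>y - z\<bar> < d \<Longrightarrow> \<bar>u y - u z\<bar> < \<bar>u 0 - u z\<bar>"
      unfolding continuous_at_eps_delta dist_real_def using \<open>u z \<noteq> u 0\<close> by (metis abs_of_pos right_minus_eq zero_less_abs_iff)
    obtain n p where "z - d < real n * \<tau> + of_int p" "real n * \<tau> + of_int p < z + d"
      by (rule int_multiples_dense[OF \<tau>, of "z - d" "z + d"]) (use d(1) in auto)
    then show False using d(2)[of "real n * \<tau> + of_int p"] un0[of n p] by (simp add: abs_less_iff)
  qed
  then have "h (g (\<xi> y)) = y + u 0" for y by (metis add.commute diff_add_cancel u_def)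
  then have "g x = \<Phi> (u 0) x" for x unfolding \<Phi>_def by (metis \<xi>_h)
  then show ?thesis using that by blast
qed

end

lemma denjoy_flow:
  assumes "circle_diffeo_lift F" "rotation_number F \<notin> \<rat>"
  obtains h \<xi> where "flow h \<xi>" "F = flow.\<Phi> h \<xi> (rotation_number F)"
proof -
  have F: "strict_mono F" "\<And>x. F (x + 1) = F x + 1" using assms(1) by (auto simp: circle_diffeo_lift_def)
  obtain h where h: "mono h" "\<And>x. h (x + 1) = h x + 1" "\<And>x. h (F x) = h x + rotation_number F" "surj h"
    using semiconjugacy[OF F assms(2)] by metis
  have "inj h" by (rule denjoy_injective[OF assms h(1-3)])
  then have "strict_mono h" using h(1) by (simp add: strict_mono_iff_mono)
  then have fl: "flow h (inv h)"
    by unfold_locales (simp_all add: h(2) surj_f_inv_f[OF h(4)] inv_f_f[OF \<open>inj h\<close>])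
  have "F x = flow.\<Phi> h (inv h) (rotation_number F) x" for x
    unfolding flow.\<Phi>_def[OF fl] h(3)[symmetric] by (simp add: inv_f_f[OF \<open>inj h\<close>])
  then show ?thesis using that[OF fl] by blast
qed

lemma finite_periodic_bounded:
  fixes w :: "'a \<Rightarrow> real \<Rightarrow> real"
  assumes "finite I" "\<And>i. i \<in> I \<Longrightarrow> continuous_on UNIV (w i)" "\<And>i x. i \<in> I \<Longrightarrow> w i (x + 1) = w i x"
  shows "\<exists>B\<ge>0. \<forall>i\<in>I. \<forall>x. \<bar>w i x\<bar> \<le> B"
  using assms
proof (induction I rule: finite_induct)
  case (insert j I)
  then obtain B where B: "B \<ge> 0" "\<forall>i\<in>I. \<forall>x. \<bar>w i x\<bar> \<le> B" by auto
  obtain B' where "\<And>x. \<bar>w j x\<bar> \<le> B'" using periodic_bounded[of "w j"] insert by auto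
  then show ?case using B by (intro exI[of _ "max B B'"]) (auto simp: le_max_iff_disj)
qed auto

theorem (in flow) generators_smooth_conjugacy:
  fixes c :: "nat \<Rightarrow> real"
  assumes good: "\<And>i. i < d \<Longrightarrow> good (c i)" and irr: "i0 < d" "c i0 \<notin> \<rat>"
    and dio: "0 < \<nu>" "0 < C" "\<And>k. 0 < k \<Longrightarrow> \<exists>i<d. C * real k powr (- \<nu>) \<le> dist_int (real k * c i)"
  shows "smooth_real h" "deriv h x > 0"
proof -
  \<comment> \<open>Both signs are included so that the small return l c_i + p can always be taken
    positive.\<close>
  define Cs where "Cs = c ` {..<d} \<union> (\<lambda>i. - c i) ` {..<d}"
  have fin: "finite Cs" by (simp add: Cs_def)
  have gC: "good b" if "b \<in> Cs" for b using that good good_minus by (auto simp: Cs_def)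
  have jets: "\<exists>B\<ge>0. \<forall>b\<in>Cs. \<forall>x. \<bar>(deriv ^^ i) (A b) x\<bar> \<le> B" for i
    by (rule finite_periodic_bounded[OF fin]) (auto intro!: smooth_continuous_on smooth_A gC funpow_deriv_periodic A_1)
  obtain V0 where V0: "0 \<le> V0" "\<forall>b\<in>Cs. \<forall>x. \<bar>(deriv ^^ 1) (A b) x\<bar> \<le> V0" using jets by blast
  have V: "\<bar>A b x - A b y\<bar> \<le> V0 * \<bar>x - y\<bar>" if "b \<in> Cs" for b x y
    using V0(2) that by (intro smooth_lipschitz smooth_A gC) auto
  have "\<exists>B\<ge>0. \<forall>b\<in>Cs. \<forall>x. \<bar>deriv (deriv (A b)) x - (deriv (A b) x)\<^sup>2 / 2\<bar> \<le> B"
  proof (rule finite_periodic_bounded[OF fin])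
    fix b assume "b \<in> Cs"
    then have "smooth_real (deriv (A b))" "smooth_real (deriv (deriv (A b)))" by (auto intro!: smooth_A gC)
    then show "continuous_on UNIV (\<lambda>x. deriv (deriv (A b)) x - (deriv (A b) x)\<^sup>2 / 2)"
      by (intro continuous_intros smooth_continuous_on) auto
    fix x show "deriv (deriv (A b)) (x + 1) - (deriv (A b) (x + 1))\<^sup>2 / 2 = deriv (deriv (A b)) x - (deriv (A b) x)\<^sup>2 / 2"
      using funpow_deriv_periodic[of "A b" 1 x] funpow_deriv_periodic[of "A b" 2 x] by (simp add: A_1 numeral_2_eq_2)
  qed
  then obtain \<Sigma>0 where \<Sigma>0: "0 \<le> \<Sigma>0" "\<forall>b\<in>Cs. \<forall>x. \<bar>deriv (deriv (A b)) x - (deriv (A b) x)\<^sup>2 / 2\<bar> \<le> \<Sigma>0" by blast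
  obtain P \<alpha>s where P: "1 \<le> P" "0 < \<alpha>s" "\<alpha>s \<le> 1"
    "\<And>\<alpha>. 0 < \<alpha> \<Longrightarrow> \<alpha> < \<alpha>s \<Longrightarrow> \<exists>i<d. \<exists>l. dist_int (real l * c i) \<le> \<alpha> / 8 \<and> \<alpha> ^ P \<le> dist_int (real l * c i) \<and>
       (\<forall>j. 1 \<le> j \<longrightarrow> j < l \<longrightarrow> \<alpha> / 8 \<le> dist_int (real j * c i))"
    using diophantine_step[OF dio] by blast
  \<comment> \<open>3 V0 is the slope bound from \<open>denjoy_koksma\<close> at the starting
    scales.\<close>
  define V1 where "V1 = max 1 (3 * V0)"
  interpret flow_jets h \<xi> Cs V0 V1 \<Sigma>0
  proof unfold_locales
    show "\<exists>W. \<forall>c\<in>Cs. \<forall>x. \<bar>(deriv ^^ i) (A c) x\<bar> \<le> W" for i using jets[of i] by blast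
  qed (use gC V V0(1) \<Sigma>0 in \<open>auto simp: V1_def\<close>)
  interpret flow_dio h \<xi> Cs V0 V1 \<Sigma>0 P \<alpha>s
  proof unfold_locales
    fix \<alpha> :: real assume \<alpha>: "0 < \<alpha>" "\<alpha> < \<alpha>s"
    obtain i l where il: "i < d" "dist_int (real l * c i) \<le> \<alpha> / 8" "\<alpha> ^ P \<le> dist_int (real l * c i)"
      "\<forall>j. 1 \<le> j \<longrightarrow> j < l \<longrightarrow> \<alpha> / 8 \<le> dist_int (real j * c i)" using P(4)[OF \<alpha>] by blast
    obtain p where p: "dist_int (real l * c i) = \<bar>real l * c i + of_int p\<bar>" using dist_int_attained by blast
    define b where "b = (if 0 \<le> real l * c i + of_int p then c i else - c i)"
    define p' where "p' = (if 0 \<le> real l * c i + of_int p then p else - p)"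
    have "dist_int (real l * c i) = real l * b + of_int p'" unfolding p b_def p'_def by simp
    moreover have "b \<in> Cs" using il(1) by (auto simp: b_def Cs_def)
    moreover have "dist_int (real j * b) = dist_int (real j * c i)" for j by (simp add: b_def)
    moreover have "0 < dist_int (real l * c i)" using il(3) zero_less_power[OF \<alpha>(1), of P] by linarith
    ultimately have "step \<alpha> (dist_int (real l * c i)) b l" unfolding step_def using il \<alpha> P(3) by auto
    then show "\<exists>\<alpha>' c l. step \<alpha> \<alpha>' c l \<and> \<alpha> ^ P \<le> \<alpha>'" using il(3) by blast
  next
    fix e :: real assume e: "0 < e"
    \<comment> \<open>Closest returns of the one irrational rotation number provide starting scales
      as small as desired.\<close>
    obtain q where q: "1 < q" "dist_int (real q * c i0) < e"
      "\<And>j. 0 < j \<Longrightarrow> j < q \<Longrightarrow> dist_int (real q * c i0) < dist_int (real j * c i0)"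
      using best_denominator[OF irr(2) e] by blast
    have ci: "c i0 \<in> Cs" using irr(1) by (auto simp: Cs_def)
    have dk: "\<bar>A (real q * c i0) x\<bar> \<le> V1" for x
      using denjoy_koksma[OF gC[OF ci] V[OF ci] q(1,3), of x] by (simp add: V1_def)
    have gq: "good (real q * c i0)" by (rule good_mult[OF gC[OF ci]])
    obtain p where p: "dist_int (real q * c i0) = \<bar>real q * c i0 + of_int p\<bar>" using dist_int_attained by blast
    define r where "r = real q * c i0 + of_int p"
    have r: "good r" "A r = A (real q * c i0)" unfolding r_def using good_add_int[OF gq] by auto
    have "good \<bar>r\<bar> \<and> (\<forall>x. \<bar>A \<bar>r\<bar> x\<bar> \<le> V1)"
      using r dk good_minus[OF r(1)] A_minus[OF r(1)] by (cases "0 \<le> r") auto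
    moreover have "0 < \<bar>r\<bar>" using dist_int_pos[OF irr(2), of q] q(1) p by (simp add: r_def)
    moreover have "\<bar>r\<bar> \<le> 1" unfolding r_def p[symmetric] dist_int_def using of_int_round_abs_le[of "real q * c i0"] by (simp add: abs_minus_commute)
    ultimately have "lev \<bar>r\<bar>" by (simp add: lev_def)
    then show "\<exists>\<alpha>. lev \<alpha> \<and> \<alpha> < e" using q(2) p by (auto simp: r_def)
  qed (use P in \<open>auto simp: V1_def\<close>)
  obtain s c' C' G where s: "0 < c'" "0 < C'" "1 \<le> G" "\<And>k. lev (s k)" "\<And>k. \<exists>b l. step (s k) (s (Suc k)) b l"
    "\<And>k. s k ^ P \<le> s (Suc k)" "\<And>k. eta (s k) \<le> C' * s k powr c'" "\<And>k. eta (s k) \<le> 1"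
    "\<And>k x y. x \<le> y \<Longrightarrow> y \<le> \<Phi> (s k) x \<Longrightarrow> \<bar>deriv (m (s (Suc k))) y\<bar> \<le> G * eta (s k) * (m (s (Suc k)) x / m (s k) x)"
    "\<And>k x y. x \<le> y \<Longrightarrow> y \<le> \<Phi> (s k) x \<Longrightarrow> 7/8 * m (s (Suc k)) x \<le> m (s (Suc k)) y"
    using good_scales by blast
  interpret flow_scales h \<xi> Cs V0 V1 \<Sigma>0 s c' C' G P
    by unfold_locales (use s P(1) in auto)
  show "smooth_real h" "deriv h x > 0" by (rule conjugacy_smooth)+
qed

text \<open>Circle maps are represented by lifts, so commutation, rotation numbers and conjugacy are
  expressed up to integers. An integer defect depending on x does no harm: being continuous it is
  constant.\<close>

theorem theorem1:
  fixes d :: nat and \<theta> :: "nat \<Rightarrow> real" and F :: "nat \<Rightarrow> real \<Rightarrow> real"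
  assumes "d \<ge> 2"
    and "\<exists>\<nu>>0. \<exists>C>0. \<forall>k::int. k \<noteq> 0 \<longrightarrow>
           Max ((\<lambda>i. dist_int (of_int k * \<theta> i)) ` {..<d}) \<ge> C * \<bar>real_of_int k\<bar> powr (- \<nu>)"
    and "\<forall>i<d. circle_diffeo_lift (F i)"
    and "\<forall>i<d. \<theta> i - rotation_number (F i) \<in> \<int>"
    and "\<forall>i<d. \<forall>j<d. \<forall>x. F i (F j x) - F j (F i x) \<in> \<int>"
  shows "\<exists>H. circle_diffeo_lift H \<and> (\<forall>i<d. \<forall>x. H (F i x) - (H x + \<theta> i) \<in> \<int>)"
proof -
  obtain \<nu> C where \<nu>: "0 < \<nu>" and C: "0 < C"
    and dio: "\<And>k::int. k \<noteq> 0 \<Longrightarrow> C * \<bar>real_of_int k\<bar> powr (- \<nu>) \<le> Max ((\<lambda>i. dist_int (of_int k * \<theta> i)) ` {..<d})"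
    using assms(2) by blast
  define c where "c i = rotation_number (F i)" for i
  have lift: "circle_diffeo_lift (F i)" if "i < d" for i using assms(3) that by blast
  have dio': "\<exists>i<d. C * real k powr (- \<nu>) \<le> dist_int (real k * c i)" if "0 < k" for k
  proof -
    have "Max ((\<lambda>i. dist_int (real k * \<theta> i)) ` {..<d}) \<in> (\<lambda>i. dist_int (real k * \<theta> i)) ` {..<d}"
      using assms(1) by (intro Max_in) (auto simp: lessThan_empty_iff)
    then obtain i where i: "i < d" "Max ((\<lambda>i. dist_int (real k * \<theta> i)) ` {..<d}) = dist_int (real k * \<theta> i)" by auto
    obtain p where p: "\<theta> i - c i = of_int p" using assms(4) i(1) unfolding c_def by (metis Ints_cases)
    have "real k * \<theta> i = real k * c i + of_int (int k * p)" using p by (simp add: algebra_simps flip: p)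
    then have "dist_int (real k * \<theta> i) = dist_int (real k * c i)" by (simp only: dist_int_add_int)
    then show ?thesis using dio[of "int k"] i that by auto
  qed
  \<comment> \<open>If all rotation numbers were rational, a common denominator k would make the
    maximum in the hypothesis vanish.\<close>
  have "\<exists>i<d. c i \<notin> \<rat>"
  proof (rule ccontr)
    assume "\<not> ?thesis"
    then obtain k where k: "0 < k" "\<forall>i\<in>{..<d}. real k * c i \<in> \<int>" using common_denominator[of "{..<d}" c] by auto
    obtain i where i: "i < d" "C * real k powr (- \<nu>) \<le> dist_int (real k * c i)" using dio'[OF k(1)] by blast
    obtain p where "real k * c i = of_int p" using k(2) i(1) by (metis Ints_cases lessThan_iff)
    then have "dist_int (real k * c i) \<le> 0" using dist_int_le[of "real k * c i" p] by simp
    then show False using i(2) mult_pos_pos[OF C, of "real k powr (- \<nu>)"] k(1) by simp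
  qed
  then obtain i0 where i0: "i0 < d" "c i0 \<notin> \<rat>" by blast
  obtain h \<xi> where fl: "flow h \<xi>" and F0: "F i0 = flow.\<Phi> h \<xi> (c i0)"
    using denjoy_flow[OF lift[OF i0(1)]] i0(2) unfolding c_def by blast
  interpret flow h \<xi> by (rule fl)
  \<comment> \<open>Commuting with the irrational F i0 puts F i into the flow; its time is then
    identified by its rotation number.\<close>
  have F\<Phi>: "F i = \<Phi> (c i)" if i: "i < d" for i
  proof -
    have Fi: "smooth_real (F i)" "\<And>x. F i (x + 1) = F i x + 1" using lift[OF i] by (auto simp: circle_diffeo_lift_def)
    have "F i (\<Phi> (c i0) x) - \<Phi> (c i0) (F i x) \<in> \<int>" for x
      using assms(5) i i0(1) unfolding F0[symmetric] by blast
    then obtain b where b: "F i = \<Phi> b" using centralizer[OF i0(2) smooth_continuous_on[OF Fi(1)] Fi(2)] by blast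
    then show ?thesis using rotation_number_\<Phi>[of b] by (simp add: c_def)
  qed
  have good: "good (c i)" if "i < d" for i
    unfolding good_def F\<Phi>[OF that, symmetric] using lift[OF that] lift_deriv_pos[OF lift[OF that]]
    by (auto simp: circle_diffeo_lift_def)
  note hs = generators_smooth_conjugacy[of d c i0 \<nu> C, OF good i0 \<nu> C dio']
  have inv: "inv h = \<xi>" by (rule inv_equality) simp_all
  have "smooth_real \<xi>" by (rule smooth_inverse_function(1)[of h \<xi>]) (use hs in auto)
  moreover have "bij h" by (rule bij_betw_byWitness[of _ \<xi>]) auto
  ultimately have "circle_diffeo_lift h"
    using hs(1) h_mono h_1 by (simp add: circle_diffeo_lift_def inv)
  moreover have "h (F i x) - (h x + \<theta> i) \<in> \<int>" if "i < d" for i x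
  proof -
    have "h (F i x) - (h x + \<theta> i) = - (\<theta> i - c i)" by (simp add: F\<Phi>[OF that])
    then show ?thesis using assms(4) that by (simp only: c_def Ints_minus)
  qed
  ultimately show ?thesis by blast
qed

end
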